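(* Let $(u_0,U_1)\in V\times L^2(D,L^2_{pot}(\Omega))$ be the unique solution of $$\int_\Omega\int_DA(x,\omega)(\nabla u_0(x)+U_1(x,\omega))\cdot(\nabla\phi_0(x)+\Phi_1(x,\omega))\,dx\,\mathbb{P}(d\omega)=\int_Df\phi_0\,dx\qquad\forall\phi_0\in V,\ \Phi_1\in L^2(D,L^2_{pot}(\Omega)),$$ and for $\rho>0$ let $(u_0^\rho(\cdot,\omega),u_1^\rho(\cdot,\cdot,\omega))\in V\times V_1^\rho$ be the solution of $$\frac1{|Y^\rho|}\int_D\int_{Y^\rho}A(x,T(y)\omega)(\nabla u_0^\rho+\nabla_yu_1^\rho)\cdot(\nabla\phi_0(x)+\nabla_y\phi_1(x,y))\,dy\,dx=\int_Df\phi_0\,dx\qquad\forall(\phi_0,\phi_1)\in V\times V_1^\rho .$$ Then almost surely $$\lim_{\rho\to\infty}\frac1{|Y^\rho|^{1/2}}\big\|U_1(\cdot,T(\cdot)\omega)-\nabla_yu_1^\rho(\cdot,\cdot,\omega)\big\|_{L^2(D\times Y^\rho)^d}=0,$$ where $U_1(\cdot,T(\cdot)\omega)$ denotes the function $(x,y)\mapsto U_1(x,T(y)\omega)$.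
   Context: $D\subset\mathbb{R}^d$ is a bounded Lipschitz domain, $V=H^1_0(D)$, and $f\in V'$; $\int_D f\phi\,dx$ denotes the duality pairing. $(\Omega,\Sigma,\mathbb{P})$ is a probability space with an ergodic (measurable, measure preserving) dynamical system $T:\mathbb{R}^d\times\Omega\to\Omega$: $T(y+y')\omega=T(y)T(y')\omega$, and every $T$-invariant subset of $\Omega$ has probability $0$ or $1$. $A:\mathbb{R}^d\times\Omega\to\mathbb{R}^{d\times d}_{sym}$ satisfies, for constants $c_1,c_2>0$, $c_1|\xi|^2\le A(x,\omega)\xi\cdot\xi$ and $A(x,\omega)\xi\cdot\zeta\le c_2|\xi||\zeta|$ for all $\xi,\zeta\in\mathbb{R}^d$ and a.a. $x\in D$, $\omega\in\Omega$; moreover $A\in C(\bar D,L^\infty(\Omega))^{d\times d}$. $\partial=(\partial_1,\dots,\partial_d)$, where $\partial_i$ is the $L^2(\Omega)$-generator of the group of shifts $\phi\mapsto\phi(T(te^i)\cdot)$, $t\in\mathbb R$, with $e^i$ the $i$th standard basis vector. $L^2_{pot}(\Omega)$ is the closure in $L^2(\Omega)^d$ of $\{\partial\psi\}$ with $\psi$ in the domain of $\partial$. $Y^\rho=(-\rho,\rho)^d$, and $V_1^\rho=L^2(D,H^1_0(Y^\rho))$. *)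

theory Defs
  imports "HOL-Probability.Probability"
begin

section \<open>Square integrable functions\<close>

text \<open>Elements of Lebesgue spaces are represented by functions; functions that agree almost
  everywhere are not identified.\<close>

definition L2 :: "'a measure \<Rightarrow> ('a \<Rightarrow> 'b::euclidean_space) set" where
  "L2 M = {f \<in> borel_measurable M. integrable M (\<lambda>x. (norm (f x))\<^sup>2)}"

text \<open>The value is meaningful only for members of \<^term>\<open>L2 M\<close>, because the Bochner integral of a
  non-integrable function is 0.\<close>

definition L2_nrm :: "'a measure \<Rightarrow> ('a \<Rightarrow> 'b::euclidean_space) \<Rightarrow> real" where
  "L2_nrm M f = sqrt (LINT x|M. (norm (f x))\<^sup>2)"


section \<open>Domains\<close>

text \<open>Near each boundary point the domain is the strict epigraph, in some direction \<open>e\<close>, of a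
  Lipschitz function on the hyperplane orthogonal to \<open>e\<close>.\<close>

definition bounded_Lipschitz_domain :: "'a::euclidean_space set \<Rightarrow> bool" where
  "bounded_Lipschitz_domain D \<longleftrightarrow>
     open D \<and> connected D \<and> bounded D \<and> D \<noteq> {} \<and>
     (\<forall>p \<in> frontier D. \<exists>e r C \<gamma>. norm e = 1 \<and> 0 < r \<and> lipschitz_on C {w. w \<bullet> e = 0} \<gamma> \<and>
        D \<inter> ball p r = {z \<in> ball p r. \<gamma> (z - (z \<bullet> e) *\<^sub>R e) < z \<bullet> e})"

definition cube :: "real \<Rightarrow> (real ^ 'n::finite) set" where
  "cube \<rho> = {y. \<forall>i. - \<rho> < y $ i \<and> y $ i < \<rho>}"


section \<open>Sobolev spaces\<close>

definition gradient :: "(real ^ 'n::finite \<Rightarrow> real) \<Rightarrow> real ^ 'n \<Rightarrow> real ^ 'n" where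
  "gradient \<phi> x = (\<chi> i. frechet_derivative \<phi> (at x) (axis i 1))"

primrec continuously_differentiable :: "nat \<Rightarrow> (real ^ 'n::finite \<Rightarrow> real) \<Rightarrow> bool" where
  "continuously_differentiable 0 \<phi> \<longleftrightarrow> continuous_on UNIV \<phi>"
| "continuously_differentiable (Suc k) \<phi> \<longleftrightarrow>
     (\<forall>x. \<phi> differentiable (at x)) \<and>
     (\<forall>i. continuously_differentiable k (\<lambda>x. gradient \<phi> x $ i))"

definition test_functions :: "(real ^ 'n::finite) set \<Rightarrow> (real ^ 'n \<Rightarrow> real) set" where
  "test_functions D = {\<phi>. (\<forall>k. continuously_differentiable k \<phi>) \<and>
     (\<exists>K. compact K \<and> K \<subseteq> D \<and> (\<forall>x. x \<notin> K \<longrightarrow> \<phi> x = 0))}"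

definition has_weak_gradient ::
  "(real ^ 'n::finite) set \<Rightarrow> (real ^ 'n \<Rightarrow> real) \<Rightarrow> (real ^ 'n \<Rightarrow> real ^ 'n) \<Rightarrow> bool" where
  "has_weak_gradient D u g \<longleftrightarrow>
     u \<in> L2 (lebesgue_on D) \<and> g \<in> L2 (lebesgue_on D) \<and>
     (\<forall>\<phi> \<in> test_functions D. \<forall>i.
        (LINT x|lebesgue_on D. u x * gradient \<phi> x $ i) = - (LINT x|lebesgue_on D. g x $ i * \<phi> x))"

definition weak_gradient ::
  "(real ^ 'n::finite) set \<Rightarrow> (real ^ 'n \<Rightarrow> real) \<Rightarrow> real ^ 'n \<Rightarrow> real ^ 'n" where
  "weak_gradient D u = (SOME g. has_weak_gradient D u g)"

definition H1 :: "(real ^ 'n::finite) set \<Rightarrow> (real ^ 'n \<Rightarrow> real) set" where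
  "H1 D = {u. \<exists>g. has_weak_gradient D u g}"

definition H1_nrm :: "(real ^ 'n::finite) set \<Rightarrow> (real ^ 'n \<Rightarrow> real) \<Rightarrow> real" where
  "H1_nrm D u = sqrt ((L2_nrm (lebesgue_on D) u)\<^sup>2 + (L2_nrm (lebesgue_on D) (weak_gradient D u))\<^sup>2)"

definition H10 :: "(real ^ 'n::finite) set \<Rightarrow> (real ^ 'n \<Rightarrow> real) set" where
  "H10 D = {u \<in> H1 D. \<forall>\<epsilon>>0. \<exists>\<phi> \<in> test_functions D. H1_nrm D (\<lambda>x. u x - \<phi> x) < \<epsilon>}"

definition dual_H10 :: "(real ^ 'n::finite) set \<Rightarrow> ((real ^ 'n \<Rightarrow> real) \<Rightarrow> real) set" where
  "dual_H10 D = {f.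
     (\<forall>u \<in> H10 D. \<forall>v \<in> H10 D. f (\<lambda>x. u x + v x) = f u + f v) \<and>
     (\<forall>c. \<forall>u \<in> H10 D. f (\<lambda>x. c * u x) = c * f u) \<and>
     (\<exists>C. \<forall>u \<in> H10 D. \<bar>f u\<bar> \<le> C * H1_nrm D u)}"

text \<open>The space $L^2(D, H^1_0(Y))$: its elements are represented by jointly measurable functions
  of \<open>(x, y)\<close> whose weak gradient in \<open>y\<close> is, as a function of both variables, square integrable
  on the product. The gradient is chosen jointly in \<open>(x, y)\<close>: an arbitrary choice of a weak gradient
  for each separate \<open>x\<close> might not be measurable in \<open>(x, y)\<close>.\<close>

definition has_weak_gradient_y ::
  "(real ^ 'n::finite) set \<Rightarrow> (real ^ 'n) set \<Rightarrow> (real ^ 'n \<Rightarrow> real ^ 'n \<Rightarrow> real) \<Rightarrow>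
   (real ^ 'n \<Rightarrow> real ^ 'n \<Rightarrow> real ^ 'n) \<Rightarrow> bool" where
  "has_weak_gradient_y D Y u g \<longleftrightarrow>
     (\<lambda>(x, y). g x y) \<in> L2 (lebesgue_on D \<Otimes>\<^sub>M lebesgue_on Y) \<and>
     (AE x in lebesgue_on D. has_weak_gradient Y (u x) (g x))"

definition weak_gradient_y ::
  "(real ^ 'n::finite) set \<Rightarrow> (real ^ 'n) set \<Rightarrow> (real ^ 'n \<Rightarrow> real ^ 'n \<Rightarrow> real) \<Rightarrow>
   real ^ 'n \<Rightarrow> real ^ 'n \<Rightarrow> real ^ 'n" where
  "weak_gradient_y D Y u = (SOME g. has_weak_gradient_y D Y u g)"

definition L2_H10 ::
  "(real ^ 'n::finite) set \<Rightarrow> (real ^ 'n) set \<Rightarrow> (real ^ 'n \<Rightarrow> real ^ 'n \<Rightarrow> real) set" where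
  "L2_H10 D Y = {u.
     (\<lambda>(x, y). u x y) \<in> L2 (lebesgue_on D \<Otimes>\<^sub>M lebesgue_on Y) \<and>
     (AE x in lebesgue_on D. u x \<in> H10 Y) \<and>
     (\<exists>g. has_weak_gradient_y D Y u g)}"


section \<open>Ergodic dynamical systems\<close>

text \<open>The identity \<open>T 0 \<omega> = \<omega>\<close> is not required. The remaining axioms imply that every event differs
  from its preimage under \<open>T 0\<close> by a null set.\<close>

definition ergodic_dynamical_system :: "'w measure \<Rightarrow> (real ^ 'n::finite \<Rightarrow> 'w \<Rightarrow> 'w) \<Rightarrow> bool" where
  "ergodic_dynamical_system M T \<longleftrightarrow>
     (\<lambda>(y, \<omega>). T y \<omega>) \<in> measurable (borel \<Otimes>\<^sub>M M) M \<and>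
     (\<forall>y. distr M M (T y) = M) \<and>
     (\<forall>y y'. \<forall>\<omega> \<in> space M. T (y + y') \<omega> = T y (T y' \<omega>)) \<and>
     (\<forall>E \<in> sets M. (\<forall>y. T y -` E \<inter> space M = E) \<longrightarrow> measure M E = 0 \<or> measure M E = 1)"

text \<open>\<open>\<psi>\<close> is in the domain of the $L^2$-generators of the shifts along all coordinate directions,
  and \<open>g\<close> is the vector of their values at \<open>\<psi>\<close>.\<close>

definition has_stochastic_gradient ::
  "'w measure \<Rightarrow> (real ^ 'n::finite \<Rightarrow> 'w \<Rightarrow> 'w) \<Rightarrow> ('w \<Rightarrow> real) \<Rightarrow> ('w \<Rightarrow> real ^ 'n) \<Rightarrow> bool" where
  "has_stochastic_gradient M T \<psi> g \<longleftrightarrow>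
     \<psi> \<in> L2 M \<and> g \<in> L2 M \<and>
     (\<forall>i. ((\<lambda>t::real. L2_nrm M (\<lambda>\<omega>. (\<psi> (T (t *\<^sub>R axis i 1) \<omega>) - \<psi> \<omega>) / t - g \<omega> $ i)) \<longlongrightarrow> 0) (at 0))"

definition L2_pot ::
  "'w measure \<Rightarrow> (real ^ 'n::finite \<Rightarrow> 'w \<Rightarrow> 'w) \<Rightarrow> ('w \<Rightarrow> real ^ 'n) set" where
  "L2_pot M T = {v \<in> L2 M. \<forall>\<epsilon>>0. \<exists>\<psi> g. has_stochastic_gradient M T \<psi> g \<and>
     L2_nrm M (\<lambda>\<omega>. v \<omega> - g \<omega>) < \<epsilon>}"

text \<open>The space $L^2(D, L^2_{pot}(\Omega))$, inside $L^2(D, L^2(\Omega)^d) = L^2(D \times \Omega)^d$.\<close>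

definition L2_L2_pot ::
  "(real ^ 'n::finite) set \<Rightarrow> 'w measure \<Rightarrow> (real ^ 'n \<Rightarrow> 'w \<Rightarrow> 'w) \<Rightarrow>
   (real ^ 'n \<Rightarrow> 'w \<Rightarrow> real ^ 'n) set" where
  "L2_L2_pot D M T = {\<Phi>.
     (\<lambda>(x, \<omega>). \<Phi> x \<omega>) \<in> L2 (lebesgue_on D \<Otimes>\<^sub>M M) \<and> (AE x in lebesgue_on D. \<Phi> x \<in> L2_pot M T)}"


section \<open>Coefficients\<close>

definition Linf_nrm :: "'w measure \<Rightarrow> ('w \<Rightarrow> real) \<Rightarrow> ereal" where
  "Linf_nrm M h = esssup M (\<lambda>\<omega>. ereal \<bar>h \<omega>\<bar>)"

definition Linf :: "'w measure \<Rightarrow> ('w \<Rightarrow> real) set" where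
  "Linf M = {h \<in> borel_measurable M. Linf_nrm M h < \<infinity>}"

definition continuous_Linf ::
  "'a::topological_space set \<Rightarrow> 'w measure \<Rightarrow> ('a \<Rightarrow> 'w \<Rightarrow> real) \<Rightarrow> bool" where
  "continuous_Linf S M a \<longleftrightarrow>
     (\<forall>x \<in> S. a x \<in> Linf M) \<and>
     (\<forall>x \<in> S. ((\<lambda>x'. Linf_nrm M (\<lambda>\<omega>. a x' \<omega> - a x \<omega>)) \<longlongrightarrow> 0) (at x within S))"

text \<open>Joint measurability of the coefficient is needed for the double integrals to make sense; every
  element of $C(\bar D, L^\infty(\Omega))^{d \times d}$ has a jointly measurable representative.\<close>

definition admissible_coefficient ::
  "(real ^ 'n::finite) set \<Rightarrow> 'w measure \<Rightarrow> (real ^ 'n \<Rightarrow> 'w \<Rightarrow> real ^ 'n ^ 'n) \<Rightarrow> real \<Rightarrow> real \<Rightarrow> bool"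
  where
  "admissible_coefficient D M A c1 c2 \<longleftrightarrow>
     (\<lambda>(x, \<omega>). A x \<omega>) \<in> borel_measurable (lebesgue_on D \<Otimes>\<^sub>M M) \<and>
     (\<forall>x. \<forall>\<omega> \<in> space M. transpose (A x \<omega>) = A x \<omega>) \<and>
     (AE x in lebesgue_on D. AE \<omega> in M. \<forall>\<xi> \<zeta>.
        c1 * (norm \<xi>)\<^sup>2 \<le> (A x \<omega> *v \<xi>) \<bullet> \<xi> \<and> (A x \<omega> *v \<xi>) \<bullet> \<zeta> \<le> c2 * norm \<xi> * norm \<zeta>) \<and>
     (\<forall>i j. continuous_Linf (closure D) M (\<lambda>x \<omega>. A x \<omega> $ i $ j))"

end

theory Submission
  imports Defs
begin

text \<open>The flux \<open>q = A (grad u\<^sub>0 + U\<^sub>1)\<close> is orthogonal to all potential fields on the probability space, so along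
  almost every orbit it is solenoidal in the sense of distributions and hence orthogonal, on each cube, to
  gradients of functions vanishing on the boundary. A pointwise ergodic theorem shows that its averages over
  large cubes tend to its mean, and that \<open>U\<^sub>1\<close> is approximated along the orbit, with small mean square error,
  by the gradient of a cut-off potential, which is an admissible test function for the problem on the cube.
  Testing that problem with the difference of its solution and this competitor, coercivity bounds the error by
  these two quantities. The macroscopic and the microscopic parts of the error do not interact, since
  gradients of functions vanishing on the boundary of the cube have mean 0.\<close>

section \<open>Approximation in \<open>L\<^sup>2\<close>\<close>

text \<open>The claim concerns all large \<rho> and every accuracy on one almost sure event, while
  each limit theorem costs a null set. Hence averages over cubes of integer size control all others,
  mollifiers and approximation levels run through sequences, and functions of \<open>x\<close> and
  \<omega> are approximated by functions of \<open>x\<close> with finitely many values among the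
  functions of \<omega>. The variable \<open>x\<close> enters arguments along orbits through a flow
  on the product of the domain and the probability space that moves \<omega> only. It preserves the
  product measure but is in general not ergodic, which is why \<open>flow\<close> is separated from
  \<open>ergodic_flow\<close>. The stochastic problem is used twice: with macroscopic test functions
  it identifies \<open>f\<close> with the mean flux, with microscopic ones it gives the
  orthogonality to potentials. The gradient of a cut-off potential misses the potential field by a
  term of order \<open>1 / \<rho>\<close> and by a boundary layer, which is a fixed small fraction
  of the cube; the ergodic theorem on the cube and on its inner part bounds the energy in this
  layer.\<close>

lemma L2_measurable: "f \<in> L2 M \<Longrightarrow> f \<in> borel_measurable M"
  by (simp add: L2_def)

lemma L2_integrable_sq: "f \<in> L2 M \<Longrightarrow> integrable M (\<lambda>x. (norm (f x))\<^sup>2)"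
  by (simp add: L2_def)

lemma L2_I: "f \<in> borel_measurable M \<Longrightarrow> integrable M (\<lambda>x. (norm (f x))\<^sup>2) \<Longrightarrow> f \<in> L2 M"
  by (simp add: L2_def)

lemma L2_nrm_nonneg [simp]: "0 \<le> L2_nrm M f"
  by (simp add: L2_nrm_def)

lemma L2_nrm_sq: "(L2_nrm M f)\<^sup>2 = (LINT x|M. (norm (f x))\<^sup>2)"
  by (simp add: L2_nrm_def)

lemma L2_nrm_leI: "0 \<le> c \<Longrightarrow> (LINT x|M. (norm (f x))\<^sup>2) \<le> c\<^sup>2 \<Longrightarrow> L2_nrm M f \<le> c"
  by (simp add: L2_nrm_def real_le_lsqrt)

lemma L2_dominated:
  fixes f :: "'a \<Rightarrow> 'b::euclidean_space" and g :: "'a \<Rightarrow> real"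
  assumes "f \<in> borel_measurable M" "integrable M g" "AE x in M. (norm (f x))\<^sup>2 \<le> g x"
  shows "f \<in> L2 M"
proof (rule L2_I[OF assms(1)])
  show "integrable M (\<lambda>x. (norm (f x))\<^sup>2)"
  proof (rule Bochner_Integration.integrable_bound[OF assms(2)])
    show "AE x in M. norm ((norm (f x))\<^sup>2) \<le> norm (g x)"
      using assms(3) by eventually_elim simp
  qed (use assms(1) in simp)
qed

lemma norm_add_sq_le: "(norm (a + b))\<^sup>2 \<le> 2 * (norm a)\<^sup>2 + 2 * (norm (b::'a::real_inner))\<^sup>2"
proof -
  have "(norm (a + b))\<^sup>2 + (norm (a - b))\<^sup>2 = 2 * (norm a)\<^sup>2 + 2 * (norm b)\<^sup>2"
    by (simp add: power2_norm_eq_inner inner_simps inner_commute)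
  then show ?thesis by (smt (verit) zero_le_power2)
qed

lemma L2_add:
  assumes "f \<in> L2 M" "g \<in> L2 M"
  shows "(\<lambda>x. f x + g x) \<in> L2 M"
proof (rule L2_dominated)
  show "(\<lambda>x. f x + g x) \<in> borel_measurable M"
    using assms by (auto dest!: L2_measurable)
  show "integrable M (\<lambda>x. 2 * (norm (f x))\<^sup>2 + 2 * (norm (g x))\<^sup>2)"
    using assms by (auto dest!: L2_integrable_sq)
qed (simp add: norm_add_sq_le)

lemma L2_scaleR: "f \<in> L2 M \<Longrightarrow> (\<lambda>x. c *\<^sub>R f x) \<in> L2 M"
  by (auto simp: L2_def power_mult_distrib)

lemma L2_mult: "f \<in> L2 M \<Longrightarrow> (\<lambda>x. c * f x) \<in> L2 M" for f :: "'a \<Rightarrow> real"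
  using L2_scaleR[of f M c] by simp

lemma L2_uminus: "f \<in> L2 M \<Longrightarrow> (\<lambda>x. - f x) \<in> L2 M"
  using L2_scaleR[of f M "-1"] by simp

lemma L2_diff: "f \<in> L2 M \<Longrightarrow> g \<in> L2 M \<Longrightarrow> (\<lambda>x. f x - g x) \<in> L2 M"
  using L2_add[OF _ L2_uminus, of f M g] by simp

lemma L2_zero [simp]: "(\<lambda>x. 0) \<in> L2 M"
  by (simp add: L2_def)

lemma L2_norm: "f \<in> L2 M \<Longrightarrow> (\<lambda>x. norm (f x)) \<in> L2 M"
  by (auto simp: L2_def intro: borel_measurable_norm)

lemma L2_component: "f \<in> L2 M \<Longrightarrow> (\<lambda>x. f x $ i) \<in> L2 M" for f :: "'a \<Rightarrow> real ^ 'n::finite"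
proof (rule L2_dominated[of _ _ "\<lambda>x. (norm (f x))\<^sup>2"])
  assume f: "f \<in> L2 M"
  show "(\<lambda>x. f x $ i) \<in> borel_measurable M"
    using measurable_compose[OF L2_measurable[OF f], of "\<lambda>v. v $ i" borel]
    by (simp add: borel_measurable_continuous_onI continuous_on_component)
  show "integrable M (\<lambda>x. (norm (f x))\<^sup>2)" using f by (rule L2_integrable_sq)
  have "(f x $ i)\<^sup>2 \<le> (norm (f x))\<^sup>2" for x
    using component_le_norm_cart[of "f x" i] power_mono[of "\<bar>f x $ i\<bar>" "norm (f x)" 2] by simp
  then show "AE x in M. (norm (f x $ i))\<^sup>2 \<le> (norm (f x))\<^sup>2" by simp
qed

lemma L2_inner_integrable:
  assumes "f \<in> L2 M" "g \<in> L2 M"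
  shows "integrable M (\<lambda>x. f x \<bullet> g x)"
proof (rule Bochner_Integration.integrable_bound)
  show "integrable M (\<lambda>x. (norm (f x))\<^sup>2 + (norm (g x))\<^sup>2)"
    using assms by (auto dest!: L2_integrable_sq)
  show "(\<lambda>x. f x \<bullet> g x) \<in> borel_measurable M"
    using assms by (auto dest!: L2_measurable)
  have "\<bar>f x \<bullet> g x\<bar> \<le> (norm (f x))\<^sup>2 + (norm (g x))\<^sup>2" for x
  proof -
    have "\<bar>f x \<bullet> g x\<bar> \<le> norm (f x) * norm (g x)" by (rule Cauchy_Schwarz_ineq2)
    also have "2 * \<dots> \<le> (norm (f x))\<^sup>2 + (norm (g x))\<^sup>2"
      using sum_squares_bound[of "norm (f x)" "norm (g x)"] by simp
    finally show ?thesis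
      using norm_ge_zero[of "f x"] norm_ge_zero[of "g x"] by (smt (verit) mult_nonneg_nonneg)
  qed
  then show "AE x in M. norm (f x \<bullet> g x) \<le> norm ((norm (f x))\<^sup>2 + (norm (g x))\<^sup>2)"
    by (simp add: order_trans[OF _ abs_ge_self])
qed

lemma L2_mult_integrable:
  fixes f g :: "'a \<Rightarrow> real"
  assumes "f \<in> L2 M" "g \<in> L2 M"
  shows "integrable M (\<lambda>x. f x * g x)"
  using L2_inner_integrable[OF assms] by (simp add: inner_real_def)

lemma le_mult_of_le_weighted_squares:
  fixes a b I :: real
  assumes ab: "0 \<le> a" "0 \<le> b" and le: "\<And>t. 0 < t \<Longrightarrow> I \<le> t / 2 * a\<^sup>2 + 1 / (2 * t) * b\<^sup>2"
  shows "I \<le> a * b"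
proof (rule field_le_epsilon)
  fix e :: real assume e: "0 < e"
  \<comment> \<open>With this weight the bound exceeds \<open>a * b\<close> by at most
    \<open>d * (a + b) / 2\<close>; the summand 1 keeps the denominator positive.\<close>
  define d where "d = e / (a + b + 1)"
  have d: "0 < d" unfolding d_def using e ab by (intro divide_pos_pos) auto
  have ad: "0 < a + d" "0 < b + d" using ab d by auto
  have "I \<le> (b + d) / (a + d) / 2 * a\<^sup>2 + 1 / (2 * ((b + d) / (a + d))) * b\<^sup>2"
    using ad by (intro le) simp
  also have "\<dots> = (b + d) / 2 * (a * (a / (a + d))) + (a + d) / 2 * (b * (b / (b + d)))"
    by (simp add: power2_eq_square)
  also have "\<dots> \<le> (b + d) / 2 * (a * 1) + (a + d) / 2 * (b * 1)"
    using ab d ad by (intro add_mono mult_left_mono) auto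
  also have "\<dots> = a * b + d * (a + b) / 2" by (simp add: field_simps)
  also have "d * (a + b) / 2 \<le> d * (a + b + 1)" using d ab by (simp add: field_simps)
  also have "d * (a + b + 1) = e" unfolding d_def using ab by simp
  finally show "I \<le> a * b + e" by simp
qed

text \<open>Young's inequality with a free weight is integrated and the weight optimised afterwards.
  With norms in place of an inner product, the two functions may take values in different spaces;
  later a vector field is paired with the constant 1.\<close>

lemma L2_Cauchy_Schwarz_norm:
  assumes f: "f \<in> L2 M" and g: "g \<in> L2 M"
  shows "(LINT x|M. norm (f x) * norm (g x)) \<le> L2_nrm M f * L2_nrm M g"
proof (rule le_mult_of_le_weighted_squares)
  fix t :: real assume t: "0 < t"
  have pt: "u * v \<le> t / 2 * u\<^sup>2 + 1 / (2 * t) * v\<^sup>2" for u v :: real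
  proof -
    have "0 \<le> (t * u - v)\<^sup>2 / (2 * t)" using t by simp
    also have "\<dots> = t / 2 * u\<^sup>2 + 1 / (2 * t) * v\<^sup>2 - u * v"
      using t by (simp add: power2_eq_square field_simps)
    finally show ?thesis by simp
  qed
  have "(LINT x|M. norm (f x) * norm (g x)) \<le> (LINT x|M. t / 2 * (norm (f x))\<^sup>2 + 1 / (2 * t) * (norm (g x))\<^sup>2)"
    by (intro integral_mono L2_mult_integrable L2_norm pt) (use f g in \<open>auto dest!: L2_integrable_sq\<close>)
  also have "\<dots> = t / 2 * (L2_nrm M f)\<^sup>2 + 1 / (2 * t) * (L2_nrm M g)\<^sup>2"
    using f g by (simp add: L2_nrm_sq L2_integrable_sq)
  finally show "(LINT x|M. norm (f x) * norm (g x)) \<le> t / 2 * (L2_nrm M f)\<^sup>2 + 1 / (2 * t) * (L2_nrm M g)\<^sup>2" .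
qed auto

lemma L2_Cauchy_Schwarz:
  assumes f: "f \<in> L2 M" and g: "g \<in> L2 M"
  shows "\<bar>LINT x|M. f x \<bullet> g x\<bar> \<le> L2_nrm M f * L2_nrm M g"
proof -
  have "\<bar>LINT x|M. f x \<bullet> g x\<bar> \<le> (LINT x|M. \<bar>f x \<bullet> g x\<bar>)" by (rule integral_abs_bound)
  also have "\<dots> \<le> (LINT x|M. norm (f x) * norm (g x))"
    by (intro integral_mono integrable_abs L2_inner_integrable f g L2_mult_integrable L2_norm
        Cauchy_Schwarz_ineq2)
  also have "\<dots> \<le> L2_nrm M f * L2_nrm M g" by (rule L2_Cauchy_Schwarz_norm[OF f g])
  finally show ?thesis .
qed

lemma L2_triangle:
  assumes f: "f \<in> L2 M" and g: "g \<in> L2 M"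
  shows "L2_nrm M (\<lambda>x. f x + g x) \<le> L2_nrm M f + L2_nrm M g"
proof (rule L2_nrm_leI)
  have "(LINT x|M. (norm (f x + g x))\<^sup>2) = (LINT x|M. (norm (f x))\<^sup>2 + (norm (g x))\<^sup>2 + 2 * (f x \<bullet> g x))"
    by (simp add: power2_norm_eq_inner inner_simps inner_commute algebra_simps)
  also have "\<dots> = (L2_nrm M f)\<^sup>2 + (L2_nrm M g)\<^sup>2 + 2 * (LINT x|M. f x \<bullet> g x)"
    using f g by (simp add: L2_nrm_sq L2_integrable_sq L2_inner_integrable)
  also have "\<dots> \<le> (L2_nrm M f + L2_nrm M g)\<^sup>2"
    using L2_Cauchy_Schwarz[OF f g] by (simp add: power2_sum abs_le_iff)
  finally show "(LINT x|M. (norm (f x + g x))\<^sup>2) \<le> (L2_nrm M f + L2_nrm M g)\<^sup>2" .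
qed simp

lemma L2_nrm_scaleR: "L2_nrm M (\<lambda>x. c *\<^sub>R f x) = \<bar>c\<bar> * L2_nrm M f"
  by (simp add: L2_nrm_def power_mult_distrib real_sqrt_mult)

lemma L2_nrm_uminus: "L2_nrm M (\<lambda>x. - f x) = L2_nrm M f"
  by (simp add: L2_nrm_def)

lemma L2_nrm_minus_commute: "L2_nrm M (\<lambda>x. f x - g x) = L2_nrm M (\<lambda>x. g x - f x)"
  by (simp add: L2_nrm_def norm_minus_commute)

lemma L2_triangle_diff:
  assumes f: "f \<in> L2 M" and g: "g \<in> L2 M" and h: "h \<in> L2 M"
  shows "L2_nrm M (\<lambda>x. f x - h x) \<le> L2_nrm M (\<lambda>x. f x - g x) + L2_nrm M (\<lambda>x. g x - h x)"
  using L2_triangle[OF L2_diff[OF f g] L2_diff[OF g h]] by simp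

lemma L2_nrm_cong_AE:
  assumes "f \<in> borel_measurable M" "g \<in> borel_measurable M" "AE x in M. f x = g x"
  shows "L2_nrm M f = L2_nrm M g"
proof -
  have "(LINT x|M. (norm (f x))\<^sup>2) = (LINT x|M. (norm (g x))\<^sup>2)"
  proof (rule integral_cong_AE)
    show "AE x in M. (norm (f x))\<^sup>2 = (norm (g x))\<^sup>2"
      using assms(3) by eventually_elim simp
  qed (use assms(1,2) in simp_all)
  then show ?thesis by (simp add: L2_nrm_def)
qed

lemma (in finite_measure) L2_bounded:
  assumes "f \<in> borel_measurable M" "AE x in M. norm (f x) \<le> B"
  shows "f \<in> L2 M"
proof (rule L2_dominated[of _ _ "\<lambda>x. B\<^sup>2"])
  show "AE x in M. (norm (f x))\<^sup>2 \<le> B\<^sup>2"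
    using assms(2) by eventually_elim (simp add: power_mono)
qed (use assms(1) in simp_all)

lemma (in finite_measure) L2_const: "(\<lambda>x. c) \<in> L2 M"
  by (rule L2_bounded[where B="norm c"]) simp_all

lemma (in finite_measure) L2_integrable:
  assumes "f \<in> L2 M" shows "integrable M f"
proof (rule Bochner_Integration.integrable_bound)
  show "integrable M (\<lambda>x. 1 + (norm (f x))\<^sup>2)" using assms by (auto dest: L2_integrable_sq)
  have "u \<le> 1 + u\<^sup>2" if "0 \<le> u" for u :: real
    using that sum_squares_bound[of u 1] unfolding power_one mult_1_right by linarith
  then show "AE x in M. norm (f x) \<le> norm (1 + (norm (f x))\<^sup>2)"
    by simp
qed (use assms in \<open>simp add: L2_measurable\<close>)

text \<open>Dominated convergence, with the approximating simple functions bounded by \<open>2 * norm f\<close>.\<close>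

lemma (in finite_measure) L2_simple_approx:
  fixes f :: "'a \<Rightarrow> 'b::euclidean_space"
  assumes f: "f \<in> L2 M" and e: "0 < e"
  obtains s where "simple_function M s" "s \<in> L2 M" "L2_nrm M (\<lambda>x. f x - s x) < e"
proof -
  obtain F where F: "\<And>i. simple_function M (F i)"
    "\<And>x. x \<in> space M \<Longrightarrow> (\<lambda>i. F i x) \<longlonglongrightarrow> f x"
    "\<And>i x. x \<in> space M \<Longrightarrow> dist (F i x) 0 \<le> 2 * dist (f x) 0"
    using borel_measurable_implies_sequence_metric[OF L2_measurable[OF f], of 0] by blast
  have Fm: "F i \<in> borel_measurable M" for i
    using F(1) by (rule borel_measurable_simple_function)
  have FL: "F i \<in> L2 M" for i
  proof (rule L2_dominated[OF Fm])
    show "integrable M (\<lambda>x. 4 * (norm (f x))\<^sup>2)" using f by (auto dest: L2_integrable_sq)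
    have "(norm (F i x))\<^sup>2 \<le> (2 * norm (f x))\<^sup>2" if "x \<in> space M" for x
      using F(3)[OF that, of i] by (intro power_mono) auto
    then show "AE x in M. (norm (F i x))\<^sup>2 \<le> 4 * (norm (f x))\<^sup>2"
      by (intro AE_I2) (simp add: power_mult_distrib)
  qed
  have "(\<lambda>i. LINT x|M. (norm (f x - F i x))\<^sup>2) \<longlonglongrightarrow> (LINT x|M. 0)"
  proof (rule integral_dominated_convergence[where w="\<lambda>x. (3 * norm (f x))\<^sup>2"])
    show "integrable M (\<lambda>x. (3 * norm (f x))\<^sup>2)" using f by (auto dest: L2_integrable_sq simp: power_mult_distrib)
    show "(\<lambda>x. (norm (f x - F i x))\<^sup>2) \<in> borel_measurable M" for i
      using Fm[of i] L2_measurable[OF f] by auto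
    show "AE x in M. (\<lambda>i. (norm (f x - F i x))\<^sup>2) \<longlonglongrightarrow> 0"
    proof (rule AE_I2)
      fix x assume "x \<in> space M"
      then have "(\<lambda>i. (norm (f x - F i x))\<^sup>2) \<longlonglongrightarrow> (norm (f x - f x))\<^sup>2"
        by (intro tendsto_intros F(2))
      then show "(\<lambda>i. (norm (f x - F i x))\<^sup>2) \<longlonglongrightarrow> 0" by simp
    qed
    show "AE x in M. norm ((norm (f x - F i x))\<^sup>2) \<le> (3 * norm (f x))\<^sup>2" for i
    proof (rule AE_I2)
      fix x assume x: "x \<in> space M"
      have "norm (f x - F i x) \<le> norm (f x) + norm (F i x)" by (rule norm_triangle_ineq4)
      also have "\<dots> \<le> 3 * norm (f x)" using F(3)[OF x, of i] by simp
      finally show "norm ((norm (f x - F i x))\<^sup>2) \<le> (3 * norm (f x))\<^sup>2"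
        using power_mono[of "norm (f x - F i x)" "3 * norm (f x)" 2] by simp
    qed
  qed auto
  then have "(\<lambda>i. LINT x|M. (norm (f x - F i x))\<^sup>2) \<longlonglongrightarrow> 0" by simp
  then have "\<forall>\<^sub>F i in sequentially. (LINT x|M. (norm (f x - F i x))\<^sup>2) < e\<^sup>2"
    using e by (intro order_tendstoD) auto
  then obtain i where i: "(LINT x|M. (norm (f x - F i x))\<^sup>2) < e\<^sup>2"
    by (auto dest: eventually_happens)
  have "L2_nrm M (\<lambda>x. f x - F i x) < e"
    unfolding L2_nrm_def using i e by (intro real_less_lsqrt) auto
  with F(1) FL show ?thesis by (rule that)
qed

text \<open>Density of simple functions as an induction rule: a property passes from multiples of
  indicators through sums to all limits in L2. It yields both the tensor approximation on products
  and the strong continuity of the shifts.\<close>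

lemma (in finite_measure) L2_induct [consumes 1, case_names indicator add approx]:
  fixes f :: "'a \<Rightarrow> 'b::euclidean_space"
  assumes f: "f \<in> L2 M"
    and ind: "\<And>A c. A \<in> sets M \<Longrightarrow> P (\<lambda>x. indicator A x *\<^sub>R c)"
    and add: "\<And>f g. f \<in> L2 M \<Longrightarrow> g \<in> L2 M \<Longrightarrow> P f \<Longrightarrow> P g \<Longrightarrow> P (\<lambda>x. f x + g x)"
    and approx: "\<And>f. f \<in> L2 M \<Longrightarrow> (\<And>e. 0 < e \<Longrightarrow> \<exists>s \<in> L2 M. P s \<and> L2_nrm M (\<lambda>x. f x - s x) < e) \<Longrightarrow> P f"
  shows "P f"
proof (rule approx[OF f])
  fix e :: real assume "0 < e"
  then obtain s where s: "simple_function M s" "s \<in> L2 M" "L2_nrm M (\<lambda>x. f x - s x) < e"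
    using L2_simple_approx[OF f] by blast
  define A where "A = (\<lambda>c. s -` {c} \<inter> space M)"
  have A: "A c \<in> sets M" for c
    using simple_functionD(2)[OF s(1)] by (simp add: A_def)
  \<comment> \<open>The canonical form of \<open>s\<close>: the level sets are disjoint, so at each
    point exactly one summand survives. It agrees with \<open>s\<close> on the space only, hence the
    comparison through the norm below.\<close>
  define r where "r = (\<lambda>C x. \<Sum>c\<in>C. indicator (A c) x *\<^sub>R c)"
  have iL: "(\<lambda>x. indicator (A c) x *\<^sub>R c) \<in> L2 M" for c :: 'b
    by (rule L2_bounded[where B="norm c"]) (use A in \<open>auto simp: indicator_def\<close>)
  have r: "r C \<in> L2 M \<and> P (r C)" if "finite C" for C
    using that
  proof (induction C rule: finite_induct)
    case empty
    then show ?case using ind[of "{}" 0] by (simp add: r_def)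
  next
    case (insert c C)
    have "r (insert c C) = (\<lambda>x. indicator (A c) x *\<^sub>R c + r C x)"
      using insert(1,2) unfolding r_def by (intro ext) (rule sum.insert)
    then show ?case using insert iL[of c] ind[OF A, of c c] by (auto intro: L2_add add)
  qed
  have fin: "finite (s ` space M)" using simple_functionD(1)[OF s(1)] .
  have eq: "r (s ` space M) x = s x" if "x \<in> space M" for x
  proof -
    have "r (s ` space M) x = (\<Sum>c\<in>s ` space M. if c = s x then c else 0)"
      unfolding r_def by (rule sum.cong) (use that in \<open>auto simp: A_def indicator_def\<close>)
    also have "\<dots> = s x" using fin that by (subst sum.delta) auto
    finally show ?thesis .
  qed
  have "L2_nrm M (\<lambda>x. f x - r (s ` space M) x) = L2_nrm M (\<lambda>x. f x - s x)"
    unfolding L2_nrm_def by (intro arg_cong[of _ _ sqrt] Bochner_Integration.integral_cong) (auto simp: eq)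
  with r[OF fin] s(3) show "\<exists>s \<in> L2 M. P s \<and> L2_nrm M (\<lambda>x. f x - s x) < e" by auto
qed


lemma L2_nrm_tendsto_0:
  fixes f :: "nat \<Rightarrow> 'a \<Rightarrow> 'b::euclidean_space"
  assumes m: "\<And>n. f n \<in> borel_measurable M" and w: "w \<in> L2 M"
    and lim: "AE x in M. (\<lambda>n. f n x) \<longlonglongrightarrow> 0"
    and le: "\<And>n. AE x in M. norm (f n x) \<le> norm (w x)"
  shows "(\<lambda>n. L2_nrm M (f n)) \<longlonglongrightarrow> 0"
proof -
  have "(\<lambda>n. LINT x|M. (norm (f n x))\<^sup>2) \<longlonglongrightarrow> (LINT x|M. 0)"
  proof (rule integral_dominated_convergence[where w="\<lambda>x. (norm (w x))\<^sup>2"])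
    show "AE x in M. (\<lambda>n. (norm (f n x))\<^sup>2) \<longlonglongrightarrow> 0"
      using lim
    proof eventually_elim
      case (elim x)
      from tendsto_power[OF tendsto_norm[OF elim], of 2] show ?case by simp
    qed
    show "AE x in M. norm ((norm (f n x))\<^sup>2) \<le> (norm (w x))\<^sup>2" for n
      using le[of n] by eventually_elim (simp add: power_mono)
    show "(\<lambda>x. (norm (f n x))\<^sup>2) \<in> borel_measurable M" for n
      using m[of n] by measurable
  qed (use w in \<open>simp_all add: L2_integrable_sq\<close>)
  from tendsto_real_sqrt[OF this] show ?thesis by (simp add: L2_nrm_def)
qed

lemma (in finite_measure) L2_indicator_UN:
  fixes c :: "'b::euclidean_space"
  assumes A: "\<And>i::nat. A i \<in> sets M" and e: "0 < e"
  shows "\<exists>n. L2_nrm M (\<lambda>x. indicator (\<Union>i. A i) x *\<^sub>R c - indicator (\<Union>i<n. A i) x *\<^sub>R c) < e"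
proof -
  let ?f = "\<lambda>n x. indicat_real (\<Union>i. A i) x *\<^sub>R c - indicat_real (\<Union>i<n. A i) x *\<^sub>R c"
  have "(\<lambda>n. L2_nrm M (?f n)) \<longlonglongrightarrow> 0"
  proof (rule L2_nrm_tendsto_0[where w="\<lambda>x. c"])
    show "?f n \<in> borel_measurable M" for n using A by measurable
    show "AE x in M. (\<lambda>n. ?f n x) \<longlonglongrightarrow> 0"
    proof (rule AE_I2)
      fix x
      have "(\<lambda>n. indicat_real (\<Union>i<n. A i) x) \<longlonglongrightarrow> indicat_real (\<Union>i. A i) x"
        by (rule LIMSEQ_indicator_UN)
      from tendsto_diff[OF tendsto_const tendsto_scaleR[OF this tendsto_const], of "indicat_real (\<Union>i. A i) x *\<^sub>R c" c]
      show "(\<lambda>n. ?f n x) \<longlonglongrightarrow> 0" by simp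
    qed
    show "AE x in M. norm (?f n x) \<le> norm c" for n
      by (intro AE_I2) (auto simp: indicator_def)
  qed (rule L2_const)
  from order_tendstoD(2)[OF this e] show ?thesis
    unfolding eventually_sequentially by blast
qed

section \<open>Approximation on products by simple functions with values in L2\<close>

lemma finite_measure_pair:
  assumes "finite_measure N" "finite_measure M"
  shows "finite_measure (N \<Otimes>\<^sub>M M)"
proof -
  interpret N: finite_measure N by fact
  interpret M: finite_measure M by fact
  show ?thesis
  proof (rule finite_measureI)
    have "emeasure (N \<Otimes>\<^sub>M M) (space (N \<Otimes>\<^sub>M M)) = emeasure N (space N) * emeasure M (space M)"
      unfolding space_pair_measure by (rule M.emeasure_pair_measure_Times) auto
    then show "emeasure (N \<Otimes>\<^sub>M M) (space (N \<Otimes>\<^sub>M M)) \<noteq> \<infinity>"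
      by (simp add: ennreal_mult_eq_top_iff)
  qed
qed

text \<open>Simple functions of the first variable whose values are elements of L2 of the second.
  The values are compared as functions, not up to null sets, so the range is finite as it stands and
  a choice or a null set can be attached to each value.\<close>

definition tensor_step :: "'a measure \<Rightarrow> 'b measure \<Rightarrow> ('a \<Rightarrow> 'b \<Rightarrow> 'c::euclidean_space) \<Rightarrow> bool" where
  "tensor_step N M s \<longleftrightarrow> simple_function N s \<and> (\<forall>x \<in> space N. s x \<in> L2 M)"

text \<open>A simple function splits the first space into finitely many measurable pieces on which
  the family is constant. \<open>F\<close> enters only through finitely many values and may
  therefore be an arbitrary choice function, as with the near-optimal potentials later.\<close>

lemma simple_function_family_measurable:
  assumes s: "simple_function N s" and m: "\<And>x. x \<in> space N \<Longrightarrow> F (s x) \<in> borel_measurable M"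
  shows "(\<lambda>(x, w). F (s x) w) \<in> borel_measurable (N \<Otimes>\<^sub>M M)"
proof -
  have sm: "s \<in> measurable N (count_space (s ` space N))"
    using s by (subst measurable_count_space_eq2) (auto simp: simple_function_def)
  have "(\<lambda>p. F (s (fst p)) (snd p)) \<in> borel_measurable (N \<Otimes>\<^sub>M M)"
  proof (rule measurable_compose_countable'[where f="\<lambda>i p. F i (snd p)" and I="s ` space N"])
    show "(\<lambda>p. F i (snd p)) \<in> borel_measurable (N \<Otimes>\<^sub>M M)" if "i \<in> s ` space N" for i
      using that by (auto intro!: measurable_compose[OF measurable_snd] m)
    show "(\<lambda>p. s (fst p)) \<in> measurable (N \<Otimes>\<^sub>M M) (count_space (s ` space N))"
      by (rule measurable_compose[OF measurable_fst sm])
    show "countable (s ` space N)"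
      using s by (auto simp: simple_function_def intro: countable_finite)
  qed
  then show ?thesis by (simp add: case_prod_beta)
qed

lemma integrable_snd_finite:
  fixes h :: "'b \<Rightarrow> real"
  assumes "finite_measure N" "finite_measure M" "integrable M h"
  shows "integrable (N \<Otimes>\<^sub>M M) (\<lambda>p. h (snd p))"
proof -
  interpret N: finite_measure N by fact
  interpret M: finite_measure M by fact
  interpret NM: pair_sigma_finite N M ..
  show ?thesis
    by (rule NM.Fubini_integrable) (use assms(3) in auto)
qed

lemma simple_function_family_L2:
  assumes fin: "finite_measure N" "finite_measure M"
    and s: "simple_function N s" and m: "\<And>x. x \<in> space N \<Longrightarrow> F (s x) \<in> L2 M"
  shows "(\<lambda>(x, w). F (s x) w) \<in> L2 (N \<Otimes>\<^sub>M M)"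
proof (rule L2_dominated)
  let ?I = "s ` space N"
  have I: "finite ?I" using simple_functionD(1)[OF s] .
  show "(\<lambda>(x, w). F (s x) w) \<in> borel_measurable (N \<Otimes>\<^sub>M M)"
    by (intro simple_function_family_measurable s L2_measurable m)
  show "integrable (N \<Otimes>\<^sub>M M) (\<lambda>p. \<Sum>i\<in>?I. (norm (F i (snd p)))\<^sup>2)"
  proof (rule Bochner_Integration.integrable_sum)
    fix i assume "i \<in> ?I"
    then have "integrable M (\<lambda>w. (norm (F i w))\<^sup>2)" using m by (auto dest: L2_integrable_sq)
    from integrable_snd_finite[OF fin this]
    show "integrable (N \<Otimes>\<^sub>M M) (\<lambda>p. (norm (F i (snd p)))\<^sup>2)" .
  qed
  have "(norm (F (s x) w))\<^sup>2 \<le> (\<Sum>i\<in>?I. (norm (F i w))\<^sup>2)" if "x \<in> space N" for x w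
    using member_le_sum[of "s x" ?I "\<lambda>i. (norm (F i w))\<^sup>2"] that I by auto
  then show "AE p in (N \<Otimes>\<^sub>M M). (norm (case p of (x, w) \<Rightarrow> F (s x) w))\<^sup>2 \<le> (\<Sum>i\<in>?I. (norm (F i (snd p)))\<^sup>2)"
    by (intro AE_I2) (auto simp: space_pair_measure)
qed

lemma tensor_step_L2:
  "finite_measure N \<Longrightarrow> finite_measure M \<Longrightarrow> tensor_step N M s \<Longrightarrow>
    (\<lambda>(x, w). s x w) \<in> L2 (N \<Otimes>\<^sub>M M)"
  using simple_function_family_L2[where F="\<lambda>s. s"] by (auto simp: tensor_step_def)

definition tensor_approx :: "'a measure \<Rightarrow> 'b measure \<Rightarrow> ('a \<times> 'b \<Rightarrow> 'c::euclidean_space) \<Rightarrow> bool" where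
  "tensor_approx N M u \<longleftrightarrow>
    (\<forall>e>0. \<exists>s. tensor_step N M s \<and> L2_nrm (N \<Otimes>\<^sub>M M) (\<lambda>p. u p - s (fst p) (snd p)) < e)"

lemma tensor_approx_cong:
  assumes "tensor_approx N M u" "\<And>p. p \<in> space (N \<Otimes>\<^sub>M M) \<Longrightarrow> u p = v p"
  shows "tensor_approx N M v"
proof -
  have "L2_nrm (N \<Otimes>\<^sub>M M) (\<lambda>p. v p - s (fst p) (snd p)) = L2_nrm (N \<Otimes>\<^sub>M M) (\<lambda>p. u p - s (fst p) (snd p))" for s
    unfolding L2_nrm_def by (intro arg_cong[of _ _ sqrt] Bochner_Integration.integral_cong) (auto simp: assms(2))
  then show ?thesis using assms(1) by (simp add: tensor_approx_def)
qed

context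
  fixes N :: "'a measure" and M :: "'b measure"
  assumes fin: "finite_measure N" "finite_measure M"
begin

lemma tensor_step_L2': "tensor_step N M s \<Longrightarrow> (\<lambda>p. s (fst p) (snd p)) \<in> L2 (N \<Otimes>\<^sub>M M)"
  using tensor_step_L2[OF fin, of s] by (simp add: case_prod_beta')

lemma tensor_approx_add:
  assumes u: "u \<in> L2 (N \<Otimes>\<^sub>M M)" "tensor_approx N M u" and v: "v \<in> L2 (N \<Otimes>\<^sub>M M)" "tensor_approx N M v"
  shows "tensor_approx N M (\<lambda>p. u p + v p)"
  unfolding tensor_approx_def
proof (intro allI impI)
  fix e :: real assume "0 < e"
  then have "0 < e / 2" by simp
  then obtain s t where st: "tensor_step N M s" "L2_nrm (N \<Otimes>\<^sub>M M) (\<lambda>p. u p - s (fst p) (snd p)) < e / 2"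
    "tensor_step N M t" "L2_nrm (N \<Otimes>\<^sub>M M) (\<lambda>p. v p - t (fst p) (snd p)) < e / 2"
    using u(2) v(2) unfolding tensor_approx_def by meson
  define r where "r = (\<lambda>x w. s x w + t x w)"
  have "simple_function N s" "simple_function N t" using st by (simp_all add: tensor_step_def)
  then have "simple_function N r"
    unfolding r_def by (rule simple_function_compose2[of N s t "\<lambda>a b w. a w + b w"])
  then have r: "tensor_step N M r"
    using st by (simp add: tensor_step_def r_def L2_add)
  have "L2_nrm (N \<Otimes>\<^sub>M M) (\<lambda>p. (u p - s (fst p) (snd p)) + (v p - t (fst p) (snd p))) < e"
    using L2_triangle[OF L2_diff[OF u(1) tensor_step_L2'[OF st(1)]] L2_diff[OF v(1) tensor_step_L2'[OF st(3)]]]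
      st(2,4) by simp
  then show "\<exists>s. tensor_step N M s \<and> L2_nrm (N \<Otimes>\<^sub>M M) (\<lambda>p. u p + v p - s (fst p) (snd p)) < e"
    using r by (intro exI[of _ r]) (simp add: r_def algebra_simps)
qed

lemma tensor_approx_limit:
  assumes u: "u \<in> L2 (N \<Otimes>\<^sub>M M)"
    and lim: "\<And>e. 0 < e \<Longrightarrow> \<exists>v \<in> L2 (N \<Otimes>\<^sub>M M). tensor_approx N M v \<and> L2_nrm (N \<Otimes>\<^sub>M M) (\<lambda>p. u p - v p) < e"
  shows "tensor_approx N M u"
  unfolding tensor_approx_def
proof (intro allI impI)
  fix e :: real assume "0 < e"
  then have e: "0 < e / 2" by simp
  obtain v where v: "v \<in> L2 (N \<Otimes>\<^sub>M M)" "tensor_approx N M v" "L2_nrm (N \<Otimes>\<^sub>M M) (\<lambda>p. u p - v p) < e / 2"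
    using lim[OF e] by blast
  obtain s where s: "tensor_step N M s" "L2_nrm (N \<Otimes>\<^sub>M M) (\<lambda>p. v p - s (fst p) (snd p)) < e / 2"
    using v(2) e unfolding tensor_approx_def by blast
  have "L2_nrm (N \<Otimes>\<^sub>M M) (\<lambda>p. u p - s (fst p) (snd p)) < e"
    using L2_triangle_diff[OF u v(1) tensor_step_L2'[OF s(1)]] v(3) s(2) by simp
  with s(1) show "\<exists>s. tensor_step N M s \<and> L2_nrm (N \<Otimes>\<^sub>M M) (\<lambda>p. u p - s (fst p) (snd p)) < e" by blast
qed

lemma tensor_approx_step: "tensor_step N M s \<Longrightarrow> tensor_approx N M (\<lambda>p. s (fst p) (snd p))"
  unfolding tensor_approx_def by (auto simp: L2_nrm_def)

text \<open>Multiples of indicators of rectangles are themselves step functions with two values.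
  Approximability survives complements by linearity and disjoint countable unions by passing to
  limits in L2, so Dynkin's argument reaches every product-measurable set.\<close>

lemma tensor_approx_indicator:
  assumes A: "A \<in> sets (N \<Otimes>\<^sub>M M)"
  shows "tensor_approx N M (\<lambda>p. indicator A p *\<^sub>R (c::'c::euclidean_space))"
proof -
  interpret N: finite_measure N by (rule fin)
  interpret M: finite_measure M by (rule fin)
  interpret NM: finite_measure "N \<Otimes>\<^sub>M M" by (rule finite_measure_pair[OF fin])
  let ?G = "{a \<times> b |a b. a \<in> sets N \<and> b \<in> sets M}"
  let ?P = "\<lambda>A. tensor_approx N M (\<lambda>p. indicator A p *\<^sub>R c)"
  have iL: "(\<lambda>p. indicator B p *\<^sub>R c) \<in> L2 (N \<Otimes>\<^sub>M M)" if "B \<in> sets (N \<Otimes>\<^sub>M M)" for B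
    by (rule NM.L2_bounded[where B="norm c"]) (use that in \<open>auto simp: indicator_def\<close>)
  have rect: "?P (a \<times> b)" if ab: "a \<in> sets N" "b \<in> sets M" for a b
  proof -
    define s where "s = (\<lambda>x. if x \<in> a then (\<lambda>w. indicator b w *\<^sub>R c) else (\<lambda>w. 0))"
    have "simple_function N s"
      unfolding s_def by (intro simple_function_If_set) (use ab in auto)
    moreover have "(\<lambda>w. indicator b w *\<^sub>R c) \<in> L2 M"
      by (rule M.L2_bounded[where B="norm c"]) (use ab in \<open>auto simp: indicator_def\<close>)
    ultimately have "tensor_step N M s" by (auto simp: tensor_step_def s_def)
    from tensor_approx_step[OF this] show ?thesis
      by (rule tensor_approx_cong) (auto simp: s_def indicator_def)
  qed
  have "A \<in> sigma_sets (space N \<times> space M) ?G"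
    using A by (simp add: sets_pair_measure)
  then show ?thesis
  proof (induction rule: sigma_sets_induct_disjoint[OF Int_stable_pair_measure_generator pair_measure_closed, consumes 1,
        case_names basic empty compl union])
    case (basic A) then show ?case using rect by blast
  next
    case empty show ?case using rect[of "{}" "{}"] by simp
  next
    case (compl A)
    have A: "A \<in> sets (N \<Otimes>\<^sub>M M)" using compl(1) by (simp add: sets_pair_measure)
    have step: "tensor_step N M s \<Longrightarrow> tensor_step N M (\<lambda>x w. - s x w)" for s :: "'a \<Rightarrow> 'b \<Rightarrow> 'c"
      unfolding tensor_step_def using simple_function_compose1[of N s "\<lambda>f w. - f w"] by (auto intro: L2_uminus)
    have neg: "tensor_approx N M (\<lambda>p. - (indicator A p *\<^sub>R c))"
      unfolding tensor_approx_def
    proof (intro allI impI)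
      fix e :: real assume "0 < e"
      then obtain s where s: "tensor_step N M s" "L2_nrm (N \<Otimes>\<^sub>M M) (\<lambda>p. indicator A p *\<^sub>R c - s (fst p) (snd p)) < e"
        using compl(2) unfolding tensor_approx_def by blast
      have "L2_nrm (N \<Otimes>\<^sub>M M) (\<lambda>p. - (indicator A p *\<^sub>R c) - - s (fst p) (snd p)) < e"
        using s(2) L2_nrm_uminus[of "N \<Otimes>\<^sub>M M" "\<lambda>p. indicator A p *\<^sub>R c - s (fst p) (snd p)"] by (simp add: algebra_simps)
      then show "\<exists>s. tensor_step N M s \<and> L2_nrm (N \<Otimes>\<^sub>M M) (\<lambda>p. - (indicator A p *\<^sub>R c) - s (fst p) (snd p)) < e"
        using step[OF s(1)] by (intro exI[of _ "\<lambda>x w. - s x w"]) auto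
    qed
    have "tensor_approx N M (\<lambda>p. indicator (space N \<times> space M) p *\<^sub>R c + - (indicator A p *\<^sub>R c))"
      by (intro tensor_approx_add rect neg iL L2_uminus A) (auto simp: sets_pair_measure)
    then show ?case
      by (rule tensor_approx_cong) (auto simp: indicator_def space_pair_measure)
  next
    case (union A)
    have A: "A i \<in> sets (N \<Otimes>\<^sub>M M)" for i using union(2) by (auto simp: sets_pair_measure)
    have fin: "?P (\<Union>i<n. A i)" for n
    proof (induction n)
      case 0 show ?case using rect[of "{}" "{}"] by simp
    next
      case (Suc n)
      have "tensor_approx N M (\<lambda>p. indicator (\<Union>i<n. A i) p *\<^sub>R c + indicator (A n) p *\<^sub>R c)"
        by (intro tensor_approx_add Suc union(3) iL) (use A in auto)
      moreover have "A i \<inter> A n = {}" if "i < n" for i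
        using that union(1) by (intro disjoint_family_onD[of A UNIV]) auto
      then have "(\<Union>i<n. A i) \<inter> A n = {}" by blast
      ultimately show ?case
        by (elim tensor_approx_cong) (auto simp: indicator_def lessThan_Suc)
    qed
    have AU: "(\<Union>i<n. A i) \<in> sets (N \<Otimes>\<^sub>M M)" for n using A by (intro sets.finite_UN) auto
    show ?case
    proof (rule tensor_approx_limit)
      show "(\<lambda>p. indicator (\<Union> (range A)) p *\<^sub>R c) \<in> L2 (N \<Otimes>\<^sub>M M)"
        by (rule iL, rule sets.countable_UN) (use A in blast)
      fix e :: real assume e: "0 < e"
      from NM.L2_indicator_UN[where A=A and c=c, OF A e]
      obtain n where "L2_nrm (N \<Otimes>\<^sub>M M) (\<lambda>p. indicator (\<Union> (range A)) p *\<^sub>R c - indicator (\<Union>i<n. A i) p *\<^sub>R c) < e"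
        by blast
      then show "\<exists>v\<in>L2 (N \<Otimes>\<^sub>M M). tensor_approx N M v \<and> L2_nrm (N \<Otimes>\<^sub>M M) (\<lambda>p. indicator (\<Union> (range A)) p *\<^sub>R c - v p) < e"
        using fin[of n] iL[OF AU, of n] by blast
    qed
  qed
qed

end

text \<open>Reduces statements about almost every \<omega> that concern all \<open>x\<close>
  together to finitely many functions of \<omega>: each value of the step function contributes one
  null set, and the remainder is controlled in the norm of the product.\<close>

lemma L2_tensor_approx:
  fixes u :: "'a \<times> 'b \<Rightarrow> 'c::euclidean_space"
  assumes fin: "finite_measure N" "finite_measure M"
    and u: "u \<in> L2 (N \<Otimes>\<^sub>M M)" and e: "0 < e"
  obtains s where "tensor_step N M s" "L2_nrm (N \<Otimes>\<^sub>M M) (\<lambda>(x, w). u (x, w) - s x w) < e"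
proof -
  interpret NM: finite_measure "N \<Otimes>\<^sub>M M" by (rule finite_measure_pair[OF fin])
  have "tensor_approx N M u"
    using u
  proof (induction rule: NM.L2_induct)
    case (indicator A c) show ?case by (rule tensor_approx_indicator[OF fin indicator])
  next
    case (add f g) show ?case by (rule tensor_approx_add[OF fin add(1,3) add(2,4)])
  next
    case (approx f) show ?case
    proof (rule tensor_approx_limit[OF fin approx(1)])
      fix e :: real assume "0 < e"
      from approx(2)[OF this] show "\<exists>v \<in> L2 (N \<Otimes>\<^sub>M M). tensor_approx N M v \<and> L2_nrm (N \<Otimes>\<^sub>M M) (\<lambda>p. f p - v p) < e" .
    qed
  qed
  then have "\<exists>s. tensor_step N M s \<and> L2_nrm (N \<Otimes>\<^sub>M M) (\<lambda>p. u p - s (fst p) (snd p)) < e"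
    using e unfolding tensor_approx_def by simp
  then obtain s where s: "tensor_step N M s" "L2_nrm (N \<Otimes>\<^sub>M M) (\<lambda>p. u p - s (fst p) (snd p)) < e"
    by auto
  show ?thesis
  proof (rule that)
    show "tensor_step N M s" by (rule s)
    have "(\<lambda>(x, w). u (x, w) - s x w) = (\<lambda>p. u p - s (fst p) (snd p))" by auto
    then show "L2_nrm (N \<Otimes>\<^sub>M M) (\<lambda>(x, w). u (x, w) - s x w) < e" using s(2) by simp
  qed
qed

section \<open>Test functions and weak gradients\<close>

lemma gradient_nth:
  assumes "(\<phi> has_derivative \<phi>') (at x)"
  shows "gradient \<phi> x $ i = \<phi>' (axis i 1)"
  using frechet_derivative_at[OF assms] by (simp add: gradient_def)

lemma has_derivative_gradient:
  fixes \<phi> :: "real ^ 'n::finite \<Rightarrow> real"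
  assumes "\<phi> differentiable (at x)"
  shows "(\<phi> has_derivative (\<lambda>h. gradient \<phi> x \<bullet> h)) (at x)"
proof -
  obtain \<phi>' where d: "(\<phi> has_derivative \<phi>') (at x)" using assms by (auto simp: differentiable_def)
  then interpret l: linear \<phi>' by (rule has_derivative_linear)
  have "\<phi>' h = gradient \<phi> x \<bullet> h" for h
  proof -
    have "h = (\<Sum>i\<in>UNIV. h $ i *\<^sub>R axis i 1)"
      using basis_expansion[of h] by (simp add: scalar_mult_eq_scaleR)
    then have "\<phi>' h = \<phi>' (\<Sum>i\<in>UNIV. h $ i *\<^sub>R axis i 1)" by simp
    also have "\<dots> = (\<Sum>i\<in>UNIV. h $ i * \<phi>' (axis i 1))" by (simp add: l.sum l.scale)
    also have "\<dots> = gradient \<phi> x \<bullet> h"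
      by (simp add: inner_vec_def gradient_nth[OF d] mult.commute)
    finally show ?thesis .
  qed
  then have "\<phi>' = (\<lambda>h. gradient \<phi> x \<bullet> h)" by auto
  with d show ?thesis by simp
qed

lemma gradient_unique:
  assumes "(\<phi> has_derivative (\<lambda>h. g \<bullet> h)) (at x)"
  shows "gradient \<phi> x = g"
  by (simp add: vec_eq_iff gradient_nth[OF assms] inner_axis)

lemma gradient_const [simp]: "gradient (\<lambda>x. c) x = 0"
  by (rule gradient_unique) simp

lemma gradient_add:
  assumes "f differentiable (at x)" "g differentiable (at x)"
  shows "gradient (\<lambda>x. f x + g x) x = gradient f x + gradient g x"
  by (rule gradient_unique)
     (use has_derivative_add[OF has_derivative_gradient[OF assms(1)] has_derivative_gradient[OF assms(2)]]
      in \<open>simp add: inner_add_left\<close>)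

lemma gradient_mult:
  assumes "f differentiable (at x)" "g differentiable (at x)"
  shows "gradient (\<lambda>x. f x * g x) x = f x *\<^sub>R gradient g x + g x *\<^sub>R gradient f x"
  by (rule gradient_unique)
     (use has_derivative_mult[OF has_derivative_gradient[OF assms(1)] has_derivative_gradient[OF assms(2)]]
      in \<open>simp add: inner_add_left mult.commute\<close>)

section \<open>Smooth functions and bump functions\<close>

definition smooth :: "(real ^ 'n::finite \<Rightarrow> real) \<Rightarrow> bool" where
  "smooth \<phi> \<longleftrightarrow> (\<forall>k. continuously_differentiable k \<phi>)"

text \<open>The recursion asks for differentiability at every level and for continuity only at the
  bottom, where differentiability supplies it.\<close>

lemma continuously_differentiable_SucD:
  "continuously_differentiable (Suc k) \<phi> \<Longrightarrow> continuously_differentiable k \<phi>"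
proof (induction k arbitrary: \<phi>)
  case 0
  then show ?case
    by (simp add: continuous_at_imp_continuous_on differentiable_imp_continuous_within)
next
  case (Suc k)
  note u = iffD1[OF continuously_differentiable.simps(2)[of "Suc k" \<phi>] Suc.prems]
  show ?case
    unfolding continuously_differentiable.simps(2)[of k \<phi>]
    using conjunct1[OF u] Suc.IH[OF spec[OF conjunct2[OF u]]] by blast
qed

lemma continuously_differentiable_const: "continuously_differentiable k (\<lambda>x. c)"
  by (induction k arbitrary: c) simp_all

lemma continuously_differentiable_add:
  "continuously_differentiable k f \<Longrightarrow> continuously_differentiable k g \<Longrightarrow>
    continuously_differentiable k (\<lambda>x. f x + g x)"
proof (induction k arbitrary: f g)
  case 0 then show ?case by (auto intro: continuous_on_add)
next
  case (Suc k)
  then have "(\<lambda>x. gradient (\<lambda>x. f x + g x) x $ i) = (\<lambda>x. gradient f x $ i + gradient g x $ i)" for i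
    by (auto simp: gradient_add)
  with Suc show ?case by auto
qed

lemma continuously_differentiable_mult:
  "continuously_differentiable k f \<Longrightarrow> continuously_differentiable k g \<Longrightarrow>
    continuously_differentiable k (\<lambda>x. f x * g x)"
proof (induction k arbitrary: f g)
  case 0 then show ?case by (auto intro: continuous_on_mult)
next
  case (Suc k)
  then have eq: "(\<lambda>x. gradient (\<lambda>x. f x * g x) x $ i) = (\<lambda>x. f x * gradient g x $ i + g x * gradient f x $ i)" for i
    by (auto simp: gradient_mult)
  have "continuously_differentiable k (\<lambda>x. f x * gradient g x $ i + g x * gradient f x $ i)" for i
    using continuously_differentiable_SucD[OF Suc.prems(1)] continuously_differentiable_SucD[OF Suc.prems(2)]
      Suc.prems by (intro continuously_differentiable_add Suc.IH) auto
  with Suc.prems eq show ?case by (auto intro: differentiable_mult)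
qed

lemma smooth_const: "smooth (\<lambda>x. c)"
  by (simp add: smooth_def continuously_differentiable_const)

lemma smooth_add: "smooth f \<Longrightarrow> smooth g \<Longrightarrow> smooth (\<lambda>x. f x + g x)"
  by (simp add: smooth_def continuously_differentiable_add)

lemma smooth_mult: "smooth f \<Longrightarrow> smooth g \<Longrightarrow> smooth (\<lambda>x. f x * g x)"
  by (simp add: smooth_def continuously_differentiable_mult)

lemma smooth_uminus: "smooth f \<Longrightarrow> smooth (\<lambda>x. - f x)"
  using smooth_mult[OF smooth_const[of "-1"], of f] by simp

lemma smooth_diff: "smooth f \<Longrightarrow> smooth g \<Longrightarrow> smooth (\<lambda>x. f x - g x)"
  using smooth_add[OF _ smooth_uminus, of f g] by simp

lemma smooth_prod: "finite I \<Longrightarrow> (\<And>i. i \<in> I \<Longrightarrow> smooth (f i)) \<Longrightarrow> smooth (\<lambda>x. \<Prod>i\<in>I. f i x)"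
  by (induction I rule: finite_induct) (auto intro: smooth_const smooth_mult)

lemma smooth_differentiable: "smooth f \<Longrightarrow> f differentiable (at x)"
  unfolding smooth_def by (drule spec[of _ "Suc 0"]) simp

lemma smooth_gradient: "smooth f \<Longrightarrow> smooth (\<lambda>x. gradient f x $ i)"
  unfolding smooth_def by (metis continuously_differentiable.simps(2))

lemma smooth_continuous: "smooth f \<Longrightarrow> continuous_on UNIV f"
  unfolding smooth_def by (drule spec[of _ 0]) simp

lemma smooth_has_derivative: "smooth f \<Longrightarrow> (f has_derivative (\<lambda>h. gradient f x \<bullet> h)) (at x)"
  by (intro has_derivative_gradient smooth_differentiable)

lemma smooth_gradient_continuous: "smooth f \<Longrightarrow> continuous_on UNIV (gradient f)"
  using continuous_on_vec_lambda[of UNIV "\<lambda>i x. gradient f x $ i"]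
  by (simp add: smooth_continuous[OF smooth_gradient])

text \<open>The derivatives of \<open>exp (- 1 / t)\<close> are of the form \<open>p (1 / t) * exp (- 1 / t)\<close> with polynomials \<open>p\<close>.\<close>

definition flat_exp :: "real poly \<Rightarrow> real \<Rightarrow> real" where
  "flat_exp p t = (if 0 < t then poly p (1 / t) * exp (- (1 / t)) else 0)"

lemma poly_times_exp_minus_tendsto_0: "((\<lambda>s. poly p s * exp (- s)) \<longlongrightarrow> 0) at_top" for p :: "real poly"
proof -
  have "((\<lambda>s. \<Sum>i\<le>degree p. coeff p i * (s ^ i / exp s)) \<longlongrightarrow> (\<Sum>i\<le>degree p. coeff p i * 0)) at_top"
    by (intro tendsto_sum tendsto_mult tendsto_const tendsto_power_div_exp_0)
  then show ?thesis
    by (simp add: poly_altdef sum_distrib_right exp_minus divide_inverse mult.assoc)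
qed

text \<open>In the variable \<open>s = 1 / t\<close> the derivative with respect to \<open>t\<close>
  is \<open>- s\<^sup>2\<close> times the derivative with respect to \<open>s\<close>; it maps
  \<open>p s * exp (- s)\<close> to \<open>s\<^sup>2 * (p s - p' s) * exp (- s)\<close>. So the
  family \<open>flat_exp\<close> is closed under differentiation.\<close>

lemma flat_has_derivative: "(flat_exp p has_real_derivative flat_exp ([:0, 0, 1:] * (p - pderiv p)) t) (at t)"
proof -
  consider "0 < t" | "t < 0" | "t = 0" by linarith
  then show ?thesis
  proof cases
    case 1
    have "((\<lambda>t. poly p (1 / t) * exp (- (1 / t))) has_real_derivative flat_exp ([:0, 0, 1:] * (p - pderiv p)) t) (at t)"
      using 1 by (auto intro!: derivative_eq_intros poly_DERIV[THEN DERIV_chain2] simp: flat_exp_def field_simps power2_eq_square)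
    then show ?thesis
      by (rule has_field_derivative_transform_within_open[of _ _ _ "{0<..}"]) (use 1 in \<open>auto simp: flat_exp_def\<close>)
  next
    case 2
    have "((\<lambda>t. 0) has_real_derivative flat_exp ([:0, 0, 1:] * (p - pderiv p)) t) (at t)"
      using 2 by (simp add: flat_exp_def)
    then show ?thesis
      by (rule has_field_derivative_transform_within_open[of _ _ _ "{..<0}"]) (use 2 in \<open>auto simp: flat_exp_def\<close>)
  next
    case 3
    \<comment> \<open>For \<open>h > 0\<close> the difference quotient
      \<open>flat_exp p h / h\<close> at 0 is \<open>s * poly p s * exp (- s)\<close> with
      \<open>s = 1 / h\<close>; the factor \<open>[:0, 1:]\<close> is the division by
      \<open>h\<close>.\<close>
    have "((\<lambda>s. poly ([:0, 1:] * p) s * exp (- s)) \<longlongrightarrow> 0) at_top"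
      by (rule poly_times_exp_minus_tendsto_0)
    then have "((\<lambda>h. poly ([:0, 1:] * p) (inverse h) * exp (- inverse h)) \<longlongrightarrow> 0) (at_right 0)"
      by (rule filterlim_compose[OF _ filterlim_inverse_at_top_right])
    then have r: "((\<lambda>h. flat_exp p h / h) \<longlongrightarrow> 0) (at_right 0)"
      by (rule Lim_transform_eventually)
        (auto simp: eventually_at_right_less flat_exp_def field_simps intro!: eventually_at_rightI[of 0 1])
    have l: "((\<lambda>h. flat_exp p h / h) \<longlongrightarrow> 0) (at_left 0)"
      by (rule Lim_transform_eventually[OF tendsto_const])
        (auto simp: flat_exp_def intro!: eventually_at_leftI[of "-1" 0])
    have "((\<lambda>h. flat_exp p h / h) \<longlongrightarrow> 0) (at 0)"
      using l r by (simp add: filterlim_at_split)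
    with 3 show ?thesis by (simp add: DERIV_def flat_exp_def)
  qed
qed

lemma flat_affine_has_derivative:
  fixes x :: "real ^ 'n::finite"
  shows "((\<lambda>x. flat_exp p (c * x $ i + d)) has_derivative
    (\<lambda>h. axis i (c * flat_exp ([:0, 0, 1:] * (p - pderiv p)) (c * x $ i + d)) \<bullet> h)) (at x)"
proof -
  have 1: "((\<lambda>x. c * x $ i + d) has_derivative (\<lambda>h. c * h $ i)) (at x)"
    by (auto intro!: derivative_eq_intros bounded_linear.has_derivative[OF bounded_linear_vec_nth])
  show ?thesis
    using has_derivative_compose[OF 1 flat_has_derivative[of p "c * x $ i + d", unfolded has_field_derivative_def]]
    by (simp add: inner_axis' ac_simps)
qed

lemma smooth_flat_affine: "smooth (\<lambda>x :: real ^ 'n::finite. flat_exp p (c * x $ i + d))"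
proof -
  have "continuously_differentiable k (\<lambda>x :: real ^ 'n. flat_exp p (c * x $ i + d))" for k
  proof (induction k arbitrary: p)
    case 0
    show ?case
      using flat_affine_has_derivative[THEN has_derivative_continuous]
      by (auto intro!: continuous_at_imp_continuous_on)
  next
    case (Suc k)
    have eq: "(\<lambda>x :: real ^ 'n. gradient (\<lambda>x. flat_exp p (c * x $ i + d)) x $ j) =
        (\<lambda>x. (if i = j then c else 0) * flat_exp ([:0, 0, 1:] * (p - pderiv p)) (c * x $ i + d))" for j
      by (auto simp: gradient_unique[OF flat_affine_has_derivative] axis_def)
    show ?case
      unfolding continuously_differentiable.simps(2) eq
      by (intro conjI allI continuously_differentiable_mult continuously_differentiable_const Suc.IH
          differentiableI[OF flat_affine_has_derivative])
  qed
  then show ?thesis by (simp add: smooth_def)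
qed

text \<open>A product of one-dimensional profiles \<open>exp (- 1 / (n * t))\<close>, with
  \<open>t\<close> the distances to the two faces in each direction. For \<open>n > 0\<close> it is
  positive exactly on the open box; \<open>n\<close> steepens it, and it tends to the indicator of
  the box as \<open>n\<close> grows.\<close>

definition bump :: "real \<Rightarrow> real ^ 'n::finite \<Rightarrow> real ^ 'n \<Rightarrow> real ^ 'n \<Rightarrow> real" where
  "bump n a b x = (\<Prod>i\<in>UNIV. flat_exp 1 (n * (x $ i - a $ i)) * flat_exp 1 (n * (b $ i - x $ i)))"

lemma smooth_bump: "smooth (bump n a b)"
proof -
  have "smooth (\<lambda>x. \<Prod>i\<in>UNIV. flat_exp 1 (n * x $ i + (- n * a $ i)) * flat_exp 1 (- n * x $ i + n * b $ i))"
    by (intro smooth_prod smooth_mult smooth_flat_affine) simp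
  moreover have "(\<lambda>x. \<Prod>i\<in>UNIV. flat_exp 1 (n * x $ i + (- n * a $ i)) * flat_exp 1 (- n * x $ i + n * b $ i)) = bump n a b"
    by (auto simp: bump_def algebra_simps intro!: prod.cong)
  ultimately show ?thesis by simp
qed

lemma flat_1_bounds: "0 \<le> flat_exp 1 t" "flat_exp 1 t \<le> 1"
  by (auto simp: flat_exp_def)

lemma flat_1_pos: "0 < t \<Longrightarrow> 0 < flat_exp 1 t"
  by (auto simp: flat_exp_def)

lemma bump_bounds: "0 \<le> bump n a b x" "bump n a b x \<le> 1"
proof -
  show "0 \<le> bump n a b x" unfolding bump_def by (intro prod_nonneg) (simp add: flat_1_bounds)
  show "bump n a b x \<le> 1"
    unfolding bump_def by (intro prod_le_1) (auto simp: flat_1_bounds intro: mult_le_one)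
qed

lemma bump_pos: "0 < n \<Longrightarrow> x \<in> box a b \<Longrightarrow> 0 < bump n a b x"
  unfolding bump_def by (intro prod_pos) (auto simp: mem_box_cart intro!: mult_pos_pos flat_1_pos)

lemma bump_outside:
  assumes "0 < n" "x \<notin> box a b" shows "bump n a b x = 0"
proof -
  obtain i where "\<not> (a $ i < x $ i \<and> x $ i < b $ i)" using assms(2) by (auto simp: mem_box_cart)
  then have "n * (x $ i - a $ i) \<le> 0 \<or> n * (b $ i - x $ i) \<le> 0"
    using assms(1) by (auto simp: mult_le_0_iff)
  then have "flat_exp 1 (n * (x $ i - a $ i)) * flat_exp 1 (n * (b $ i - x $ i)) = 0"
    by (auto simp: flat_exp_def)
  then show ?thesis unfolding bump_def by (intro prod_zero) auto
qed

lemma bump_tendsto_1: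
  assumes "x \<in> box a b" shows "(\<lambda>n. bump (real n) a b x) \<longlonglongrightarrow> 1"
proof -
  have f: "(\<lambda>n. flat_exp 1 (real n * t)) \<longlonglongrightarrow> 1" if t: "0 < t" for t
  proof -
    have "(\<lambda>n. exp (- (1 / t * inverse (real n)))) \<longlonglongrightarrow> exp (- (1 / t * 0))"
      by (intro tendsto_intros lim_inverse_n)
    then have "(\<lambda>n. exp (- (1 / t * inverse (real n)))) \<longlonglongrightarrow> 1" by simp
    then show ?thesis
      by (rule Lim_transform_eventually)
        (auto simp: flat_exp_def t field_simps intro!: eventually_mono[OF eventually_gt_at_top[of 0]])
  qed
  have "(\<lambda>n. bump (real n) a b x) \<longlonglongrightarrow> (\<Prod>i\<in>(UNIV::'a set). 1 * 1)"
    unfolding bump_def using assms by (intro tendsto_prod tendsto_mult f) (auto simp: mem_box_cart)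
  then show ?thesis by simp
qed


section \<open>Closure properties and bounds of test functions\<close>

lemma test_functionsI:
  "smooth \<phi> \<Longrightarrow> compact K \<Longrightarrow> K \<subseteq> D \<Longrightarrow> (\<And>x. x \<notin> K \<Longrightarrow> \<phi> x = 0) \<Longrightarrow> \<phi> \<in> test_functions D"
  by (auto simp: test_functions_def smooth_def)

lemma test_functions_smooth: "\<phi> \<in> test_functions D \<Longrightarrow> smooth \<phi>"
  by (auto simp: test_functions_def smooth_def)

lemma test_functions_support:
  assumes "\<phi> \<in> test_functions D"
  shows "\<exists>K. compact K \<and> K \<subseteq> D \<and> (\<forall>x. x \<notin> K \<longrightarrow> \<phi> x = 0)"
  using assms by (auto simp: test_functions_def)

lemma test_functions_mono: "\<phi> \<in> test_functions D \<Longrightarrow> D \<subseteq> E \<Longrightarrow> \<phi> \<in> test_functions E"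
  by (auto simp: test_functions_def)

lemma test_functions_outside: "\<phi> \<in> test_functions D \<Longrightarrow> x \<notin> D \<Longrightarrow> \<phi> x = 0"
  using test_functions_support by blast

lemma test_functions_add:
  assumes "f \<in> test_functions D" "g \<in> test_functions D"
  shows "(\<lambda>x. f x + g x) \<in> test_functions D"
proof -
  obtain K where K: "compact K" "K \<subseteq> D" "\<And>x. x \<notin> K \<Longrightarrow> f x = 0"
    using assms(1) test_functions_support by blast
  obtain L where L: "compact L" "L \<subseteq> D" "\<And>x. x \<notin> L \<Longrightarrow> g x = 0"
    using assms(2) test_functions_support by blast
  show ?thesis
    using K L test_functions_smooth[OF assms(1)] test_functions_smooth[OF assms(2)]
    by (intro test_functionsI[of _ "K \<union> L"] smooth_add compact_Un) auto
qed

lemma test_functions_mult: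
  assumes "f \<in> test_functions D" "smooth g"
  shows "(\<lambda>x. f x * g x) \<in> test_functions D"
proof -
  obtain K where K: "compact K" "K \<subseteq> D" "\<And>x. x \<notin> K \<Longrightarrow> f x = 0"
    using assms(1) test_functions_support by blast
  show ?thesis
    using K test_functions_smooth[OF assms(1)] assms(2)
    by (intro test_functionsI[of _ K] smooth_mult) auto
qed

lemma test_functions_scale: "f \<in> test_functions D \<Longrightarrow> (\<lambda>x. c * f x) \<in> test_functions D"
  using test_functions_mult[OF _ smooth_const, of f D c] by (simp add: mult.commute)

lemma test_functions_zero: "(\<lambda>x. 0) \<in> test_functions D"
  by (rule test_functionsI[of _ "{}"]) (auto intro: smooth_const)

lemma gradient_outside:
  assumes "closed K" "\<And>x. x \<notin> K \<Longrightarrow> \<phi> x = 0" "x \<notin> K"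
  shows "gradient \<phi> x = 0"
proof (rule gradient_unique)
  have "((\<lambda>x. 0) has_derivative (\<lambda>h. 0)) (at x)" by simp
  then have "(\<phi> has_derivative (\<lambda>h. 0)) (at x)"
    by (rule has_derivative_transform_within_open[of _ _ _ _ "- K"]) (use assms in auto)
  then show "(\<phi> has_derivative (\<lambda>h. 0 \<bullet> h)) (at x)" by simp
qed

lemma test_functions_gradient:
  assumes "\<phi> \<in> test_functions D" shows "(\<lambda>x. gradient \<phi> x $ i) \<in> test_functions D"
proof -
  obtain K where K: "compact K" "K \<subseteq> D" "\<And>x. x \<notin> K \<Longrightarrow> \<phi> x = 0"
    using assms test_functions_support by blast
  have "gradient \<phi> x = 0" if "x \<notin> K" for x
    using compact_imp_closed[OF K(1)] K(3) that by (rule gradient_outside)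
  then show ?thesis
    by (intro test_functionsI[OF _ K(1,2)] smooth_gradient test_functions_smooth[OF assms]) auto
qed

lemma test_functions_bounded:
  assumes "\<phi> \<in> test_functions D"
  shows "\<exists>B. 0 < B \<and> (\<forall>x. \<bar>\<phi> x\<bar> \<le> B)"
proof -
  obtain K where K: "compact K" "\<And>x. x \<notin> K \<Longrightarrow> \<phi> x = 0"
    using assms test_functions_support by blast
  have "compact (\<phi> ` K)"
    using continuous_on_subset[OF smooth_continuous[OF test_functions_smooth[OF assms]]] K(1)
    by (intro compact_continuous_image) auto
  then have "bounded (\<phi> ` K)" by (rule compact_imp_bounded)
  then obtain B where B: "0 < B" "\<And>y. y \<in> \<phi> ` K \<Longrightarrow> norm y \<le> B"
    unfolding bounded_pos by auto
  have "\<bar>\<phi> x\<bar> \<le> B" for x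
    using B K(2)[of x] by (cases "x \<in> K") auto
  with B(1) show ?thesis by blast
qed

lemma test_functions_gradient_bounded:
  assumes "\<phi> \<in> test_functions D"
  shows "\<exists>B. 0 < B \<and> (\<forall>x. norm (gradient \<phi> x) \<le> B)"
proof -
  have "\<exists>B. 0 < B \<and> (\<forall>x. \<bar>gradient \<phi> x $ i\<bar> \<le> B)" for i
    by (rule test_functions_bounded[OF test_functions_gradient[OF assms, of i]])
  then have "\<forall>i. \<exists>B. 0 < B \<and> (\<forall>x. \<bar>gradient \<phi> x $ i\<bar> \<le> B)" by blast
  from choice[OF this]
  obtain B where B: "\<And>i. 0 < B i" "\<And>i x. \<bar>gradient \<phi> x $ i\<bar> \<le> B i" by blast
  show ?thesis
  proof (intro exI[of _ "\<Sum>i\<in>UNIV. B i"] conjI allI)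
    show "0 < (\<Sum>i\<in>UNIV. B i)" using B(1) by (intro sum_pos) auto
    show "norm (gradient \<phi> x) \<le> (\<Sum>i\<in>UNIV. B i)" for x
      using order_trans[OF norm_le_l1_cart sum_mono[of UNIV "\<lambda>i. \<bar>gradient \<phi> x $ i\<bar>" B]] B(2) by blast
  qed
qed

lemma smooth_borel: "smooth f \<Longrightarrow> f \<in> borel_measurable borel"
  by (rule borel_measurable_continuous_onI[OF smooth_continuous])

lemma smooth_gradient_borel: "smooth f \<Longrightarrow> gradient f \<in> borel_measurable borel"
  by (rule borel_measurable_continuous_onI[OF smooth_gradient_continuous])

lemma test_functions_integrable:
  assumes "\<phi> \<in> test_functions D" shows "integrable lborel \<phi>"
proof -
  obtain K where K: "compact K" "\<And>x. x \<notin> K \<Longrightarrow> \<phi> x = 0"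
    using assms test_functions_support by blast
  have "integrable lborel (\<lambda>x. indicator K x *\<^sub>R \<phi> x)"
    by (rule borel_integrable_compact[OF K(1)])
      (rule continuous_on_subset[OF smooth_continuous[OF test_functions_smooth[OF assms]]], simp)
  moreover have "(\<lambda>x. indicator K x *\<^sub>R \<phi> x) = \<phi>" using K(2) by (intro ext) (auto simp: indicator_def)
  ultimately show ?thesis by simp
qed

lemma bump_test_function:
  assumes "0 < n" "cbox a b \<subseteq> D" shows "bump n a b \<in> test_functions D"
  using assms box_subset_cbox[of a b]
  by (intro test_functionsI[of _ "cbox a b"] smooth_bump) (auto intro: bump_outside)

lemma lborel_integral_translation:
  fixes f :: "'a::euclidean_space \<Rightarrow> 'b::{banach, second_countable_topology}"
  assumes [measurable]: "f \<in> borel_measurable borel"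
  shows "(LINT x|lborel. f (c + x)) = (LINT x|lborel. f x)"
  by (subst (2) lborel_distr_plus[of c, symmetric]) (simp add: integral_distr)

lemma lborel_integrable_translation:
  fixes f :: "'a::euclidean_space \<Rightarrow> 'b::{banach, second_countable_topology}"
  assumes [measurable]: "f \<in> borel_measurable borel"
  shows "integrable lborel (\<lambda>x. f (c + x)) \<longleftrightarrow> integrable lborel f"
  by (subst (2) lborel_distr_plus[of c, symmetric]) (simp add: integrable_distr_eq)

text \<open>The difference quotients of \<open>\<phi>\<close> have integral 0, because Lebesgue measure is translation
  invariant.\<close>

lemma integral_gradient_0:
  fixes \<phi> :: "real ^ 'n::finite \<Rightarrow> real"
  assumes phi: "\<phi> \<in> test_functions D"
  shows "(LINT x|lborel. gradient \<phi> x $ i) = 0"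
proof -
  define e where "e = (axis i 1 :: real ^ 'n)"
  obtain B where B: "0 < B" "\<And>x. norm (gradient \<phi> x) \<le> B"
    using test_functions_gradient_bounded[OF phi] by blast
  obtain K where K: "compact K" "\<And>x. x \<notin> K \<Longrightarrow> \<phi> x = 0"
    using phi test_functions_support by blast
  obtain R where R: "0 < R" "\<And>x. x \<in> K \<Longrightarrow> norm x \<le> R"
    using compact_imp_bounded[OF K(1)] unfolding bounded_pos by auto
  have sm: "smooth \<phi>" by (rule test_functions_smooth[OF phi])
  have [measurable]: "\<phi> \<in> borel_measurable borel" by (rule smooth_borel[OF sm])
  have Lip: "\<bar>\<phi> x - \<phi> y\<bar> \<le> B * norm (x - y)" for x y
  proof -
    have "norm (\<phi> x - \<phi> y) \<le> B * norm (x - y)"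
    proof (rule differentiable_bound[of UNIV \<phi> "\<lambda>x h. gradient \<phi> x \<bullet> h"])
      show "(\<phi> has_derivative (\<lambda>h. gradient \<phi> x \<bullet> h)) (at x within UNIV)" for x
        using smooth_has_derivative[OF sm] by simp
      show "onorm (\<lambda>h. gradient \<phi> x \<bullet> h) \<le> B" for x
        using order_trans[OF Cauchy_Schwarz_ineq2 mult_right_mono[OF B(2) norm_ge_zero]] B(1)
        by (intro onorm_bound) auto
    qed auto
    then show ?thesis by simp
  qed
  define t where "t = (\<lambda>n. 1 / real (Suc n))"
  have t: "0 < t n" "t n \<le> 1" for n by (auto simp: t_def)
  have t0: "t \<longlonglongrightarrow> 0" unfolding t_def using LIMSEQ_inverse_real_of_nat by (simp add: inverse_eq_divide)
  define F where "F = (\<lambda>n x. (\<phi> (x + t n *\<^sub>R e) - \<phi> x) / t n)"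
  have int0: "(LINT x|lborel. F n x) = 0" for n
  proof -
    have i1: "integrable lborel (\<lambda>x. \<phi> (t n *\<^sub>R e + x))"
      using test_functions_integrable[OF phi] by (simp add: lborel_integrable_translation)
    have "(LINT x|lborel. \<phi> (t n *\<^sub>R e + x)) = (LINT x|lborel. \<phi> x)"
      by (rule lborel_integral_translation) simp
    then show ?thesis
      unfolding F_def using i1 test_functions_integrable[OF phi] by (simp add: add.commute)
  qed
  have "(\<lambda>n. LINT x|lborel. F n x) \<longlonglongrightarrow> (LINT x|lborel. gradient \<phi> x $ i)"
  \<comment> \<open>Steps are at most 1, so the quotients vanish outside the ball of radius
    \<open>R + 1\<close>; inside they are bounded by the Lipschitz constant
    \<open>B\<close>.\<close>
  proof (rule integral_dominated_convergence[where w="\<lambda>x. indicator (cball 0 (R + 1)) x * B"])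
    show "integrable lborel (\<lambda>x::real^'n. indicator (cball 0 (R + 1)) x * B)"
      by (intro integrable_mult_left integrable_real_indicator emeasure_bounded_finite) auto
    show "AE x in lborel. norm (F n x) \<le> indicator (cball 0 (R + 1)) x * B" for n
    proof (rule AE_I2)
      fix x
      have "\<bar>F n x\<bar> \<le> B"
        using Lip[of "x + t n *\<^sub>R e" x] t(1)[of n] by (simp add: F_def e_def field_simps)
      moreover have "F n x = 0" if "x \<notin> cball 0 (R + 1)"
      proof -
        have "norm x \<le> norm (x + t n *\<^sub>R e) + norm (t n *\<^sub>R e)"
          using norm_triangle_ineq4[of "x + t n *\<^sub>R e" "t n *\<^sub>R e"] by simp
        then have "R < norm x" "R < norm (x + t n *\<^sub>R e)"
          using that t[of n] by (auto simp: e_def)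
        then have "x \<notin> K" "x + t n *\<^sub>R e \<notin> K" using R(2) by force+
        then show ?thesis by (simp add: F_def K(2))
      qed
      ultimately show "norm (F n x) \<le> indicator (cball 0 (R + 1)) x * B"
        by (cases "x \<in> cball 0 (R + 1)") auto
    qed
    show "AE x in lborel. (\<lambda>n. F n x) \<longlonglongrightarrow> gradient \<phi> x $ i"
    proof (rule AE_I2)
      fix x
      have "((\<lambda>s. \<phi> (x + s *\<^sub>R e)) has_derivative (\<lambda>h. gradient \<phi> (x + 0 *\<^sub>R e) \<bullet> (h *\<^sub>R e))) (at 0)"
        by (rule has_derivative_compose[OF _ smooth_has_derivative[OF sm]]) (auto intro!: derivative_eq_intros)
      then have "((\<lambda>s. \<phi> (x + s *\<^sub>R e)) has_real_derivative gradient \<phi> x $ i) (at 0)"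
        by (simp add: has_field_derivative_def e_def inner_axis mult_commute_abs)
      then have "((\<lambda>s. (\<phi> (x + s *\<^sub>R e) - \<phi> x) / s) \<longlongrightarrow> gradient \<phi> x $ i) (at 0)"
        by (simp add: DERIV_def)
      moreover have "t n \<noteq> 0" for n using t(1)[of n] by simp
      then have "filterlim t (at 0) sequentially"
        unfolding filterlim_at using t0 by simp
      ultimately show "(\<lambda>n. F n x) \<longlonglongrightarrow> gradient \<phi> x $ i"
        unfolding F_def by (rule filterlim_compose)
    qed
    show "(\<lambda>x. gradient \<phi> x $ i) \<in> borel_measurable lborel"
      using smooth_borel[OF smooth_gradient[OF sm]] by simp
    show "F n \<in> borel_measurable lborel" for n unfolding F_def by measurable
  qed
  then show ?thesis using int0 by (simp add: LIMSEQ_const_iff)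
qed


text \<open>The product has compact support, so its gradient has integral 0. Only \<open>u\<close>
  carries that support; \<open>v\<close> will be a mollified function defined on the whole
  space.\<close>

lemma integral_gradient_by_parts:
  assumes u: "u \<in> test_functions D" and v: "smooth v"
  shows "(LINT x|lborel. u x * gradient v x $ i) = - (LINT x|lborel. gradient u x $ i * v x)"
proof -
  have "gradient (\<lambda>x. u x * v x) x $ i = u x * gradient v x $ i + gradient u x $ i * v x" for x
    using gradient_mult[OF smooth_differentiable[OF test_functions_smooth[OF u]] smooth_differentiable[OF v], of x]
    by simp
  moreover have "integrable lborel (\<lambda>x. u x * gradient v x $ i)" "integrable lborel (\<lambda>x. gradient u x $ i * v x)"
    using test_functions_integrable[OF test_functions_mult[OF u smooth_gradient[OF v]]]
      test_functions_integrable[OF test_functions_mult[OF test_functions_gradient[OF u] v]] .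
  moreover have "(LINT x|lborel. gradient (\<lambda>x. u x * v x) x $ i) = 0"
    by (rule integral_gradient_0[OF test_functions_mult[OF u v]])
  ultimately show ?thesis by simp
qed

text \<open>The function spaces live on restrictions of completed Lebesgue measure, translations and
  orbits on Borel measure. For Borel integrands this passes from one to the other.\<close>

lemma integral_lebesgue_on_borel:
  fixes f :: "'a::euclidean_space \<Rightarrow> 'b::{banach, second_countable_topology}"
  assumes "f \<in> borel_measurable borel" "S \<in> sets borel"
  shows "(LINT x|lebesgue_on S. f x) = (LINT x|lborel. indicator S x *\<^sub>R f x)"
  using assms by (subst integral_restrict_space) (auto intro!: integral_completion)

lemma integrable_lebesgue_on_borel:
  fixes f :: "'a::euclidean_space \<Rightarrow> 'b::{banach, second_countable_topology}"
  assumes "f \<in> borel_measurable borel" "S \<in> sets borel"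
  shows "integrable (lebesgue_on S) f \<longleftrightarrow> integrable lborel (\<lambda>x. indicator S x *\<^sub>R f x)"
  using assms by (subst integrable_restrict_space) (auto intro!: integrable_completion)

lemma measurable_lebesgue_on_borel:
  "f \<in> measurable borel M \<Longrightarrow> f \<in> measurable (lebesgue_on S) M"
  by (rule measurable_restrict_space1) (rule measurable_completion, simp)

lemma integral_lebesgue_on_support:
  fixes f :: "'a::euclidean_space \<Rightarrow> 'b::{banach, second_countable_topology}"
  assumes "f \<in> borel_measurable borel" "S \<in> sets borel" "\<And>x. x \<notin> S \<Longrightarrow> f x = 0"
  shows "(LINT x|lebesgue_on S. f x) = (LINT x|lborel. f x)"
  unfolding integral_lebesgue_on_borel[OF assms(1,2)]
  by (rule Bochner_Integration.integral_cong) (use assms(3) in \<open>auto simp: indicator_def\<close>)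

lemma finite_measure_lebesgue_on_open:
  "open D \<Longrightarrow> bounded D \<Longrightarrow> finite_measure (lebesgue_on (D::'a::euclidean_space set))"
  by (intro finite_measure_lebesgue_on bounded_set_imp_lmeasurable lmeasurable_open) auto

lemma test_functions_L2:
  assumes D: "open D" "bounded D" and phi: "\<phi> \<in> test_functions E"
  shows "\<phi> \<in> L2 (lebesgue_on D)" "gradient \<phi> \<in> L2 (lebesgue_on D)"
proof -
  interpret finite_measure "lebesgue_on D" by (rule finite_measure_lebesgue_on_open[OF D])
  obtain B where B: "\<And>x. \<bar>\<phi> x\<bar> \<le> B" using test_functions_bounded[OF phi] by blast
  obtain C where C: "\<And>x. norm (gradient \<phi> x) \<le> C" using test_functions_gradient_bounded[OF phi] by blast
  show "\<phi> \<in> L2 (lebesgue_on D)"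
    by (rule L2_bounded[where B=B]) (auto intro!: measurable_lebesgue_on_borel smooth_borel test_functions_smooth[OF phi] simp: B)
  show "gradient \<phi> \<in> L2 (lebesgue_on D)"
    by (rule L2_bounded[where B=C]) (auto intro!: measurable_lebesgue_on_borel smooth_gradient_borel test_functions_smooth[OF phi] simp: C)
qed

lemma has_weak_gradient_test_function:
  assumes D: "open D" "bounded D" and phi: "\<phi> \<in> test_functions D"
  shows "has_weak_gradient D \<phi> (gradient \<phi>)"
  unfolding has_weak_gradient_def
proof (intro conjI ballI allI test_functions_L2[OF D phi])
  fix \<psi> i assume psi: "\<psi> \<in> test_functions D"
  have [measurable]: "\<phi> \<in> borel_measurable borel" "(\<lambda>x. gradient \<phi> x $ i) \<in> borel_measurable borel"
    "\<psi> \<in> borel_measurable borel" "(\<lambda>x. gradient \<psi> x $ i) \<in> borel_measurable borel"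
    using test_functions_smooth[OF phi] test_functions_smooth[OF psi] by (auto intro: smooth_borel smooth_gradient)
  have "(LINT x|lebesgue_on D. \<phi> x * gradient \<psi> x $ i) = (LINT x|lborel. \<phi> x * gradient \<psi> x $ i)"
    by (rule integral_lebesgue_on_support) (use D in \<open>auto simp: test_functions_outside[OF phi]\<close>)
  also have "\<dots> = - (LINT x|lborel. gradient \<phi> x $ i * \<psi> x)"
    by (rule integral_gradient_by_parts[OF phi test_functions_smooth[OF psi]])
  also have "(LINT x|lborel. gradient \<phi> x $ i * \<psi> x) = (LINT x|lebesgue_on D. gradient \<phi> x $ i * \<psi> x)"
    by (rule integral_lebesgue_on_support[symmetric]) (use D in \<open>auto simp: test_functions_outside[OF psi]\<close>)
  finally show "(LINT x|lebesgue_on D. \<phi> x * gradient \<psi> x $ i) = - (LINT x|lebesgue_on D. gradient \<phi> x $ i * \<psi> x)" .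
qed

text \<open>An open set is a countable union of open boxes whose closures it contains. One minus the
  product of all \<open>1 - bump\<close> is a smooth version of the union of the first
  \<open>n\<close> boxes, with values between 0 and 1 and support in a finite union of closed
  boxes.\<close>

lemma open_indicator_test_function_limit:
  fixes U :: "(real ^ 'n::finite) set"
  assumes "open U"
  obtains \<phi> where "\<And>n. \<phi> n \<in> test_functions U" "\<And>n x. 0 \<le> \<phi> n x" "\<And>n x. \<phi> n x \<le> 1"
    "\<And>x. (\<lambda>n. \<phi> n x) \<longlonglongrightarrow> indicator U x"
proof (cases "U = {}")
  case True
  then show ?thesis
    by (intro that[of "\<lambda>n x. 0"]) (auto intro: test_functions_zero)
next
  case False
  define F where "F = {(a, b) | a b. cbox a b \<subseteq> U}"
  define G where "G = {box a b | a b. (a, b) \<in> F}"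
  have "\<Union>G = U"
  proof (intro equalityI subsetI)
    fix x assume "x \<in> U"
    then obtain a b where "cbox a b \<subseteq> U" "x \<in> box a b"
      using open_contains_cbox[OF assms] by metis
    then show "x \<in> \<Union>G" by (auto simp: G_def F_def)
  qed (use box_subset_cbox in \<open>fastforce simp: G_def F_def\<close>)
  obtain H where H: "H \<subseteq> G" "countable H" "\<Union>H = \<Union>G"
    using Lindelof[of G] by (auto simp: G_def)
  have "H \<noteq> {}" using H(3) \<open>\<Union>G = U\<close> False by auto
  define X where "X = from_nat_into H"
  have X: "range X = H" unfolding X_def by (rule range_from_nat_into[OF \<open>H \<noteq> {}\<close> H(2)])
  have "\<exists>a b. X i = box a b \<and> cbox a b \<subseteq> U" for i
  proof -
    have "X i \<in> G" using X H(1) by blast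
    then show ?thesis by (auto simp: G_def F_def)
  qed
  then have "\<forall>i. \<exists>p. X i = box (fst p) (snd p) \<and> cbox (fst p) (snd p) \<subseteq> U" by simp
  from choice[OF this] obtain p where p: "\<forall>i. X i = box (fst (p i)) (snd (p i)) \<and> cbox (fst (p i)) (snd (p i)) \<subseteq> U"
    by blast
  define a b where "a = (\<lambda>i. fst (p i))" and "b = (\<lambda>i. snd (p i))"
  have ab: "X i = box (a i) (b i)" "cbox (a i) (b i) \<subseteq> U" for i using p by (auto simp: a_def b_def)
  \<comment> \<open>The index \<open>n\<close> serves twice, as the number of boxes and as the
    steepness of the bumps. A point of \<open>U\<close> lies in some box \<open>j\<close>, and the
    single factor \<open>j\<close> already forces the product to 0.\<close>
  define \<phi> where "\<phi> = (\<lambda>n x. 1 - (\<Prod>i<n. (1 - bump (real n) (a i) (b i) x)))"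
  have b01: "0 \<le> (\<Prod>i<n. (1 - bump (real m) (a i) (b i) x))" "(\<Prod>i<n. (1 - bump (real m) (a i) (b i) x)) \<le> 1" for n m x
    using bump_bounds by (auto intro!: prod_nonneg prod_le_1)
  show ?thesis
  proof (rule that)
    show "\<phi> n \<in> test_functions U" for n
    proof (rule test_functionsI)
      show "smooth (\<phi> n)" unfolding \<phi>_def by (intro smooth_diff smooth_prod smooth_const smooth_bump) auto
      show "compact (\<Union>i<n. cbox (a i) (b i))" by (intro compact_UN) auto
      show "(\<Union>i<n. cbox (a i) (b i)) \<subseteq> U" using ab(2) by auto
      show "\<phi> n x = 0" if "x \<notin> (\<Union>i<n. cbox (a i) (b i))" for x
      proof -
        have "(\<Prod>i<n. (1 - bump (real n) (a i) (b i) x)) = (\<Prod>i<n. 1)"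
        proof (rule prod.cong)
          fix i assume "i \<in> {..<n}"
          then show "1 - bump (real n) (a i) (b i) x = 1"
            using that box_subset_cbox[of "a i" "b i"] bump_outside[of "real n" x "a i" "b i"] by auto
        qed simp
        then show ?thesis by (simp add: \<phi>_def)
      qed
    qed
    show "0 \<le> \<phi> n x" "\<phi> n x \<le> 1" for n x using b01[where n=n and m=n and x=x] by (auto simp: \<phi>_def)
    show "(\<lambda>n. \<phi> n x) \<longlonglongrightarrow> indicator U x" for x
    proof (cases "x \<in> U")
      case True
      then obtain Y where "Y \<in> range X" "x \<in> Y"
        using \<open>\<Union>G = U\<close> H(3) X by blast
      then obtain j where j: "x \<in> box (a j) (b j)"
        using ab(1) by blast
      have "(\<lambda>n. \<Prod>i<n. (1 - bump (real n) (a i) (b i) x)) \<longlonglongrightarrow> 0"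
      proof (rule tendsto_sandwich[OF _ _ tendsto_const])
        show "\<forall>\<^sub>F n in sequentially. 0 \<le> (\<Prod>i<n. (1 - bump (real n) (a i) (b i) x))" using b01(1) by simp
        show "\<forall>\<^sub>F n in sequentially. (\<Prod>i<n. (1 - bump (real n) (a i) (b i) x)) \<le> 1 - bump (real n) (a j) (b j) x"
          using eventually_gt_at_top[of j]
        proof eventually_elim
          case (elim n)
          have "(\<Prod>i<n. (1 - bump (real n) (a i) (b i) x)) =
              (1 - bump (real n) (a j) (b j) x) * (\<Prod>i\<in>{..<n} - {j}. (1 - bump (real n) (a i) (b i) x))"
            using elim by (intro prod.remove) auto
          also have "\<dots> \<le> (1 - bump (real n) (a j) (b j) x) * 1"
            using bump_bounds by (intro mult_left_mono prod_le_1) auto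
          finally show ?case by simp
        qed
        show "(\<lambda>n. 1 - bump (real n) (a j) (b j) x) \<longlonglongrightarrow> 0"
          using tendsto_diff[OF tendsto_const[of 1] bump_tendsto_1[OF j]] by simp
      qed
      from tendsto_diff[OF tendsto_const[of 1] this] True show ?thesis by (simp add: \<phi>_def)
    next
      case False
      have "\<phi> n x = 0" for n
        using test_functions_outside[OF \<open>\<phi> n \<in> test_functions U\<close> False] .
      then show ?thesis using False by simp
    qed
  qed
qed


section \<open>Uniqueness of weak gradients\<close>

lemma AE_eq_0_if_integral_0:
  fixes g :: "'a \<Rightarrow> real"
  assumes g: "integrable M g"
    and 0: "\<And>A. A \<in> sets M \<Longrightarrow> (LINT x|M. indicator A x * g x) = 0"
  shows "AE x in M. g x = 0"
proof -
  have [measurable]: "g \<in> borel_measurable M" using g by simp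
  have *: "AE x in M. max (s * g x) 0 = 0" if s: "s = 1 \<or> s = -1" for s :: real
  proof -
    define A where "A = {x \<in> space M. 0 < s * g x}"
    have A: "A \<in> sets M" unfolding A_def by measurable
    have "(LINT x|M. max (s * g x) 0) = (LINT x|M. s * (indicator A x * g x))"
      by (rule Bochner_Integration.integral_cong) (auto simp: A_def indicator_def max_def)
    also have "\<dots> = 0" using 0[OF A] by simp
    finally have "(LINT x|M. max (s * g x) 0) = 0" .
    moreover have "integrable M (\<lambda>x. max (s * g x) 0)" using g by simp
    ultimately show ?thesis by (subst (asm) integral_nonneg_eq_0_iff_AE) auto
  qed
  have "AE x in M. max (1 * g x) 0 = 0" "AE x in M. max (- 1 * g x) 0 = 0"
    by (rule *, simp)+
  then show ?thesis
    by eventually_elim (simp add: max_def split: if_splits)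
qed

text \<open>Limits of test functions give vanishing integrals over open sets, Dynkin's argument
  extends this to Borel sets, and a Lebesgue measurable set differs from a Borel set by a null set.
  Integrals over all measurable sets determine \<open>g\<close>.\<close>

lemma fundamental_lemma_of_variations:
  fixes g :: "real ^ 'n::finite \<Rightarrow> real"
  assumes D: "open D" and g: "integrable (lebesgue_on D) g"
    and 0: "\<And>\<phi>. \<phi> \<in> test_functions D \<Longrightarrow> (LINT x|lebesgue_on D. g x * \<phi> x) = 0"
  shows "AE x in lebesgue_on D. g x = 0"
proof (rule AE_eq_0_if_integral_0[OF g])
  let ?N = "lebesgue_on D"
  let ?I = "\<lambda>A. LINT x|?N. indicator A x * g x"
  have [measurable]: "g \<in> borel_measurable ?N" using g by simp
  have im: "(\<lambda>x. indicator A x :: real) \<in> borel_measurable ?N" if "A \<in> sets borel" for A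
    by (rule measurable_lebesgue_on_borel) (use that in simp)
  have ii: "integrable ?N (\<lambda>x. indicator A x * g x)" if "A \<in> sets borel" for A
    using borel_measurable_times[OF im[OF that]]
    by (intro Bochner_Integration.integrable_bound[OF g]) (auto simp: indicator_def)
  have open0: "?I U = 0" if U: "open U" for U
  proof -
    obtain \<phi> where phi: "\<And>n. \<phi> n \<in> test_functions (U \<inter> D)" "\<And>n x. 0 \<le> \<phi> n x" "\<And>n x. \<phi> n x \<le> 1"
      "\<And>x. (\<lambda>n. \<phi> n x) \<longlonglongrightarrow> indicator (U \<inter> D) x"
      by (rule open_indicator_test_function_limit[OF open_Int[OF U D]]) blast
    have "(\<lambda>n. LINT x|?N. g x * \<phi> n x) \<longlonglongrightarrow> (LINT x|?N. g x * indicator (U \<inter> D) x)"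
    proof (rule integral_dominated_convergence[where w="\<lambda>x. \<bar>g x\<bar>"])
      show "(\<lambda>x. g x * indicator (U \<inter> D) x) \<in> borel_measurable ?N"
        by (intro borel_measurable_times im) (use U D in auto)
      show "(\<lambda>x. g x * \<phi> n x) \<in> borel_measurable ?N" for n
        using measurable_lebesgue_on_borel[OF smooth_borel[OF test_functions_smooth[OF phi(1)]]]
        by (intro borel_measurable_times) simp_all
      show "integrable ?N (\<lambda>x. \<bar>g x\<bar>)" using g by simp
      show "AE x in ?N. (\<lambda>n. g x * \<phi> n x) \<longlonglongrightarrow> g x * indicator (U \<inter> D) x"
        by (intro AE_I2 tendsto_mult tendsto_const phi(4))
      show "AE x in ?N. norm (g x * \<phi> n x) \<le> \<bar>g x\<bar>" for n
        using phi(2,3) by (intro AE_I2) (simp add: abs_mult mult_left_le)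
    qed
    moreover have "(LINT x|?N. g x * \<phi> n x) = 0" for n
      by (rule 0) (rule test_functions_mono[OF phi(1)], simp)
    ultimately have "(LINT x|?N. g x * indicator (U \<inter> D) x) = 0" by (simp add: LIMSEQ_const_iff)
    moreover have "(LINT x|?N. g x * indicator (U \<inter> D) x) = ?I U"
      by (rule Bochner_Integration.integral_cong) (auto simp: indicator_def)
    ultimately show ?thesis by simp
  qed
  have borel0: "?I A = 0" if "A \<in> sets borel" for A
  proof -
    have st: "Int_stable {S :: (real ^ 'n) set. open S}" by (auto simp: Int_stable_def)
    have cl: "{S :: (real ^ 'n) set. open S} \<subseteq> Pow UNIV" by simp
    have "A \<in> sigma_sets UNIV {S. open S}" using that by (simp add: borel_def)
    then show ?thesis
    proof (induction rule: sigma_sets_induct_disjoint[OF st cl, consumes 1, case_names basic empty compl union])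
      case (basic A) then show ?case using open0 by simp
    next
      case empty show ?case by simp
    next
      case (compl A)
      have A: "A \<in> sets borel" using compl(1) by (simp add: borel_def)
      have "?I (UNIV - A) = (LINT x|?N. indicator UNIV x * g x - indicator A x * g x)"
        by (rule Bochner_Integration.integral_cong) (auto simp: indicator_def)
      also have "\<dots> = ?I UNIV - ?I A" by (intro Bochner_Integration.integral_diff ii A) simp
      also have "\<dots> = 0" using compl(2) open0[of UNIV] by simp
      finally show ?case .
    next
      case (union A)
      have A: "A i \<in> sets borel" for i using union(2) by (auto simp: borel_def)
      have fin: "?I (\<Union>i<n. A i) = 0" for n
      proof (induction n)
        case 0 show ?case by simp
      next
        case (Suc n)
        have "(\<Union>i<n. A i) \<inter> A n = {}"
        proof -
          have "A i \<inter> A n = {}" if "i < n" for i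
            using that by (intro disjoint_family_onD[OF union(1)]) auto
          then show ?thesis by blast
        qed
        then have "?I (\<Union>i<Suc n. A i) = (LINT x|?N. indicator (\<Union>i<n. A i) x * g x + indicator (A n) x * g x)"
          by (intro Bochner_Integration.integral_cong) (auto simp: indicator_def lessThan_Suc)
        also have "\<dots> = ?I (\<Union>i<n. A i) + ?I (A n)"
          using A by (intro Bochner_Integration.integral_add ii) auto
        finally show ?case using Suc union(3) by simp
      qed
      have "(\<lambda>n. ?I (\<Union>i<n. A i)) \<longlonglongrightarrow> ?I (\<Union>i. A i)"
      proof (rule integral_dominated_convergence[where w="\<lambda>x. \<bar>g x\<bar>"])
        show "(\<lambda>x. indicator (\<Union>i. A i) x * g x) \<in> borel_measurable ?N"
          using A by (intro borel_measurable_times im) auto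
        show "(\<lambda>x. indicator (\<Union>i<n. A i) x * g x) \<in> borel_measurable ?N" for n
          using A by (intro borel_measurable_times im) auto
        show "AE x in ?N. (\<lambda>n. indicator (\<Union>i<n. A i) x * g x) \<longlonglongrightarrow> indicator (\<Union>i. A i) x * g x"
          by (intro AE_I2 tendsto_mult tendsto_const LIMSEQ_indicator_UN)
        show "AE x in ?N. norm (indicator (\<Union>i<n. A i) x * g x) \<le> \<bar>g x\<bar>" for n
          by (intro AE_I2) (auto simp: indicator_def)
      qed (use g in auto)
      then show ?case using fin by (simp add: LIMSEQ_const_iff)
    qed
  qed
  fix A assume A: "A \<in> sets ?N"
  then have Al: "A \<in> sets (completion lborel)"
    using D by (subst (asm) sets_restrict_space_iff) auto
  \<comment> \<open>The measure is completed, so \<open>A\<close> need not be Borel; its Borel main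
    part differs from it by a subset of a null set.\<close>
  have "?I A = ?I (main_part lborel A)"
  proof (rule integral_cong_AE)
    have "AE x in lebesgue. x \<notin> null_part lborel A"
    proof -
      obtain N' where "N' \<in> null_sets lborel" "null_part lborel A \<subseteq> N'"
        using null_part[OF Al(1)] by blast
      then show ?thesis
        by (intro AE_completion AE_I'[of N']) auto
    qed
    then have "AE x in ?N. x \<notin> null_part lborel A"
      using D by (subst AE_restrict_space_iff) auto
    then show "AE x in ?N. indicator A x * g x = indicator (main_part lborel A) x * g x"
      by eventually_elim (subst (1) main_part_null_part_Un[OF Al(1), symmetric], auto simp: indicator_def)
    show "(\<lambda>x. indicator A x * g x) \<in> borel_measurable ?N" using A by measurable
    show "(\<lambda>x. indicator (main_part lborel A) x * g x) \<in> borel_measurable ?N"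
      using main_part_sets[OF Al(1)] by (intro borel_measurable_times im) auto
  qed
  also have "\<dots> = 0" using borel0 main_part_sets[OF Al(1)] by simp
  finally show "?I A = 0" .
qed

text \<open>Weak gradients of functions that agree almost everywhere have the same integrals against
  all test functions. This makes the arbitrary choice in \<open>weak_gradient\<close> harmless up to
  null sets.\<close>

lemma weak_gradient_unique:
  fixes D :: "(real ^ 'n::finite) set"
  assumes D: "open D" "bounded D"
    and g: "has_weak_gradient D u g" and h: "has_weak_gradient D v h" and uv: "AE x in lebesgue_on D. u x = v x"
  shows "AE x in lebesgue_on D. g x = h x"
proof -
  let ?N = "lebesgue_on D"
  interpret finite_measure ?N by (rule finite_measure_lebesgue_on_open[OF D])
  have L2: "u \<in> L2 ?N" "v \<in> L2 ?N" "g \<in> L2 ?N" "h \<in> L2 ?N"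
    using g h by (auto simp: has_weak_gradient_def)
  have "AE x in ?N. g x $ i - h x $ i = 0" for i
  proof (rule fundamental_lemma_of_variations[OF D(1)])
    show "integrable ?N (\<lambda>x. g x $ i - h x $ i)"
      by (intro Bochner_Integration.integrable_diff L2_integrable L2_component L2)
    fix \<phi> assume phi: "\<phi> \<in> test_functions D"
    note P = test_functions_L2(1)[OF D phi] test_functions_L2(1)[OF D test_functions_gradient[OF phi]]
    have "(LINT x|?N. u x * gradient \<phi> x $ i) = (LINT x|?N. v x * gradient \<phi> x $ i)"
    proof (rule integral_cong_AE)
      show "AE x in ?N. u x * gradient \<phi> x $ i = v x * gradient \<phi> x $ i"
        using uv by eventually_elim simp
    qed (use L2(1,2) P in \<open>auto intro!: borel_measurable_times dest!: L2_measurable\<close>)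
    then have "(LINT x|?N. g x $ i * \<phi> x) = (LINT x|?N. h x $ i * \<phi> x)"
      using g h phi by (auto simp: has_weak_gradient_def)
    then show "(LINT x|?N. (g x $ i - h x $ i) * \<phi> x) = 0"
      using L2_mult_integrable[OF L2_component[OF L2(3)] P(1)] L2_mult_integrable[OF L2_component[OF L2(4)] P(1)]
      by (simp add: left_diff_distrib)
  qed
  then have "AE x in ?N. \<forall>i. g x $ i - h x $ i = 0" by (simp add: AE_all_countable)
  then show ?thesis by eventually_elim (simp add: vec_eq_iff)
qed

section \<open>Functions vanishing on the boundary\<close>

lemma H10_has_weak_gradient: "u \<in> H10 D \<Longrightarrow> has_weak_gradient D u (weak_gradient D u)"
  unfolding H10_def H1_def weak_gradient_def by (auto intro: someI[of "has_weak_gradient D u"])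

lemma weak_gradient_AE_eq:
  assumes "open D" "bounded D" "has_weak_gradient D u g"
  shows "AE x in lebesgue_on D. weak_gradient D u x = g x"
proof -
  have "has_weak_gradient D u (weak_gradient D u)"
    unfolding weak_gradient_def using assms(3) by (rule someI[of "has_weak_gradient D u"])
  from weak_gradient_unique[OF assms(1,2) this assms(3)] show ?thesis by simp
qed

lemma has_weak_gradient_add:
  assumes D: "open D" "bounded D" and u: "has_weak_gradient D u g" and v: "has_weak_gradient D v h"
  shows "has_weak_gradient D (\<lambda>x. u x + v x) (\<lambda>x. g x + h x)"
  unfolding has_weak_gradient_def
proof (intro conjI ballI allI)
  have L2: "u \<in> L2 (lebesgue_on D)" "v \<in> L2 (lebesgue_on D)" "g \<in> L2 (lebesgue_on D)" "h \<in> L2 (lebesgue_on D)"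
    using u v by (simp_all add: has_weak_gradient_def)
  show "(\<lambda>x. u x + v x) \<in> L2 (lebesgue_on D)" "(\<lambda>x. g x + h x) \<in> L2 (lebesgue_on D)"
    by (intro L2_add L2)+
  fix \<phi> i assume phi: "\<phi> \<in> test_functions D"
  note P = test_functions_L2(1)[OF D phi] test_functions_L2(1)[OF D test_functions_gradient[OF phi]]
  note I = L2_mult_integrable[OF L2(1) P(2)] L2_mult_integrable[OF L2(2) P(2)]
    L2_mult_integrable[OF L2_component[OF L2(3)] P(1)] L2_mult_integrable[OF L2_component[OF L2(4)] P(1)]
  show "(LINT x|lebesgue_on D. (u x + v x) * gradient \<phi> x $ i) =
      - (LINT x|lebesgue_on D. (g x + h x) $ i * \<phi> x)"
    using u v phi I by (simp add: distrib_right has_weak_gradient_def)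
qed

lemma has_weak_gradient_uminus:
  assumes u: "has_weak_gradient D u g"
  shows "has_weak_gradient D (\<lambda>x. - u x) (\<lambda>x. - g x)"
  using u by (auto simp: has_weak_gradient_def intro: L2_uminus)

lemma has_weak_gradient_diff:
  assumes "open D" "bounded D" "has_weak_gradient D u g" "has_weak_gradient D v h"
  shows "has_weak_gradient D (\<lambda>x. u x - v x) (\<lambda>x. g x - h x)"
  using has_weak_gradient_add[OF assms(1-3) has_weak_gradient_uminus[OF assms(4)]] by simp

lemma H1_nrm_eq:
  assumes "open D" "bounded D" and u: "has_weak_gradient D u g"
  shows "H1_nrm D u = sqrt ((L2_nrm (lebesgue_on D) u)\<^sup>2 + (L2_nrm (lebesgue_on D) g)\<^sup>2)"
proof -
  have "has_weak_gradient D u (weak_gradient D u)"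
    unfolding weak_gradient_def using u by (rule someI[of "has_weak_gradient D u"])
  then have "L2_nrm (lebesgue_on D) (weak_gradient D u) = L2_nrm (lebesgue_on D) g"
    using u weak_gradient_AE_eq[OF assms]
    by (intro L2_nrm_cong_AE) (simp_all add: has_weak_gradient_def L2_measurable)
  then show ?thesis by (simp add: H1_nrm_def)
qed

text \<open>Together with \<open>H10_approx\<close> it replaces \<open>H1_nrm\<close>, which is
  built on the chosen gradient, by two separate conditions on any weak gradient at hand.\<close>

lemma H10_I:
  assumes D: "open D" "bounded D" and u: "has_weak_gradient D u g"
    and a: "\<And>e. 0 < e \<Longrightarrow> \<exists>\<phi>\<in>test_functions D. L2_nrm (lebesgue_on D) (\<lambda>x. u x - \<phi> x) < e \<and>
      L2_nrm (lebesgue_on D) (\<lambda>x. g x - gradient \<phi> x) < e"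
  shows "u \<in> H10 D"
proof -
  have "\<exists>\<phi>\<in>test_functions D. H1_nrm D (\<lambda>x. u x - \<phi> x) < e" if "0 < e" for e
  proof -
    have "0 < e / 2" using that by simp
    from a[OF this] obtain \<phi> where phi: "\<phi> \<in> test_functions D" "L2_nrm (lebesgue_on D) (\<lambda>x. u x - \<phi> x) < e / 2"
      "L2_nrm (lebesgue_on D) (\<lambda>x. g x - gradient \<phi> x) < e / 2"
      by blast
    have "H1_nrm D (\<lambda>x. u x - \<phi> x) \<le> L2_nrm (lebesgue_on D) (\<lambda>x. u x - \<phi> x) + L2_nrm (lebesgue_on D) (\<lambda>x. g x - gradient \<phi> x)"
      unfolding H1_nrm_eq[OF D has_weak_gradient_diff[OF D u has_weak_gradient_test_function[OF D phi(1)]]]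
      by (rule sqrt_sum_squares_le_sum) auto
    with phi show ?thesis by (intro bexI[of _ \<phi>]) auto
  qed
  then show ?thesis using u by (auto simp: H10_def H1_def)
qed

lemma H10_approx:
  assumes D: "open D" "bounded D" and u: "u \<in> H10 D" "has_weak_gradient D u g" and e: "0 < e"
  shows "\<exists>\<phi>\<in>test_functions D. L2_nrm (lebesgue_on D) (\<lambda>x. u x - \<phi> x) < e \<and>
      L2_nrm (lebesgue_on D) (\<lambda>x. g x - gradient \<phi> x) < e"
proof -
  obtain \<phi> where phi: "\<phi> \<in> test_functions D" "H1_nrm D (\<lambda>x. u x - \<phi> x) < e"
    using u(1) e by (auto simp: H10_def)
  note eq = H1_nrm_eq[OF D has_weak_gradient_diff[OF D u(2) has_weak_gradient_test_function[OF D phi(1)]]]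
  have "L2_nrm (lebesgue_on D) (\<lambda>x. u x - \<phi> x) \<le> H1_nrm D (\<lambda>x. u x - \<phi> x)"
    "L2_nrm (lebesgue_on D) (\<lambda>x. g x - gradient \<phi> x) \<le> H1_nrm D (\<lambda>x. u x - \<phi> x)"
    unfolding eq by (auto intro: real_le_rsqrt)
  with phi show ?thesis by (intro bexI[of _ \<phi>]) auto
qed

lemma H10_test_function:
  assumes D: "open D" "bounded D" and phi: "\<phi> \<in> test_functions D"
  shows "\<phi> \<in> H10 D"
  by (rule H10_I[OF D has_weak_gradient_test_function[OF D phi]])
    (rule bexI[OF _ phi], simp add: L2_nrm_def)

lemma L2_nrm_diff_diff_less:
  assumes "f \<in> L2 N" "g \<in> L2 N" "f' \<in> L2 N" "g' \<in> L2 N"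
    "L2_nrm N (\<lambda>x. f x - f' x) < e / 2" "L2_nrm N (\<lambda>x. g x - g' x) < e / 2"
  shows "L2_nrm N (\<lambda>x. (f x - g x) - (f' x - g' x)) < e"
proof -
  have "L2_nrm N (\<lambda>x. (f x - f' x) + (g' x - g x)) \<le> L2_nrm N (\<lambda>x. f x - f' x) + L2_nrm N (\<lambda>x. g' x - g x)"
    by (intro L2_triangle L2_diff assms)
  with assms(5,6) show ?thesis by (simp add: L2_nrm_minus_commute[of _ g' g] algebra_simps)
qed

lemma H10_diff:
  assumes D: "open D" "bounded D" and u: "u \<in> H10 D" and v: "v \<in> H10 D"
  shows "(\<lambda>x. u x - v x) \<in> H10 D"
proof (rule H10_I[OF D has_weak_gradient_diff[OF D H10_has_weak_gradient[OF u] H10_has_weak_gradient[OF v]]])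
  let ?N = "lebesgue_on D"
  fix e :: real assume "0 < e"
  then have e: "0 < e / 2" by simp
  note wu = H10_has_weak_gradient[OF u] and wv = H10_has_weak_gradient[OF v]
  obtain \<phi> where phi: "\<phi> \<in> test_functions D" "L2_nrm ?N (\<lambda>x. u x - \<phi> x) < e / 2"
      "L2_nrm ?N (\<lambda>x. weak_gradient D u x - gradient \<phi> x) < e / 2"
    using H10_approx[OF D u wu e] by auto
  obtain \<psi> where psi: "\<psi> \<in> test_functions D" "L2_nrm ?N (\<lambda>x. v x - \<psi> x) < e / 2"
      "L2_nrm ?N (\<lambda>x. weak_gradient D v x - gradient \<psi> x) < e / 2"
    using H10_approx[OF D v wv e] by auto
  have L: "u \<in> L2 ?N" "v \<in> L2 ?N" "weak_gradient D u \<in> L2 ?N" "weak_gradient D v \<in> L2 ?N"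
    using wu wv by (simp_all add: has_weak_gradient_def)
  define w where "w = (\<lambda>x. \<phi> x + -1 * \<psi> x)"
  have chi: "w \<in> test_functions D"
    unfolding w_def by (intro test_functions_add test_functions_scale phi(1) psi(1))
  have grad_w: "gradient w x = gradient \<phi> x - gradient \<psi> x" for x
  proof -
    have d: "\<phi> differentiable (at x)" "\<psi> differentiable (at x)" "(\<lambda>x. -1 * \<psi> x) differentiable (at x)"
      by (intro smooth_differentiable smooth_mult smooth_const test_functions_smooth[OF phi(1)] test_functions_smooth[OF psi(1)])+
    show ?thesis
      unfolding w_def gradient_add[OF d(1,3)] gradient_mult[OF differentiable_const d(2)] by simp
  qed
  show "\<exists>\<phi>\<in>test_functions D. L2_nrm ?N (\<lambda>x. u x - v x - \<phi> x) < e \<and>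
      L2_nrm ?N (\<lambda>x. weak_gradient D u x - weak_gradient D v x - gradient \<phi> x) < e"
  proof (intro bexI[OF _ chi] conjI)
    show "L2_nrm ?N (\<lambda>x. u x - v x - w x) < e"
      using L2_nrm_diff_diff_less[OF L(1,2) test_functions_L2(1)[OF D phi(1)] test_functions_L2(1)[OF D psi(1)] phi(2) psi(2)]
      by (simp add: w_def)
    show "L2_nrm ?N (\<lambda>x. weak_gradient D u x - weak_gradient D v x - gradient w x) < e"
      using L2_nrm_diff_diff_less[OF L(3,4) test_functions_L2(2)[OF D phi(1)] test_functions_L2(2)[OF D psi(1)] phi(3) psi(3)]
      by (simp add: grad_w)
  qed
qed

text \<open>Orthogonality to gradients of test functions passes to the closure. It turns a flux that
  is solenoidal in the sense of distributions into one orthogonal to the gradients of the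
  microscopic problem.\<close>

lemma H10_orthogonal:
  assumes D: "open D" "bounded D" and u: "u \<in> H10 D" "has_weak_gradient D u g"
    and h: "h \<in> L2 (lebesgue_on D)"
    and 0: "\<And>\<phi>. \<phi> \<in> test_functions D \<Longrightarrow> (LINT x|lebesgue_on D. h x \<bullet> gradient \<phi> x) = 0"
  shows "(LINT x|lebesgue_on D. h x \<bullet> g x) = 0"
proof -
  let ?N = "lebesgue_on D" and ?I = "\<bar>LINT x|lebesgue_on D. h x \<bullet> g x\<bar>"
  have g: "g \<in> L2 ?N" using u(2) by (simp add: has_weak_gradient_def)
  have "?I \<le> e" if e: "0 < e" for e
  proof -
    \<comment> \<open>The summand 1 keeps \<open>c\<close> positive when \<open>h\<close> is 0
      almost everywhere.\<close>
    define c where "c = L2_nrm ?N h + 1"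
    have c: "0 < c" by (simp add: c_def add_nonneg_pos)
    obtain \<phi> where phi: "\<phi> \<in> test_functions D" "L2_nrm ?N (\<lambda>x. g x - gradient \<phi> x) < e / c"
      using H10_approx[OF D u, of "e / c"] e c by auto
    note P = test_functions_L2(2)[OF D phi(1)]
    have "(LINT x|?N. h x \<bullet> g x) = (LINT x|?N. h x \<bullet> (g x - gradient \<phi> x))"
      using 0[OF phi(1)] L2_inner_integrable[OF h g] L2_inner_integrable[OF h P] by (simp add: inner_diff_right)
    then have "?I \<le> L2_nrm ?N h * L2_nrm ?N (\<lambda>x. g x - gradient \<phi> x)"
      using L2_Cauchy_Schwarz[OF h L2_diff[OF g P]] by simp
    also have "\<dots> \<le> c * (e / c)"
      using phi(2) c by (intro mult_mono) (auto simp: c_def)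
    finally show ?thesis using c by simp
  qed
  then have "?I \<le> 0" using field_le_epsilon[of ?I 0] by simp
  then show ?thesis by simp
qed

text \<open>A constant field is orthogonal to gradients of test functions because each partial
  derivative of a test function has integral 0; the closure inherits this.\<close>

lemma H10_mean_gradient_0:
  assumes D: "open D" "bounded D" and u: "u \<in> H10 D" "has_weak_gradient D u g"
  shows "(LINT x|lebesgue_on D. c \<bullet> g x) = 0"
proof (rule H10_orthogonal[OF D u])
  interpret finite_measure "lebesgue_on D" by (rule finite_measure_lebesgue_on_open[OF D])
  show "(\<lambda>x. c) \<in> L2 (lebesgue_on D)" by (rule L2_const)
  fix \<phi> assume phi: "\<phi> \<in> test_functions D"
  have "(LINT x|lebesgue_on D. c \<bullet> gradient \<phi> x) = (LINT x|lebesgue_on D. (\<Sum>i\<in>UNIV. c $ i * gradient \<phi> x $ i))"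
    by (simp add: inner_vec_def)
  also have "\<dots> = (\<Sum>i\<in>UNIV. c $ i * (LINT x|lebesgue_on D. gradient \<phi> x $ i))"
    using L2_integrable[OF test_functions_L2(1)[OF D test_functions_gradient[OF phi]]]
    by (subst Bochner_Integration.integral_sum) auto
  also have "\<dots> = 0"
  proof -
    have "(LINT x|lebesgue_on D. gradient \<phi> x $ i) = (LINT x|lborel. gradient \<phi> x $ i)" for i
      by (rule integral_lebesgue_on_support)
        (use D in \<open>auto intro: smooth_borel smooth_gradient test_functions_smooth[OF phi]
          simp: test_functions_outside[OF test_functions_gradient[OF phi]]\<close>)
    then show ?thesis using integral_gradient_0[OF phi] by simp
  qed
  finally show "(LINT x|lebesgue_on D. c \<bullet> gradient \<phi> x) = 0" .
qed

section \<open>Families of functions vanishing on the boundary\<close>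

lemma L2_H10_has_weak_gradient_y:
  "u \<in> L2_H10 D Y \<Longrightarrow> has_weak_gradient_y D Y u (weak_gradient_y D Y u)"
  unfolding L2_H10_def weak_gradient_y_def by (auto intro: someI[of "has_weak_gradient_y D Y u"])

text \<open>Uniqueness holds on almost every fibre. Since both gradients are jointly measurable, the
  set of agreement is measurable, and Fubini makes it a set of full measure in the product.\<close>

lemma weak_gradient_y_AE_eq:
  assumes D: "open D" "bounded D" and Y: "open Y" "bounded Y" and u: "has_weak_gradient_y D Y u g"
  shows "AE p in lebesgue_on D \<Otimes>\<^sub>M lebesgue_on Y. weak_gradient_y D Y u (fst p) (snd p) = g (fst p) (snd p)"
proof -
  interpret D: finite_measure "lebesgue_on D" by (rule finite_measure_lebesgue_on_open[OF D])
  interpret Y: finite_measure "lebesgue_on Y" by (rule finite_measure_lebesgue_on_open[OF Y])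
  interpret DY: pair_sigma_finite "lebesgue_on D" "lebesgue_on Y" ..
  define G where "G = weak_gradient_y D Y u"
  have w: "has_weak_gradient_y D Y u G"
    unfolding weak_gradient_y_def G_def using u by (rule someI[of "has_weak_gradient_y D Y u"])
  have [measurable]: "(\<lambda>p. G (fst p) (snd p)) \<in> borel_measurable (lebesgue_on D \<Otimes>\<^sub>M lebesgue_on Y)"
    "(\<lambda>p. g (fst p) (snd p)) \<in> borel_measurable (lebesgue_on D \<Otimes>\<^sub>M lebesgue_on Y)"
    using w u by (auto simp: has_weak_gradient_y_def case_prod_beta' dest: L2_measurable)
  show ?thesis
    unfolding G_def[symmetric]
  proof (rule DY.AE_pair_measure)
    show "{p \<in> space (lebesgue_on D \<Otimes>\<^sub>M lebesgue_on Y). G (fst p) (snd p) = g (fst p) (snd p)}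
        \<in> sets (lebesgue_on D \<Otimes>\<^sub>M lebesgue_on Y)" by measurable
    have "AE x in lebesgue_on D. has_weak_gradient Y (u x) (G x)" "AE x in lebesgue_on D. has_weak_gradient Y (u x) (g x)"
      using w u by (simp_all add: has_weak_gradient_y_def)
    then show "AE x in lebesgue_on D. AE y in lebesgue_on Y. G (fst (x, y)) (snd (x, y)) = g (fst (x, y)) (snd (x, y))"
    proof eventually_elim
      case (elim x)
      from weak_gradient_unique[OF Y elim] show ?case by simp
    qed
  qed
qed

lemma has_weak_gradient_y_diff:
  assumes Y: "open Y" "bounded Y" and u: "has_weak_gradient_y D Y u g" and v: "has_weak_gradient_y D Y v h"
  shows "has_weak_gradient_y D Y (\<lambda>x y. u x y - v x y) (\<lambda>x y. g x y - h x y)"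
  unfolding has_weak_gradient_y_def
proof
  show "(\<lambda>(x, y). g x y - h x y) \<in> L2 (lebesgue_on D \<Otimes>\<^sub>M lebesgue_on Y)"
    using u v L2_diff[of "\<lambda>(x, y). g x y" _ "\<lambda>(x, y). h x y"]
    by (simp add: has_weak_gradient_y_def case_prod_beta')
  have "AE x in lebesgue_on D. has_weak_gradient Y (u x) (g x)" "AE x in lebesgue_on D. has_weak_gradient Y (v x) (h x)"
    using u v by (simp_all add: has_weak_gradient_y_def)
  then show "AE x in lebesgue_on D. has_weak_gradient Y (\<lambda>y. u x y - v x y) (\<lambda>y. g x y - h x y)"
    by eventually_elim (rule has_weak_gradient_diff[OF Y])
qed

lemma L2_H10_diff:
  assumes Y: "open Y" "bounded Y" and u: "u \<in> L2_H10 D Y" and v: "v \<in> L2_H10 D Y"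
  shows "(\<lambda>x y. u x y - v x y) \<in> L2_H10 D Y"
  unfolding L2_H10_def
proof (intro CollectI conjI)
  show "(\<lambda>(x, y). u x y - v x y) \<in> L2 (lebesgue_on D \<Otimes>\<^sub>M lebesgue_on Y)"
    using u v L2_diff[of "\<lambda>(x, y). u x y" _ "\<lambda>(x, y). v x y"]
    by (simp add: L2_H10_def case_prod_beta')
  have "AE x in lebesgue_on D. u x \<in> H10 Y" "AE x in lebesgue_on D. v x \<in> H10 Y"
    using u v by (simp_all add: L2_H10_def)
  then show "AE x in lebesgue_on D. (\<lambda>y. u x y - v x y) \<in> H10 Y"
    by eventually_elim (rule H10_diff[OF Y])
  show "\<exists>g. has_weak_gradient_y D Y (\<lambda>x y. u x y - v x y) g"
    using has_weak_gradient_y_diff[OF Y L2_H10_has_weak_gradient_y[OF u] L2_H10_has_weak_gradient_y[OF v]] by blast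
qed

lemma test_functions_Lipschitz:
  assumes phi: "\<phi> \<in> test_functions D"
  shows "\<exists>B>0. \<forall>x y. \<bar>\<phi> x - \<phi> y\<bar> \<le> B * norm (x - y)"
proof -
  obtain B where B: "0 < B" "\<And>x. norm (gradient \<phi> x) \<le> B"
    using test_functions_gradient_bounded[OF phi] by blast
  have "norm (\<phi> x - \<phi> y) \<le> B * norm (x - y)" for x y
  proof (rule differentiable_bound[of UNIV \<phi> "\<lambda>x h. gradient \<phi> x \<bullet> h"])
    show "(\<phi> has_derivative (\<lambda>h. gradient \<phi> x \<bullet> h)) (at x within UNIV)" for x
      using smooth_has_derivative[OF test_functions_smooth[OF phi]] by simp
    show "onorm (\<lambda>h. gradient \<phi> x \<bullet> h) \<le> B" for x
      using order_trans[OF Cauchy_Schwarz_ineq2 mult_right_mono[OF B(2) norm_ge_zero]] B(1)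
      by (intro onorm_bound) auto
  qed auto
  with B(1) show ?thesis by auto
qed

lemma test_functions_gradient_Lipschitz:
  assumes phi: "\<phi> \<in> test_functions D"
  shows "\<exists>B>0. \<forall>x y. norm (gradient \<phi> x - gradient \<phi> y) \<le> B * norm (x - y)"
proof -
  have "\<forall>i. \<exists>B. 0 < B \<and> (\<forall>x y. \<bar>gradient \<phi> x $ i - gradient \<phi> y $ i\<bar> \<le> B * norm (x - y))"
    using test_functions_Lipschitz[OF test_functions_gradient[OF phi]] by blast
  from choice[OF this] obtain B where B: "\<And>i. 0 < B i"
    "\<And>i x y. \<bar>gradient \<phi> x $ i - gradient \<phi> y $ i\<bar> \<le> B i * norm (x - y)" by blast
  have "norm (gradient \<phi> x - gradient \<phi> y) \<le> (\<Sum>i\<in>UNIV. B i) * norm (x - y)" for x y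
  proof -
    have "norm (gradient \<phi> x - gradient \<phi> y) \<le> (\<Sum>i\<in>UNIV. \<bar>(gradient \<phi> x - gradient \<phi> y) $ i\<bar>)"
      by (rule norm_le_l1_cart)
    also have "\<dots> \<le> (\<Sum>i\<in>UNIV. B i * norm (x - y))" using B(2) by (intro sum_mono) simp
    finally show ?thesis by (simp add: sum_distrib_right)
  qed
  moreover have "0 < (\<Sum>i\<in>UNIV. B i)" using B(1) by (intro sum_pos) auto
  ultimately show ?thesis by blast
qed

text \<open>The mean value inequality is applied to
  \<open>\<phi> (x + w) - gradient \<phi> x \<bullet> w\<close>, whose derivative is a difference of
  gradients and hence of order \<open>norm w\<close>. The constant is uniform in \<open>x\<close>,
  so the estimate survives integration.\<close>

lemma test_functions_Taylor:
  fixes \<phi> :: "real ^ 'n::finite \<Rightarrow> real"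
  assumes phi: "\<phi> \<in> test_functions D"
  shows "\<exists>C>0. \<forall>x v. \<bar>\<phi> (x + v) - \<phi> x - gradient \<phi> x \<bullet> v\<bar> \<le> C * (norm v)\<^sup>2"
proof -
  obtain C where C: "0 < C" "\<And>x y. norm (gradient \<phi> x - gradient \<phi> y) \<le> C * norm (x - y)"
    using test_functions_gradient_Lipschitz[OF phi] by blast
  have "\<bar>\<phi> (x + v) - \<phi> x - gradient \<phi> x \<bullet> v\<bar> \<le> C * (norm v)\<^sup>2" for x v
  proof -
    define f where "f = (\<lambda>w. \<phi> (x + w) - gradient \<phi> x \<bullet> w)"
    have "norm (f v - f 0) \<le> (C * norm v) * norm (v - 0)"
    proof (rule differentiable_bound[of "cball 0 (norm v)" f "\<lambda>w h. (gradient \<phi> (x + w) - gradient \<phi> x) \<bullet> h"])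
      fix w :: "real ^ 'n" assume w: "w \<in> cball 0 (norm v)"
      have "((\<lambda>w. \<phi> (x + w)) has_derivative (\<lambda>h. gradient \<phi> (x + w) \<bullet> h)) (at w within cball 0 (norm v))"
        by (rule has_derivative_compose[OF _ smooth_has_derivative[OF test_functions_smooth[OF phi]]])
          (auto intro!: derivative_eq_intros)
      then show "(f has_derivative (\<lambda>h. (gradient \<phi> (x + w) - gradient \<phi> x) \<bullet> h)) (at w within cball 0 (norm v))"
        unfolding f_def by (auto intro!: derivative_eq_intros simp: inner_diff_left)
      have "norm (gradient \<phi> (x + w) - gradient \<phi> x) \<le> C * norm w"
        using C(2)[of "x + w" x] by simp
      also have "C * norm w \<le> C * norm v" using w C(1) by (intro mult_left_mono) auto
      finally have "norm (gradient \<phi> (x + w) - gradient \<phi> x) \<le> C * norm v" .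
      from order_trans[OF Cauchy_Schwarz_ineq2 mult_right_mono[OF this norm_ge_zero]]
      show "onorm (\<lambda>h. (gradient \<phi> (x + w) - gradient \<phi> x) \<bullet> h) \<le> C * norm v"
        using C(1) by (intro onorm_bound) auto
    qed auto
    then show ?thesis by (simp add: f_def power2_eq_square algebra_simps)
  qed
  with C(1) show ?thesis by blast
qed

section \<open>Mollification by correlation\<close>

definition locally_integrable :: "('a::euclidean_space \<Rightarrow> 'b::euclidean_space) \<Rightarrow> bool" where
  "locally_integrable h \<longleftrightarrow> h \<in> borel_measurable borel \<and>
    (\<forall>R. integrable lborel (\<lambda>z. indicator (cball 0 R) z *\<^sub>R h z))"

lemma locally_integrable_mult:
  fixes h :: "'a::euclidean_space \<Rightarrow> real"
  assumes h: "locally_integrable h" and k: "k \<in> borel_measurable borel" "\<And>z. \<bar>k z\<bar> \<le> B"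
    "\<And>z. R < norm z \<Longrightarrow> k z = 0"
  shows "integrable lborel (\<lambda>z. k z * h z)"
proof (rule Bochner_Integration.integrable_bound)
  show "integrable lborel (\<lambda>z. B *\<^sub>R (indicator (cball 0 R) z *\<^sub>R h z))"
    using h by (intro integrable_scaleR_right) (simp add: locally_integrable_def)
  show "(\<lambda>z. k z * h z) \<in> borel_measurable lborel"
    using borel_measurable_times[OF k(1), of h] h by (simp add: locally_integrable_def)
  have "\<bar>k z * h z\<bar> \<le> \<bar>B * (indicator (cball 0 R) z * h z)\<bar>" for z
  proof (cases "R < norm z")
    case False
    have "0 \<le> B" using k(2)[of z] by simp
    then show ?thesis using False k(2)[of z] by (simp add: abs_mult mult_right_mono)
  qed (simp add: k(3))
  then show "AE z in lborel. norm (k z * h z) \<le> norm (B *\<^sub>R (indicator (cball 0 R) z *\<^sub>R h z))"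
    by simp
qed

text \<open>Convolution with the reflected kernel: the kernel is centred at \<open>y\<close> without
  being reflected, so that \<open>corr\<close> describes averages of a function along an orbit as
  seen from the point \<open>y\<close>. The price is the minus sign in its derivative.\<close>

definition corr :: "('a::euclidean_space \<Rightarrow> real) \<Rightarrow> ('a \<Rightarrow> real) \<Rightarrow> 'a \<Rightarrow> real" where
  "corr \<kappa> h y = (LINT z|lborel. \<kappa> (z - y) * h z)"

lemma test_functions_radius:
  assumes "\<phi> \<in> test_functions D"
  shows "\<exists>R>0. \<forall>x. R < norm x \<longrightarrow> \<phi> x = 0"
proof -
  obtain K where K: "compact K" "\<And>x. x \<notin> K \<Longrightarrow> \<phi> x = 0"
    using test_functions_support[OF assms] by blast
  obtain R where "0 < R" "\<And>x. x \<in> K \<Longrightarrow> norm x \<le> R"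
    using compact_imp_bounded[OF K(1)] unfolding bounded_pos by auto
  with K(2) show ?thesis by (intro exI[of _ R]) force
qed

lemma corr_integrable:
  fixes h :: "real ^ 'n::finite \<Rightarrow> real"
  assumes k: "\<kappa> \<in> test_functions D" and h: "locally_integrable h"
  shows "integrable lborel (\<lambda>z. \<kappa> (z - y) * h z)"
proof -
  obtain R where R: "0 < R" "\<And>x. R < norm x \<Longrightarrow> \<kappa> x = 0" using test_functions_radius[OF k] by blast
  obtain B where B: "\<And>x. \<bar>\<kappa> x\<bar> \<le> B" using test_functions_bounded[OF k] by blast
  have [measurable]: "\<kappa> \<in> borel_measurable borel" by (rule smooth_borel[OF test_functions_smooth[OF k]])
  show ?thesis
  proof (rule locally_integrable_mult[OF h, where B=B and R="R + norm y"])
    show "\<kappa> (z - y) = 0" if "R + norm y < norm z" for z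
      using that norm_triangle_ineq2[of z y] by (intro R(2)) simp
  qed (auto simp: B)
qed

text \<open>The kernel is expanded, not \<open>h\<close>. \<open>C\<close> and \<open>R'\<close>
  depend on the kernel and on \<open>y\<close> only and are fixed before \<open>h\<close>, which
  later makes the error uniform over all realisations of a bounded function.\<close>

lemma corr_Taylor:
  fixes \<kappa> :: "real ^ 'n::finite \<Rightarrow> real"
  assumes k: "\<kappa> \<in> test_functions D"
  shows "\<exists>C R'. 0 < C \<and> (\<forall>h v. locally_integrable h \<longrightarrow> norm v \<le> 1 \<longrightarrow>
    \<bar>corr \<kappa> h (y + v) - corr \<kappa> h y - (\<chi> i. - corr (\<lambda>x. gradient \<kappa> x $ i) h y) \<bullet> v\<bar>
      \<le> C * (LINT z|lborel. \<bar>indicator (cball 0 R') z *\<^sub>R h z\<bar>) * (norm v)\<^sup>2)"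
proof -
  obtain R where R: "0 < R" "\<And>x. R < norm x \<Longrightarrow> \<kappa> x = 0" using test_functions_radius[OF k] by blast
  have gR: "gradient \<kappa> x = 0" if "R < norm x" for x
    by (rule gradient_outside[of "cball 0 R"]) (use R that in auto)
  obtain C where C: "0 < C" "\<And>x v. \<bar>\<kappa> (x + v) - \<kappa> x - gradient \<kappa> x \<bullet> v\<bar> \<le> C * (norm v)\<^sup>2"
    using test_functions_Taylor[OF k] by blast
  \<comment> \<open>This ball contains the supports of the kernel centred at \<open>y\<close> and at
    \<open>y + v\<close> whenever \<open>norm v \<le> 1\<close>.\<close>
  define R' where "R' = R + norm y + 1"
  have "\<bar>corr \<kappa> h (y + v) - corr \<kappa> h y - (\<chi> i. - corr (\<lambda>x. gradient \<kappa> x $ i) h y) \<bullet> v\<bar>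
      \<le> C * (LINT z|lborel. \<bar>indicator (cball 0 R') z *\<^sub>R h z\<bar>) * (norm v)\<^sup>2"
    if h: "locally_integrable h" and v: "norm v \<le> 1" for h v
  proof -
    define g where "g = (\<chi> i. - corr (\<lambda>x. gradient \<kappa> x $ i) h y)"
    define J where "J = (LINT z|lborel. \<bar>indicator (cball 0 R') z *\<^sub>R h z\<bar>)"
    have Jint: "integrable lborel (\<lambda>z. \<bar>indicator (cball 0 R') z *\<^sub>R h z\<bar>)"
      using h unfolding locally_integrable_def by auto
    have gi: "integrable lborel (\<lambda>z. gradient \<kappa> (z - y) $ i * h z)" for i
      by (rule corr_integrable[OF test_functions_gradient[OF k] h])
    have gs: "(\<lambda>z. (gradient \<kappa> (z - y) \<bullet> v) * h z) = (\<lambda>z. \<Sum>i\<in>UNIV. v $ i * (gradient \<kappa> (z - y) $ i * h z))"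
      by (intro ext) (simp add: inner_vec_def sum_distrib_right sum_distrib_left mult_ac)
    have gI: "integrable lborel (\<lambda>z. (gradient \<kappa> (z - y) \<bullet> v) * h z)"
      unfolding gs using gi by auto
    have "g \<bullet> v = - (LINT z|lborel. (gradient \<kappa> (z - y) \<bullet> v) * h z)"
      unfolding gs g_def using gi by (simp add: inner_vec_def corr_def sum_negf mult.commute)
    then have "corr \<kappa> h (y + v) - corr \<kappa> h y - g \<bullet> v =
        (LINT z|lborel. \<kappa> (z - (y + v)) * h z - \<kappa> (z - y) * h z + (gradient \<kappa> (z - y) \<bullet> v) * h z)"
      using corr_integrable[OF k h] gI by (simp add: corr_def)
    also have "\<bar>\<dots>\<bar> \<le> (LINT z|lborel. (C * (norm v)\<^sup>2) * \<bar>indicator (cball 0 R') z *\<^sub>R h z\<bar>)"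
    proof (rule order_trans[OF integral_abs_bound], rule integral_mono)
      show "integrable lborel (\<lambda>z. \<bar>\<kappa> (z - (y + v)) * h z - \<kappa> (z - y) * h z + (gradient \<kappa> (z - y) \<bullet> v) * h z\<bar>)"
        using corr_integrable[OF k h] gI by auto
      show "integrable lborel (\<lambda>z. (C * (norm v)\<^sup>2) * \<bar>indicator (cball 0 R') z *\<^sub>R h z\<bar>)"
        using Jint by simp
      fix z
      let ?r = "\<kappa> (z - (y + v)) - \<kappa> (z - y) + gradient \<kappa> (z - y) \<bullet> v"
      have eq: "\<kappa> (z - (y + v)) * h z - \<kappa> (z - y) * h z + (gradient \<kappa> (z - y) \<bullet> v) * h z = ?r * h z"
        by (simp add: algebra_simps)
      have r: "\<bar>?r\<bar> \<le> C * (norm v)\<^sup>2" using C(2)[of "z - y" "- v"] by (simp add: algebra_simps)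
      have r0: "?r = 0" if "z \<notin> cball 0 R'"
      proof -
        have "R < norm (z - y)" "R < norm (z - (y + v))"
          using that v norm_triangle_ineq2[of z y] norm_triangle_ineq2[of z "y + v"] norm_triangle_ineq[of y v]
          by (auto simp: R'_def)
        then show ?thesis by (simp add: R(2) gR)
      qed
      show "\<bar>\<kappa> (z - (y + v)) * h z - \<kappa> (z - y) * h z + (gradient \<kappa> (z - y) \<bullet> v) * h z\<bar>
          \<le> (C * (norm v)\<^sup>2) * \<bar>indicator (cball 0 R') z *\<^sub>R h z\<bar>"
        unfolding eq using r r0 by (cases "z \<in> cball 0 R'") (auto simp: abs_mult intro!: mult_right_mono)
    qed
    also have "\<dots> = C * J * (norm v)\<^sup>2" using Jint by (simp add: J_def mult_ac)
    finally show ?thesis by (simp add: g_def J_def)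
  qed
  with C(1) show ?thesis by blast
qed

lemma corr_has_derivative:
  fixes h :: "real ^ 'n::finite \<Rightarrow> real"
  assumes k: "\<kappa> \<in> test_functions D" and h: "locally_integrable h"
  shows "(corr \<kappa> h has_derivative (\<lambda>v. (\<chi> i. - corr (\<lambda>x. gradient \<kappa> x $ i) h y) \<bullet> v)) (at y)"
proof -
  define g where "g = (\<chi> i. - corr (\<lambda>x. gradient \<kappa> x $ i) h y)"
  obtain C R' where C: "0 < C" "\<forall>h v. locally_integrable h \<longrightarrow> norm v \<le> 1 \<longrightarrow>
    \<bar>corr \<kappa> h (y + v) - corr \<kappa> h y - (\<chi> i. - corr (\<lambda>x. gradient \<kappa> x $ i) h y) \<bullet> v\<bar>
      \<le> C * (LINT z|lborel. \<bar>indicator (cball 0 R') z *\<^sub>R h z\<bar>) * (norm v)\<^sup>2"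
    using corr_Taylor[OF k, of y] by blast
  define J where "J = (LINT z|lborel. \<bar>indicator (cball 0 R') z *\<^sub>R h z\<bar>)"
  have bound: "\<bar>corr \<kappa> h (y + v) - corr \<kappa> h y - g \<bullet> v\<bar> \<le> C * J * (norm v)\<^sup>2" if v: "norm v \<le> 1" for v
    using C(2) h v unfolding g_def J_def by blast
  have "(corr \<kappa> h has_derivative (\<lambda>v. g \<bullet> v)) (at y)"
    unfolding has_derivative_at
  proof
    show "bounded_linear (\<lambda>v. g \<bullet> v)" by (rule bounded_linear_inner_right)
    have lim: "((\<lambda>v :: real ^ 'n. C * J * norm v) \<longlongrightarrow> 0) (at 0)"
      by (auto intro!: tendsto_eq_intros)
    show "(\<lambda>v. norm (corr \<kappa> h (y + v) - corr \<kappa> h y - g \<bullet> v) / norm v) \<midarrow>0\<rightarrow> 0"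
    proof (rule Lim_null_comparison[OF _ lim])
      show "\<forall>\<^sub>F v in at 0. norm (norm (corr \<kappa> h (y + v) - corr \<kappa> h y - g \<bullet> v) / norm v) \<le> C * J * norm v"
        unfolding eventually_at
      proof (intro exI[of _ 1] conjI ballI impI)
        fix v :: "real ^ 'n" assume "v \<noteq> 0 \<and> dist v 0 < 1"
        then have v: "0 < norm v" "norm v \<le> 1" by auto
        show "norm (norm (corr \<kappa> h (y + v) - corr \<kappa> h y - g \<bullet> v) / norm v) \<le> C * J * norm v"
          using bound[OF v(2)] v(1) by (simp add: pos_divide_le_eq power2_eq_square mult.assoc)
      qed simp
    qed
  qed
  then show ?thesis by (simp add: g_def)
qed

lemma corr_smooth:
  fixes h :: "real ^ 'n::finite \<Rightarrow> real"
  assumes k: "\<kappa> \<in> test_functions D" and h: "locally_integrable h"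
  shows "smooth (corr \<kappa> h)"
proof -
  have "continuously_differentiable j (corr \<kappa> h)" if "\<kappa> \<in> test_functions D" for j \<kappa>
    using that
  proof (induction j arbitrary: \<kappa>)
    case 0
    then show ?case
      using corr_has_derivative[OF _ h, THEN has_derivative_continuous] by (auto intro!: continuous_at_imp_continuous_on)
  next
    case (Suc j)
    have eq: "(\<lambda>x. gradient (corr \<kappa> h) x $ i) = (\<lambda>x. -1 * corr (\<lambda>x. gradient \<kappa> x $ i) h x)" for i
      by (simp add: gradient_unique[OF corr_has_derivative[OF Suc.prems h]])
    show ?case
      unfolding continuously_differentiable.simps(2) eq
      by (intro conjI allI differentiableI[OF corr_has_derivative[OF Suc.prems h]]
          continuously_differentiable_mult continuously_differentiable_const Suc.IH test_functions_gradient[OF Suc.prems])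
  qed
  with k show ?thesis by (simp add: smooth_def)
qed

lemma gradient_corr:
  fixes h :: "real ^ 'n::finite \<Rightarrow> real"
  assumes "\<kappa> \<in> test_functions D" "locally_integrable h"
  shows "gradient (corr \<kappa> h) y $ i = - corr (\<lambda>x. gradient \<kappa> x $ i) h y"
  by (simp add: gradient_unique[OF corr_has_derivative[OF assms]])

section \<open>An ergodic theorem for cubes\<close>

lemma mem_cube: "y \<in> cube \<rho> \<longleftrightarrow> (\<forall>i. \<bar>y $ i\<bar> < \<rho>)"
proof -
  have "(- \<rho> < t \<and> t < \<rho>) \<longleftrightarrow> \<bar>t\<bar> < \<rho>" for t :: real by auto
  then show ?thesis by (simp add: cube_def)
qed

lemma cube_eq_box: "(cube \<rho> :: (real ^ 'n::finite) set) = box (\<chi> i. - \<rho>) (\<chi> i. \<rho>)"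
  by (auto simp: cube_def mem_box_cart)

lemma open_cube [simp]: "open (cube \<rho>)" and bounded_cube [simp]: "bounded (cube \<rho>)"
  and borel_cube [measurable, simp]: "cube \<rho> \<in> sets borel"
  by (auto simp: cube_eq_box bounded_box)

lemma cube_mono: "r \<le> s \<Longrightarrow> cube r \<subseteq> cube s"
  by (auto simp: mem_cube) (meson less_le_trans)

lemma emeasure_cube:
  assumes "0 \<le> \<rho>"
  shows "emeasure lborel (cube \<rho> :: (real ^ 'n::finite) set) = ennreal ((2 * \<rho>) ^ CARD('n))"
proof -
  have "(\<chi> i. c) \<bullet> b = c" if "b \<in> Basis" for b :: "real ^ 'n" and c
    using that by (auto simp: Basis_vec_def inner_axis)
  then show ?thesis
    using assms by (simp add: cube_eq_box emeasure_lborel_box_eq inner_diff_left ennreal_power)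
qed

lemma measure_cube: "0 \<le> \<rho> \<Longrightarrow> measure lborel (cube \<rho> :: (real ^ 'n::finite) set) = (2 * \<rho>) ^ CARD('n)"
  by (simp add: measure_def emeasure_cube)

lemma card_vec_lattice:
  assumes "finite S"
  shows "finite {z :: real ^ 'n::finite. \<forall>i. z $ i \<in> S}" "card {z :: real ^ 'n. \<forall>i. z $ i \<in> S} = card S ^ CARD('n)"
proof -
  have b: "bij_betw (\<lambda>f. \<chi> i. f i) (PiE (UNIV :: 'n set) (\<lambda>_. S)) {z :: real ^ 'n. \<forall>i. z $ i \<in> S}"
    by (rule bij_betw_byWitness[where f'="\<lambda>z i. z $ i"]) (auto simp: PiE_UNIV_domain)
  show "finite {z :: real ^ 'n. \<forall>i. z $ i \<in> S}"
    using bij_betw_finite[OF b] assms by (simp add: finite_PiE)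
  show "card {z :: real ^ 'n. \<forall>i. z $ i \<in> S} = card S ^ CARD('n)"
    using bij_betw_same_card[OF b] by (simp add: card_PiE)
qed

text \<open>Vitali's greedy selection: members of largest \<open>n\<close> are chosen first.\<close>

lemma greedy_selection:
  fixes n :: "'a \<Rightarrow> nat"
  assumes "finite F" "\<And>a. a \<in> F \<Longrightarrow> conf a a" "\<And>a b. conf a b \<Longrightarrow> conf b a"
  shows "\<exists>G\<subseteq>F. (\<forall>a\<in>G. \<forall>b\<in>G. a \<noteq> b \<longrightarrow> \<not> conf a b) \<and> (\<forall>a\<in>F. \<exists>b\<in>G. conf a b \<and> n a \<le> n b)"
  using assms(1,2)
proof (induction "card F" arbitrary: F rule: less_induct)
  case less
  show ?case
  proof (cases "F = {}")
    case False
    have "Max (n ` F) \<in> n ` F" using False less.prems(1) by (intro Max_in) auto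
    then obtain z where z: "z \<in> F" "Max (n ` F) = n z" by auto
    have zmax: "n a \<le> n z" if "a \<in> F" for a
      using that less.prems(1) z(2) by (metis Max_ge finite_imageI imageI)
    \<comment> \<open>Whatever conflicts with \<open>z\<close> is dominated by \<open>z\<close>,
      which has the largest \<open>n\<close>; only the rest has to be treated recursively.\<close>
    define F' where "F' = {a \<in> F. \<not> conf a z}"
    have "F' \<subset> F" using z(1) less.prems(2) by (auto simp: F'_def)
    then have c: "card F' < card F" using less.prems(1) by (rule psubset_card_mono[rotated])
    have f: "finite F'" "\<And>a. a \<in> F' \<Longrightarrow> conf a a" using less.prems by (auto simp: F'_def)
    from less.hyps[OF c f] obtain G where G: "G \<subseteq> F'" "\<forall>a\<in>G. \<forall>b\<in>G. a \<noteq> b \<longrightarrow> \<not> conf a b"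
      "\<forall>a\<in>F'. \<exists>b\<in>G. conf a b \<and> n a \<le> n b"
      by auto
    have Gz: "\<not> conf a z \<and> \<not> conf z a" if "a \<in> G" for a
      using that G(1) assms(3) by (auto simp: F'_def)
    show ?thesis
    proof (intro exI[of _ "insert z G"] conjI ballI impI)
      show "insert z G \<subseteq> F" using z(1) G(1) by (auto simp: F'_def)
      show "\<not> conf a b" if "a \<in> insert z G" "b \<in> insert z G" "a \<noteq> b" for a b
        using that G(2) Gz by blast
      show "\<exists>b\<in>insert z G. conf a b \<and> n a \<le> n b" if "a \<in> F" for a
        using G(3) zmax[OF that] that by (cases "conf a z") (auto simp: F'_def)
    qed
  qed auto
qed

text \<open>Only finiteness and invariance of the measure are recorded. Besides the probability
  space, the locale is applied to the product of the domain with the probability space, where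
  \<omega> alone is moved and the total mass need not be 1.\<close>

locale flow = finite_measure M for M :: "'w measure" +
  fixes T :: "real ^ 'n::finite \<Rightarrow> 'w \<Rightarrow> 'w"
  assumes T_measurable: "(\<lambda>(y, w). T y w) \<in> measurable (borel \<Otimes>\<^sub>M M) M"
    and T_distr: "distr M M (T y) = M"
    and T_add: "w \<in> space M \<Longrightarrow> T (y + y') w = T y (T y' w)"
begin

sublocale lebesgue_M: pair_sigma_finite lborel M ..

sublocale M_lebesgue: pair_sigma_finite M lborel ..

lemma T_measurable_Pair [measurable (raw)]:
  assumes "f \<in> measurable N borel" "g \<in> measurable N M"
  shows "(\<lambda>x. T (f x) (g x)) \<in> measurable N M"
  using measurable_compose[OF measurable_Pair[OF assms] T_measurable] by simp

lemma T_measurable1 [measurable]: "T y \<in> measurable M M"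
  using T_measurable_Pair[of "\<lambda>_. y" M "\<lambda>x. x"] by simp

lemma T_space [simp]: "w \<in> space M \<Longrightarrow> T y w \<in> space M"
  by (rule measurable_space[OF T_measurable1])

lemma orbit_measurable: "w \<in> space M \<Longrightarrow> (\<lambda>y. T y w) \<in> measurable borel M"
  by (rule T_measurable_Pair) auto

lemma orbit_borel_measurable:
  "w \<in> space M \<Longrightarrow> h \<in> measurable M N \<Longrightarrow> (\<lambda>y. h (T y w)) \<in> measurable borel N"
  by (rule measurable_compose[OF orbit_measurable])

lemma nn_integral_T: "h \<in> borel_measurable M \<Longrightarrow> (\<integral>\<^sup>+ w. h (T y w) \<partial>M) = (\<integral>\<^sup>+ w. h w \<partial>M)"
  by (subst (2) T_distr[symmetric, of y]) (simp add: nn_integral_distr)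

lemma integral_T:
  fixes h :: "'w \<Rightarrow> 'b::{banach, second_countable_topology}"
  shows "h \<in> borel_measurable M \<Longrightarrow> (LINT w|M. h (T y w)) = (LINT w|M. h w)"
  by (subst (2) T_distr[symmetric, of y]) (simp add: integral_distr)

lemma integrable_T:
  fixes h :: "'w \<Rightarrow> 'b::{banach, second_countable_topology}"
  shows "integrable M h \<Longrightarrow> integrable M (\<lambda>w. h (T y w))"
  by (rule integrable_distr[of _ _ M]) (simp_all add: T_distr)

lemma AE_T: assumes "AE w in M. P w" shows "AE w in M. P (T y w)"
proof -
  show ?thesis by (rule AE_distrD[OF T_measurable1]) (subst T_distr, rule assms)
qed

lemma nn_integral_orbit:
  assumes [measurable]: "h \<in> borel_measurable M" "k \<in> borel_measurable borel"
  shows "(\<integral>\<^sup>+ w. (\<integral>\<^sup>+ y. k y * h (T y w) \<partial>lborel) \<partial>M) = (\<integral>\<^sup>+ y. k y \<partial>lborel) * (\<integral>\<^sup>+ w. h w \<partial>M)"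
proof -
  have "(\<integral>\<^sup>+ w. (\<integral>\<^sup>+ y. k y * h (T y w) \<partial>lborel) \<partial>M) = (\<integral>\<^sup>+ y. (\<integral>\<^sup>+ w. k y * h (T y w) \<partial>M) \<partial>lborel)"
    by (rule lebesgue_M.Fubini') measurable
  also have "\<dots> = (\<integral>\<^sup>+ y. k y * (\<integral>\<^sup>+ w. h w \<partial>M) \<partial>lborel)"
    by (intro nn_integral_cong) (simp add: nn_integral_cmult nn_integral_T)
  also have "\<dots> = (\<integral>\<^sup>+ y. k y \<partial>lborel) * (\<integral>\<^sup>+ w. h w \<partial>M)"
    by (rule nn_integral_multc) measurable
  finally show ?thesis .
qed

text \<open>Tonelli and invariance of the measure give joint integrability in the point and the
  time; the rest is Fubini. In particular, realisations of integrable functions are integrable over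
  a given cube on almost every orbit.\<close>

lemma orbit_integrable:
  fixes h :: "'w \<Rightarrow> real"
  assumes h: "integrable M h" and k: "integrable lborel k"
  shows "integrable (M \<Otimes>\<^sub>M lborel) (\<lambda>(w, y). k y * h (T y w))"
    and "AE w in M. integrable lborel (\<lambda>y. k y * h (T y w))"
    and "integrable M (\<lambda>w. LINT y|lborel. k y * h (T y w))"
    and "(LINT w|M. LINT y|lborel. k y * h (T y w)) = (LINT y|lborel. k y) * (LINT w|M. h w)"
proof -
  have [measurable]: "h \<in> borel_measurable M" "k \<in> borel_measurable borel"
    using h k by auto
  show I: "integrable (M \<Otimes>\<^sub>M lborel) (\<lambda>(w, y). k y * h (T y w))"
  proof (rule integrableI_bounded)
    show "(\<lambda>(w, y). k y * h (T y w)) \<in> borel_measurable (M \<Otimes>\<^sub>M lborel)" by measurable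
    have "(\<integral>\<^sup>+ p. ennreal (norm (case p of (w, y) \<Rightarrow> k y * h (T y w))) \<partial>(M \<Otimes>\<^sub>M lborel)) =
        (\<integral>\<^sup>+ w. (\<integral>\<^sup>+ y. ennreal \<bar>k y\<bar> * ennreal \<bar>h (T y w)\<bar> \<partial>lborel) \<partial>M)"
      by (subst lborel.nn_integral_fst[symmetric]) (auto simp: abs_mult ennreal_mult)
    also have "\<dots> = (\<integral>\<^sup>+ y. ennreal \<bar>k y\<bar> \<partial>lborel) * (\<integral>\<^sup>+ w. ennreal \<bar>h w\<bar> \<partial>M)"
      by (rule nn_integral_orbit) measurable
    also have "\<dots> < \<infinity>"
      using h k by (auto simp: integrable_iff_bounded ennreal_mult_less_top)
    finally show "(\<integral>\<^sup>+ p. ennreal (norm (case p of (w, y) \<Rightarrow> k y * h (T y w))) \<partial>(M \<Otimes>\<^sub>M lborel)) < \<infinity>" .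
  qed
  show "AE w in M. integrable lborel (\<lambda>y. k y * h (T y w))"
    using M_lebesgue.AE_integrable_fst'[OF I] by simp
  show "integrable M (\<lambda>w. LINT y|lborel. k y * h (T y w))"
    using M_lebesgue.integrable_fst'[OF I] by simp
  have "(LINT w|M. LINT y|lborel. k y * h (T y w)) = (LINT y|lborel. LINT w|M. k y * h (T y w))"
    using lebesgue_M.Fubini_integral[of "\<lambda>y w. k y * h (T y w)"] M_lebesgue.integrable_product_swap[OF I]
    by (simp add: case_prod_beta')
  also have "\<dots> = (LINT y|lborel. k y * (LINT w|M. h w))"
    by (simp add: integral_T)
  finally show "(LINT w|M. LINT y|lborel. k y * h (T y w)) = (LINT y|lborel. k y) * (LINT w|M. h w)"
    by simp
qed

text \<open>Unnormalised and with extended values, it is meaningful on every orbit, before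
  integrability along almost every orbit enters. This lets the events built from it be invariant
  without exceptional points.\<close>

definition cube_integral :: "real \<Rightarrow> ('w \<Rightarrow> ennreal) \<Rightarrow> 'w \<Rightarrow> ennreal" where
  "cube_integral r h w = (\<integral>\<^sup>+ y. indicator (cube r) y * h (T y w) \<partial>lborel)"

lemma cube_integral_measurable [measurable]:
  assumes [measurable]: "h \<in> borel_measurable M" shows "cube_integral r h \<in> borel_measurable M"
  unfolding cube_integral_def by measurable

lemma cube_integral_T:
  assumes [measurable]: "h \<in> borel_measurable M" and wa: "w \<in> space M"
  shows "cube_integral r h (T z w) = (\<integral>\<^sup>+ y. indicator {y. \<forall>i. \<bar>y $ i - z $ i\<bar> < r} y * h (T y w) \<partial>lborel)"
proof -
  note [measurable] = orbit_borel_measurable[OF wa assms(1)]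
  have "{y. \<forall>i. \<bar>y $ i - z $ i\<bar> < r} = (\<lambda>y. y - z) -` cube r"
    by (auto simp: mem_cube)
  then have [measurable]: "{y. \<forall>i. \<bar>y $ i - z $ i\<bar> < r} \<in> sets borel"
    using measurable_sets[of "\<lambda>y. y - z" borel borel "cube r"] by simp
  have "(\<integral>\<^sup>+ y. indicator {y. \<forall>i. \<bar>y $ i - z $ i\<bar> < r} y * h (T y w) \<partial>lborel) =
      (\<integral>\<^sup>+ y. indicator {y. \<forall>i. \<bar>y $ i - z $ i\<bar> < r} (z + y) * h (T (z + y) w) \<partial>lborel)"
    by (subst lborel_distr_plus[of z, symmetric]) (simp add: nn_integral_distr)
  also have "\<dots> = cube_integral r h (T z w)"
    unfolding cube_integral_def
    by (intro nn_integral_cong) (auto simp: mem_cube indicator_def T_add[OF wa, symmetric] add.commute)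
  finally show ?thesis by simp
qed

lemma cube_integral_shift_le:
  assumes [measurable]: "h \<in> borel_measurable M" and wa: "w \<in> space M" and z: "\<And>i. \<bar>z $ i\<bar> \<le> m"
  shows "cube_integral r h (T z w) \<le> cube_integral (r + m) h w"
    and "cube_integral r h w \<le> cube_integral (r + m) h (T z w)"
proof -
  have a: "\<bar>y $ i\<bar> < r + m" if "\<bar>y $ i - z $ i\<bar> < r" for y i
    using that z[of i] by linarith
  have b: "\<bar>y $ i - z $ i\<bar> < r + m" if "\<bar>y $ i\<bar> < r" for y i
    using that z[of i] by linarith
  show "cube_integral r h (T z w) \<le> cube_integral (r + m) h w"
    unfolding cube_integral_T[OF assms(1) wa] unfolding cube_integral_def
    by (intro nn_integral_mono) (auto simp: indicator_def mem_cube dest: a)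
  show "cube_integral r h w \<le> cube_integral (r + m) h (T z w)"
    unfolding cube_integral_T[OF assms(1) wa] unfolding cube_integral_def
    by (intro nn_integral_mono) (auto simp: indicator_def mem_cube dest: b)
qed

end

text \<open>A covering argument of Vitali type on the integer lattice. Every point of
  \<open>F\<close> carries a cube with average at least \<open>l\<close>. Disjoint cubes are
  selected such that each point of \<open>F\<close> lies within twice the radius of a selected
  centre. Counting lattice points there costs the factor \<open>2 ^ CARD('n)\<close>, the ratio of
  \<open>(4 * n) ^ CARD('n)\<close> to the volume \<open>(2 * n) ^ CARD('n)\<close>.\<close>

lemma lattice_cover:
  fixes H :: "real ^ 'n::finite \<Rightarrow> ennreal" and N L :: nat and n :: "real ^ 'n \<Rightarrow> nat"
  assumes [measurable]: "H \<in> borel_measurable borel"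
    and F: "F \<subseteq> {z. \<forall>i. z $ i \<in> real_of_int ` {- int N..int N}}"
    and n: "\<And>z. z \<in> F \<Longrightarrow> 1 \<le> n z \<and> n z \<le> L"
    and l: "0 \<le> l" "\<And>z. z \<in> F \<Longrightarrow> ennreal (l * (2 * real (n z)) ^ CARD('n)) \<le>
      (\<integral>\<^sup>+ y. indicator {y. \<forall>i. \<bar>y $ i - z $ i\<bar> < real (n z)} y * H y \<partial>lborel)"
  shows "ennreal (l * real (card F)) \<le> ennreal (2 ^ CARD('n)) * (\<integral>\<^sup>+ y. indicator (cube (real N + real L)) y * H y \<partial>lborel)"
proof -
  define Z where "Z = {z :: real ^ 'n. \<forall>i. z $ i \<in> real_of_int ` {- int N..int N}}"
  have finZ: "finite Z" unfolding Z_def by (rule card_vec_lattice) auto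
  have FZ: "F \<subseteq> Z" using F by (simp add: Z_def)
  then have finF: "finite F" using finZ by (rule finite_subset)
  \<comment> \<open>For positive radii this says that the two open cubes meet.\<close>
  define conf where "conf = (\<lambda>z z' :: real ^ 'n. \<forall>i. \<bar>z $ i - z' $ i\<bar> < real (n z) + real (n z'))"
  obtain G where G: "G \<subseteq> F" "\<And>a b. a \<in> G \<Longrightarrow> b \<in> G \<Longrightarrow> a \<noteq> b \<Longrightarrow> \<not> conf a b"
    "\<And>a. a \<in> F \<Longrightarrow> \<exists>b\<in>G. conf a b \<and> n a \<le> n b"
    using greedy_selection[OF finF, of conf n] n
    unfolding conf_def by (force simp: abs_minus_commute add.commute)
  have finG: "finite G" using G(1) finF by (rule finite_subset)
  define B where "B = (\<lambda>z'. {z \<in> Z. \<forall>i. \<bar>z $ i - z' $ i\<bar> < 2 * real (n z')})"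
  have cardB: "card (B z') \<le> (4 * n z') ^ CARD('n)" if z': "z' \<in> G" for z'
  proof -
    \<comment> \<open>The inequality is strict, so per coordinate only
      \<open>2 * k + 1 = 4 * n z' - 1\<close> integers lie within distance \<open>2 * n z'\<close>.
      This keeps the count below \<open>4 * n z'\<close> and the constant of the maximal inequality
      at \<open>2 ^ CARD('n)\<close>.\<close>
    define k where "k = 2 * int (n z') - 1"
    have k: "0 < k" using n[of z'] z' G(1) by (auto simp: k_def)
    define S where "S = real_of_int ` {- k..k}"
    have S: "finite S" "card S = nat (2 * k + 1)"
      using k by (auto simp: S_def card_image inj_on_def)
    have "(\<lambda>z. z - z') ` B z' \<subseteq> {w. \<forall>i. w $ i \<in> S}"
    proof clarsimp
      fix z i assume z: "z \<in> B z'"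
      have "z \<in> Z" "z' \<in> Z" using z z' G(1) FZ by (auto simp: B_def)
      then obtain a b where ab: "z $ i = real_of_int a" "z' $ i = real_of_int b"
        unfolding Z_def by blast
      have "\<bar>z $ i - z' $ i\<bar> < 2 * real (n z')" using z by (simp add: B_def)
      then have "\<bar>real_of_int a - real_of_int b\<bar> < 2 * real (n z')" by (simp add: ab)
      then have "\<bar>a - b\<bar> < 2 * int (n z')" by linarith
      then have "a - b \<in> {- k..k}" by (auto simp: k_def)
      then have "real_of_int (a - b) \<in> S" unfolding S_def by (rule imageI)
      then show "z $ i - z' $ i \<in> S" by (simp add: ab)
    qed
    then have "card ((\<lambda>z. z - z') ` B z') \<le> card {w :: real ^ 'n. \<forall>i. w $ i \<in> S}"
      by (intro card_mono card_vec_lattice S)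
    also have "\<dots> = nat (2 * k + 1) ^ CARD('n)" by (simp add: card_vec_lattice S)
    also have "\<dots> \<le> (4 * n z') ^ CARD('n)" by (intro power_mono) (auto simp: k_def)
    finally show ?thesis by (simp add: card_image inj_on_def)
  qed
  have "F \<subseteq> (\<Union>z'\<in>G. B z')"
  proof
    fix z assume z: "z \<in> F"
    obtain z' where z': "z' \<in> G" "conf z z'" "n z \<le> n z'" using G(3)[OF z] by blast
    have "\<bar>z $ i - z' $ i\<bar> < 2 * real (n z')" for i
    proof -
      have "\<bar>z $ i - z' $ i\<bar> < real (n z) + real (n z')" using z'(2) by (simp add: conf_def)
      moreover have "real (n z) \<le> real (n z')" using z'(3) by simp
      ultimately show ?thesis by linarith
    qed
    then show "z \<in> (\<Union>z'\<in>G. B z')" using z z'(1) FZ by (auto simp: B_def)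
  qed
  then have "card F \<le> card (\<Union>z'\<in>G. B z')"
    by (rule card_mono[rotated]) (use finG finZ in \<open>auto simp: B_def\<close>)
  also have "\<dots> \<le> (\<Sum>z'\<in>G. card (B z'))" by (rule card_UN_le[OF finG])
  also have "\<dots> \<le> (\<Sum>z'\<in>G. (4 * n z') ^ CARD('n))" by (rule sum_mono) (rule cardB)
  finally have "card F \<le> (\<Sum>z'\<in>G. (4 * n z') ^ CARD('n))" .
  then have "real (card F) \<le> real (\<Sum>z'\<in>G. (4 * n z') ^ CARD('n))" by linarith
  then have "real (card F) \<le> (\<Sum>z'\<in>G. (4 * real (n z')) ^ CARD('n))" by simp
  then have "l * real (card F) \<le> l * (\<Sum>z'\<in>G. (4 * real (n z')) ^ CARD('n))"
    using l(1) by (rule mult_left_mono)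
  also have "\<dots> = 2 ^ CARD('n) * (\<Sum>z'\<in>G. l * (2 * real (n z')) ^ CARD('n))"
  proof -
    have "(4 * real (n z')) ^ CARD('n) = 2 ^ CARD('n) * (2 * real (n z')) ^ CARD('n)" for z'
      using power_mult_distrib[of 2 "2 * real (n z')" "CARD('n)"] by simp
    then show ?thesis by (simp only: sum_distrib_left mult.left_commute[of l])
  qed
  finally have "ennreal (l * real (card F)) \<le> ennreal (2 ^ CARD('n) * (\<Sum>z'\<in>G. l * (2 * real (n z')) ^ CARD('n)))"
    by (rule ennreal_leI)
  also have "\<dots> = ennreal (2 ^ CARD('n)) * (\<Sum>z'\<in>G. ennreal (l * (2 * real (n z')) ^ CARD('n)))"
    using l(1) by (subst ennreal_mult) (auto intro!: sum_nonneg simp: sum_ennreal)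
  also have "\<dots> \<le> ennreal (2 ^ CARD('n)) * (\<integral>\<^sup>+ y. indicator (cube (real N + real L)) y * H y \<partial>lborel)"
  proof (rule mult_left_mono)
    let ?C = "\<lambda>z. {y :: real ^ 'n. \<forall>i. \<bar>y $ i - z $ i\<bar> < real (n z)}"
    have "?C z = (\<lambda>y. y - z) -` cube (real (n z))" for z by (auto simp: mem_cube)
    then have [measurable]: "?C z \<in> sets borel" for z
      using measurable_sets[of "\<lambda>y. y - z" borel borel "cube (real (n z))"] by simp
    have "(\<Sum>z'\<in>G. ennreal (l * (2 * real (n z')) ^ CARD('n))) \<le> (\<Sum>z\<in>G. \<integral>\<^sup>+ y. indicator (?C z) y * H y \<partial>lborel)"
      using G(1) by (intro sum_mono l(2)) auto
    also have "\<dots> = (\<integral>\<^sup>+ y. (\<Sum>z\<in>G. indicator (?C z) y * H y) \<partial>lborel)"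
      by (rule nn_integral_sum[symmetric]) measurable
    also have "\<dots> \<le> (\<integral>\<^sup>+ y. indicator (cube (real N + real L)) y * H y \<partial>lborel)"
    proof (rule nn_integral_mono)
      fix y
      show "(\<Sum>z\<in>G. indicator (?C z) y * H y) \<le> indicator (cube (real N + real L)) y * H y"
      proof (cases "\<exists>z\<in>G. y \<in> ?C z")
        case True
        then obtain z where z: "z \<in> G" "y \<in> ?C z" by blast
        have uniq: "y \<notin> ?C z'" if "z' \<in> G" "z' \<noteq> z" for z'
        proof
          assume y': "y \<in> ?C z'"
          have "\<bar>z' $ i - z $ i\<bar> < real (n z') + real (n z)" for i
          proof -
            have "\<bar>y $ i - z' $ i\<bar> < real (n z')" "\<bar>y $ i - z $ i\<bar> < real (n z)" using y' z(2) by auto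
            then show ?thesis by linarith
          qed
          then have "conf z' z" by (simp add: conf_def)
          with G(2)[OF that(1) z(1) that(2)] show False by simp
        qed
        have "\<bar>y $ i\<bar> < real N + real L" for i
        proof -
          have "z \<in> Z" using z(1) G(1) FZ by blast
          then obtain a where a: "z $ i = real_of_int a" "a \<in> {- int N..int N}" unfolding Z_def by blast
          have "\<bar>real_of_int a\<bar> \<le> real N" using a(2) by auto
          moreover have "\<bar>y $ i - z $ i\<bar> < real (n z)" using z(2) by blast
          moreover have "real (n z) \<le> real L" using n[of z] z(1) G(1) by auto
          ultimately show ?thesis using a(1) by linarith
        qed
        then have "y \<in> cube (real N + real L)" by (simp add: mem_cube)
        moreover have "(\<Sum>z\<in>G. indicator (?C z) y * H y) = (\<Sum>z'\<in>G. if z' = z then H y else 0)"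
          using uniq z(2) by (intro sum.cong) (auto simp: indicator_def)
        ultimately show ?thesis using z(1) finG by simp
      next
        case False
        then have "(\<Sum>z\<in>G. indicator (?C z) y * H y) = 0" by (intro sum.neutral) auto
        then show ?thesis by simp
      qed
    qed
    finally show "(\<Sum>z'\<in>G. ennreal (l * (2 * real (n z')) ^ CARD('n))) \<le> (\<integral>\<^sup>+ y. indicator (cube (real N + real L)) y * H y \<partial>lborel)" .
  qed simp
  finally show ?thesis .
qed

lemma tendsto_shift_ratio_power: "(\<lambda>n. ((real n + a) / (real n + b)) ^ d) \<longlonglongrightarrow> 1"
proof -
  have "(\<lambda>n. (real n + a) / (real n + b)) \<longlonglongrightarrow> 1" by real_asymp
  from tendsto_power[OF this, of d] show ?thesis by simp
qed

section \<open>The maximal inequality\<close>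

context flow
begin

text \<open>The maximal average is truncated at radius \<open>L\<close>: seen from lattice points in
  a cube of size \<open>N\<close>, all cubes involved stay in the cube of size \<open>N + L\<close>,
  and with \<open>L\<close> fixed this enlargement is negligible as \<open>N\<close> grows.\<close>

definition exceed :: "nat \<Rightarrow> real \<Rightarrow> ('w \<Rightarrow> ennreal) \<Rightarrow> 'w set" where
  "exceed L l h = {w \<in> space M. \<exists>n\<in>{1..L}. ennreal (l * (2 * real n) ^ CARD('n)) < cube_integral (real n) h w}"

lemma exceed_measurable [measurable]:
  assumes [measurable]: "h \<in> borel_measurable M" shows "exceed L l h \<in> sets M"
  unfolding exceed_def by measurable

text \<open>Transference: on each orbit the covering bound is applied to the lattice points at which
  the shifted point lies in \<open>exceed\<close>, and the result is integrated. Invariance turns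
  the count of these points into \<open>(2 * N + 1) ^ CARD('n)\<close> times the measure of the
  event.\<close>

lemma maximal_lattice:
  assumes h[measurable]: "h \<in> borel_measurable M" and l: "0 \<le> l"
  shows "ennreal (l * (2 * real N + 1) ^ CARD('n)) * emeasure M (exceed L l h) \<le>
    ennreal (2 ^ CARD('n) * (2 * (real N + real L)) ^ CARD('n)) * (\<integral>\<^sup>+ w. h w \<partial>M)"
proof -
  define S where "S = real_of_int ` {- int N..int N}"
  define Z where "Z = {z :: real ^ 'n. \<forall>i. z $ i \<in> S}"
  have S: "finite S" "card S = 2 * N + 1" by (auto simp: S_def card_image inj_on_def)
  have Z: "finite Z" "card Z = (2 * N + 1) ^ CARD('n)" unfolding Z_def using S by (simp_all add: card_vec_lattice)
  have pw: "(\<Sum>z\<in>Z. ennreal l * indicator (exceed L l h) (T z w)) \<le> ennreal (2 ^ CARD('n)) * cube_integral (real N + real L) h w"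
    if wa: "w \<in> space M" for w
  proof -
    define F where "F = {z \<in> Z. T z w \<in> exceed L l h}"
    have "\<forall>z\<in>F. \<exists>n. n \<in> {1..L} \<and> ennreal (l * (2 * real n) ^ CARD('n)) < cube_integral (real n) h (T z w)"
      by (auto simp: F_def exceed_def)
    from bchoice[OF this] obtain n where n: "\<forall>z\<in>F. n z \<in> {1..L} \<and>
        ennreal (l * (2 * real (n z)) ^ CARD('n)) < cube_integral (real (n z)) h (T z w)" by blast
    have "(\<Sum>z\<in>Z. ennreal l * indicator (exceed L l h) (T z w)) = (\<Sum>z\<in>F. ennreal l)"
      unfolding F_def sum.inter_filter[OF Z(1)] by (intro sum.cong) (auto simp: indicator_def)
    also have "\<dots> = ennreal (l * real (card F))"
      using l by (simp add: ennreal_mult ennreal_of_nat_eq_real_of_nat mult.commute)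
    also have "\<dots> \<le> ennreal (2 ^ CARD('n)) * (\<integral>\<^sup>+ y. indicator (cube (real N + real L)) y * h (T y w) \<partial>lborel)"
    proof (rule lattice_cover[where n=n])
      show "(\<lambda>y. h (T y w)) \<in> borel_measurable borel" by (rule orbit_borel_measurable[OF wa h])
      show "F \<subseteq> {z. \<forall>i. z $ i \<in> real_of_int ` {- int N..int N}}" by (auto simp: F_def Z_def S_def)
      show "1 \<le> n z \<and> n z \<le> L" if "z \<in> F" for z using n that by auto
      fix z assume "z \<in> F"
      then have "ennreal (l * (2 * real (n z)) ^ CARD('n)) < cube_integral (real (n z)) h (T z w)"
        using n by blast
      then show "ennreal (l * (2 * real (n z)) ^ CARD('n)) \<le>
          (\<integral>\<^sup>+ y. indicator {y. \<forall>i. \<bar>y $ i - z $ i\<bar> < real (n z)} y * h (T y w) \<partial>lborel)"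
        unfolding cube_integral_T[OF h wa] by (rule less_imp_le)
    qed (rule l)
    finally show ?thesis by (simp add: cube_integral_def)
  qed
  have "(\<integral>\<^sup>+ w. (\<Sum>z\<in>Z. ennreal l * indicator (exceed L l h) (T z w)) \<partial>M) =
      (\<Sum>z\<in>Z. ennreal l * emeasure M (exceed L l h))"
    by (subst nn_integral_sum) (auto simp: nn_integral_cmult nn_integral_T intro!: sum.cong)
  also have "\<dots> = ennreal (l * (2 * real N + 1) ^ CARD('n)) * emeasure M (exceed L l h)"
    using l by (simp add: Z ennreal_mult ennreal_of_nat_eq_real_of_nat mult_ac add.commute)
  finally have eq: "(\<integral>\<^sup>+ w. (\<Sum>z\<in>Z. ennreal l * indicator (exceed L l h) (T z w)) \<partial>M) =
      ennreal (l * (2 * real N + 1) ^ CARD('n)) * emeasure M (exceed L l h)" .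
  have "ennreal (l * (2 * real N + 1) ^ CARD('n)) * emeasure M (exceed L l h) \<le>
      (\<integral>\<^sup>+ w. ennreal (2 ^ CARD('n)) * cube_integral (real N + real L) h w \<partial>M)"
    unfolding eq[symmetric] by (rule nn_integral_mono) (rule pw)
  also have "\<dots> = ennreal (2 ^ CARD('n)) * (emeasure lborel (cube (real N + real L) :: (real ^ 'n) set) * (\<integral>\<^sup>+ w. h w \<partial>M))"
    unfolding cube_integral_def by (subst nn_integral_cmult) (auto simp: nn_integral_orbit)
  also have "\<dots> = ennreal (2 ^ CARD('n) * (2 * (real N + real L)) ^ CARD('n)) * (\<integral>\<^sup>+ w. h w \<partial>M)"
    by (subst emeasure_cube) (auto simp: ennreal_mult mult_ac)
  finally show ?thesis .
qed

text \<open>The weak type estimate with constant \<open>2 ^ CARD('n)\<close>, independent of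
  \<open>L\<close>. The bound for finite \<open>N\<close> contains the ratio of the volume of the
  enlarged cube to the number of lattice points, which tends to 1.\<close>

lemma maximal_inequality:
  assumes h: "h \<in> borel_measurable M" and l: "0 < l" and e: "(\<integral>\<^sup>+ w. h w \<partial>M) = ennreal e" "0 \<le> e"
  shows "l * measure M (exceed L l h) \<le> 2 ^ CARD('n) * e"
proof (rule tendsto_le[OF sequentially_bot _ tendsto_const])
  let ?m = "measure M (exceed L l h)"
  have *: "l * ?m \<le> 2 ^ CARD('n) * e * ((real N + real L) / (real N + 1 / 2)) ^ CARD('n)" for N
  proof -
    have "ennreal (l * (2 * real N + 1) ^ CARD('n) * ?m) \<le> ennreal (2 ^ CARD('n) * (2 * (real N + real L)) ^ CARD('n) * e)"
      using maximal_lattice[OF h less_imp_le[OF l], of N L] l e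
      by (simp add: emeasure_eq_measure ennreal_mult)
    then have "l * (2 * real N + 1) ^ CARD('n) * ?m \<le> 2 ^ CARD('n) * (2 * (real N + real L)) ^ CARD('n) * e"
      using e(2) by (subst (asm) ennreal_le_iff) auto
    then have "l * ?m \<le> 2 ^ CARD('n) * e * ((2 * (real N + real L)) ^ CARD('n) / (2 * real N + 1) ^ CARD('n))"
      by (simp add: field_simps)
    also have "(2 * (real N + real L)) ^ CARD('n) / (2 * real N + 1) ^ CARD('n) = ((real N + real L) / (real N + 1 / 2)) ^ CARD('n)"
    proof -
      have "(2 * (real N + real L)) / (2 * real N + 1) = (real N + real L) / (real N + 1 / 2)"
        by (simp add: field_simps)
      then show ?thesis by (simp only: power_divide[symmetric])
    qed
    finally show ?thesis .
  qed
  then show "\<forall>\<^sub>F N in sequentially. l * ?m \<le> 2 ^ CARD('n) * e * ((real N + real L) / (real N + 1 / 2)) ^ CARD('n)"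
    by simp
  from tendsto_mult[OF tendsto_const[of "2 ^ CARD('n) * e"] tendsto_shift_ratio_power[of "real L" "1 / 2" "CARD('n)"]]
  show "(\<lambda>N. 2 ^ CARD('n) * e * ((real N + real L) / (real N + 1 / 2)) ^ CARD('n)) \<longlonglongrightarrow> 2 ^ CARD('n) * e" by simp
qed

end

locale ergodic_flow = flow M T + prob_space M for M :: "'w measure" and T :: "real ^ 'n::finite \<Rightarrow> 'w \<Rightarrow> 'w" +
  assumes ergodic: "E \<in> sets M \<Longrightarrow> (\<And>y. T y -` E \<inter> space M = E) \<Longrightarrow> measure M E = 0 \<or> measure M E = 1"
begin

text \<open>Ergodicity is given for strictly invariant events. The predicates to which this is
  applied are therefore built from limits superior that agree at all points of an orbit, without an
  exceptional set.\<close>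

lemma zero_one:
  assumes E: "{w \<in> space M. P w} \<in> sets M" and P: "\<And>y w. w \<in> space M \<Longrightarrow> P (T y w) \<longleftrightarrow> P w"
  shows "(AE w in M. P w) \<or> (AE w in M. \<not> P w)"
proof -
  have "T y -` {w \<in> space M. P w} \<inter> space M = {w \<in> space M. P w}" for y
    using P by auto
  from ergodic[OF E this] show ?thesis
    using E by (auto simp: prob_eq_0 prob_eq_1)
qed

lemma eventually_growth:
  fixes c c' :: real
  assumes "c < c'" "0 \<le> c"
  shows "\<forall>\<^sub>F n in sequentially. c * (2 * (real n + m)) ^ d \<le> c' * (2 * real n) ^ d"
proof -
  have "(\<lambda>n. c * ((real n + m) / (real n + 0)) ^ d) \<longlonglongrightarrow> c * 1"
    by (intro tendsto_mult tendsto_const tendsto_shift_ratio_power)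
  then have "\<forall>\<^sub>F n in sequentially. c * ((real n + m) / (real n + 0)) ^ d < c'"
    using assms by (intro order_tendstoD) auto
  then show ?thesis using eventually_gt_at_top[of 0]
  proof eventually_elim
    case (elim n)
    have "c * (2 * (real n + m)) ^ d = c * ((real n + m) / (real n + 0)) ^ d * (2 * real n) ^ d"
    proof -
      have "2 * (real n + m) = (real n + m) / (real n + 0) * (2 * real n)" using elim(2) by simp
      then show ?thesis by (simp only: power_mult_distrib mult.assoc)
    qed
    also have "\<dots> \<le> c' * (2 * real n) ^ d" using elim(1) by (intro mult_right_mono) auto
    finally show ?case .
  qed
qed

text \<open>That the limit superior of the averages exceeds \<open>b\<close> is an invariant event.
  Were its probability 1, the events \<open>exceed L b h\<close> would exhaust the space, whereas
  the maximal inequality bounds their measures by \<open>2 ^ CARD('n) * e / b\<close>, which is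
  below 1.\<close>

lemma limsup_cube_integral:
  assumes h[measurable]: "h \<in> borel_measurable M" and e: "(\<integral>\<^sup>+ w. h w \<partial>M) = ennreal e" "0 \<le> e"
    and c: "2 ^ CARD('n) * e < c"
  shows "AE w in M. \<forall>\<^sub>F n in sequentially. cube_integral (real n) h w \<le> ennreal (c * (2 * real n) ^ CARD('n))"
proof -
  let ?d = "CARD('n)"
  define x where "x = 2 ^ ?d * e"
  have x: "0 \<le> x" "x < c" using e(2) c by (simp_all add: x_def)
  \<comment> \<open>Strictly between: above \<open>2 ^ CARD('n) * e\<close> for the contradiction,
    below \<open>c\<close> to leave room for the margin \<open>1 / (real k + 1)\<close>.\<close>
  define b where "b = (x + c) / 2"
  have b1: "2 ^ ?d * e < b" unfolding x_def[symmetric] b_def using x by simp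
  have b2: "b < c" unfolding b_def using x by simp
  have b3: "0 < b" unfolding b_def using x by simp
  note b = b1 b2 b3
  \<comment> \<open>The normalised limit superior exceeds \<open>b\<close>, in a form with a margin.
    Shifting the index by \<open>m\<close> changes the normalisation by a factor tending to 1, which
    is absorbed by passing from \<open>k\<close> to \<open>Suc k\<close>.\<close>
  define Q where "Q X \<longleftrightarrow> (\<exists>k::nat. \<forall>p. \<exists>n\<ge>p. ennreal ((b + 1 / (real k + 1)) * (2 * real n) ^ ?d) < X n)"
    for X :: "nat \<Rightarrow> ennreal"
  have Q: "Q Y" if le: "\<And>n. X n \<le> Y (n + m)" and X: "Q X" for X Y and m :: nat
  proof -
    obtain k where k: "\<And>p. \<exists>n\<ge>p. ennreal ((b + 1 / (real k + 1)) * (2 * real n) ^ ?d) < X n"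
      using X unfolding Q_def by blast
    have "b + 1 / (real (Suc k) + 1) < b + 1 / (real k + 1)" by (simp add: divide_strict_left_mono)
    from eventually_growth[OF this, of "real m" ?d] b(3)
    obtain n0 where n0: "\<And>n. n0 \<le> n \<Longrightarrow> (b + 1 / (real (Suc k) + 1)) * (2 * (real n + real m)) ^ ?d \<le> (b + 1 / (real k + 1)) * (2 * real n) ^ ?d"
      unfolding eventually_sequentially by auto
    have "\<exists>n\<ge>p. ennreal ((b + 1 / (real (Suc k) + 1)) * (2 * real n) ^ ?d) < Y n" for p
    proof -
      obtain n where n: "max p n0 \<le> n" "ennreal ((b + 1 / (real k + 1)) * (2 * real n) ^ ?d) < X n" using k by blast
      have "ennreal ((b + 1 / (real (Suc k) + 1)) * (2 * real (n + m)) ^ ?d) \<le> ennreal ((b + 1 / (real k + 1)) * (2 * real n) ^ ?d)"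
        using n0[of n] n(1) by (intro ennreal_leI) simp
      also note n(2)
      also note le[of n]
      finally show ?thesis using n(1) by (intro exI[of _ "n + m"]) auto
    qed
    then show ?thesis unfolding Q_def by blast
  qed
  define P where "P w \<longleftrightarrow> Q (\<lambda>n. cube_integral (real n) h w)" for w
  have Pset: "{w \<in> space M. P w} \<in> sets M" unfolding P_def Q_def by measurable
  have inv: "P (T z w) \<longleftrightarrow> P w" if wa: "w \<in> space M" for z w
  proof -
    define m where "m = nat \<lceil>norm z\<rceil>"
    have z: "\<bar>z $ i\<bar> \<le> real m" for i
      using component_le_norm_cart[of z i] of_nat_ceiling[of "norm z"] unfolding m_def by linarith
    show ?thesis
      unfolding P_def
      using Q[of "\<lambda>n. cube_integral (real n) h (T z w)" "\<lambda>n. cube_integral (real n) h w" m]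
        Q[of "\<lambda>n. cube_integral (real n) h w" "\<lambda>n. cube_integral (real n) h (T z w)" m]
        cube_integral_shift_le[OF h wa z] by auto
  qed
  have "\<not> (AE w in M. P w)"
  proof
    assume AE: "AE w in M. P w"
    have sub: "AE w in M. w \<in> (\<Union>L. exceed L b h)"
      using AE AE_space
    proof eventually_elim
      case (elim w)
      then obtain k where k: "\<And>p. \<exists>n\<ge>p. ennreal ((b + 1 / (real k + 1)) * (2 * real n) ^ ?d) < cube_integral (real n) h w"
        unfolding P_def Q_def by blast
      obtain n where n: "1 \<le> n" "ennreal ((b + 1 / (real k + 1)) * (2 * real n) ^ ?d) < cube_integral (real n) h w"
        using k by blast
      have "ennreal (b * (2 * real n) ^ ?d) \<le> ennreal ((b + 1 / (real k + 1)) * (2 * real n) ^ ?d)"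
        by (intro ennreal_leI mult_right_mono) auto
      with n elim(2) have "w \<in> exceed n b h" unfolding exceed_def by (auto intro: le_less_trans)
      then show ?case by blast
    qed
    have lim: "(\<lambda>L. measure M (exceed L b h)) \<longlonglongrightarrow> measure M (\<Union>L. exceed L b h)"
    proof (rule finite_Lim_measure_incseq)
      show "incseq (\<lambda>L. exceed L b h)" unfolding incseq_def exceed_def by fastforce
    qed auto
    have bd: "measure M (exceed L b h) \<le> 2 ^ ?d * e / b" for L
      using maximal_inequality[OF h b(3) e, of L] b(3) by (simp add: pos_le_divide_eq mult.commute)
    have "measure M (\<Union>L. exceed L b h) \<le> 2 ^ ?d * e / b"
      by (rule LIMSEQ_le_const2[OF lim]) (use bd in blast)
    also have "\<dots> < 1" using b by simp
    finally have "measure M (\<Union>L. exceed L b h) < 1" .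
    moreover have "measure M (\<Union>L. exceed L b h) = 1"
      by (subst prob_eq_1) (use sub in simp_all)
    ultimately show False by simp
  qed
  then have "AE w in M. \<not> P w" using zero_one[OF Pset inv] by blast
  then show ?thesis
  proof eventually_elim
    case (elim w)
    obtain k :: nat where k: "1 / (real k + 1) < c - b"
      using reals_Archimedean[of "c - b"] b(2) by (auto simp: inverse_eq_divide add.commute)
    obtain p where p: "\<And>n. n \<ge> p \<Longrightarrow> \<not> ennreal ((b + 1 / (real k + 1)) * (2 * real n) ^ ?d) < cube_integral (real n) h w"
      using elim unfolding P_def Q_def by blast
    show ?case
      unfolding eventually_sequentially
    proof (intro exI[of _ p] allI impI)
      fix n assume "p \<le> n"
      then have "cube_integral (real n) h w \<le> ennreal ((b + 1 / (real k + 1)) * (2 * real n) ^ ?d)"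
        using p by (simp add: not_less)
      also have "\<dots> \<le> ennreal (c * (2 * real n) ^ ?d)"
        using k by (intro ennreal_leI mult_right_mono) auto
      finally show "cube_integral (real n) h w \<le> ennreal (c * (2 * real n) ^ ?d)" .
    qed
  qed
qed

end

section \<open>Averages over cubes and their dependence on the base point\<close>

context flow
begin

definition avg :: "real \<Rightarrow> ('w \<Rightarrow> real) \<Rightarrow> 'w \<Rightarrow> real" where
  "avg r h w = (LINT y|lborel. indicator (cube r) y * h (T y w)) / (2 * r) ^ CARD('n)"

definition orbit_int :: "real \<Rightarrow> ('w \<Rightarrow> real) \<Rightarrow> 'w \<Rightarrow> bool" where
  "orbit_int r h w \<longleftrightarrow> integrable lborel (\<lambda>y. indicator (cube r) y * h (T y w))"

lemma integrable_indicator_cube: "integrable lborel (indicat_real (cube r :: (real ^ 'n) set))"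
  by (intro integrable_real_indicator emeasure_bounded_finite) auto

lemma integral_indicator_cube: "0 \<le> r \<Longrightarrow> (LINT y|lborel. indicat_real (cube r :: (real ^ 'n) set) y) = (2 * r) ^ CARD('n)"
  using measure_cube[of r, where 'n='n] by simp

lemma orbit_int_bounded:
  assumes "w \<in> space M" "h \<in> borel_measurable M" "\<And>w. w \<in> space M \<Longrightarrow> \<bar>h w\<bar> \<le> B"
  shows "orbit_int r h w"
  unfolding orbit_int_def
proof (rule Bochner_Integration.integrable_bound)
  show "integrable lborel (\<lambda>y. indicat_real (cube r :: (real ^ 'n) set) y * B)"
    by (rule integrable_mult_left[OF integrable_indicator_cube])
  show "(\<lambda>y. indicat_real (cube r) y * h (T y w)) \<in> borel_measurable lborel"
    using orbit_borel_measurable[OF assms(1,2)] by measurable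
  have "\<bar>h (T y w)\<bar> \<le> \<bar>B\<bar>" for y using assms(3)[of "T y w"] assms(1) by simp
  then show "AE y in lborel. norm (indicat_real (cube r) y * h (T y w)) \<le> norm (indicat_real (cube r) y * B)"
    by (intro AE_I2) (simp add: abs_mult mult_left_mono)
qed

text \<open>Every cube is contained in one of integer size, so countably many null sets suffice for
  all real \<open>r\<close>.\<close>

lemma AE_orbit_int:
  assumes "integrable M h" shows "AE w in M. \<forall>r. orbit_int r h w"
proof -
  have "AE w in M. \<forall>n. orbit_int (real n) h w"
    unfolding orbit_int_def AE_all_countable
    by (intro allI orbit_integrable(2) assms integrable_indicator_cube)
  then show ?thesis using AE_space
  proof eventually_elim
    case (elim w)
    have "orbit_int r h w" for r
    proof -
      define n where "n = nat \<lceil>r\<rceil>"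
      have "r \<le> real n" unfolding n_def using of_nat_ceiling[of r] .
      then have sub: "cube r \<subseteq> (cube (real n) :: (real ^ 'n) set)" by (rule cube_mono)
      show ?thesis
        unfolding orbit_int_def
      proof (rule Bochner_Integration.integrable_bound)
        show "integrable lborel (\<lambda>y. indicator (cube (real n)) y * h (T y w))"
          using elim(1) by (simp add: orbit_int_def)
        show "(\<lambda>y. indicat_real (cube r) y * h (T y w)) \<in> borel_measurable lborel"
          using orbit_borel_measurable[OF elim(2) borel_measurable_integrable[OF assms]] by measurable
        show "AE y in lborel. norm (indicat_real (cube r) y * h (T y w)) \<le> norm (indicator (cube (real n)) y * h (T y w))"
          using sub by (intro AE_I2) (auto simp: indicator_def)
      qed
    qed
    then show ?case by blast
  qed
qed

lemma avg_measurable [measurable]: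
  assumes [measurable]: "h \<in> borel_measurable M" shows "avg r h \<in> borel_measurable M"
  unfolding avg_def by measurable

lemma avg_add: "orbit_int r f w \<Longrightarrow> orbit_int r g w \<Longrightarrow> avg r (\<lambda>w. f w + g w) w = avg r f w + avg r g w"
  by (simp add: avg_def orbit_int_def distrib_left add_divide_distrib)

lemma avg_diff: "orbit_int r f w \<Longrightarrow> orbit_int r g w \<Longrightarrow> avg r (\<lambda>w. f w - g w) w = avg r f w - avg r g w"
  by (simp add: avg_def orbit_int_def right_diff_distrib diff_divide_distrib)

lemma avg_cmult: "avg r (\<lambda>w. c * f w) w = c * avg r f w"
  by (simp add: avg_def mult.left_commute[of _ c])

lemma avg_const: "0 < r \<Longrightarrow> avg r (\<lambda>w. c) w = c"
  using integral_indicator_cube[of r] by (simp add: avg_def)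

lemma orbit_int_const: "orbit_int r (\<lambda>w. c) w"
  unfolding orbit_int_def by (rule integrable_mult_left[OF integrable_indicator_cube])

lemma orbit_int_add: "orbit_int r f w \<Longrightarrow> orbit_int r g w \<Longrightarrow> orbit_int r (\<lambda>w. f w + g w) w"
  by (simp add: orbit_int_def distrib_left)

lemma orbit_int_diff: "orbit_int r f w \<Longrightarrow> orbit_int r g w \<Longrightarrow> orbit_int r (\<lambda>w. f w - g w) w"
  by (simp add: orbit_int_def right_diff_distrib)

lemma avg_mono:
  assumes "0 < r" "orbit_int r f w" "orbit_int r g w" "\<And>y. y \<in> cube r \<Longrightarrow> f (T y w) \<le> g (T y w)"
  shows "avg r f w \<le> avg r g w"
  unfolding avg_def using assms
  by (intro divide_right_mono integral_mono) (auto simp: orbit_int_def indicator_def)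

lemma avg_near:
  assumes r: "0 < r" and f: "orbit_int r f w" and near: "\<And>y. y \<in> cube r \<Longrightarrow> \<bar>f (T y w) - a\<bar> \<le> e"
  shows "\<bar>avg r f w - a\<bar> \<le> e"
proof -
  have "f (T y w) \<le> a + e" "a - e \<le> f (T y w)" if "y \<in> cube r" for y
    using near[OF that] by linarith+
  then have "avg r f w \<le> avg r (\<lambda>_. a + e) w" "avg r (\<lambda>_. a - e) w \<le> avg r f w"
    by (intro avg_mono r f orbit_int_const; simp)+
  then show ?thesis using avg_const[OF r] by simp
qed

lemma avg_expectation:
  assumes "integrable M h" "0 < r"
  shows "integrable M (avg r h)" "(LINT w|M. avg r h w) = (LINT w|M. h w)"
  using orbit_integrable(3,4)[OF assms(1) integrable_indicator_cube[of r]] integral_indicator_cube[of r] assms(2)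
  by (simp_all add: avg_def[abs_def])

text \<open>Jensen's inequality for the square: \<open>2 * a * h \<le> h\<^sup>2 + a\<^sup>2\<close>
  is averaged with \<open>a\<close> the average of \<open>h\<close>.\<close>

lemma avg_sq_le:
  assumes wa: "w \<in> space M" and h: "h \<in> borel_measurable M" "\<And>w. w \<in> space M \<Longrightarrow> \<bar>h w\<bar> \<le> B" and r: "0 < r"
  shows "(avg r h w)\<^sup>2 \<le> avg r (\<lambda>w. (h w)\<^sup>2) w"
proof -
  define a where "a = avg r h w"
  have "\<bar>(h w)\<^sup>2\<bar> \<le> B\<^sup>2" if "w \<in> space M" for w
    using power_mono[OF h(2)[OF that], of 2] by simp
  then have o2: "orbit_int r (\<lambda>w. (h w)\<^sup>2) w"
    using h(1) by (intro orbit_int_bounded[OF wa]) auto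
  have o1: "orbit_int r h w" by (rule orbit_int_bounded[OF wa h])
  then have o3: "orbit_int r (\<lambda>w. 2 * a * h w) w"
    by (simp add: orbit_int_def mult.left_commute[of _ "2 * a"])
  have "avg r (\<lambda>w. 2 * a * h w) w \<le> avg r (\<lambda>w. (h w)\<^sup>2 + a\<^sup>2) w"
  proof (intro avg_mono r o3 orbit_int_add o2 orbit_int_const)
    show "2 * a * h (T y w) \<le> (h (T y w))\<^sup>2 + a\<^sup>2" for y
      using sum_squares_bound[of "h (T y w)" a] by (simp add: mult_ac)
  qed
  then show ?thesis
    using avg_add[OF o2 orbit_int_const[of r "a\<^sup>2"]] avg_const[OF r, of "a\<^sup>2"] avg_cmult[of r "2 * a" h w]
    by (simp add: a_def power2_eq_square)
qed

text \<open>Translations commute, so both sides are the same double integral over the product of the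
  two cubes. Boundedness gives integrability on every orbit.\<close>

lemma avg_commute:
  assumes wa: "w \<in> space M" and h: "h \<in> borel_measurable M" "\<And>w. w \<in> space M \<Longrightarrow> \<bar>h w\<bar> \<le> B"
  shows "avg r (avg s h) w = avg s (avg r h) w"
proof -
  define F where "F = (\<lambda>y z :: real ^ 'n. indicat_real (cube r) y * indicat_real (cube s) z * h (T (y + z) w))"
  note [measurable] = orbit_borel_measurable[OF wa h(1)]
  have I: "integrable (lborel \<Otimes>\<^sub>M lborel) (\<lambda>(y, z). F y z)"
  proof (rule Bochner_Integration.integrable_bound)
    show "integrable (lborel \<Otimes>\<^sub>M lborel) (\<lambda>p. indicat_real (cube r \<times> cube s :: ((real ^ 'n) \<times> (real ^ 'n)) set) p * \<bar>B\<bar>)"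
    proof (intro integrable_mult_left integrable_real_indicator)
      show "(cube r \<times> cube s :: ((real ^ 'n) \<times> (real ^ 'n)) set) \<in> sets (lborel \<Otimes>\<^sub>M lborel)" by simp
      have "emeasure lborel (cube r :: (real ^ 'n) set) < \<infinity>" "emeasure lborel (cube s :: (real ^ 'n) set) < \<infinity>"
        by (intro emeasure_bounded_finite bounded_cube)+
      then show "emeasure (lborel \<Otimes>\<^sub>M lborel) (cube r \<times> cube s :: ((real ^ 'n) \<times> (real ^ 'n)) set) < \<infinity>"
        by (subst lborel.emeasure_pair_measure_Times) (auto simp: ennreal_mult_less_top)
    qed
    show "(\<lambda>(y, z). F y z) \<in> borel_measurable (lborel \<Otimes>\<^sub>M lborel)"
      unfolding F_def by measurable
    have "\<bar>h (T y w)\<bar> \<le> \<bar>B\<bar>" for y using h(2)[of "T y w"] wa by simp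
    then show "AE p in lborel \<Otimes>\<^sub>M lborel. norm (case p of (y, z) \<Rightarrow> F y z) \<le> norm (indicat_real (cube r \<times> cube s) p * \<bar>B\<bar>)"
      by (intro AE_I2) (auto simp: F_def indicator_def)
  qed
  have e1: "(LINT y|lborel. indicat_real (cube r) y * (LINT z|lborel. indicat_real (cube s) z * h (T z (T y w)))) = (LINT y|lborel. LINT z|lborel. F y z)"
    by (simp add: F_def T_add[OF wa, symmetric] add.commute mult.assoc)
  have e2: "(LINT z|lborel. indicat_real (cube s) z * (LINT y|lborel. indicat_real (cube r) y * h (T y (T z w)))) = (LINT z|lborel. LINT y|lborel. F y z)"
    by (simp add: F_def T_add[OF wa, symmetric] mult.assoc mult.left_commute[of _ "indicat_real (cube s) _"])
  have "(LINT y|lborel. LINT z|lborel. F y z) = (LINT z|lborel. LINT y|lborel. F y z)"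
    using lborel_pair.Fubini_integral[OF I] by simp
  then show ?thesis
    unfolding avg_def using e1 e2 by simp
qed

lemma avg_abs_le:
  assumes wa: "w \<in> space M" and h: "h \<in> borel_measurable M" "\<And>w. w \<in> space M \<Longrightarrow> \<bar>h w\<bar> \<le> B" and r: "0 < r"
  shows "\<bar>avg r h w\<bar> \<le> B"
  using avg_near[OF r orbit_int_bounded[OF wa h], of 0 B] h(2) wa by simp

text \<open>The cube and its translate by \<open>z\<close> both contain the cube of size
  \<open>r - m\<close>, so the two integrals differ only over two boundary layers, each of volume
  \<open>(2 * r) ^ CARD('n) - (2 * (r - m)) ^ CARD('n)\<close>.\<close>

lemma avg_shift:
  assumes wa: "w \<in> space M" and h[measurable]: "h \<in> borel_measurable M" and B: "\<And>w. w \<in> space M \<Longrightarrow> \<bar>h w\<bar> \<le> B"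
    and m: "0 \<le> m" "m \<le> r" "0 < r" and z: "\<And>i. \<bar>z $ i\<bar> \<le> m"
  shows "\<bar>avg r h (T z w) - avg r h w\<bar> \<le> 2 * B * (1 - ((r - m) / r) ^ CARD('n))"
proof -
  define A where "A = {y :: real ^ 'n. \<forall>i. \<bar>y $ i - z $ i\<bar> < r}"
  note [measurable] = orbit_borel_measurable[OF wa h]
  have "A = (\<lambda>y. y - z) -` cube r" by (auto simp: A_def mem_cube)
  then have [measurable]: "A \<in> sets borel"
    using measurable_sets[of "\<lambda>y. y - z" borel borel "cube r"] by simp
  have B0: "0 \<le> B" using B[OF wa] by simp
  have shift: "(LINT y|lborel. indicat_real A y * f y) = (LINT y|lborel. indicat_real (cube r) y * f (z + y))"
    if [measurable]: "f \<in> borel_measurable borel" for f :: "real ^ 'n \<Rightarrow> real"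
  proof -
    have "(LINT y|lborel. indicat_real A y * f y) = (LINT y|lborel. indicat_real A (z + y) * f (z + y))"
      by (subst lborel_distr_plus[of z, symmetric]) (simp add: integral_distr)
    then show ?thesis by (simp add: A_def mem_cube indicator_def)
  qed
  have bA: "bounded A"
  proof (rule bounded_subset[OF bounded_cube])
    show "A \<subseteq> cube (r + m)"
    proof
      fix y assume "y \<in> A"
      then have "\<bar>y $ i\<bar> < r + m" for i using z[of i] by (auto simp: A_def dest: spec[of _ i])
      then show "y \<in> cube (r + m)" by (simp add: mem_cube)
    qed
  qed
  have IA: "integrable lborel (indicat_real A)"
    using bA by (intro integrable_real_indicator emeasure_bounded_finite) auto
  have Ir: "integrable lborel (indicat_real (cube s :: (real ^ 'n) set))" for s by (rule integrable_indicator_cube)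
  have sub: "y \<in> A \<and> y \<in> cube r" if "y \<in> cube (r - m)" for y
    using that z m(1) unfolding A_def mem_cube by (smt (verit) mem_Collect_eq)
  have hb: "\<bar>h (T y w)\<bar> \<le> B" for y using B wa by simp
  have Ih: "integrable lborel (\<lambda>y. indicat_real S y * h (T y w))"
    if "integrable lborel (indicat_real S)" "S \<in> sets borel" for S
  proof (rule Bochner_Integration.integrable_bound)
    show "integrable lborel (\<lambda>y. indicat_real S y * B)" by (rule integrable_mult_left[OF that(1)])
    show "(\<lambda>y. indicat_real S y * h (T y w)) \<in> borel_measurable lborel" using that(2) by measurable
    show "AE y in lborel. norm (indicat_real S y * h (T y w)) \<le> norm (indicat_real S y * B)"
      using hb B0 by (intro AE_I2) (simp add: abs_mult mult_left_mono)
  qed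
  have "(LINT y|lborel. indicat_real (cube r) y * h (T y (T z w))) = (LINT y|lborel. indicat_real A y * h (T y w))"
    by (subst shift) (simp_all add: T_add[OF wa, symmetric] add.commute)
  then have "\<bar>(LINT y|lborel. indicat_real (cube r) y * h (T y (T z w))) - (LINT y|lborel. indicat_real (cube r) y * h (T y w))\<bar>
      = \<bar>LINT y|lborel. (indicat_real A y * h (T y w) - indicat_real (cube r) y * h (T y w))\<bar>"
    using Ih[OF IA] Ih[OF Ir[of r]] by simp
  also have "\<dots> \<le> (LINT y|lborel. B * (indicat_real A y + indicat_real (cube r) y - 2 * indicat_real (cube (r - m)) y))"
  proof (rule order_trans[OF integral_abs_bound], rule integral_mono)
    show "integrable lborel (\<lambda>y. \<bar>indicat_real A y * h (T y w) - indicat_real (cube r) y * h (T y w)\<bar>)"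
      using Ih[OF IA] Ih[OF Ir[of r]] by auto
    show "integrable lborel (\<lambda>y. B * (indicat_real A y + indicat_real (cube r) y - 2 * indicat_real (cube (r - m)) y))"
      using IA Ir by (intro integrable_mult_right Bochner_Integration.integrable_diff Bochner_Integration.integrable_add) auto
    show "\<bar>indicat_real A y * h (T y w) - indicat_real (cube r) y * h (T y w)\<bar>
        \<le> B * (indicat_real A y + indicat_real (cube r) y - 2 * indicat_real (cube (r - m)) y)" for y
      using hb[of y] sub[of y] B0 by (auto simp: indicator_def)
  qed
  also have "\<dots> = B * ((2 * r) ^ CARD('n) + (2 * r) ^ CARD('n) - 2 * (2 * (r - m)) ^ CARD('n))"
  proof -
    have "(LINT y|lborel. indicat_real A y) = (2 * r) ^ CARD('n)"
      using shift[of "\<lambda>_. 1"] integral_indicator_cube[of r] m by simp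
    then show ?thesis
      using IA Ir integral_indicator_cube[of r] integral_indicator_cube[of "r - m"] m by simp
  qed
  also have "\<dots> = 2 * B * (1 - ((r - m) / r) ^ CARD('n)) * (2 * r) ^ CARD('n)"
  proof -
    have "(2 * (r - m)) = ((r - m) / r) * (2 * r)" using m by simp
    then have "(2 * (r - m)) ^ CARD('n) = ((r - m) / r) ^ CARD('n) * (2 * r) ^ CARD('n)"
      by (simp only: power_mult_distrib)
    then show ?thesis by (simp add: algebra_simps)
  qed
  finally show ?thesis
    using m(3) unfolding avg_def diff_divide_distrib[symmetric] by (simp add: pos_divide_le_eq)
qed

end

section \<open>The mean ergodic theorem\<close>

context flow
begin

text \<open>Relative volume of the two boundary layers in \<open>avg_shift\<close>: times a bound of
  \<open>h\<close>, it limits the change of the average over radius \<open>r\<close> when the base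
  point moves by at most \<open>m\<close> in each coordinate.\<close>

definition drift :: "real \<Rightarrow> real \<Rightarrow> real" where
  "drift m r = 2 * (1 - ((r - m) / r) ^ CARD('n))"

lemma drift_tendsto_0: "(\<lambda>n. drift m (real n)) \<longlonglongrightarrow> 0"
  using tendsto_mult[OF tendsto_const[of 2] tendsto_diff[OF tendsto_const[of 1] tendsto_shift_ratio_power[of "- m" 0 "CARD('n)"]]]
  by (simp add: drift_def)

text \<open>After exchanging the two averages, the one over the large cube hardly changes while its
  base point runs through the small cube. So replacing \<open>h\<close> by an average at fixed scale
  is invisible at larger scales.\<close>

lemma avg_avg_near:
  assumes wa: "w \<in> space M" and h: "h \<in> borel_measurable M" "\<And>w. w \<in> space M \<Longrightarrow> \<bar>h w\<bar> \<le> B"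
    and m: "0 < m" "m \<le> r"
  shows "\<bar>avg r (avg m h) w - avg r h w\<bar> \<le> B * drift m r"
proof -
  have r: "0 < r" using m by simp
  have "\<bar>avg m (avg r h) w - avg r h w\<bar> \<le> B * drift m r"
  proof (rule avg_near[OF m(1)])
    show "orbit_int m (avg r h) w"
      by (rule orbit_int_bounded[OF wa avg_measurable[OF h(1)] avg_abs_le[OF _ h r]])
    fix y :: "real ^ 'n" assume "y \<in> cube m"
    then have "\<bar>y $ i\<bar> \<le> m" for i by (auto simp: mem_cube less_imp_le)
    from avg_shift[OF wa h less_imp_le[OF m(1)] m(2) r this]
    show "\<bar>avg r h (T y w) - avg r h w\<bar> \<le> B * drift m r" by (simp add: drift_def algebra_simps)
  qed
  then show ?thesis using avg_commute[OF wa h, of r m] by simp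
qed

text \<open>The convex hull of iterated averages, generated by midpoints because these are what the
  parallelogram identity involves. Boundedness and closeness to \<open>h\<close> at large scales
  pass through both rules by induction.\<close>

inductive avg_hull :: "('w \<Rightarrow> real) \<Rightarrow> ('w \<Rightarrow> real) \<Rightarrow> bool" for h where
  base: "avg_hull h h"
| avg: "avg_hull h k \<Longrightarrow> 0 < n \<Longrightarrow> avg_hull h (avg (real n) k)"
| mid: "avg_hull h k \<Longrightarrow> avg_hull h l \<Longrightarrow> avg_hull h (\<lambda>w. (k w + l w) / 2)"

lemma hull_bounded:
  assumes "avg_hull h k" and h: "h \<in> borel_measurable M" "\<And>w. w \<in> space M \<Longrightarrow> \<bar>h w\<bar> \<le> B"
  shows "k \<in> borel_measurable M \<and> (\<forall>w\<in>space M. \<bar>k w\<bar> \<le> B)"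
  using assms(1)
proof induction
  case base then show ?case using h by auto
next
  case (avg k n)
  then show ?case using avg_abs_le[of _ k B "real n"] by auto
next
  case (mid k l)
  have "\<bar>(k w + l w) / 2\<bar> \<le> B" if "w \<in> space M" for w
  proof -
    have "\<bar>k w\<bar> \<le> B" "\<bar>l w\<bar> \<le> B" using mid that by auto
    then have "\<bar>k w + l w\<bar> \<le> 2 * B" by linarith
    then show ?thesis by simp
  qed
  moreover have "(\<lambda>w. (k w + l w) / 2) \<in> borel_measurable M"
    using mid by (intro borel_measurable_divide borel_measurable_add) auto
  ultimately show ?case by blast
qed

lemma hull_near:
  assumes "avg_hull h k" and h: "h \<in> borel_measurable M" "\<And>w. w \<in> space M \<Longrightarrow> \<bar>h w\<bar> \<le> B"
  shows "\<forall>e>0. \<exists>N. \<forall>n\<ge>N. \<forall>w\<in>space M. \<bar>avg (real n) k w - avg (real n) h w\<bar> \<le> e"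
  using assms(1)
proof induction
  case base then show ?case by auto
next
  case (avg k m)
  have kB: "k \<in> borel_measurable M" "\<And>w. w \<in> space M \<Longrightarrow> \<bar>k w\<bar> \<le> B" using hull_bounded[OF avg(1) h] by auto
  show ?case
  proof (intro allI impI)
    fix e :: real assume e: "0 < e"
    obtain N1 where N1: "\<And>n w. N1 \<le> n \<Longrightarrow> w \<in> space M \<Longrightarrow> \<bar>avg (real n) k w - avg (real n) h w\<bar> \<le> e / 2"
      using avg(3) e by (meson half_gt_zero)
    have "(\<lambda>n. B * drift (real m) (real n)) \<longlonglongrightarrow> B * 0"
      by (intro tendsto_mult tendsto_const drift_tendsto_0)
    then have "\<forall>\<^sub>F n in sequentially. B * drift (real m) (real n) < e / 2"
      using e by (intro order_tendstoD) auto
    then obtain N2 where N2: "\<And>n. N2 \<le> n \<Longrightarrow> B * drift (real m) (real n) < e / 2"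
      unfolding eventually_sequentially by blast
    show "\<exists>N. \<forall>n\<ge>N. \<forall>w\<in>space M. \<bar>avg (real n) (avg (real m) k) w - avg (real n) h w\<bar> \<le> e"
    proof (intro exI[of _ "max m (max N1 N2)"] allI impI ballI)
      fix n w assume n: "max m (max N1 N2) \<le> n" and wa: "w \<in> space M"
      have "\<bar>avg (real n) (avg (real m) k) w - avg (real n) k w\<bar> \<le> B * drift (real m) (real n)"
        by (rule avg_avg_near[OF wa kB]) (use n avg(2) in auto)
      moreover have "B * drift (real m) (real n) < e / 2" using N2[of n] n by simp
      moreover have "\<bar>avg (real n) k w - avg (real n) h w\<bar> \<le> e / 2" using N1[of n w] n wa by simp
      ultimately show "\<bar>avg (real n) (avg (real m) k) w - avg (real n) h w\<bar> \<le> e" by linarith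
    qed
  qed
next
  case (mid k l)
  have kB: "k \<in> borel_measurable M" "\<And>w. w \<in> space M \<Longrightarrow> \<bar>k w\<bar> \<le> B" using hull_bounded[OF mid(1) h] by auto
  have lB: "l \<in> borel_measurable M" "\<And>w. w \<in> space M \<Longrightarrow> \<bar>l w\<bar> \<le> B" using hull_bounded[OF mid(2) h] by auto
  show ?case
  proof (intro allI impI)
    fix e :: real assume e: "0 < e"
    obtain N1 where N1: "\<And>n w. N1 \<le> n \<Longrightarrow> w \<in> space M \<Longrightarrow> \<bar>avg (real n) k w - avg (real n) h w\<bar> \<le> e"
      using mid(3) e by meson
    obtain N2 where N2: "\<And>n w. N2 \<le> n \<Longrightarrow> w \<in> space M \<Longrightarrow> \<bar>avg (real n) l w - avg (real n) h w\<bar> \<le> e"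
      using mid(4) e by meson
    show "\<exists>N. \<forall>n\<ge>N. \<forall>w\<in>space M. \<bar>avg (real n) (\<lambda>w. (k w + l w) / 2) w - avg (real n) h w\<bar> \<le> e"
    proof (intro exI[of _ "max N1 N2"] allI impI ballI)
      fix n w assume n: "max N1 N2 \<le> n" and wa: "w \<in> space M"
      have "avg (real n) (\<lambda>w. k w + l w) w = avg (real n) k w + avg (real n) l w"
        by (rule avg_add[OF orbit_int_bounded[OF wa kB] orbit_int_bounded[OF wa lB]])
      then have "avg (real n) (\<lambda>w. (k w + l w) / 2) w = (avg (real n) k w + avg (real n) l w) / 2"
        using avg_cmult[of "real n" "1 / 2" "\<lambda>w. k w + l w" w] by simp
      then show "\<bar>avg (real n) (\<lambda>w. (k w + l w) / 2) w - avg (real n) h w\<bar> \<le> e"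
        using N1[of n w] N2[of n w] n wa by (simp add: abs_le_iff field_simps)
    qed
  qed
qed

lemma integrable_bounded:
  fixes h :: "'w \<Rightarrow> real"
  assumes "h \<in> borel_measurable M" "\<And>w. w \<in> space M \<Longrightarrow> \<bar>h w\<bar> \<le> B"
  shows "integrable M h"
  by (rule integrable_const_bound[where B=B]) (use assms in \<open>auto intro: AE_I2\<close>)

lemma integrable_bounded_sq:
  fixes h :: "'w \<Rightarrow> real"
  assumes "h \<in> borel_measurable M" "\<And>w. w \<in> space M \<Longrightarrow> \<bar>h w\<bar> \<le> B"
  shows "integrable M (\<lambda>w. (h w)\<^sup>2)"
proof (rule integrable_bounded)
  show "\<bar>(h w)\<^sup>2\<bar> \<le> B\<^sup>2" if "w \<in> space M" for w
    using power_mono[OF assms(2)[OF that], of 2] by simp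
qed (use assms(1) in measurable)

lemma avg_sq_expectation:
  assumes h: "h \<in> borel_measurable M" "\<And>w. w \<in> space M \<Longrightarrow> \<bar>h w\<bar> \<le> B" and r: "0 < r"
  shows "(LINT w|M. (avg r h w)\<^sup>2) \<le> (LINT w|M. (h w)\<^sup>2)"
proof -
  have "(LINT w|M. (avg r h w)\<^sup>2) \<le> (LINT w|M. avg r (\<lambda>w. (h w)\<^sup>2) w)"
  proof (rule integral_mono)
    show "integrable M (\<lambda>w. (avg r h w)\<^sup>2)"
      by (rule integrable_bounded_sq[OF avg_measurable[OF h(1)] avg_abs_le[OF _ h r]])
    show "integrable M (avg r (\<lambda>w. (h w)\<^sup>2))"
      by (rule avg_expectation(1)[OF integrable_bounded_sq[OF h] r])
  qed (rule avg_sq_le[OF _ h r])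
  also have "\<dots> = (LINT w|M. (h w)\<^sup>2)"
    by (rule avg_expectation(2)[OF integrable_bounded_sq[OF h] r])
  finally show ?thesis .
qed

text \<open>Almost minimal elements of the convex hull of the averages have almost equal averages by the
  parallelogram identity, and \<open>avg n\<close> forgets which element of the hull it is applied to.\<close>

lemma avg_Cauchy_L2:
  assumes h: "h \<in> borel_measurable M" "\<And>w. w \<in> space M \<Longrightarrow> \<bar>h w\<bar> \<le> B" and e: "0 < e"
    and fin: "measure M (space M) \<le> 1"
  shows "\<exists>N. \<forall>n\<ge>N. \<forall>m\<ge>N. (LINT w|M. (avg (real n) h w - avg (real m) h w)\<^sup>2) \<le> e"
proof -
  let ?E = "\<lambda>k. LINT w|M. (k w)\<^sup>2"
  define V where "V = {?E k |k. avg_hull h k}"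
  have V: "V \<noteq> {}" "bdd_below V"
    unfolding V_def using avg_hull.base by (auto intro!: bdd_belowI[of _ 0])
  define a where "a = Inf V"
  \<comment> \<open>The budget: the parallelogram identity contributes \<open>4 * (e / 18)\<close>,
    tripled by splitting a square of three terms, and the two replacements of \<open>k\<close> by
    \<open>h\<close> contribute \<open>6 * (e / 18)\<close>; together \<open>e\<close>.\<close>
  have "a < a + e / 18" using e by simp
  then obtain k where k: "avg_hull h k" "?E k < a + e / 18"
    using cInf_lessD[OF V(1), of "a + e / 18"] unfolding a_def V_def by blast
  have low: "a \<le> ?E l" if "avg_hull h l" for l
    unfolding a_def by (rule cInf_lower[OF _ V(2)]) (use that in \<open>auto simp: V_def\<close>)
  have kB: "k \<in> borel_measurable M" "\<And>w. w \<in> space M \<Longrightarrow> \<bar>k w\<bar> \<le> B" using hull_bounded[OF k(1) h] by auto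
  define d where "d = sqrt (e / 18)"
  have d: "0 < d" "d\<^sup>2 = e / 18" using e by (auto simp: d_def)
  obtain N where N: "\<And>n w. N \<le> n \<Longrightarrow> w \<in> space M \<Longrightarrow> \<bar>avg (real n) k w - avg (real n) h w\<bar> \<le> d"
    using hull_near[OF k(1) h] d(1) by meson
  have main: "(LINT w|M. (avg (real n) h w - avg (real m) h w)\<^sup>2) \<le> e"
    if nm: "N + 1 \<le> n" "N + 1 \<le> m" for n m
  proof -
    let ?n = "avg (real n) k" and ?m = "avg (real m) k"
    have pos: "0 < real n" "0 < real m" using nm by auto
    have bn: "?n \<in> borel_measurable M" "\<And>w. w \<in> space M \<Longrightarrow> \<bar>?n w\<bar> \<le> B"
      and bm: "?m \<in> borel_measurable M" "\<And>w. w \<in> space M \<Longrightarrow> \<bar>?m w\<bar> \<le> B"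
      using avg_abs_le[OF _ kB pos(1)] avg_abs_le[OF _ kB pos(2)] avg_measurable[OF kB(1)] by auto
    have ab: "\<bar>avg r h w\<bar> \<le> B" if "w \<in> space M" "0 < r" for w r
      by (rule avg_abs_le[OF that(1) h that(2)])
    have hn: "avg_hull h ?n" "avg_hull h ?m" using pos by (auto intro!: avg_hull.avg k(1))
    note sqn = integrable_bounded_sq[OF bn] integrable_bounded_sq[OF bm]
    note hm = hull_bounded[OF avg_hull.mid[OF hn] h]
    have sqm: "integrable M (\<lambda>w. ((?n w + ?m w) / 2)\<^sup>2)"
      by (rule integrable_bounded_sq[where B=B]) (use hm in auto)
    \<comment> \<open>The parallelogram identity. Averaging does not increase the mean square, so
      both averages of \<open>k\<close> are almost minimal, and their midpoint lies in the hull and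
      cannot be below the infimum \<open>a\<close>.\<close>
    have "(LINT w|M. (?n w - ?m w)\<^sup>2) = (LINT w|M. 2 * (?n w)\<^sup>2 + 2 * (?m w)\<^sup>2 - 4 * ((?n w + ?m w) / 2)\<^sup>2)"
      by (rule Bochner_Integration.integral_cong) (auto simp: power2_eq_square field_simps)
    also have "\<dots> = 2 * ?E ?n + 2 * ?E ?m - 4 * ?E (\<lambda>w. (?n w + ?m w) / 2)"
      using sqn sqm by simp
    also have "\<dots> \<le> 4 * (e / 18)"
    proof -
      have "?E ?n \<le> ?E k" by (rule avg_sq_expectation[OF kB pos(1)])
      moreover have "?E ?m \<le> ?E k" by (rule avg_sq_expectation[OF kB pos(2)])
      moreover have "a \<le> ?E (\<lambda>w. (?n w + ?m w) / 2)" by (rule low[OF avg_hull.mid[OF hn]])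
      moreover have "2 * p + 2 * q - 4 * s \<le> 4 * t" if "p \<le> K" "q \<le> K" "a \<le> s" "K < a + t" for p q s t K
        using that by argo
      ultimately show ?thesis using k(2) by blast
    qed
    finally have D: "(LINT w|M. (?n w - ?m w)\<^sup>2) \<le> 4 * (e / 18)" .
    have Bn: "avg (real n) h \<in> borel_measurable M" "avg (real m) h \<in> borel_measurable M"
      by (rule avg_measurable[OF h(1)])+
    have bd: "\<bar>?n w - ?m w\<bar> \<le> 2 * B" if "w \<in> space M" for w
      using bn(2)[OF that] bm(2)[OF that] by linarith
    have ID: "integrable M (\<lambda>w. (?n w - ?m w)\<^sup>2)"
      by (rule integrable_bounded_sq[OF _ bd]) (use bn(1) bm(1) in auto)
    have "(LINT w|M. (avg (real n) h w - avg (real m) h w)\<^sup>2) \<le> (LINT w|M. 3 * (?n w - ?m w)\<^sup>2 + 6 * d\<^sup>2)"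
    proof (rule integral_mono)
      show "integrable M (\<lambda>w. (avg (real n) h w - avg (real m) h w)\<^sup>2)"
      proof (rule integrable_bounded_sq)
        show "\<bar>avg (real n) h w - avg (real m) h w\<bar> \<le> 2 * B" if "w \<in> space M" for w
          using ab[OF that pos(1)] ab[OF that pos(2)] by linarith
      qed (use Bn in auto)
      show "integrable M (\<lambda>w. 3 * (?n w - ?m w)\<^sup>2 + 6 * d\<^sup>2)" using ID by simp
      fix w assume wa: "w \<in> space M"
      define x y z where "x = avg (real n) h w - ?n w" and "y = ?n w - ?m w" and "z = ?m w - avg (real m) h w"
      have "\<bar>x\<bar> \<le> d" "\<bar>z\<bar> \<le> d"
        using N[of n, OF _ wa] N[of m, OF _ wa] nm by (auto simp: x_def z_def abs_minus_commute)
      then have "x\<^sup>2 \<le> d\<^sup>2" "z\<^sup>2 \<le> d\<^sup>2" using power_mono[of "\<bar>x\<bar>" d 2] power_mono[of "\<bar>z\<bar>" d 2] by auto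
      moreover have "(x + y + z)\<^sup>2 \<le> 3 * x\<^sup>2 + 3 * y\<^sup>2 + 3 * z\<^sup>2"
        using sum_squares_bound[of x y] sum_squares_bound[of y z] sum_squares_bound[of x z]
        by (simp add: power2_eq_square algebra_simps)
      moreover have "avg (real n) h w - avg (real m) h w = x + y + z" by (simp add: x_def y_def z_def)
      ultimately show "(avg (real n) h w - avg (real m) h w)\<^sup>2 \<le> 3 * (?n w - ?m w)\<^sup>2 + 6 * d\<^sup>2"
        by (simp add: y_def)
    qed
    also have "\<dots> = 3 * (LINT w|M. (?n w - ?m w)\<^sup>2) + 6 * d\<^sup>2 * measure M (space M)" using ID by simp
    also have "\<dots> \<le> 3 * (4 * (e / 18)) + 6 * d\<^sup>2 * 1"
      using D fin by (intro add_mono mult_left_mono) auto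
    also have "\<dots> = e" using d(2) by simp
    finally show ?thesis .
  qed
  show ?thesis by (rule exI[of _ "N + 1"]) (use main in blast)
qed

end

context ergodic_flow
begin

lemma avg_Cauchy_L1:
  assumes h: "h \<in> borel_measurable M" "\<And>w. w \<in> space M \<Longrightarrow> \<bar>h w\<bar> \<le> B" and e: "0 < e"
  shows "\<exists>N. \<forall>n\<ge>N. \<forall>m\<ge>N. (LINT w|M. \<bar>avg (real n) h w - avg (real m) h w\<bar>) \<le> e"
proof -
  have "0 < e\<^sup>2" using e by simp
  then obtain N where N: "\<And>n m. N \<le> n \<Longrightarrow> N \<le> m \<Longrightarrow> (LINT w|M. (avg (real n) h w - avg (real m) h w)\<^sup>2) \<le> e\<^sup>2"
    using avg_Cauchy_L2[OF h, of "e\<^sup>2"] prob_space by auto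
  have "(LINT w|M. \<bar>avg (real n) h w - avg (real m) h w\<bar>) \<le> e" if nm: "N + 1 \<le> n" "N + 1 \<le> m" for n m
  proof -
    let ?f = "\<lambda>w. avg (real n) h w - avg (real m) h w"
    have pos: "0 < real n" "0 < real m" using nm by auto
    have b: "\<bar>?f w\<bar> \<le> 2 * B" if "w \<in> space M" for w
    proof -
      have "\<bar>avg (real n) h w\<bar> \<le> B" by (rule avg_abs_le[OF that h pos(1)])
      moreover have "\<bar>avg (real m) h w\<bar> \<le> B" by (rule avg_abs_le[OF that h pos(2)])
      ultimately show ?thesis by linarith
    qed
    have f: "?f \<in> L2 M"
      by (rule L2_bounded[where B="2 * B"]) (use b avg_measurable[OF h(1)] in \<open>auto intro: AE_I2\<close>)
    have "(LINT w|M. norm (?f w) * norm (1::real)) \<le> L2_nrm M ?f * L2_nrm M (\<lambda>w. 1::real)"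
      by (rule L2_Cauchy_Schwarz_norm[OF f L2_const])
    also have "\<dots> \<le> e * 1"
    proof (rule mult_mono)
      show "L2_nrm M ?f \<le> e" by (rule L2_nrm_leI) (use N[of n m] nm e in auto)
      show "L2_nrm M (\<lambda>w. 1::real) \<le> 1" by (rule L2_nrm_leI) (auto simp: prob_space)
    qed (use e in auto)
    finally show ?thesis by simp
  qed
  then show ?thesis by (intro exI[of _ "N + 1"]) blast
qed

end

section \<open>Identification of limits of averages\<close>

context ergodic_flow
begin

lemma AE_summable:
  fixes f :: "nat \<Rightarrow> 'w \<Rightarrow> real"
  assumes [measurable]: "\<And>k. f k \<in> borel_measurable M"
    and le: "\<And>k. (\<integral>\<^sup>+ w. ennreal \<bar>f k w\<bar> \<partial>M) \<le> ennreal ((1 / 2) ^ k)"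
  shows "AE w in M. summable (\<lambda>k. f k w)"
proof -
  have "(\<integral>\<^sup>+ w. (\<Sum>k. ennreal \<bar>f k w\<bar>) \<partial>M) = (\<Sum>k. \<integral>\<^sup>+ w. ennreal \<bar>f k w\<bar> \<partial>M)"
    by (rule nn_integral_suminf) measurable
  also have "\<dots> \<le> (\<Sum>k. ennreal ((1 / 2) ^ k))"
    by (intro suminf_le le) auto
  also have "\<dots> = ennreal (\<Sum>k. (1 / 2) ^ k)"
    by (intro suminf_ennreal2) (auto intro: summable_geometric)
  also have "\<dots> < \<infinity>" by simp
  finally have "(\<integral>\<^sup>+ w. (\<Sum>k. ennreal \<bar>f k w\<bar>) \<partial>M) \<noteq> \<infinity>" by simp
  then have "AE w in M. (\<Sum>k. ennreal \<bar>f k w\<bar>) \<noteq> \<infinity>"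
    by (intro nn_integral_PInf_AE) measurable
  then show ?thesis
  proof eventually_elim
    case (elim w)
    then have "summable (\<lambda>k. \<bar>f k w\<bar>)" by (intro summable_suminf_not_top) auto
    then show ?case by (rule summable_rabs_cancel)
  qed
qed

text \<open>The event that the limit superior exceeds a level is invariant, because the shifted and
  the unshifted sequence differ by a null sequence on every orbit. It has probability 0 or 1 at each
  level, and the limit is the supremum of the levels with probability 1.\<close>

lemma AE_limit_const:
  fixes f :: "nat \<Rightarrow> 'w \<Rightarrow> real"
  assumes f[measurable]: "\<And>k. f k \<in> borel_measurable M" and B: "\<And>k w. w \<in> space M \<Longrightarrow> \<bar>f k w\<bar> \<le> B"
    and inv: "\<And>z w. w \<in> space M \<Longrightarrow> (\<lambda>k. f k (T z w) - f k w) \<longlonglongrightarrow> 0"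
    and conv: "AE w in M. convergent (\<lambda>k. f k w)"
  shows "\<exists>a. AE w in M. (\<lambda>k. f k w) \<longlonglongrightarrow> a"
proof -
  \<comment> \<open>The strict inequality between \<open>c\<close> and the limit superior, again
    with a margin that absorbs a null sequence by passing from \<open>j\<close> to
    \<open>Suc j\<close>.\<close>
  define Q where "Q c X \<longleftrightarrow> (\<exists>j::nat. \<forall>p. \<exists>k\<ge>p. c + 1 / (real j + 1) < X k)" for c :: real and X :: "nat \<Rightarrow> real"
  define P where "P c w \<longleftrightarrow> Q c (\<lambda>k. f k w)" for c w
  have Q: "Q c Y" if d: "(\<lambda>k. Y k - X k) \<longlonglongrightarrow> 0" and X: "Q c X" for c X Y
  proof -
    obtain j where j: "\<And>p. \<exists>k\<ge>p. c + 1 / (real j + 1) < X k" using X unfolding Q_def by blast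
    have "1 / (real (Suc j) + 1) < 1 / (real j + 1)" by (simp add: divide_strict_left_mono)
    then have "1 / (real (Suc j) + 1) - 1 / (real j + 1) < 0" by simp
    from order_tendstoD(1)[OF d this]
    obtain k0 where k0: "\<And>k. k0 \<le> k \<Longrightarrow> 1 / (real (Suc j) + 1) - 1 / (real j + 1) < Y k - X k"
      unfolding eventually_sequentially by blast
    have "\<exists>k\<ge>p. c + 1 / (real (Suc j) + 1) < Y k" for p
    proof -
      obtain k where k: "max p k0 \<le> k" "c + 1 / (real j + 1) < X k" using j by blast
      with k0[of k] show ?thesis by (intro exI[of _ k]) simp
    qed
    then show ?thesis unfolding Q_def by blast
  qed
  have zo: "(AE w in M. P c w) \<or> (AE w in M. \<not> P c w)" for c
  proof (rule zero_one)
    show "{w \<in> space M. P c w} \<in> sets M" unfolding P_def Q_def by measurable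
    fix z w assume wa: "w \<in> space M"
    have "(\<lambda>k. f k w - f k (T z w)) \<longlonglongrightarrow> 0" using tendsto_minus[OF inv[OF wa, of z]] by simp
    from Q[OF this] Q[OF inv[OF wa, of z]] show "P c (T z w) \<longleftrightarrow> P c w"
      unfolding P_def by (intro iffI)
  qed
  have lim: "L \<le> c" if Pc: "\<not> P c w" and toL: "(\<lambda>k. f k w) \<longlonglongrightarrow> L" for c L w
  proof (rule ccontr)
    assume "\<not> L \<le> c"
    then obtain j :: nat where "1 / (real j + 1) < L - c"
      using reals_Archimedean[of "L - c"] by (auto simp: inverse_eq_divide add.commute)
    then have "c + 1 / (real j + 1) < L" by simp
    from order_tendstoD(1)[OF toL this] obtain k0 where k0: "\<And>k. k0 \<le> k \<Longrightarrow> c + 1 / (real j + 1) < f k w"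
      unfolding eventually_sequentially by blast
    have "\<exists>k\<ge>p. c + 1 / (real j + 1) < f k w" for p
      by (rule exI[of _ "max p k0"]) (simp add: k0)
    then show False using Pc unfolding P_def Q_def by blast
  qed
  have lim': "c \<le> L" if Pc: "P c w" and toL: "(\<lambda>k. f k w) \<longlonglongrightarrow> L" for c L w
  proof (rule ccontr)
    assume "\<not> c \<le> L"
    then have "L < c" by simp
    from order_tendstoD(2)[OF toL this] obtain k0 where k0: "\<And>k. k0 \<le> k \<Longrightarrow> f k w < c"
      unfolding eventually_sequentially by blast
    obtain j :: nat where "\<And>p. \<exists>k\<ge>p. c + 1 / (real j + 1) < f k w" using Pc unfolding P_def Q_def by blast
    then obtain k where k: "k0 \<le> k" "c + 1 / (real j + 1) < f k w" by blast
    have "0 \<le> 1 / (real j + 1)" by simp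
    with k k0[OF k(1)] show False by linarith
  qed
  define S where "S = {c. AE w in M. P c w}"
  have PB: "P c w" if cB: "c < - B" and wa: "w \<in> space M" for c w
  proof -
    obtain j :: nat where "1 / (real j + 1) < - B - c"
      using reals_Archimedean[of "- B - c"] cB by (auto simp: inverse_eq_divide add.commute)
    then have "c + 1 / (real j + 1) < f k w" for k using B[OF wa, of k] by linarith
    then show ?thesis unfolding P_def Q_def by blast
  qed
  have nPB: "\<not> P c w" if cB: "B \<le> c" and wa: "w \<in> space M" for c w
  proof
    assume "P c w"
    then obtain j k where "c + 1 / (real (j::nat) + 1) < f k w" unfolding P_def Q_def by blast
    moreover have "0 \<le> 1 / (real j + 1)" by simp
    ultimately show False using B[OF wa, of k] cB by linarith
  qed
  have "- B - 1 \<in> S" unfolding S_def using PB by (auto intro!: AE_I2)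
  have Sle: "c \<le> B" if "c \<in> S" for c
  proof (rule ccontr)
    assume "\<not> c \<le> B"
    then have "AE w in M. \<not> P c w" using nPB by (intro AE_I2) auto
    moreover have "AE w in M. P c w" using that by (simp add: S_def)
    ultimately have "AE w in M. False" by eventually_elim simp
    then show False by simp
  qed
  have bdd: "bdd_above S" using Sle by (rule bdd_aboveI)
  define a where "a = Sup S"
  have "AE w in M. \<forall>j::nat. \<not> P (a + 1 / (real j + 1)) w"
    unfolding AE_all_countable
  proof
    fix j :: nat
    have "a + 1 / (real j + 1) \<notin> S"
    proof
      assume "a + 1 / (real j + 1) \<in> S"
      then have "a + 1 / (real j + 1) \<le> a" unfolding a_def by (rule cSup_upper[OF _ bdd])
      then show False by (simp add: field_simps)
    qed
    then show "AE w in M. \<not> P (a + 1 / (real j + 1)) w" using zo by (auto simp: S_def)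
  qed
  moreover have "AE w in M. \<forall>j::nat. \<exists>c > a - 1 / (real j + 1). P c w"
    unfolding AE_all_countable
  proof
    fix j :: nat
    have "a - 1 / (real j + 1) < Sup S" unfolding a_def[symmetric] by simp
    then obtain c where c: "c \<in> S" "a - 1 / (real j + 1) < c"
      using less_cSupD[of S "a - 1 / (real j + 1)"] \<open>- B - 1 \<in> S\<close> by blast
    have "AE w in M. P c w" using c(1) by (simp add: S_def)
    then show "AE w in M. \<exists>c > a - 1 / (real j + 1). P c w"
      by eventually_elim (use c(2) in blast)
  qed
  moreover note conv
  ultimately have "AE w in M. (\<lambda>k. f k w) \<longlonglongrightarrow> a"
  proof eventually_elim
    case (elim w)
    then obtain L where L: "(\<lambda>k. f k w) \<longlonglongrightarrow> L" by (auto simp: convergent_def)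
    have "L \<le> a + 1 / (real j + 1)" "a - 1 / (real j + 1) \<le> L" for j :: nat
    proof -
      show "L \<le> a + 1 / (real j + 1)" using lim[OF _ L] elim(1) by blast
      obtain c where "a - 1 / (real j + 1) < c" "P c w" using elim(2) by blast
      then show "a - 1 / (real j + 1) \<le> L" using lim'[OF _ L, of c] by simp
    qed
    then have bd: "\<bar>L - a\<bar> \<le> 1 / (real j + 1)" for j :: nat by (simp add: abs_le_iff algebra_simps)
    have "L = a"
    proof (rule ccontr)
      assume "L \<noteq> a"
      then obtain j :: nat where "1 / (real j + 1) < \<bar>L - a\<bar>"
        using reals_Archimedean[of "\<bar>L - a\<bar>"] by (auto simp: inverse_eq_divide add.commute)
      with bd[of j] show False by simp
    qed
    with L show ?case by simp
  qed
  then show ?thesis ..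
qed

text \<open>A rapidly Cauchy subsequence of averages converges almost everywhere. Its limit is
  constant by ergodicity and equals the mean by dominated convergence. For each accuracy one good
  scale \<open>m\<close> suffices for the pointwise theorem.\<close>

lemma mean_ergodic:
  assumes h: "h \<in> borel_measurable M" "\<And>w. w \<in> space M \<Longrightarrow> \<bar>h w\<bar> \<le> B" and e: "0 < e"
  shows "\<exists>m::nat. 0 < m \<and> (LINT w|M. \<bar>avg (real m) h w - (LINT w|M. h w)\<bar>) < e"
proof -
  have "\<forall>k. \<exists>N. \<forall>n\<ge>N. \<forall>m\<ge>N. (LINT w|M. \<bar>avg (real n) h w - avg (real m) h w\<bar>) \<le> (1 / 2) ^ k"
    by (intro allI avg_Cauchy_L1[OF h] zero_less_power half_gt_zero zero_less_one)
  from choice[OF this] obtain N where N: "\<And>k n m. N k \<le> n \<Longrightarrow> N k \<le> m \<Longrightarrow>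
      (LINT w|M. \<bar>avg (real n) h w - avg (real m) h w\<bar>) \<le> (1 / 2) ^ k" by blast
  \<comment> \<open>The sum dominates every \<open>N j\<close> with \<open>j \<le> k\<close>, so
    \<open>r k\<close> and \<open>r (Suc k)\<close> both lie beyond \<open>N k\<close>; the summand
    \<open>Suc k\<close> makes the radii positive and unbounded.\<close>
  define r where "r k = Suc k + (\<Sum>j\<le>k. N j)" for k
  have rN: "N k \<le> r k" "N k \<le> r (Suc k)" "0 < r k" "k \<le> r k" for k
    using member_le_sum[of k "{..k}" N] by (auto simp: r_def)
  define f where "f k = avg (real (r k)) h" for k
  have fm[measurable]: "f k \<in> borel_measurable M" for k unfolding f_def by (rule avg_measurable[OF h(1)])
  have fB: "\<bar>f k w\<bar> \<le> B" if "w \<in> space M" for k w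
    unfolding f_def using rN(3)[of k] by (intro avg_abs_le that h) auto
  have fi: "integrable M (f k)" for k by (rule integrable_bounded[OF fm fB])
  have "AE w in M. summable (\<lambda>k. f (Suc k) w - f k w)"
  proof (rule AE_summable)
    fix k
    have "(\<integral>\<^sup>+ w. ennreal \<bar>f (Suc k) w - f k w\<bar> \<partial>M) = ennreal (LINT w|M. \<bar>f (Suc k) w - f k w\<bar>)"
      by (intro nn_integral_eq_integral integrable_abs Bochner_Integration.integrable_diff fi) simp
    also have "\<dots> \<le> ennreal ((1 / 2) ^ k)"
      unfolding f_def by (intro ennreal_leI N rN)
    finally show "(\<integral>\<^sup>+ w. ennreal \<bar>f (Suc k) w - f k w\<bar> \<partial>M) \<le> ennreal ((1 / 2) ^ k)" .
  qed measurable
  then have conv: "AE w in M. convergent (\<lambda>k. f k w)"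
  proof eventually_elim
    case (elim w)
    then have "convergent (\<lambda>n. \<Sum>k<n. f (Suc k) w - f k w)" by (simp add: summable_iff_convergent)
    then have "convergent (\<lambda>n. f n w - f 0 w)" unfolding sum_lessThan_telescope[of "\<lambda>k. f k w"] .
    then have "convergent (\<lambda>n. (f n w - f 0 w) + f 0 w)" by (intro convergent_add convergent_const)
    then show ?case by simp
  qed
  have inv: "(\<lambda>k. f k (T z w) - f k w) \<longlonglongrightarrow> 0" if wa: "w \<in> space M" for z w
  proof (rule Lim_null_comparison)
    have z: "\<bar>z $ i\<bar> \<le> norm z" for i by (rule component_le_norm_cart)
    have "filterlim r at_top sequentially"
      by (rule filterlim_at_top_mono[OF filterlim_ident]) (use rN(4) in simp)
    then have "(\<lambda>k. drift (norm z) (real (r k))) \<longlonglongrightarrow> 0"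
      by (rule filterlim_compose[OF drift_tendsto_0])
    from tendsto_mult[OF tendsto_const[of B] this]
    show "(\<lambda>k. B * drift (norm z) (real (r k))) \<longlonglongrightarrow> 0" by simp
    show "\<forall>\<^sub>F k in sequentially. norm (f k (T z w) - f k w) \<le> B * drift (norm z) (real (r k))"
      using eventually_ge_at_top[of "nat \<lceil>norm z\<rceil>"]
    proof eventually_elim
      case (elim k)
      have "norm z \<le> real (r k)" using elim rN(4)[of k] of_nat_ceiling[of "norm z"] by linarith
      from avg_shift[OF wa h norm_ge_zero this _ z] rN(3)[of k]
      show ?case by (simp add: f_def drift_def algebra_simps)
    qed
  qed
  obtain a where a: "AE w in M. (\<lambda>k. f k w) \<longlonglongrightarrow> a"
    using AE_limit_const[OF fm fB inv conv] by blast
  have "(\<lambda>k. LINT w|M. f k w) \<longlonglongrightarrow> (LINT w|M. a)"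
    by (rule integral_dominated_convergence[where w="\<lambda>_. B"]) (use a fB in \<open>auto intro: AE_I2\<close>)
  moreover have "(LINT w|M. f k w) = (LINT w|M. h w)" for k
    unfolding f_def using rN(3)[of k] by (intro avg_expectation(2) integrable_bounded[OF h]) auto
  ultimately have ah: "a = (LINT w|M. h w)" by (simp add: LIMSEQ_const_iff prob_space)
  have "(\<lambda>k. LINT w|M. \<bar>f k w - a\<bar>) \<longlonglongrightarrow> (LINT w|M. 0)"
  proof (rule integral_dominated_convergence[where w="\<lambda>_. B + \<bar>a\<bar>"])
    show "AE w in M. (\<lambda>k. \<bar>f k w - a\<bar>) \<longlonglongrightarrow> 0"
      using a
    proof eventually_elim
      case (elim w)
      from tendsto_rabs[OF tendsto_diff[OF elim tendsto_const[of a]]] show ?case by simp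
    qed
    show "AE w in M. norm \<bar>f k w - a\<bar> \<le> B + \<bar>a\<bar>" for k
    proof (rule AE_I2)
      fix w assume "w \<in> space M"
      from fB[OF this, of k] show "norm \<bar>f k w - a\<bar> \<le> B + \<bar>a\<bar>" by simp
    qed
  qed auto
  then have "(\<lambda>k. LINT w|M. \<bar>f k w - a\<bar>) \<longlonglongrightarrow> 0" by simp
  from order_tendstoD(2)[OF this e] obtain k where "(LINT w|M. \<bar>f k w - a\<bar>) < e"
    by (auto dest: eventually_happens)
  then show ?thesis using rN(3)[of k] unfolding f_def ah by blast
qed

lemma limsup_avg:
  assumes g: "integrable M g" "\<And>w. w \<in> space M \<Longrightarrow> 0 \<le> g w" and c: "2 ^ CARD('n) * (LINT w|M. g w) < c"
  shows "AE w in M. \<forall>\<^sub>F n in sequentially. avg (real n) g w \<le> c"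
proof -
  have [measurable]: "g \<in> borel_measurable M" using g(1) by simp
  have E0: "0 \<le> (LINT w|M. g w)" using g(2) by (intro integral_nonneg_AE AE_I2)
  then have c0: "0 \<le> c" using c by (smt (verit) mult_nonneg_nonneg zero_le_power)
  have "(\<integral>\<^sup>+ w. ennreal (g w) \<partial>M) = ennreal (LINT w|M. g w)"
    by (rule nn_integral_eq_integral[OF g(1)]) (use g(2) in \<open>auto intro: AE_I2\<close>)
  from limsup_cube_integral[OF _ this E0 c]
  have "AE w in M. \<forall>\<^sub>F n in sequentially. cube_integral (real n) (\<lambda>w. ennreal (g w)) w \<le> ennreal (c * (2 * real n) ^ CARD('n))"
    by simp
  then show ?thesis using AE_orbit_int[OF g(1)] AE_space
  proof eventually_elim
    case (elim w)
    show ?case using elim(1) eventually_gt_at_top[of 0]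
    proof eventually_elim
      case (elim n)
      have "cube_integral (real n) (\<lambda>w. ennreal (g w)) w = (\<integral>\<^sup>+ y. ennreal (indicator (cube (real n)) y * g (T y w)) \<partial>lborel)"
        unfolding cube_integral_def by (intro nn_integral_cong) (auto simp: indicator_def)
      also have "\<dots> = ennreal (LINT y|lborel. indicator (cube (real n)) y * g (T y w))"
        using \<open>\<forall>r. orbit_int r g w\<close> g(2) \<open>w \<in> space M\<close>
        by (intro nn_integral_eq_integral) (auto simp: orbit_int_def)
      finally have "ennreal (LINT y|lborel. indicator (cube (real n)) y * g (T y w)) \<le> ennreal (c * (2 * real n) ^ CARD('n))"
        using elim(1) by simp
      then have "(LINT y|lborel. indicator (cube (real n)) y * g (T y w)) \<le> c * (2 * real n) ^ CARD('n)"
        using c0 by (subst (asm) ennreal_le_iff) auto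
      then show ?case using elim(2) by (simp add: avg_def pos_divide_le_eq)
    qed
  qed
qed

end

section \<open>The pointwise ergodic theorem\<close>

context ergodic_flow
begin

text \<open>At large scales \<open>h\<close> may be replaced by its average at the scale
  \<open>m j\<close>, whose deviation from the mean has small expectation. The maximal inequality
  bounds the limit superior of the averages of this deviation by
  \<open>2 ^ CARD('n) / (j + 1)\<close>.\<close>

lemma pointwise_bounded:
  assumes h: "h \<in> borel_measurable M" "\<And>w. w \<in> space M \<Longrightarrow> \<bar>h w\<bar> \<le> B"
  shows "AE w in M. (\<lambda>n. avg (real n) h w) \<longlonglongrightarrow> (LINT w|M. h w)"
proof -
  let ?d = "CARD('n)" and ?a = "LINT w|M. h w"
  have "\<forall>j. \<exists>m::nat. 0 < m \<and> (LINT w|M. \<bar>avg (real m) h w - ?a\<bar>) < 1 / (real j + 1)"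
    by (intro allI mean_ergodic[OF h]) auto
  from choice[OF this] obtain m where m: "\<And>j. 0 < m j"
    "\<And>j. (LINT w|M. \<bar>avg (real (m j)) h w - ?a\<bar>) < 1 / (real j + 1)" by blast
  define g where "g j w = \<bar>avg (real (m j)) h w - ?a\<bar>" for j w
  have gm: "g j \<in> borel_measurable M" for j
    unfolding g_def using avg_measurable[OF h(1), of "real (m j)"] by measurable
  have mB: "\<bar>avg (real (m j)) h w\<bar> \<le> B" if "w \<in> space M" for j w
    by (rule avg_abs_le[OF that h]) (use m(1) in auto)
  have gB: "\<bar>g j w\<bar> \<le> B + \<bar>?a\<bar>" if "w \<in> space M" for j w
    using mB[OF that, of j] unfolding g_def by linarith
  have "AE w in M. \<forall>\<^sub>F n in sequentially. avg (real n) (g j) w \<le> 2 ^ ?d / (real j + 1)" for j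
  proof (rule limsup_avg)
    show "integrable M (g j)" by (rule integrable_bounded[OF gm gB])
    show "2 ^ ?d * (LINT w|M. g j w) < 2 ^ ?d / (real j + 1)"
      using mult_strict_left_mono[OF m(2)[of j], of "2 ^ ?d"] by (simp add: g_def)
  qed (simp add: g_def)
  then have "AE w in M. \<forall>j. \<forall>\<^sub>F n in sequentially. avg (real n) (g j) w \<le> 2 ^ ?d / (real j + 1)"
    by (simp add: AE_all_countable)
  then show ?thesis using AE_space
  proof eventually_elim
    case (elim w)
    note wa = elim(2)
    show ?case
    proof (rule LIMSEQ_I)
      fix e :: real assume e: "0 < e"
      have "(\<lambda>j. 2 ^ ?d / (real j + 1)) \<longlonglongrightarrow> 0" by real_asymp
      from order_tendstoD(2)[OF this half_gt_zero[OF e]]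
      obtain j where j: "2 ^ ?d / (real j + 1) < e / 2" by (auto dest: eventually_happens)
      have "(\<lambda>n. B * drift (real (m j)) (real n)) \<longlonglongrightarrow> B * 0"
        by (intro tendsto_mult tendsto_const drift_tendsto_0)
      then have "(\<lambda>n. B * drift (real (m j)) (real n)) \<longlonglongrightarrow> 0" by simp
      from order_tendstoD(2)[OF this half_gt_zero[OF e]]
      have "\<forall>\<^sub>F n in sequentially. B * drift (real (m j)) (real n) < e / 2" .
      then have "\<forall>\<^sub>F n in sequentially. norm (avg (real n) h w - ?a) < e"
        using spec[OF elim(1), of j] eventually_ge_at_top[of "m j"]
      proof eventually_elim
        case (elim n)
        have n: "0 < real n" using elim(3) m(1)[of j] by linarith
        let ?s = "avg (real (m j)) h"
        have os: "orbit_int (real n) ?s w" by (rule orbit_int_bounded[OF wa avg_measurable[OF h(1)] mB])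
        have og: "orbit_int (real n) (g j) w" by (rule orbit_int_bounded[OF wa gm gB])
        have "avg (real n) ?s w \<le> avg (real n) (\<lambda>w. g j w + ?a) w"
          by (intro avg_mono n os orbit_int_add og orbit_int_const) (simp add: g_def)
        moreover have "avg (real n) (\<lambda>w. ?a - g j w) w \<le> avg (real n) ?s w"
          by (intro avg_mono n os orbit_int_diff og orbit_int_const) (simp add: g_def)
        ultimately have 1: "\<bar>avg (real n) ?s w - ?a\<bar> \<le> avg (real n) (g j) w"
          by (simp add: avg_add[OF og orbit_int_const] avg_diff[OF orbit_int_const og] avg_const[OF n] abs_le_iff)
        have 2: "\<bar>avg (real n) ?s w - avg (real n) h w\<bar> \<le> B * drift (real (m j)) (real n)"
          by (rule avg_avg_near[OF wa h]) (use m(1)[of j] elim(3) in auto)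
        have gen: "\<bar>y - a\<bar> < e" if "\<bar>x - a\<bar> \<le> p" "\<bar>x - y\<bar> \<le> q" "p \<le> s" "s < e / 2" "q < e / 2" for x y a p q s
        proof -
          have "\<bar>y - a\<bar> \<le> p + q" using that(1,2) by linarith
          also have "\<dots> < e / 2 + e / 2" using that(3-5) by (intro add_strict_mono) auto
          finally show ?thesis by simp
        qed
        show ?case using gen[OF 1 2 elim(2) j elim(1)] by simp
      qed
      then show "\<exists>no. \<forall>n\<ge>no. norm (avg (real n) h w - ?a) < e" by (simp add: eventually_sequentially)
    qed
  qed
qed

text \<open>Truncation at height \<open>j\<close>: the bounded part is covered by
  \<open>pointwise_bounded\<close>, and the limit superior of the averages of the excess is
  controlled by its expectation, which tends to 0.\<close>

lemma pointwise_nonneg: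
  assumes h: "integrable M h" "\<And>w. w \<in> space M \<Longrightarrow> 0 \<le> h w"
  shows "AE w in M. (\<lambda>n. avg (real n) h w) \<longlonglongrightarrow> (LINT w|M. h w)"
proof -
  let ?d = "CARD('n)" and ?a = "LINT w|M. h w"
  have [measurable]: "h \<in> borel_measurable M" using h(1) by simp
  define k where "k j w = min (h w) (real j)" for j :: nat and w
  define g where "g j w = h w - k j w" for j w
  have km: "k j \<in> borel_measurable M" for j unfolding k_def by measurable
  have kB: "\<bar>k j w\<bar> \<le> real j" if "w \<in> space M" for j w using h(2)[OF that] by (simp add: k_def)
  have ki: "integrable M (k j)" for j by (rule integrable_bounded[OF km kB])
  have gi: "integrable M (g j)" for j unfolding g_def using h(1) ki by auto
  have g0: "0 \<le> g j w" for j w by (simp add: g_def k_def)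
  define c where "c j = 2 ^ ?d * (LINT w|M. g j w) + 1 / (real j + 1)" for j
  have E: "(\<lambda>j. LINT w|M. g j w) \<longlonglongrightarrow> (LINT w|M. 0)"
  proof (rule integral_dominated_convergence[where w=h])
    show "AE w in M. (\<lambda>j. g j w) \<longlonglongrightarrow> 0"
    proof (rule AE_I2)
      fix w
      have "\<forall>\<^sub>F j in sequentially. g j w = 0"
        using eventually_ge_at_top[of "nat \<lceil>h w\<rceil>"]
      proof eventually_elim
        case (elim j)
        then have "h w \<le> real j" using of_nat_ceiling[of "h w"] by linarith
        then show ?case by (simp add: g_def k_def)
      qed
      then show "(\<lambda>j. g j w) \<longlonglongrightarrow> 0" by (rule tendsto_eventually)
    qed
    show "AE w in M. norm (g j w) \<le> h w" for j
      using h(2) by (intro AE_I2) (simp add: g_def k_def)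
  qed (use h(1) gi in auto)
  then have E0: "(\<lambda>j. LINT w|M. g j w) \<longlonglongrightarrow> 0" by simp
  have "(\<lambda>j. 1 / (real j + 1)) \<longlonglongrightarrow> 0" by real_asymp
  from tendsto_add[OF tendsto_add[OF tendsto_mult[OF tendsto_const[of "2 ^ ?d"] E0] this] E0]
  have c0: "(\<lambda>j. c j + (LINT w|M. g j w)) \<longlonglongrightarrow> 0" by (simp add: c_def)
  have "AE w in M. \<forall>\<^sub>F n in sequentially. avg (real n) (g j) w \<le> c j" for j
    by (rule limsup_avg[OF gi g0]) (simp add: c_def)
  then have A1: "AE w in M. \<forall>j. \<forall>\<^sub>F n in sequentially. avg (real n) (g j) w \<le> c j" by (simp add: AE_all_countable)
  have A2: "AE w in M. \<forall>j. (\<lambda>n. avg (real n) (k j) w) \<longlonglongrightarrow> (LINT w|M. k j w)"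
    unfolding AE_all_countable by (intro allI pointwise_bounded[OF km kB])
  show ?thesis using A1 A2 AE_orbit_int[OF h(1)] AE_space
  proof eventually_elim
    case (elim w)
    note wa = elim(4)
    show ?case
    proof (rule LIMSEQ_I)
      fix e :: real assume e: "0 < e"
      from order_tendstoD(2)[OF c0 half_gt_zero[OF e]]
      obtain j where j: "c j + (LINT w|M. g j w) < e / 2" by (auto dest: eventually_happens)
      have "\<forall>\<^sub>F n in sequentially. dist (avg (real n) (k j) w) (LINT w|M. k j w) < e / 2"
        using spec[OF elim(2), of j] half_gt_zero[OF e] by (rule tendstoD)
      then have "\<forall>\<^sub>F n in sequentially. norm (avg (real n) h w - ?a) < e"
        using spec[OF elim(1), of j] eventually_gt_at_top[of 0]
      proof eventually_elim
        case (elim n)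
        have n: "0 < real n" using elim(3) by simp
        have ok: "orbit_int (real n) (k j) w" by (rule orbit_int_bounded[OF wa km kB])
        have oh: "orbit_int (real n) h w" using \<open>\<forall>r. orbit_int r h w\<close> by blast
        have d: "avg (real n) (g j) w = avg (real n) h w - avg (real n) (k j) w"
          unfolding g_def by (rule avg_diff[OF oh ok])
        have og: "orbit_int (real n) (g j) w" unfolding g_def by (rule orbit_int_diff[OF oh ok])
        have "avg (real n) (\<lambda>_. 0) w \<le> avg (real n) (g j) w"
          by (intro avg_mono n og orbit_int_const g0)
        then have p: "0 \<le> avg (real n) (g j) w" by (simp add: avg_const[OF n])
        have Eg: "(LINT w|M. g j w) = ?a - (LINT w|M. k j w)" unfolding g_def using h(1) ki by simp
        have p': "0 \<le> (LINT w|M. g j w)" by (intro integral_nonneg_AE AE_I2 g0)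
        have gen: "\<bar>x - y\<bar> < e" if "\<bar>u - v\<bar> < e / 2" "x - u \<le> p" "0 \<le> x - u" "q = y - v" "0 \<le> q" "p + q < e / 2" for x y u v p q
        proof -
          have "\<bar>x - y\<bar> \<le> \<bar>u - v\<bar> + (p + q)" using that by linarith
          also have "\<dots> < e / 2 + e / 2" using that by (intro add_strict_mono) auto
          finally show ?thesis by simp
        qed
        show ?case
          using gen[OF elim(1)[unfolded dist_real_def] elim(2)[unfolded d] p[unfolded d] Eg p' j] by simp
      qed
      then show "\<exists>no. \<forall>n\<ge>no. norm (avg (real n) h w - ?a) < e" by (simp add: eventually_sequentially)
    qed
  qed
qed

lemma avg_scale_le:
  assumes rs: "0 < r" "r \<le> s" and h: "\<And>w. w \<in> space M \<Longrightarrow> 0 \<le> h w" and wa: "w \<in> space M"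
    and o: "\<And>r. orbit_int r h w"
  shows "avg r h w \<le> (s / r) ^ CARD('n) * avg s h w"
proof -
  have "(LINT y|lborel. indicat_real (cube r) y * h (T y w)) \<le> (LINT y|lborel. indicat_real (cube s) y * h (T y w))"
    using o[unfolded orbit_int_def] cube_mono[OF rs(2), where 'a='n] h[of "T _ w"] wa
    by (intro integral_mono) (auto simp: indicator_def)
  then have "avg r h w \<le> (LINT y|lborel. indicat_real (cube s) y * h (T y w)) / (2 * r) ^ CARD('n)"
    unfolding avg_def using rs by (intro divide_right_mono) auto
  also have "\<dots> = (s / r) ^ CARD('n) * avg s h w"
    unfolding avg_def using rs by (simp add: power_mult_distrib power_divide)
  finally show ?thesis .
qed

lemma ratio_power_tendsto:
  "((\<lambda>\<rho>. ((of_int \<lfloor>\<rho>\<rfloor> + 1) / \<rho>) ^ d) \<longlongrightarrow> (1::real)) at_top" "((\<lambda>\<rho>. (\<rho> / of_int \<lfloor>\<rho>\<rfloor>) ^ d) \<longlongrightarrow> (1::real)) at_top"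
proof -
  have "((\<lambda>\<rho>. (of_int \<lfloor>\<rho>\<rfloor> + 1) / \<rho>) \<longlongrightarrow> (1::real)) at_top" by real_asymp
  from tendsto_power[OF this, of d] show "((\<lambda>\<rho>. ((of_int \<lfloor>\<rho>\<rfloor> + 1) / \<rho>) ^ d) \<longlongrightarrow> (1::real)) at_top" by simp
  have "((\<lambda>\<rho>. \<rho> / of_int \<lfloor>\<rho>\<rfloor>) \<longlongrightarrow> (1::real)) at_top" by real_asymp
  from tendsto_power[OF this, of d] show "((\<lambda>\<rho>. (\<rho> / of_int \<lfloor>\<rho>\<rfloor>) ^ d) \<longlongrightarrow> (1::real)) at_top" by simp
qed

text \<open>For nonnegative functions the integral over a cube grows with the cube, so the average
  at \<rho> is squeezed between those at the two neighbouring integers, up to volume ratios tending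
  to 1.\<close>

lemma pointwise_nonneg_real:
  assumes h: "integrable M h" "\<And>w. w \<in> space M \<Longrightarrow> 0 \<le> h w"
  shows "AE w in M. ((\<lambda>\<rho>. avg \<rho> h w) \<longlongrightarrow> (LINT w|M. h w)) at_top"
proof -
  have lim: "AE w in M. (\<lambda>n. avg (real n) h w) \<longlonglongrightarrow> (LINT w|M. h w)"
    by (rule pointwise_nonneg[OF h])
  show ?thesis
  using lim AE_orbit_int[OF h(1)] AE_space
proof eventually_elim
  case (elim w)
  let ?d = "CARD('n)" and ?a = "LINT w|M. h w"
  note o = spec[OF elim(2)]
  have fl: "filterlim (\<lambda>\<rho>::real. nat \<lfloor>\<rho>\<rfloor>) sequentially at_top" by real_asymp
  have fl1: "filterlim (\<lambda>\<rho>::real. nat \<lfloor>\<rho>\<rfloor> + 1) sequentially at_top" by real_asymp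
  note lim = filterlim_compose[OF elim(1) fl] filterlim_compose[OF elim(1) fl1]
  have inv: "((\<lambda>\<rho>. inverse ((\<rho> / of_int \<lfloor>\<rho>\<rfloor>) ^ ?d)) \<longlongrightarrow> inverse (1::real)) at_top"
    by (rule tendsto_inverse[OF ratio_power_tendsto(2)]) simp
  show ?case
  proof (rule tendsto_sandwich)
    show "((\<lambda>\<rho>. inverse ((\<rho> / of_int \<lfloor>\<rho>\<rfloor>) ^ ?d) * avg (real (nat \<lfloor>\<rho>\<rfloor>)) h w) \<longlongrightarrow> ?a) at_top"
      using tendsto_mult[OF inv lim(1)] by simp
    show "((\<lambda>\<rho>. ((of_int \<lfloor>\<rho>\<rfloor> + 1) / \<rho>) ^ ?d * avg (real (nat \<lfloor>\<rho>\<rfloor> + 1)) h w) \<longlongrightarrow> ?a) at_top"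
      using tendsto_mult[OF ratio_power_tendsto(1)[of ?d] lim(2)] by simp
    show "\<forall>\<^sub>F \<rho> in at_top. inverse ((\<rho> / of_int \<lfloor>\<rho>\<rfloor>) ^ ?d) * avg (real (nat \<lfloor>\<rho>\<rfloor>)) h w \<le> avg \<rho> h w"
      using eventually_ge_at_top[of 1]
    proof eventually_elim
      case (elim \<rho>)
      have fl: "1 \<le> \<lfloor>\<rho>\<rfloor>" using elim by simp
      then have n: "real (nat \<lfloor>\<rho>\<rfloor>) = of_int \<lfloor>\<rho>\<rfloor>" by simp
      have "avg (real (nat \<lfloor>\<rho>\<rfloor>)) h w \<le> (\<rho> / real (nat \<lfloor>\<rho>\<rfloor>)) ^ ?d * avg \<rho> h w"
        by (rule avg_scale_le[OF _ _ h(2) \<open>w \<in> space M\<close> o]) (use fl n in auto)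
      then show ?case using fl elim unfolding n by (simp add: inverse_eq_divide divide_le_eq mult.commute)
    qed
    show "\<forall>\<^sub>F \<rho> in at_top. avg \<rho> h w \<le> ((of_int \<lfloor>\<rho>\<rfloor> + 1) / \<rho>) ^ ?d * avg (real (nat \<lfloor>\<rho>\<rfloor> + 1)) h w"
      using eventually_ge_at_top[of 1]
    proof eventually_elim
      case (elim \<rho>)
      have fl: "1 \<le> \<lfloor>\<rho>\<rfloor>" using elim by simp
      then have n: "real (nat \<lfloor>\<rho>\<rfloor> + 1) = of_int \<lfloor>\<rho>\<rfloor> + 1" by simp
      have le: "\<rho> \<le> real (nat \<lfloor>\<rho>\<rfloor> + 1)" unfolding n by linarith
      have "avg \<rho> h w \<le> (real (nat \<lfloor>\<rho>\<rfloor> + 1) / \<rho>) ^ ?d * avg (real (nat \<lfloor>\<rho>\<rfloor> + 1)) h w"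
        using elim by (intro avg_scale_le[OF _ le h(2) \<open>w \<in> space M\<close> o]) auto
      then show ?case unfolding n .
    qed
  qed
qed
qed

theorem pointwise_ergodic:
  assumes h: "integrable M h"
  shows "AE w in M. ((\<lambda>\<rho>. avg \<rho> h w) \<longlongrightarrow> (LINT w|M. h w)) at_top"
proof -
  define p q where "p w = max (h w) 0" and "q w = max (- h w) 0" for w
  have i: "integrable M p" "integrable M q" unfolding p_def q_def using h by auto
  have p0: "AE w in M. ((\<lambda>\<rho>. avg \<rho> p w) \<longlongrightarrow> (LINT w|M. p w)) at_top"
    by (rule pointwise_nonneg_real[OF i(1)]) (simp add: p_def)
  have q0: "AE w in M. ((\<lambda>\<rho>. avg \<rho> q w) \<longlongrightarrow> (LINT w|M. q w)) at_top"
    by (rule pointwise_nonneg_real[OF i(2)]) (simp add: q_def)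
  have e: "h w = p w - q w" for w by (simp add: p_def q_def)
  have "(LINT w|M. h w) = (LINT w|M. p w) - (LINT w|M. q w)" unfolding e using i by simp
  moreover have "AE w in M. ((\<lambda>\<rho>. avg \<rho> h w) \<longlongrightarrow> (LINT w|M. p w) - (LINT w|M. q w)) at_top"
    using p0 q0 AE_orbit_int[OF i(1)] AE_orbit_int[OF i(2)]
  proof eventually_elim
    case (elim w)
    have "avg \<rho> h w = avg \<rho> p w - avg \<rho> q w" for \<rho>
      using avg_diff[OF spec[OF elim(3)] spec[OF elim(4)], of \<rho>] by (simp add: e[abs_def])
    then show ?case using tendsto_diff[OF elim(1,2)] by simp
  qed
  ultimately show ?thesis by simp
qed

end

section \<open>Potential fields\<close>

text \<open>Between a compact \<open>K\<close> and an open \<open>U\<close> around \<open>S\<close>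
  with small difference there is room for short shifts. If exactly one of \<open>y\<close> and
  \<open>z + y\<close> lies in \<open>S\<close>, one of them lies in \<open>U - K\<close>, since a
  short shift moves a point of \<open>K\<close> into \<open>U\<close>.\<close>

lemma translation_continuous_indicator:
  fixes S :: "'a::euclidean_space set"
  assumes S: "S \<in> sets borel" "bounded S" and e: "0 < e"
  shows "\<exists>d>0. \<forall>z. norm z < d \<longrightarrow> (LINT y|lborel. \<bar>indicat_real S (z + y) - indicator S y\<bar>) \<le> e"
proof -
  have Sl: "S \<in> sets lebesgue" using S(1) by simp
  obtain K where K: "closed K" "K \<subseteq> S" "S - K \<in> lmeasurable" "emeasure lebesgue (S - K) < ennreal (e / 4)"
    using sets_lebesgue_inner_closed[OF Sl, of "e / 4"] e by auto
  obtain U where U: "open U" "S \<subseteq> U" "U - S \<in> lmeasurable" "emeasure lebesgue (U - S) < ennreal (e / 4)"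
    using sets_lebesgue_outer_open[OF Sl, of "e / 4"] e by auto
  have "compact K" using K(1) bounded_subset[OF S(2) K(2)] by (simp add: compact_eq_bounded_closed)
  from compact_subset_open_imp_ball_epsilon_subset[OF this U(1)] K(2) U(2)
  obtain d where d: "0 < d" "(\<Union>x\<in>K. ball x d) \<subseteq> U" by blast
  have near: "y \<in> U" if "x \<in> K" "norm (y - x) < d" for x y
    using d(2) that by (force simp: dist_norm norm_minus_commute)
  have [measurable]: "K \<in> sets borel" "U \<in> sets borel" "S \<in> sets borel" using K(1) U(1) S(1) by auto
  have UK: "U - K = (U - S) \<union> (S - K)" using K(2) U(2) by auto
  have eU: "emeasure lborel (U - K) \<le> ennreal (e / 2)"
  proof -
    have "emeasure lborel (U - K) \<le> emeasure lborel (U - S) + emeasure lborel (S - K)"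
      unfolding UK by (rule emeasure_subadditive) auto
    also have "\<dots> \<le> ennreal (e / 4) + ennreal (e / 4)"
      using K(4) U(4) by (intro add_mono) (auto simp: less_imp_le)
    also have "\<dots> = ennreal (e / 2)" using e by (simp flip: ennreal_plus)
    finally show ?thesis .
  qed
  then have "emeasure lborel (U - K) < \<infinity>" by (rule order.strict_trans1) simp
  then have I: "integrable lborel (indicat_real (U - K))" by (intro integrable_real_indicator) auto
  have Iz: "integrable lborel (\<lambda>y. indicat_real (U - K) (z + y))" for z
    using I by (simp add: lborel_integrable_translation)
  have m: "(LINT y|lborel. indicat_real (U - K) y) \<le> e / 2"
  proof -
    have "enn2real (emeasure lborel (U - K)) \<le> e / 2" by (rule enn2real_leI) (use eU e in auto)
    then show ?thesis by (simp add: measure_def)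
  qed
  have mz: "(LINT y|lborel. indicat_real (U - K) (z + y)) \<le> e / 2" for z
    using m by (subst lborel_integral_translation) auto
  show ?thesis
  proof (intro exI[of _ d] conjI allI impI d(1))
    fix z :: 'a assume z: "norm z < d"
    have "(LINT y|lborel. \<bar>indicat_real S (z + y) - indicator S y\<bar>) \<le>
        (LINT y|lborel. indicat_real (U - K) (z + y) + indicat_real (U - K) y)"
    proof (rule integral_mono_AE)
      show "integrable lborel (\<lambda>y. indicat_real (U - K) (z + y) + indicat_real (U - K) y)" using I Iz by auto
      have pw: "\<bar>indicat_real S (z + y) - indicator S y\<bar> \<le> indicat_real (U - K) (z + y) + indicat_real (U - K) y" for y
        using near[of y "z + y"] near[of "z + y" y] z K(2) U(2) by (auto simp: indicator_def)
      then show "AE y in lborel. \<bar>indicat_real S (z + y) - indicator S y\<bar> \<le> indicat_real (U - K) (z + y) + indicat_real (U - K) y"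
        by simp
      show "integrable lborel (\<lambda>y. \<bar>indicat_real S (z + y) - indicator S y\<bar>)"
        by (rule Bochner_Integration.integrable_bound[OF Bochner_Integration.integrable_add[OF Iz[of z] I]])
          (use pw in \<open>auto intro!: AE_I2 simp: order_trans[OF _ abs_ge_self]\<close>)
    qed
    also have "\<dots> = (LINT y|lborel. indicat_real (U - K) (z + y)) + (LINT y|lborel. indicat_real (U - K) y)"
      using I Iz by (intro Bochner_Integration.integral_add)
    also have "\<dots> \<le> e / 2 + e / 2" by (rule add_mono[OF mz m])
    finally show "(LINT y|lborel. \<bar>indicat_real S (z + y) - indicator S y\<bar>) \<le> e" by simp
  qed
qed

section \<open>Continuity of the shifts in L2\<close>

context flow
begin

lemma L2_T: "f \<in> L2 M \<Longrightarrow> (\<lambda>w. f (T z w)) \<in> L2 M"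
  by (auto simp: L2_def intro: integrable_T measurable_compose[OF T_measurable1])

lemma L2_nrm_T:
  assumes f: "f \<in> L2 M" shows "L2_nrm M (\<lambda>w. f (T z w)) = L2_nrm M f"
proof -
  have [measurable]: "f \<in> borel_measurable M" by (rule L2_measurable[OF f])
  have "(\<lambda>w. (norm (f w))\<^sup>2) \<in> borel_measurable M" by measurable
  from integral_T[OF this, of z] show ?thesis by (simp add: L2_nrm_def)
qed

text \<open>Joint measurability of the flow yields continuity: by invariance the integral over
  \<open>M\<close> equals, up to the volume \<open>2 ^ CARD('n)\<close> of \<open>cube 1\<close>,
  the mean of integrals along orbits, and on a single orbit Lebesgue translation continuity
  applies.\<close>

lemma shift_continuous_indicator:
  assumes A[measurable]: "A \<in> sets M"
  shows "((\<lambda>z. LINT w|M. \<bar>indicat_real A (T z w) - indicator A w\<bar>) \<longlongrightarrow> 0) (at 0)"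
  unfolding tendsto_at_iff_sequentially comp_def
proof (intro allI impI)
  fix X :: "nat \<Rightarrow> real ^ 'n" assume X: "X \<longlonglongrightarrow> 0"
  define D where "D z w = (LINT y|lborel. indicator (cube 1) y * \<bar>indicat_real A (T (z + y) w) - indicator A (T y w)\<bar>)"
    for z w
  have Dm: "D z \<in> borel_measurable M" for z unfolding D_def by measurable
  have DE: "(LINT w|M. D z w) = 2 ^ CARD('n) * (LINT w|M. \<bar>indicat_real A (T z w) - indicator A w\<bar>)" for z
  proof -
    have "integrable M (\<lambda>w. \<bar>indicat_real A (T z w) - indicator A w\<bar>)"
      by (rule integrable_bounded[where B=1]) (auto simp: indicator_def)
    from orbit_integrable(4)[OF this integrable_indicator_cube[of 1]]
    have "(LINT w|M. LINT y|lborel. indicator (cube 1) y * \<bar>indicat_real A (T z (T y w)) - indicator A (T y w)\<bar>) =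
        2 ^ CARD('n) * (LINT w|M. \<bar>indicat_real A (T z w) - indicator A w\<bar>)"
      using integral_indicator_cube[of 1] by simp
    moreover have "(LINT w|M. D z w) = (LINT w|M. LINT y|lborel. indicator (cube 1) y * \<bar>indicat_real A (T z (T y w)) - indicator A (T y w)\<bar>)"
      unfolding D_def by (intro Bochner_Integration.integral_cong refl) (simp add: T_add)
    ultimately show ?thesis by simp
  qed
  have Dint: "integrable lborel (\<lambda>y. indicator (cube 1) y * \<bar>indicat_real A (T (z + y) w) - indicator A (T y w)\<bar>)"
    if wa: "w \<in> space M" for z w
  proof (rule Bochner_Integration.integrable_bound[OF integrable_indicator_cube[of 1]])
    have [measurable]: "(\<lambda>y. T (z + y) w) \<in> measurable borel M" "(\<lambda>y. T y w) \<in> measurable borel M"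
      using wa by (auto intro: T_measurable_Pair)
    show "(\<lambda>y. indicator (cube 1) y * \<bar>indicat_real A (T (z + y) w) - indicator A (T y w)\<bar>) \<in> borel_measurable lborel"
      by measurable
  qed (auto simp: indicator_def)
  have Dlim: "(\<lambda>n. D (X n) w) \<longlonglongrightarrow> 0" if wa: "w \<in> space M" for w
  proof (rule LIMSEQ_I)
    fix e :: real assume e: "0 < e"
    \<comment> \<open>The trace of \<open>A\<close> on the orbit, cut to \<open>cube 2\<close>:
      shifts of size below 1 keep \<open>cube 1\<close> inside, and the trace becomes
      bounded.\<close>
    define S where "S = {y. T y w \<in> A} \<inter> cube 2"
    have "{y. T y w \<in> A} = (\<lambda>y. T y w) -` A \<inter> space borel" by auto
    then have S: "S \<in> sets borel" "bounded S"
      unfolding S_def using measurable_sets[OF orbit_measurable[OF wa] A] bounded_subset[OF bounded_cube, of _ 2] by auto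
    obtain d where d: "0 < d" "\<And>z. norm z < d \<Longrightarrow> (LINT y|lborel. \<bar>indicat_real S (z + y) - indicator S y\<bar>) \<le> e / 2"
      using translation_continuous_indicator[OF S half_gt_zero[OF e]] by blast
    have "0 < min d 1" using d(1) by simp
    from LIMSEQ_D[OF X this] obtain n0 where n0: "\<And>n. n0 \<le> n \<Longrightarrow> norm (X n) < min d 1" by auto
    have bd: "D z w \<le> e / 2" if z: "norm z < min d 1" for z
    proof -
      have "D z w \<le> (LINT y|lborel. \<bar>indicat_real S (z + y) - indicator S y\<bar>)"
        unfolding D_def
      proof (rule integral_mono[OF Dint[OF wa]])
        have IS: "integrable lborel (indicat_real S)"
          using S by (intro integrable_real_indicator emeasure_bounded_finite) auto
        moreover have "integrable lborel (\<lambda>y. indicat_real S (z + y))"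
          using IS S(1) by (subst lborel_integrable_translation) auto
        ultimately show "integrable lborel (\<lambda>y. \<bar>indicat_real S (z + y) - indicator S y\<bar>)" by auto
        fix y :: "real ^ 'n"
        have "y \<in> cube 2 \<and> z + y \<in> cube 2" if y: "y \<in> cube 1"
        proof -
          have "\<bar>y $ i\<bar> < 2 \<and> \<bar>(z + y) $ i\<bar> < 2" for i
          proof -
            have "\<bar>y $ i\<bar> < 1" using y by (simp add: mem_cube)
            moreover have "\<bar>z $ i\<bar> < 1" using component_le_norm_cart[of z i] z by linarith
            ultimately show ?thesis by simp
          qed
          then show ?thesis by (simp add: mem_cube)
        qed
        then show "indicator (cube 1) y * \<bar>indicat_real A (T (z + y) w) - indicator A (T y w)\<bar> \<le> \<bar>indicat_real S (z + y) - indicator S y\<bar>"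
          by (auto simp: S_def indicator_def)
      qed
      also have "\<dots> \<le> e / 2" using d(2) z by simp
      finally show ?thesis .
    qed
    have D0: "0 \<le> D z w" for z unfolding D_def by (intro integral_nonneg_AE AE_I2) simp
    have "norm (D (X n) w - 0) < e" if "n0 \<le> n" for n
    proof -
      have "D (X n) w \<le> e / 2" by (rule bd[OF n0[OF that]])
      also have "\<dots> < e" using e by simp
      finally show ?thesis using D0[of "X n"] by simp
    qed
    then show "\<exists>no. \<forall>n\<ge>no. norm (D (X n) w - 0) < e" by blast
  qed
  have Dle: "\<bar>D z w\<bar> \<le> 2 ^ CARD('n)" if wa: "w \<in> space M" for z w
  proof -
    have "\<bar>D z w\<bar> \<le> (LINT y|lborel. \<bar>indicator (cube 1) y * \<bar>indicat_real A (T (z + y) w) - indicator A (T y w)\<bar>\<bar>)"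
      unfolding D_def by (rule integral_abs_bound)
    also have "\<dots> \<le> (LINT y|lborel. indicat_real (cube 1 :: (real ^ 'n) set) y)"
      by (intro integral_mono integrable_abs Dint[OF wa] integrable_indicator_cube) (auto simp: indicator_def)
    finally show ?thesis using integral_indicator_cube[of 1] by simp
  qed
  have "(\<lambda>n. LINT w|M. D (X n) w) \<longlonglongrightarrow> (LINT w|M. 0)"
    by (rule integral_dominated_convergence[where w="\<lambda>_. 2 ^ CARD('n)"])
      (use Dm Dlim Dle in \<open>auto intro!: AE_I2\<close>)
  then have "(\<lambda>n. 2 ^ CARD('n) * (LINT w|M. \<bar>indicat_real A (T (X n) w) - indicator A w\<bar>)) \<longlonglongrightarrow> 0"
    unfolding DE by simp
  from tendsto_mult[OF tendsto_const[of "1 / 2 ^ CARD('n)"] this]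
  show "(\<lambda>n. LINT w|M. \<bar>indicat_real A (T (X n) w) - indicator A w\<bar>) \<longlonglongrightarrow> 0" by simp
qed

text \<open>Shifts are isometries, so the modulus of continuity is stable under approximation in L2,
  and the claim reduces to indicators.\<close>

lemma shift_continuous:
  fixes f :: "'w \<Rightarrow> 'b::euclidean_space"
  assumes "f \<in> L2 M"
  shows "((\<lambda>z. L2_nrm M (\<lambda>w. f (T z w) - f w)) \<longlongrightarrow> 0) (at 0)"
  using assms
proof (induction rule: L2_induct)
  case (indicator A c)
  have eq: "L2_nrm M (\<lambda>w. indicator A (T z w) *\<^sub>R c - indicator A w *\<^sub>R c) =
      norm c * sqrt (LINT w|M. \<bar>indicat_real A (T z w) - indicator A w\<bar>)" for z
  proof -
    have "(LINT w|M. (norm (indicator A (T z w) *\<^sub>R c - indicator A w *\<^sub>R c))\<^sup>2) =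
        (LINT w|M. (norm c)\<^sup>2 * \<bar>indicat_real A (T z w) - indicator A w\<bar>)"
      by (intro Bochner_Integration.integral_cong refl) (auto simp: indicator_def)
    then show ?thesis by (simp add: L2_nrm_def real_sqrt_mult)
  qed
  have "((\<lambda>z. norm c * sqrt (LINT w|M. \<bar>indicat_real A (T z w) - indicator A w\<bar>)) \<longlongrightarrow> norm c * sqrt 0) (at 0)"
    by (intro tendsto_mult tendsto_const tendsto_real_sqrt shift_continuous_indicator indicator)
  then show ?case unfolding eq by simp
next
  case (add f g)
  have "((\<lambda>z. L2_nrm M (\<lambda>w. f (T z w) - f w) + L2_nrm M (\<lambda>w. g (T z w) - g w)) \<longlongrightarrow> 0 + 0) (at 0)"
    by (intro tendsto_add add)
  then have lim: "((\<lambda>z. L2_nrm M (\<lambda>w. f (T z w) - f w) + L2_nrm M (\<lambda>w. g (T z w) - g w)) \<longlongrightarrow> 0) (at 0)" by simp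
  show ?case
  proof (rule Lim_null_comparison[OF always_eventually lim], intro allI)
    fix z
    have "L2_nrm M (\<lambda>w. (f (T z w) - f w) + (g (T z w) - g w)) \<le>
        L2_nrm M (\<lambda>w. f (T z w) - f w) + L2_nrm M (\<lambda>w. g (T z w) - g w)"
      by (intro L2_triangle L2_diff L2_T add)
    then show "norm (L2_nrm M (\<lambda>w. f (T z w) + g (T z w) - (f w + g w))) \<le>
        L2_nrm M (\<lambda>w. f (T z w) - f w) + L2_nrm M (\<lambda>w. g (T z w) - g w)"
      by (simp add: algebra_simps)
  qed
next
  case (approx f)
  show ?case
  proof (rule tendstoI)
    fix e :: real assume e: "0 < e"
    then have e4: "0 < e / 4" by simp
    from approx(2)[OF e4] obtain s where s: "s \<in> L2 M" "((\<lambda>z. L2_nrm M (\<lambda>w. s (T z w) - s w)) \<longlongrightarrow> 0) (at 0)"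
      "L2_nrm M (\<lambda>w. f w - s w) < e / 4" by blast
    show "\<forall>\<^sub>F z in at 0. dist (L2_nrm M (\<lambda>w. f (T z w) - f w)) 0 < e"
      using order_tendstoD(2)[OF s(2) e4]
    proof eventually_elim
      case (elim z)
      let ?d = "\<lambda>w. f w - s w"
      have d: "?d \<in> L2 M" by (intro L2_diff approx(1) s(1))
      have "L2_nrm M (\<lambda>w. ?d (T z w) + ((s (T z w) - s w) + - ?d w)) \<le>
          L2_nrm M (\<lambda>w. ?d (T z w)) + L2_nrm M (\<lambda>w. (s (T z w) - s w) + - ?d w)"
        by (intro L2_triangle L2_add L2_uminus L2_T[OF d] d L2_diff L2_T[OF s(1)] s(1))
      moreover have "L2_nrm M (\<lambda>w. (s (T z w) - s w) + - ?d w) \<le> L2_nrm M (\<lambda>w. s (T z w) - s w) + L2_nrm M (\<lambda>w. - ?d w)"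
        by (intro L2_triangle L2_uminus d L2_diff L2_T[OF s(1)] s(1))
      moreover have "L2_nrm M (\<lambda>w. ?d (T z w)) = L2_nrm M ?d" "L2_nrm M (\<lambda>w. - ?d w) = L2_nrm M ?d"
        using L2_nrm_T[OF d] by (simp_all only: L2_nrm_uminus)
      moreover have "(\<lambda>w. ?d (T z w) + ((s (T z w) - s w) + - ?d w)) = (\<lambda>w. f (T z w) - f w)" by auto
      ultimately have "L2_nrm M (\<lambda>w. f (T z w) - f w) \<le> L2_nrm M ?d + (L2_nrm M (\<lambda>w. s (T z w) - s w) + L2_nrm M ?d)"
        by simp
      also have "\<dots> < e / 4 + (e / 4 + e / 4)" using elim s(3) by (intro add_strict_mono)
      finally have "L2_nrm M (\<lambda>w. f (T z w) - f w) < e" using e by simp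
      then show ?case by simp
    qed
  qed
qed

end

text \<open>Cauchy-Schwarz for the splitting of \<open>\<kappa> * u\<close> into
  \<open>sqrt \<bar>\<kappa>\<bar>\<close> and \<open>sqrt \<bar>\<kappa>\<bar> * u\<close>, up to
  sign. Extended values include the case of a divergent right-hand side, so that the inequality can
  be integrated over all points before integrability is known.\<close>

lemma weighted_integral_sq_le:
  fixes \<kappa> u :: "'a \<Rightarrow> real"
  assumes k: "integrable M \<kappa>" and u[measurable]: "u \<in> borel_measurable M"
  shows "ennreal ((LINT z|M. \<kappa> z * u z)\<^sup>2) \<le> ennreal (LINT z|M. \<bar>\<kappa> z\<bar>) * (\<integral>\<^sup>+ z. ennreal (\<bar>\<kappa> z\<bar> * (u z)\<^sup>2) \<partial>M)"
proof (cases "integrable M (\<lambda>z. \<bar>\<kappa> z\<bar> * (u z)\<^sup>2)")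
  case True
  have [measurable]: "\<kappa> \<in> borel_measurable M" using k by simp
  define f where "f z = sqrt \<bar>\<kappa> z\<bar>" for z
  define g where "g z = sqrt \<bar>\<kappa> z\<bar> * u z" for z
  have f: "f \<in> L2 M" using k by (intro L2_I) (auto simp: f_def[abs_def])
  have g: "g \<in> L2 M" using True by (intro L2_I) (auto simp: g_def[abs_def] power_mult_distrib)
  have fg: "norm (f z) * norm (g z) = \<bar>\<kappa> z * u z\<bar>" for z
    by (simp add: f_def g_def abs_mult flip: mult.assoc)
  have "\<bar>LINT z|M. \<kappa> z * u z\<bar> \<le> (LINT z|M. norm (f z) * norm (g z))"
    unfolding fg by (rule integral_abs_bound)
  also have "\<dots> \<le> L2_nrm M f * L2_nrm M g" by (rule L2_Cauchy_Schwarz_norm[OF f g])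
  finally have "\<bar>LINT z|M. \<kappa> z * u z\<bar>\<^sup>2 \<le> (L2_nrm M f * L2_nrm M g)\<^sup>2" by (rule power_mono) simp
  also have "\<dots> = (LINT z|M. \<bar>\<kappa> z\<bar>) * (LINT z|M. \<bar>\<kappa> z\<bar> * (u z)\<^sup>2)"
    unfolding power_mult_distrib L2_nrm_sq by (simp add: f_def g_def power_mult_distrib)
  finally have "ennreal ((LINT z|M. \<kappa> z * u z)\<^sup>2) \<le> ennreal ((LINT z|M. \<bar>\<kappa> z\<bar>) * (LINT z|M. \<bar>\<kappa> z\<bar> * (u z)\<^sup>2))"
    by (intro ennreal_leI) simp
  also have "\<dots> = ennreal (LINT z|M. \<bar>\<kappa> z\<bar>) * ennreal (LINT z|M. \<bar>\<kappa> z\<bar> * (u z)\<^sup>2)"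
    by (rule ennreal_mult) (auto intro!: integral_nonneg_AE)
  also have "ennreal (LINT z|M. \<bar>\<kappa> z\<bar> * (u z)\<^sup>2) = (\<integral>\<^sup>+ z. ennreal (\<bar>\<kappa> z\<bar> * (u z)\<^sup>2) \<partial>M)"
    by (rule nn_integral_eq_integral[symmetric, OF True]) simp
  finally show ?thesis .
next
  case False
  have [measurable]: "\<kappa> \<in> borel_measurable M" using k by simp
  have top: "(\<integral>\<^sup>+ z. ennreal (\<bar>\<kappa> z\<bar> * (u z)\<^sup>2) \<partial>M) = \<infinity>"
  proof (rule ccontr)
    assume "\<not> ?thesis"
    then have "integrable M (\<lambda>z. \<bar>\<kappa> z\<bar> * (u z)\<^sup>2)"
      by (intro integrableI_nonneg) (auto simp: top.not_eq_extremum)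
    with False show False by simp
  qed
  \<comment> \<open>If the total weight were 0, then \<open>\<kappa>\<close> would vanish almost
    everywhere and the second factor could not be infinite; this excludes the product of 0 and
    infinity.\<close>
  have nz: "(LINT z|M. \<bar>\<kappa> z\<bar>) \<noteq> 0"
  proof
    assume "(LINT z|M. \<bar>\<kappa> z\<bar>) = 0"
    then have "AE z in M. \<kappa> z = 0"
      using integral_nonneg_eq_0_iff_AE[of M "\<lambda>z. \<bar>\<kappa> z\<bar>"] k by simp
    then have "AE z in M. \<bar>\<kappa> z\<bar> * (u z)\<^sup>2 = 0" by eventually_elim simp
    then have "(\<integral>\<^sup>+ z. ennreal (\<bar>\<kappa> z\<bar> * (u z)\<^sup>2) \<partial>M) = 0"
      by (subst nn_integral_0_iff_AE) auto
    with top show False by simp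
  qed
  have "0 \<le> (LINT z|M. \<bar>\<kappa> z\<bar>)" by (intro integral_nonneg_AE) simp
  with nz have "0 < (LINT z|M. \<bar>\<kappa> z\<bar>)" by (simp add: less_le)
  then have "ennreal (LINT z|M. \<bar>\<kappa> z\<bar>) \<noteq> 0" by (simp add: ennreal_eq_0_iff not_le)
  then show ?thesis unfolding top by (simp add: ennreal_mult_top)
qed

section \<open>Mollification along orbits\<close>

context flow
begin

text \<open>Minkowski's integral inequality for a family with norms at most \<open>c\<close>
  wherever the weight is nonzero, from Cauchy-Schwarz in \<open>z\<close> and Tonelli.\<close>

lemma weighted_orbit_L2_le:
  fixes u :: "real ^ 'n \<Rightarrow> 'w \<Rightarrow> real"
  assumes k: "integrable lborel \<kappa>"
    and u[measurable]: "(\<lambda>(z, w). u z w) \<in> borel_measurable (borel \<Otimes>\<^sub>M M)"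
    and le: "\<And>z. \<kappa> z \<noteq> 0 \<Longrightarrow> (\<integral>\<^sup>+ w. ennreal ((u z w)\<^sup>2) \<partial>M) \<le> ennreal (c\<^sup>2)"
  shows "(\<lambda>w. LINT z|lborel. \<kappa> z * u z w) \<in> L2 M"
    and "0 \<le> c \<Longrightarrow> L2_nrm M (\<lambda>w. LINT z|lborel. \<kappa> z * u z w) \<le> (LINT z|lborel. \<bar>\<kappa> z\<bar>) * c"
proof -
  have [measurable]: "\<kappa> \<in> borel_measurable borel" using k by auto
  let ?K = "LINT z|lborel. \<bar>\<kappa> z\<bar>"
  define F where "F w = (LINT z|lborel. \<kappa> z * u z w)" for w
  have Fm[measurable]: "F \<in> borel_measurable M" unfolding F_def by measurable
  have K0: "0 \<le> ?K" by (intro integral_nonneg_AE) simp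
  have "(\<integral>\<^sup>+ w. ennreal ((F w)\<^sup>2) \<partial>M) \<le> (\<integral>\<^sup>+ w. ennreal ?K * (\<integral>\<^sup>+ z. ennreal (\<bar>\<kappa> z\<bar> * (u z w)\<^sup>2) \<partial>lborel) \<partial>M)"
    unfolding F_def
  proof (intro nn_integral_mono weighted_integral_sq_le k)
    fix w assume "w \<in> space M"
    from measurable_compose[OF measurable_Pair2'[OF this] u] show "(\<lambda>z. u z w) \<in> borel_measurable lborel" by simp
  qed
  also have "\<dots> = ennreal ?K * (\<integral>\<^sup>+ w. (\<integral>\<^sup>+ z. ennreal (\<bar>\<kappa> z\<bar> * (u z w)\<^sup>2) \<partial>lborel) \<partial>M)"
    by (rule nn_integral_cmult) measurable
  finally have A: "(\<integral>\<^sup>+ w. ennreal ((F w)\<^sup>2) \<partial>M) \<le>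
      ennreal ?K * (\<integral>\<^sup>+ w. (\<integral>\<^sup>+ z. ennreal (\<bar>\<kappa> z\<bar> * (u z w)\<^sup>2) \<partial>lborel) \<partial>M)" .
  have "(\<integral>\<^sup>+ w. (\<integral>\<^sup>+ z. ennreal (\<bar>\<kappa> z\<bar> * (u z w)\<^sup>2) \<partial>lborel) \<partial>M) = (\<integral>\<^sup>+ z. (\<integral>\<^sup>+ w. ennreal (\<bar>\<kappa> z\<bar> * (u z w)\<^sup>2) \<partial>M) \<partial>lborel)"
    by (rule lebesgue_M.Fubini') measurable
  also have "\<dots> \<le> (\<integral>\<^sup>+ z. ennreal \<bar>\<kappa> z\<bar> * ennreal (c\<^sup>2) \<partial>lborel)"
  proof (rule nn_integral_mono)
    fix z
    have [measurable]: "u z \<in> borel_measurable M"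
      using measurable_compose[OF measurable_Pair1'[of z borel M] u] by simp
    have "(\<integral>\<^sup>+ w. ennreal (\<bar>\<kappa> z\<bar> * (u z w)\<^sup>2) \<partial>M) = ennreal \<bar>\<kappa> z\<bar> * (\<integral>\<^sup>+ w. ennreal ((u z w)\<^sup>2) \<partial>M)"
      by (subst nn_integral_cmult[symmetric]) (auto simp: ennreal_mult)
    also have "\<dots> \<le> ennreal \<bar>\<kappa> z\<bar> * ennreal (c\<^sup>2)"
      using le[of z] by (cases "\<kappa> z = 0") (auto intro: mult_left_mono)
    finally show "(\<integral>\<^sup>+ w. ennreal (\<bar>\<kappa> z\<bar> * (u z w)\<^sup>2) \<partial>M) \<le> ennreal \<bar>\<kappa> z\<bar> * ennreal (c\<^sup>2)" .
  qed
  also have "\<dots> = (\<integral>\<^sup>+ z. ennreal \<bar>\<kappa> z\<bar> \<partial>lborel) * ennreal (c\<^sup>2)"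
    by (rule nn_integral_multc) measurable
  also have "(\<integral>\<^sup>+ z. ennreal \<bar>\<kappa> z\<bar> \<partial>lborel) = ennreal ?K"
    using k by (intro nn_integral_eq_integral) auto
  finally have B: "(\<integral>\<^sup>+ w. (\<integral>\<^sup>+ z. ennreal (\<bar>\<kappa> z\<bar> * (u z w)\<^sup>2) \<partial>lborel) \<partial>M) \<le> ennreal ?K * ennreal (c\<^sup>2)" .
  have "ennreal ?K * (ennreal ?K * ennreal (c\<^sup>2)) = ennreal (?K * (?K * c\<^sup>2))"
    using K0 by (simp add: ennreal_mult)
  also have "?K * (?K * c\<^sup>2) = (?K * c)\<^sup>2" by (simp add: power2_eq_square mult_ac)
  finally have C: "ennreal ?K * (ennreal ?K * ennreal (c\<^sup>2)) = ennreal ((?K * c)\<^sup>2)" .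
  have main: "(\<integral>\<^sup>+ w. ennreal ((F w)\<^sup>2) \<partial>M) \<le> ennreal ((?K * c)\<^sup>2)"
    using order_trans[OF A mult_left_mono[OF B]] unfolding C by simp
  then have I: "integrable M (\<lambda>w. (F w)\<^sup>2)"
    by (intro integrableI_nonneg) (auto intro: le_less_trans)
  then show "F \<in> L2 M" by (intro L2_I) auto
  assume c: "0 \<le> c"
  have "ennreal (LINT w|M. (F w)\<^sup>2) \<le> ennreal ((?K * c)\<^sup>2)"
    using main nn_integral_eq_integral[OF I] by simp
  then have "(LINT w|M. (F w)\<^sup>2) \<le> (?K * c)\<^sup>2" by (subst (asm) ennreal_le_iff) auto
  then show "L2_nrm M F \<le> ?K * c" using c K0 by (intro L2_nrm_leI) auto
qed

text \<open>Mollification of a function on the probability space itself: the value at the origin of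
  the mollified realisation. By \<open>orbit_corr_T\<close> its own realisations are the
  correlations of those of \<open>h\<close>, hence smooth on almost every orbit when
  \<open>\<kappa>\<close> is a test function and \<open>h\<close> is integrable.\<close>

definition orbit_corr :: "(real ^ 'n \<Rightarrow> real) \<Rightarrow> ('w \<Rightarrow> real) \<Rightarrow> 'w \<Rightarrow> real" where
  "orbit_corr \<kappa> h w = (LINT z|lborel. \<kappa> z * h (T z w))"

lemma orbit_corr_T:
  assumes "w \<in> space M" "h \<in> borel_measurable M" "\<kappa> \<in> borel_measurable borel"
  shows "orbit_corr \<kappa> h (T y w) = corr \<kappa> (\<lambda>z. h (T z w)) y"
proof -
  have [measurable]: "(\<lambda>z. h (T z w)) \<in> borel_measurable borel" by (rule orbit_borel_measurable[OF assms(1,2)])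
  note [measurable] = assms(3)
  have "corr \<kappa> (\<lambda>z. h (T z w)) y = (LINT z|lborel. \<kappa> (y + z - y) * h (T (y + z) w))"
    unfolding corr_def by (rule lborel_integral_translation[symmetric]) measurable
  then show ?thesis by (simp add: orbit_corr_def T_add[OF assms(1), symmetric] add.commute)
qed

lemma AE_locally_integrable:
  fixes h :: "'w \<Rightarrow> real"
  assumes h: "integrable M h"
  shows "AE w in M. locally_integrable (\<lambda>z. h (T z w))"
  using AE_orbit_int[OF h] AE_space
proof eventually_elim
  case (elim w)
  have m[measurable]: "(\<lambda>z. h (T z w)) \<in> borel_measurable borel"
    using h by (intro orbit_borel_measurable[OF elim(2)]) auto
  have "integrable lborel (\<lambda>z. indicator (cball 0 R) z *\<^sub>R h (T z w))" for R
  proof (rule Bochner_Integration.integrable_bound)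
    show "integrable lborel (\<lambda>y. indicator (cube (R + 1)) y * h (T y w))"
      using elim(1) by (simp add: orbit_int_def)
    have "y \<in> cube (R + 1)" if "norm y \<le> R" for y :: "real ^ 'n"
    proof -
      have "\<bar>y $ i\<bar> < R + 1" for i using component_le_norm_cart[of y i] that by linarith
      then show ?thesis by (simp add: mem_cube)
    qed
    then show "AE z in lborel. norm (indicator (cball 0 R) z *\<^sub>R h (T z w)) \<le> norm (indicator (cube (R + 1)) z * h (T z w))"
      by (intro AE_I2) (auto simp: indicator_def)
    show "(\<lambda>z. indicator (cball 0 R) z *\<^sub>R h (T z w)) \<in> borel_measurable lborel"
      using m by (intro borel_measurable_scaleR borel_measurable_indicator) auto
  qed
  with m show ?case by (simp add: locally_integrable_def)
qed

lemma orbit_corr_L2: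
  assumes k: "integrable lborel \<kappa>" and h: "h \<in> L2 M"
  shows "orbit_corr \<kappa> h \<in> L2 M"
proof -
  have hm[measurable]: "h \<in> borel_measurable M" by (rule L2_measurable[OF h])
  have "(\<integral>\<^sup>+ w. ennreal ((h (T z w))\<^sup>2) \<partial>M) \<le> ennreal ((L2_nrm M h)\<^sup>2)" for z
    using nn_integral_T[of "\<lambda>w. ennreal ((h w)\<^sup>2)" z] nn_integral_eq_integral[OF L2_integrable_sq[OF h]]
    by (simp add: L2_nrm_sq)
  then show ?thesis
    unfolding orbit_corr_def by (intro weighted_orbit_L2_le(1)[OF k, where c="L2_nrm M h"]) measurable
qed

lemma mollifier_L2_le:
  assumes k: "integrable lborel \<kappa>" "(LINT z|lborel. \<bar>\<kappa> z\<bar>) = 1" "(LINT z|lborel. \<kappa> z) = 1"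
    and h: "h \<in> L2 M" and c: "0 \<le> c" "\<And>z. \<kappa> z \<noteq> 0 \<Longrightarrow> L2_nrm M (\<lambda>w. h (T z w) - h w) \<le> c"
  shows "L2_nrm M (\<lambda>w. orbit_corr \<kappa> h w - h w) \<le> c"
proof -
  have hm[measurable]: "h \<in> borel_measurable M" by (rule L2_measurable[OF h])
  have [measurable]: "\<kappa> \<in> borel_measurable borel" using k by auto
  have nn: "(\<integral>\<^sup>+ w. ennreal ((h (T z w) - h w)\<^sup>2) \<partial>M) \<le> ennreal (c\<^sup>2)" if "\<kappa> z \<noteq> 0" for z
  proof -
    have d: "(\<lambda>w. h (T z w) - h w) \<in> L2 M" by (intro L2_diff L2_T h)
    have "(\<integral>\<^sup>+ w. ennreal ((h (T z w) - h w)\<^sup>2) \<partial>M) = ennreal ((L2_nrm M (\<lambda>w. h (T z w) - h w))\<^sup>2)"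
      using nn_integral_eq_integral[OF L2_integrable_sq[OF d]] by (simp add: L2_nrm_sq)
    also have "\<dots> \<le> ennreal (c\<^sup>2)" using c(2)[OF that] by (intro ennreal_leI power_mono) auto
    finally show ?thesis .
  qed
  have "L2_nrm M (\<lambda>w. LINT z|lborel. \<kappa> z * (h (T z w) - h w)) \<le> (LINT z|lborel. \<bar>\<kappa> z\<bar>) * c"
    by (rule weighted_orbit_L2_le(2)[OF k(1) _ nn c(1)]) measurable
  moreover have "L2_nrm M (\<lambda>w. orbit_corr \<kappa> h w - h w) = L2_nrm M (\<lambda>w. LINT z|lborel. \<kappa> z * (h (T z w) - h w))"
  proof (rule L2_nrm_cong_AE)
    show "(\<lambda>w. orbit_corr \<kappa> h w - h w) \<in> borel_measurable M" unfolding orbit_corr_def by measurable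
    show "(\<lambda>w. LINT z|lborel. \<kappa> z * (h (T z w) - h w)) \<in> borel_measurable M" by measurable
    show "AE w in M. orbit_corr \<kappa> h w - h w = (LINT z|lborel. \<kappa> z * (h (T z w) - h w))"
      using orbit_integrable(2)[OF L2_integrable[OF h] k(1)]
    proof eventually_elim
      case (elim w)
      then show ?case
        using k(1,3) by (simp add: orbit_corr_def right_diff_distrib)
    qed
  qed
  ultimately show ?thesis using k(2) by simp
qed

text \<open>Mollified difference quotients of \<open>\<psi>\<close> converge in two ways: almost
  everywhere to the classical derivative of the mollification, and in L2 to the mollification of the
  generator's value. The two limits coincide.\<close>

lemma generator_orbit_corr:
  assumes psi: "has_stochastic_gradient M T \<psi> g" and k: "\<kappa> \<in> test_functions UNIV"
  shows "AE w in M. - orbit_corr (\<lambda>z. gradient \<kappa> z $ i) \<psi> w = orbit_corr \<kappa> (\<lambda>w. g w $ i) w"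
proof -
  have L: "\<psi> \<in> L2 M" "(\<lambda>w. g w $ i) \<in> L2 M" using psi by (auto simp: has_stochastic_gradient_def intro: L2_component)
  note [measurable] = L2_measurable[OF L(1)] L2_measurable[OF L(2)]
  define e where "e = (axis i 1 :: real ^ 'n)"
  define t where "t n = inverse (real (Suc n))" for n
  have t: "0 < t n" for n by (simp add: t_def)
  have t0: "t \<longlonglongrightarrow> 0" unfolding t_def by (rule LIMSEQ_inverse_real_of_nat)
  have tat: "filterlim t (at 0) sequentially"
    unfolding filterlim_at using t0 t by (auto simp: less_imp_neq[THEN not_sym])
  have ki: "integrable lborel \<kappa>" by (rule test_functions_integrable[OF k])
  have km[measurable]: "\<kappa> \<in> borel_measurable borel" by (rule smooth_borel[OF test_functions_smooth[OF k]])
  define d where "d n w = (\<psi> (T (t n *\<^sub>R e) w) - \<psi> w) / t n - g w $ i" for n w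
  have dL: "d n \<in> L2 M" for n
    unfolding d_def divide_inverse mult.commute[of _ "inverse (t n)"] by (intro L2_diff L2_mult L2_T L)
  note [measurable] = L2_measurable[OF dL]
  have d0: "(\<lambda>n. L2_nrm M (d n)) \<longlonglongrightarrow> 0"
    using psi filterlim_compose[OF _ tat] unfolding has_stochastic_gradient_def d_def e_def by fast
  \<comment> \<open>The difference of the two candidates, and the pointwise limit of the mollified
    \<open>d n\<close>. As \<open>d n\<close> tends to 0 in L2, so do its mollifications, and
    Fatou's lemma forces \<open>G\<close> to vanish almost everywhere.\<close>
  define G where "G w = - orbit_corr (\<lambda>z. gradient \<kappa> z $ i) \<psi> w - orbit_corr \<kappa> (\<lambda>w. g w $ i) w" for w
  have Gm[measurable]: "G \<in> borel_measurable M"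
    using orbit_corr_L2[OF test_functions_integrable[OF test_functions_gradient[OF k]] L(1), of i] orbit_corr_L2[OF ki L(2)]
    unfolding G_def by (intro borel_measurable_diff borel_measurable_uminus) (auto dest: L2_measurable)
  have lim: "AE w in M. (\<lambda>n. orbit_corr \<kappa> (d n) w) \<longlonglongrightarrow> G w"
    using AE_locally_integrable[OF L2_integrable[OF L(1)]] orbit_integrable(2)[OF L2_integrable[OF L(2)] ki] AE_space
  proof eventually_elim
    case (elim w)
    let ?h = "\<lambda>z. \<psi> (T z w)"
    have eq: "orbit_corr \<kappa> (d n) w = (corr \<kappa> ?h (t n *\<^sub>R e) - corr \<kappa> ?h 0) / t n - orbit_corr \<kappa> (\<lambda>w. g w $ i) w" for n
    proof -
      have c: "corr \<kappa> ?h (t n *\<^sub>R e) = (LINT z|lborel. \<kappa> z * \<psi> (T (t n *\<^sub>R e) (T z w)))"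
        using orbit_corr_T[OF elim(3) L2_measurable[OF L(1)] km, of "t n *\<^sub>R e"]
        by (simp add: orbit_corr_def T_add[OF elim(3), symmetric] add.commute)
      have I0: "integrable lborel (\<lambda>z. \<kappa> z * ?h z)" using corr_integrable[OF k elim(1), of 0] by simp
      have "integrable lborel (\<lambda>z. \<kappa> (t n *\<^sub>R e + z - t n *\<^sub>R e) * ?h (t n *\<^sub>R e + z))"
        using orbit_borel_measurable[OF elim(3) L2_measurable[OF L(1)]] corr_integrable[OF k elim(1), of "t n *\<^sub>R e"]
        by (subst lborel_integrable_translation) auto
      then have I1: "integrable lborel (\<lambda>z. \<kappa> z * \<psi> (T (t n *\<^sub>R e) (T z w)))"
        by (simp add: T_add[OF elim(3), symmetric])
      have "orbit_corr \<kappa> (d n) w = (LINT z|lborel. (\<kappa> z * \<psi> (T (t n *\<^sub>R e) (T z w)) - \<kappa> z * ?h z) / t n - \<kappa> z * g (T z w) $ i)"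
        unfolding orbit_corr_def d_def by (intro Bochner_Integration.integral_cong refl) (simp add: right_diff_distrib)
      also have "\<dots> = ((LINT z|lborel. \<kappa> z * \<psi> (T (t n *\<^sub>R e) (T z w))) - (LINT z|lborel. \<kappa> z * ?h z)) / t n - (LINT z|lborel. \<kappa> z * g (T z w) $ i)"
        using I0 I1 elim(2) by simp
      finally show ?thesis by (simp add: c orbit_corr_def) (simp add: corr_def)
    qed
    have "((\<lambda>s. corr \<kappa> ?h (s *\<^sub>R e)) has_derivative (\<lambda>s. (\<chi> i. - corr (\<lambda>x. gradient \<kappa> x $ i) ?h (0 *\<^sub>R e)) \<bullet> (s *\<^sub>R e))) (at 0)"
      by (rule has_derivative_compose[OF _ corr_has_derivative[OF k elim(1)]]) (auto intro!: derivative_eq_intros)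
    moreover have "(\<lambda>s. (\<chi> i. - corr (\<lambda>x. gradient \<kappa> x $ i) ?h (0 *\<^sub>R e)) \<bullet> (s *\<^sub>R e)) = (*) (- corr (\<lambda>x. gradient \<kappa> x $ i) ?h 0)"
      by (auto simp: e_def inner_axis)
    ultimately have "((\<lambda>s. corr \<kappa> ?h (s *\<^sub>R e)) has_real_derivative - corr (\<lambda>x. gradient \<kappa> x $ i) ?h 0) (at 0)"
      by (simp only: has_field_derivative_def)
    then have "((\<lambda>s. (corr \<kappa> ?h (s *\<^sub>R e) - corr \<kappa> ?h 0) / s) \<longlongrightarrow> - corr (\<lambda>x. gradient \<kappa> x $ i) ?h 0) (at 0)"
      by (simp add: DERIV_def)
    from tendsto_diff[OF filterlim_compose[OF this tat] tendsto_const]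
    show ?case unfolding eq G_def by (simp add: orbit_corr_def corr_def)
  qed
  have dn: "L2_nrm M (orbit_corr \<kappa> (d n)) \<le> (LINT z|lborel. \<bar>\<kappa> z\<bar>) * L2_nrm M (d n)" for n
    unfolding orbit_corr_def
  proof (rule weighted_orbit_L2_le(2)[OF ki])
    show "(\<integral>\<^sup>+ w. ennreal ((d n (T z w))\<^sup>2) \<partial>M) \<le> ennreal ((L2_nrm M (d n))\<^sup>2)" for z
      using nn_integral_T[of "\<lambda>w. ennreal ((d n w)\<^sup>2)" z] nn_integral_eq_integral[OF L2_integrable_sq[OF dL[of n]]]
      by (simp add: L2_nrm_sq)
    have [measurable]: "d n \<in> borel_measurable M" by (rule L2_measurable[OF dL])
    show "(\<lambda>(z, w). d n (T z w)) \<in> borel_measurable (borel \<Otimes>\<^sub>M M)" by measurable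
  qed simp
  have oL: "orbit_corr \<kappa> (d n) \<in> L2 M" for n by (rule orbit_corr_L2[OF ki dL])
  note [measurable] = L2_measurable[OF oL]
  have "(\<integral>\<^sup>+ w. ennreal ((G w)\<^sup>2) \<partial>M) \<le> (\<integral>\<^sup>+ w. liminf (\<lambda>n. ennreal ((orbit_corr \<kappa> (d n) w)\<^sup>2)) \<partial>M)"
  proof (rule nn_integral_mono_AE)
    show "AE w in M. ennreal ((G w)\<^sup>2) \<le> liminf (\<lambda>n. ennreal ((orbit_corr \<kappa> (d n) w)\<^sup>2))"
      using lim
    proof eventually_elim
      case (elim w)
      have "(\<lambda>n. ennreal ((orbit_corr \<kappa> (d n) w)\<^sup>2)) \<longlonglongrightarrow> ennreal ((G w)\<^sup>2)"
        by (rule tendsto_ennrealI[OF tendsto_power[OF elim]])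
      from lim_imp_Liminf[OF sequentially_bot this] show ?case by simp
    qed
  qed
  also have "\<dots> \<le> liminf (\<lambda>n. \<integral>\<^sup>+ w. ennreal ((orbit_corr \<kappa> (d n) w)\<^sup>2) \<partial>M)"
    by (rule nn_integral_liminf) measurable
  also have "\<dots> = 0"
  proof -
    have eq: "(\<integral>\<^sup>+ w. ennreal ((orbit_corr \<kappa> (d n) w)\<^sup>2) \<partial>M) = ennreal ((L2_nrm M (orbit_corr \<kappa> (d n)))\<^sup>2)" for n
      using nn_integral_eq_integral[OF L2_integrable_sq[OF oL[of n]]] by (simp add: L2_nrm_sq)
    have "(\<lambda>n. (LINT z|lborel. \<bar>\<kappa> z\<bar>) * L2_nrm M (d n)) \<longlonglongrightarrow> 0"
      using tendsto_mult[OF tendsto_const d0] by simp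
    then have "(\<lambda>n. L2_nrm M (orbit_corr \<kappa> (d n))) \<longlonglongrightarrow> 0"
      by (rule Lim_null_comparison[rotated]) (use dn in simp)
    from tendsto_ennrealI[OF tendsto_power[OF this, of 2]]
    have "(\<lambda>n. \<integral>\<^sup>+ w. ennreal ((orbit_corr \<kappa> (d n) w)\<^sup>2) \<partial>M) \<longlonglongrightarrow> 0" unfolding eq by simp
    then show ?thesis by (simp add: lim_imp_Liminf)
  qed
  finally have "AE w in M. ennreal ((G w)\<^sup>2) = 0" by (subst (asm) le_zero_eq) (simp add: nn_integral_0_iff_AE)
  then show ?thesis by eventually_elim (simp add: G_def)
qed

end

lemma borel_measurable_vecI:
  fixes f :: "'a \<Rightarrow> real ^ 'n::finite"
  assumes "\<And>i. (\<lambda>x. f x $ i) \<in> borel_measurable M"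
  shows "f \<in> borel_measurable M"
proof -
  have "(\<lambda>x. \<Sum>i\<in>UNIV. f x $ i *\<^sub>R axis i (1::real)) \<in> borel_measurable M"
    using assms by (intro borel_measurable_sum borel_measurable_scaleR) auto
  moreover have "(\<lambda>x. \<Sum>i\<in>UNIV. f x $ i *\<^sub>R axis i (1::real)) = f"
    using basis_expansion[where 'a=real and 'n='n] by (auto simp: scalar_mult_eq_scaleR)
  ultimately show ?thesis by simp
qed

lemma L2_vecI:
  fixes f :: "'a \<Rightarrow> real ^ 'n::finite"
  assumes "\<And>i. (\<lambda>x. f x $ i) \<in> L2 M"
  shows "f \<in> L2 M"
proof (rule L2_dominated)
  show "f \<in> borel_measurable M" by (rule borel_measurable_vecI[OF L2_measurable[OF assms]])
  show "integrable M (\<lambda>x. \<Sum>i\<in>UNIV. (f x $ i)\<^sup>2)"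
    using L2_integrable_sq[OF assms] by simp
qed (simp add: norm_vec_def L2_set_def sum_nonneg)

lemma L2_nrm_vec_le:
  fixes f :: "'a \<Rightarrow> real ^ 'n::finite"
  assumes f: "f \<in> L2 M"
  shows "L2_nrm M f \<le> (\<Sum>i\<in>UNIV. L2_nrm M (\<lambda>x. f x $ i))"
proof -
  have "(LINT x|M. (norm (f x))\<^sup>2) = (LINT x|M. (\<Sum>i\<in>UNIV. (f x $ i)\<^sup>2))"
    by (simp add: norm_vec_def L2_set_def sum_nonneg)
  also have "\<dots> = (\<Sum>i\<in>UNIV. (L2_nrm M (\<lambda>x. f x $ i))\<^sup>2)"
    using L2_integrable_sq[OF L2_component[OF f]] by (simp add: L2_nrm_sq)
  finally have "L2_nrm M f = L2_set (\<lambda>i. L2_nrm M (\<lambda>x. f x $ i)) UNIV" by (simp add: L2_nrm_def L2_set_def)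
  then show ?thesis using L2_set_le_sum[of UNIV "\<lambda>i. L2_nrm M (\<lambda>x. f x $ i)"] by simp
qed

lemma mollifier_exists:
  assumes "0 < \<delta>"
  shows "\<exists>\<kappa> :: real ^ 'n::finite \<Rightarrow> real. \<kappa> \<in> test_functions UNIV \<and> (\<forall>z. 0 \<le> \<kappa> z) \<and> (LINT z|lborel. \<kappa> z) = 1 \<and>
    (\<forall>z. \<kappa> z \<noteq> 0 \<longrightarrow> norm z < \<delta>)"
proof -
  \<comment> \<open>The Euclidean norm is at most the sum of the absolute coordinates, so a cube of
    half-width \<open>\<delta> / CARD('n)\<close> lies in the ball of radius
    \<open>\<delta>\<close>.\<close>
  define r where "r = \<delta> / real CARD('n)"
  have r: "0 < r" using assms by (simp add: r_def)
  define b :: "real ^ 'n \<Rightarrow> real" where "b = bump 1 (\<chi> i. - r) (\<chi> i. r)"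
  have box: "box (\<chi> i. - r) (\<chi> i. r) = (cube r :: (real ^ 'n) set)" by (simp add: cube_eq_box)
  have b: "b \<in> test_functions (UNIV :: (real ^ 'n) set)" unfolding b_def by (rule bump_test_function) auto
  have pos: "0 < (LINT z|lborel. b z)"
  proof -
    have "(LINT z|lborel. b z) \<noteq> 0"
    proof
      assume "(LINT z|lborel. b z) = 0"
      then have "AE z in lborel. b z = 0"
        using integral_nonneg_eq_0_iff_AE[OF test_functions_integrable[OF b]] by (simp add: b_def bump_bounds)
      then have "AE z in lborel. z \<notin> (cube r :: (real ^ 'n) set)"
      proof eventually_elim
        case (elim z)
        then show ?case using bump_pos[of 1 z "\<chi> i. - r" "\<chi> i. r"] by (auto simp: b_def box)
      qed
      then have "emeasure lborel (cube r :: (real ^ 'n) set) = 0"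
        by (subst (asm) AE_iff_measurable[of "cube r"]) auto
      then show False using r by (simp add: emeasure_cube)
    qed
    moreover have "0 \<le> (LINT z|lborel. b z)" by (intro integral_nonneg_AE AE_I2) (simp add: b_def bump_bounds)
    ultimately show ?thesis by (simp add: less_le)
  qed
  define \<kappa> where "\<kappa> z = 1 / (LINT z|lborel. b z) * b z" for z
  show ?thesis
  proof (intro exI[of _ \<kappa>] conjI allI impI)
    show "\<kappa> \<in> test_functions UNIV" unfolding \<kappa>_def by (rule test_functions_scale[OF b])
    show "0 \<le> \<kappa> z" for z using pos by (simp add: \<kappa>_def b_def bump_bounds)
    show "(LINT z|lborel. \<kappa> z) = 1" using pos by (simp add: \<kappa>_def)
    fix z assume "\<kappa> z \<noteq> 0"
    then have "z \<in> (cube r :: (real ^ 'n) set)"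
      using bump_outside[of 1 z "\<chi> i. - r" "\<chi> i. r"] by (auto simp: \<kappa>_def b_def box)
    then have "(\<Sum>i\<in>UNIV. \<bar>z $ i\<bar>) < (\<Sum>i\<in>(UNIV::'n set). r)" by (intro sum_strict_mono) (auto simp: mem_cube)
    also have "\<dots> = \<delta>" by (simp add: r_def)
    finally show "norm z < \<delta>" using norm_le_l1_cart[of z] by simp
  qed
qed

section \<open>Potentials with smooth realisations\<close>

context flow
begin

text \<open>\<open>T 0\<close> is idempotent, so \<open>f\<close> and its composition with
  \<open>T 0\<close> agree after one more application of \<open>T 0\<close>, and this application
  preserves norms.\<close>

lemma shift_0:
  assumes f: "f \<in> L2 M" shows "L2_nrm M (\<lambda>w. f (T 0 w) - f w) = 0"
proof -
  have "L2_nrm M (\<lambda>w. f (T 0 w) - f w) = L2_nrm M (\<lambda>w. f (T 0 (T 0 w)) - f (T 0 w))"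
    using L2_nrm_T[OF L2_diff[OF L2_T[OF f] f], of 0 0] by simp
  also have "\<dots> = 0"
  proof -
    have "(LINT w|M. (norm (f (T 0 (T 0 w)) - f (T 0 w)))\<^sup>2) = (LINT w|M. 0)"
      by (intro Bochner_Integration.integral_cong refl) (simp add: T_add[symmetric])
    then show ?thesis by (simp add: L2_nrm_def)
  qed
  finally show ?thesis .
qed

text \<open>Potentials to which classical calculus applies along almost every orbit. Multiplied by a
  cut-off they become test functions on a cube, with a gradient given by the product rule.\<close>

definition nice_potential :: "('w \<Rightarrow> real) \<Rightarrow> ('w \<Rightarrow> real ^ 'n) \<Rightarrow> bool" where
  "nice_potential \<psi> v \<longleftrightarrow> \<psi> \<in> L2 M \<and> v \<in> L2 M \<and>
    (AE w in M. smooth (\<lambda>y. \<psi> (T y w)) \<and> (\<forall>y. gradient (\<lambda>y. \<psi> (T y w)) y = v (T y w)))"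

lemma nice_potential_orbit_corr:
  assumes psi: "\<psi> \<in> L2 M" and k: "\<kappa> \<in> test_functions UNIV"
  shows "nice_potential (orbit_corr \<kappa> \<psi>) (\<lambda>w. \<chi> i. - orbit_corr (\<lambda>z. gradient \<kappa> z $ i) \<psi> w)"
  unfolding nice_potential_def
proof (intro conjI)
  have km: "\<kappa> \<in> borel_measurable borel" "\<And>i. (\<lambda>z. gradient \<kappa> z $ i) \<in> borel_measurable borel"
    using test_functions_smooth[OF k] by (auto intro: smooth_borel smooth_gradient)
  show "orbit_corr \<kappa> \<psi> \<in> L2 M" by (rule orbit_corr_L2[OF test_functions_integrable[OF k] psi])
  show "(\<lambda>w. \<chi> i. - orbit_corr (\<lambda>z. gradient \<kappa> z $ i) \<psi> w) \<in> L2 M"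
    by (rule L2_vecI) (simp add: L2_uminus orbit_corr_L2[OF test_functions_integrable[OF test_functions_gradient[OF k]] psi])
  show "AE w in M. smooth (\<lambda>y. orbit_corr \<kappa> \<psi> (T y w)) \<and>
      (\<forall>y. gradient (\<lambda>y. orbit_corr \<kappa> \<psi> (T y w)) y = (\<chi> i. - orbit_corr (\<lambda>z. gradient \<kappa> z $ i) \<psi> (T y w)))"
    using AE_locally_integrable[OF L2_integrable[OF psi]] AE_space
  proof eventually_elim
    case (elim w)
    have eq: "(\<lambda>y. orbit_corr \<kappa> \<psi> (T y w)) = corr \<kappa> (\<lambda>z. \<psi> (T z w))"
      using orbit_corr_T[OF elim(2) L2_measurable[OF psi] km(1)] by auto
    show ?case
      unfolding eq vec_eq_iff
      using corr_smooth[OF k elim(1)] gradient_corr[OF k elim(1)] orbit_corr_T[OF elim(2) L2_measurable[OF psi] km(2)]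
      by simp
  qed
qed

text \<open>A potential in the domain of the generators is mollified: its gradient is then the
  mollified generator value, which is close to the original one by continuity of the shifts.\<close>

lemma nice_potential_dense:
  assumes v: "v \<in> L2_pot M T" and e: "0 < e"
  shows "\<exists>\<psi> wa. nice_potential \<psi> wa \<and> L2_nrm M (\<lambda>w. v w - wa w) < e"
proof -
  have vL: "v \<in> L2 M" using v by (simp add: L2_pot_def)
  obtain \<psi> g where sg: "has_stochastic_gradient M T \<psi> g" and vg: "L2_nrm M (\<lambda>w. v w - g w) < e / 2"
    using v half_gt_zero[OF e] unfolding L2_pot_def by blast
  have psi: "\<psi> \<in> L2 M" and g: "g \<in> L2 M" using sg by (auto simp: has_stochastic_gradient_def)
  have gi: "(\<lambda>w. g w $ i) \<in> L2 M" for i by (rule L2_component[OF g])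
  define c where "c = e / 2 / real CARD('n)"
  have c: "0 < c" using e by (simp add: c_def)
  have "\<forall>\<^sub>F z in at 0. \<forall>i. L2_nrm M (\<lambda>w. g (T z w) $ i - g w $ i) < c"
    by (intro eventually_all_finite order_tendstoD(2)[OF shift_continuous[OF gi] c])
  then obtain d where d: "0 < d" "\<And>z i. z \<noteq> 0 \<Longrightarrow> norm z < d \<Longrightarrow> L2_nrm M (\<lambda>w. g (T z w) $ i - g w $ i) < c"
    unfolding eventually_at by (auto simp: dist_norm)
  obtain \<kappa> :: "real ^ 'n \<Rightarrow> real" where k: "\<kappa> \<in> test_functions UNIV" "\<And>z. 0 \<le> \<kappa> z" "(LINT z|lborel. \<kappa> z) = 1"
    "\<And>z. \<kappa> z \<noteq> 0 \<Longrightarrow> norm z < d"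
    using mollifier_exists[OF d(1)] by blast
  define wa where "wa w = (\<chi> i. - orbit_corr (\<lambda>z. gradient \<kappa> z $ i) \<psi> w)" for w
  have nice: "nice_potential (orbit_corr \<kappa> \<psi>) wa"
    unfolding wa_def by (rule nice_potential_orbit_corr[OF psi k(1)])
  then have wa: "wa \<in> L2 M" by (simp add: nice_potential_def)
  have comp: "L2_nrm M (\<lambda>w. (g w - wa w) $ i) \<le> c" for i
  proof -
    have oL: "orbit_corr \<kappa> (\<lambda>w. g w $ i) \<in> L2 M" by (rule orbit_corr_L2[OF test_functions_integrable[OF k(1)] gi])
    have "L2_nrm M (\<lambda>w. (g w - wa w) $ i) = L2_nrm M (\<lambda>w. g w $ i - orbit_corr \<kappa> (\<lambda>w. g w $ i) w)"
    proof (rule L2_nrm_cong_AE)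
      show "(\<lambda>w. (g w - wa w) $ i) \<in> borel_measurable M" by (rule L2_measurable[OF L2_component[OF L2_diff[OF g wa]]])
      show "(\<lambda>w. g w $ i - orbit_corr \<kappa> (\<lambda>w. g w $ i) w) \<in> borel_measurable M" by (rule L2_measurable[OF L2_diff[OF gi oL]])
      show "AE w in M. (g w - wa w) $ i = g w $ i - orbit_corr \<kappa> (\<lambda>w. g w $ i) w"
        using generator_orbit_corr[OF sg k(1), of i] by eventually_elim (simp add: wa_def)
    qed
    also have "\<dots> = L2_nrm M (\<lambda>w. orbit_corr \<kappa> (\<lambda>w. g w $ i) w - g w $ i)" by (rule L2_nrm_minus_commute)
    also have "\<dots> \<le> c"
    proof (rule mollifier_L2_le[OF test_functions_integrable[OF k(1)] _ k(3) gi])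
      show "(LINT z|lborel. \<bar>\<kappa> z\<bar>) = 1" using k(2,3) by simp
      show "0 \<le> c" using c by simp
      show "L2_nrm M (\<lambda>w. g (T z w) $ i - g w $ i) \<le> c" if "\<kappa> z \<noteq> 0" for z
        \<comment> \<open>The modulus of continuity is a limit at 0 and says nothing about
          \<open>z = 0\<close> itself; there \<open>shift_0\<close> applies.\<close>
        using d(2)[of z i] k(4)[OF that] shift_0[OF gi, of i] c by (cases "z = 0") auto
    qed
    finally show ?thesis .
  qed
  have "L2_nrm M (\<lambda>w. g w - wa w) \<le> (\<Sum>i\<in>UNIV. L2_nrm M (\<lambda>w. (g w - wa w) $ i))"
    by (rule L2_nrm_vec_le[OF L2_diff[OF g wa]])
  also have "\<dots> \<le> (\<Sum>i\<in>(UNIV::'n set). c)" by (rule sum_mono) (rule comp)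
  also have "\<dots> = e / 2" by (simp add: c_def)
  finally have "L2_nrm M (\<lambda>w. g w - wa w) \<le> e / 2" .
  with vg L2_triangle_diff[OF vL g wa] have "L2_nrm M (\<lambda>w. v w - wa w) < e" by simp
  with nice show ?thesis by blast
qed

text \<open>Supplies the test fields for the stochastic problem. For bounded \<open>b\<close> the
  Taylor error of the mollification is quadratic uniformly over all points, so the difference
  quotients converge uniformly, and hence in L2, to the mollified gradient.\<close>

lemma L2_pot_orbit_corr:
  assumes k: "\<kappa> \<in> test_functions UNIV" and b: "b \<in> borel_measurable M" "\<And>w. w \<in> space M \<Longrightarrow> \<bar>b w\<bar> \<le> B"
  shows "(\<lambda>w. \<chi> i. - orbit_corr (\<lambda>z. gradient \<kappa> z $ i) b w) \<in> L2_pot M T"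
proof -
  define v where "v w = (\<chi> i. - orbit_corr (\<lambda>z. gradient \<kappa> z $ i) b w)" for w
  have bL: "b \<in> L2 M" by (rule L2_bounded[OF b(1), of B]) (use b(2) in \<open>auto intro: AE_I2\<close>)
  have nice: "nice_potential (orbit_corr \<kappa> b) v" unfolding v_def by (rule nice_potential_orbit_corr[OF bL k])
  have km: "\<kappa> \<in> borel_measurable borel" by (rule smooth_borel[OF test_functions_smooth[OF k]])
  obtain C R where C: "0 < C" "\<And>h wa. locally_integrable h \<Longrightarrow> norm wa \<le> 1 \<Longrightarrow>
    \<bar>corr \<kappa> h (0 + wa) - corr \<kappa> h 0 - (\<chi> i. - corr (\<lambda>x. gradient \<kappa> x $ i) h 0) \<bullet> wa\<bar>
      \<le> C * (LINT z|lborel. \<bar>indicator (cball 0 R) z *\<^sub>R h z\<bar>) * (norm wa)\<^sup>2"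
    using corr_Taylor[OF k, of 0] by blast
  define V where "V = measure lborel (cball 0 R :: (real ^ 'n) set)"
  have V: "0 \<le> V" by (simp add: V_def)
  define B' where "B' = \<bar>B\<bar>"
  have key: "\<bar>(orbit_corr \<kappa> b (T (t *\<^sub>R axis i 1) w) - orbit_corr \<kappa> b w) / t - v w $ i\<bar> \<le> C * (B' * V) * \<bar>t\<bar>"
    if wa: "w \<in> space M" and t: "t \<noteq> 0" "\<bar>t\<bar> \<le> 1" for w t i
  proof -
    let ?h = "\<lambda>z. b (T z w)"
    have hm: "?h \<in> borel_measurable borel" by (rule orbit_borel_measurable[OF wa b(1)])
    have hB: "\<bar>?h z\<bar> \<le> B'" for z using b(2)[of "T z w"] wa by (simp add: B'_def)
    have Ic: "integrable lborel (\<lambda>z. indicat_real (cball 0 r :: (real ^ 'n) set) z * B')" for r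
      by (intro integrable_mult_left integrable_real_indicator emeasure_bounded_finite) auto
    have Ih: "integrable lborel (\<lambda>z. indicat_real (cball 0 r) z *\<^sub>R ?h z)" for r
    proof (rule Bochner_Integration.integrable_bound[OF Ic[of r]])
      show "(\<lambda>z. indicat_real (cball 0 r) z *\<^sub>R ?h z) \<in> borel_measurable lborel"
        using hm by (intro borel_measurable_scaleR borel_measurable_indicator) auto
      show "AE z in lborel. norm (indicat_real (cball 0 r) z *\<^sub>R ?h z) \<le> norm (indicat_real (cball 0 r) z * B')"
        using hB by (intro AE_I2) (simp add: abs_mult mult_left_mono B'_def)
    qed
    have li: "locally_integrable ?h" using hm Ih by (simp add: locally_integrable_def)
    have "(LINT z|lborel. \<bar>indicat_real (cball 0 R) z *\<^sub>R ?h z\<bar>) \<le> (LINT z|lborel. indicat_real (cball 0 R :: (real ^ 'n) set) z * B')"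
      using hB by (intro integral_mono integrable_abs Ih Ic) (simp add: abs_mult mult_left_mono)
    also have "\<dots> = B' * V" by (simp add: V_def mult.commute)
    finally have J: "(LINT z|lborel. \<bar>indicat_real (cball 0 R) z *\<^sub>R ?h z\<bar>) \<le> B' * V" .
    let ?wa = "t *\<^sub>R axis i 1 :: real ^ 'n"
    have nw: "norm ?wa = \<bar>t\<bar>" by simp
    have c0: "corr \<kappa> ?h 0 = orbit_corr \<kappa> b w" by (simp add: corr_def orbit_corr_def)
    have cw: "corr \<kappa> ?h ?wa = orbit_corr \<kappa> b (T ?wa w)" by (rule orbit_corr_T[OF wa b(1) km, symmetric])
    have vi: "(\<chi> i. - corr (\<lambda>x. gradient \<kappa> x $ i) ?h 0) \<bullet> ?wa = t * v w $ i"
      by (simp add: inner_axis v_def corr_def orbit_corr_def)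
    have "\<bar>orbit_corr \<kappa> b (T ?wa w) - orbit_corr \<kappa> b w - t * v w $ i\<bar> \<le> C * (LINT z|lborel. \<bar>indicator (cball 0 R) z *\<^sub>R ?h z\<bar>) * \<bar>t\<bar>\<^sup>2"
      using C(2)[OF li, of ?wa] t(2) unfolding nw add_0 c0 cw vi by simp
    also have "\<dots> \<le> C * (B' * V) * \<bar>t\<bar>\<^sup>2"
      using J C(1) by (intro mult_right_mono mult_left_mono) auto
    finally have "\<bar>orbit_corr \<kappa> b (T ?wa w) - orbit_corr \<kappa> b w - t * v w $ i\<bar> \<le> C * (B' * V) * \<bar>t\<bar> * \<bar>t\<bar>"
      by (simp only: power2_eq_square mult.assoc)
    moreover have "(orbit_corr \<kappa> b (T ?wa w) - orbit_corr \<kappa> b w) / t - v w $ i = (orbit_corr \<kappa> b (T ?wa w) - orbit_corr \<kappa> b w - t * v w $ i) / t"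
      using t(1) by (simp add: diff_divide_distrib)
    ultimately show ?thesis using t(1) by (simp add: abs_divide pos_divide_le_eq)
  qed
  have "has_stochastic_gradient M T (orbit_corr \<kappa> b) v"
    unfolding has_stochastic_gradient_def
  proof (intro conjI allI)
    show L: "orbit_corr \<kappa> b \<in> L2 M" "v \<in> L2 M" using nice by (auto simp: nice_potential_def)
    fix i
    define m where "m = sqrt (measure M (space M))"
    have lim: "((\<lambda>t::real. C * (B' * V) * \<bar>t\<bar> * m) \<longlongrightarrow> 0) (at 0)" by (auto intro!: tendsto_eq_intros)
    show "((\<lambda>t. L2_nrm M (\<lambda>w. (orbit_corr \<kappa> b (T (t *\<^sub>R axis i 1) w) - orbit_corr \<kappa> b w) / t - v w $ i)) \<longlongrightarrow> 0) (at 0)"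
    proof (rule Lim_null_comparison[OF _ lim])
      show "\<forall>\<^sub>F t in at 0. norm (L2_nrm M (\<lambda>w. (orbit_corr \<kappa> b (T (t *\<^sub>R axis i 1) w) - orbit_corr \<kappa> b w) / t - v w $ i)) \<le> C * (B' * V) * \<bar>t\<bar> * m"
        unfolding eventually_at
      proof (intro exI[of _ 1] conjI ballI impI)
        fix t :: real assume "t \<noteq> 0 \<and> dist t 0 < 1"
        then have t: "t \<noteq> 0" "\<bar>t\<bar> \<le> 1" by auto
        let ?f = "\<lambda>w. (orbit_corr \<kappa> b (T (t *\<^sub>R axis i 1) w) - orbit_corr \<kappa> b w) / t - v w $ i"
        have fL: "?f \<in> L2 M"
          unfolding divide_inverse mult.commute[of _ "inverse t"] by (intro L2_diff L2_mult L2_T L L2_component)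
        have c0: "0 \<le> C * (B' * V) * \<bar>t\<bar>" using C(1) V by (simp add: B'_def)
        have "(LINT w|M. (norm (?f w))\<^sup>2) \<le> (LINT w|M. (C * (B' * V) * \<bar>t\<bar>)\<^sup>2)"
          by (intro integral_mono L2_integrable_sq[OF fL] power_mono) (use key[OF _ t] in auto)
        also have "\<dots> = (C * (B' * V) * \<bar>t\<bar> * m)\<^sup>2" by (simp add: m_def power_mult_distrib)
        finally have "L2_nrm M ?f \<le> C * (B' * V) * \<bar>t\<bar> * m" using c0 by (intro L2_nrm_leI) (auto simp: m_def)
        then show "norm (L2_nrm M ?f) \<le> C * (B' * V) * \<bar>t\<bar> * m" by simp
      qed simp
    qed
  qed
  moreover have "v \<in> L2 M" using nice by (auto simp: nice_potential_def)
  ultimately have "v \<in> L2_pot M T"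
    unfolding L2_pot_def by (auto intro!: exI[of _ "orbit_corr \<kappa> b"] exI[of _ v] simp: L2_nrm_def)
  then show ?thesis by (simp add: v_def[abs_def])
qed

text \<open>The adjoint of mollification along the flow is mollification along the reversed flow, by
  invariance under \<open>T (- y)\<close>. The composition \<open>T y (T (- y) w)\<close> is
  \<open>T 0 w\<close>, which is carried along. The bound on \<open>k\<close> compensates for
  \<open>q\<close> being merely integrable.\<close>

lemma orbit_adjoint:
  fixes q k :: "'w \<Rightarrow> real"
  assumes q: "integrable M q" and \<kappa>: "integrable lborel \<kappa>"
    and k[measurable]: "k \<in> borel_measurable M" and k1: "\<And>w. \<bar>k w\<bar> \<le> 1"
  shows "integrable M (\<lambda>w. q w * orbit_corr \<kappa> k w)"
    and "integrable M (\<lambda>w. k (T 0 w) * (LINT y|lborel. \<kappa> y * q (T (- y) w)))"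
    and "(LINT w|M. q w * orbit_corr \<kappa> k w) = (LINT w|M. k (T 0 w) * (LINT y|lborel. \<kappa> y * q (T (- y) w)))"
    and "integrable M (\<lambda>w. LINT y|lborel. \<kappa> y * q (T (- y) w))"
proof -
  have [measurable]: "q \<in> borel_measurable M" "\<kappa> \<in> borel_measurable borel" using q \<kappa> by auto
  have I1: "integrable (lborel \<Otimes>\<^sub>M M) (\<lambda>(y, w). \<kappa> y * (q w * k (T y w)))"
  proof (rule lebesgue_M.Fubini_integrable)
    show "(\<lambda>(y, w). \<kappa> y * (q w * k (T y w))) \<in> borel_measurable (lborel \<Otimes>\<^sub>M M)" by measurable
    have qi: "integrable M (\<lambda>w. q w * k (T y w))" for y
      by (rule Bochner_Integration.integrable_bound[OF q]) (auto simp: abs_mult mult_left_le k1 intro!: AE_I2)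
    show "AE y in lborel. integrable M (\<lambda>w. case (y, w) of (y, w) \<Rightarrow> \<kappa> y * (q w * k (T y w)))"
      using qi by simp
    show "integrable lborel (\<lambda>y. LINT w|M. norm (case (y, w) of (y, w) \<Rightarrow> \<kappa> y * (q w * k (T y w))))"
    proof (rule Bochner_Integration.integrable_bound)
      show "integrable lborel (\<lambda>y. \<bar>\<kappa> y\<bar> * (LINT w|M. \<bar>q w\<bar>))" using \<kappa> by auto
      show "(\<lambda>y. LINT w|M. norm (case (y, w) of (y, w) \<Rightarrow> \<kappa> y * (q w * k (T y w)))) \<in> borel_measurable lborel" by measurable
      have "(LINT w|M. \<bar>\<kappa> y * (q w * k (T y w))\<bar>) \<le> (LINT w|M. \<bar>\<kappa> y\<bar> * \<bar>q w\<bar>)" for y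
        using q integrable_abs[OF qi[of y]]
        by (intro integral_mono) (auto simp: abs_mult mult_left_le k1 intro!: mult_left_mono)
      then show "AE y in lborel. norm (LINT w|M. norm (case (y, w) of (y, w) \<Rightarrow> \<kappa> y * (q w * k (T y w)))) \<le> norm (\<bar>\<kappa> y\<bar> * (LINT w|M. \<bar>q w\<bar>))"
        by (intro AE_I2) (simp add: abs_of_nonneg integral_nonneg_AE)
    qed
  qed
  have I2: "integrable (lborel \<Otimes>\<^sub>M M) (\<lambda>(y, w). \<kappa> y * q (T (- y) w))"
  proof (rule lebesgue_M.Fubini_integrable)
    show "(\<lambda>(y, w). \<kappa> y * q (T (- y) w)) \<in> borel_measurable (lborel \<Otimes>\<^sub>M M)" by measurable
    show "AE y in lborel. integrable M (\<lambda>w. case (y, w) of (y, w) \<Rightarrow> \<kappa> y * q (T (- y) w))"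
      using integrable_T[OF q] by simp
    have "(LINT w|M. \<bar>q (T (- y) w)\<bar>) = (LINT w|M. \<bar>q w\<bar>)" for y
      using integral_T[of "\<lambda>w. \<bar>q w\<bar>" "- y"] by simp
    then show "integrable lborel (\<lambda>y. LINT w|M. norm (case (y, w) of (y, w) \<Rightarrow> \<kappa> y * q (T (- y) w)))"
      using \<kappa> by (simp add: abs_mult)
  qed
  have I3: "integrable (lborel \<Otimes>\<^sub>M M) (\<lambda>(y, w). \<kappa> y * (q (T (- y) w) * k (T 0 w)))"
    by (rule Bochner_Integration.integrable_bound[OF I2])
      (auto simp: abs_mult mult_left_le k1 intro!: AE_I2 mult_left_mono)
  have e1: "q w * orbit_corr \<kappa> k w = (LINT y|lborel. \<kappa> y * (q w * k (T y w)))" for w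
    unfolding orbit_corr_def by (simp add: mult.left_commute[of _ "q w"])
  have e3: "k (T 0 w) * (LINT y|lborel. \<kappa> y * q (T (- y) w)) = (LINT y|lborel. \<kappa> y * (q (T (- y) w) * k (T 0 w)))" for w
    by (simp add: mult.commute[of "k (T 0 w)"] flip: mult.assoc)
  show "integrable M (\<lambda>w. q w * orbit_corr \<kappa> k w)"
    unfolding e1 using lebesgue_M.integrable_snd[OF I1] by simp
  show "integrable M (\<lambda>w. k (T 0 w) * (LINT y|lborel. \<kappa> y * q (T (- y) w)))"
    unfolding e3 using lebesgue_M.integrable_snd[OF I3] by simp
  show "integrable M (\<lambda>w. LINT y|lborel. \<kappa> y * q (T (- y) w))"
    using lebesgue_M.integrable_snd[OF I2] by simp
  have "(LINT w|M. q w * orbit_corr \<kappa> k w) = (LINT y|lborel. LINT w|M. \<kappa> y * (q w * k (T y w)))"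
    unfolding e1 using lebesgue_M.Fubini_integral[OF I1] by simp
  also have "\<dots> = (LINT y|lborel. LINT w|M. \<kappa> y * (q (T (- y) w) * k (T 0 w)))"
  proof (rule Bochner_Integration.integral_cong[OF refl])
    fix y
    have "(LINT w|M. \<kappa> y * (q (T (- y) w) * k (T y (T (- y) w)))) = (LINT w|M. \<kappa> y * (q w * k (T y w)))"
      by (rule integral_T) measurable
    moreover have "(LINT w|M. \<kappa> y * (q (T (- y) w) * k (T y (T (- y) w)))) = (LINT w|M. \<kappa> y * (q (T (- y) w) * k (T 0 w)))"
      by (intro Bochner_Integration.integral_cong refl) (simp add: T_add[symmetric])
    ultimately show "(LINT w|M. \<kappa> y * (q w * k (T y w))) = (LINT w|M. \<kappa> y * (q (T (- y) w) * k (T 0 w)))" by (rule trans[OF sym])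
  qed
  also have "\<dots> = (LINT w|M. k (T 0 w) * (LINT y|lborel. \<kappa> y * q (T (- y) w)))"
    unfolding e3 using lebesgue_M.Fubini_integral[OF I3] by simp
  finally show "(LINT w|M. q w * orbit_corr \<kappa> k w) = (LINT w|M. k (T 0 w) * (LINT y|lborel. \<kappa> y * q (T (- y) w)))" .
qed

end

section \<open>Solenoidal fields along orbits\<close>

lemma gradient_scale:
  assumes "\<phi> differentiable (at (c *\<^sub>R x))"
  shows "(\<lambda>x. \<phi> (c *\<^sub>R x)) differentiable (at x)" "gradient (\<lambda>x. \<phi> (c *\<^sub>R x)) x = c *\<^sub>R gradient \<phi> (c *\<^sub>R x)"
proof -
  have "((\<lambda>x. c *\<^sub>R x) has_derivative (\<lambda>h. c *\<^sub>R h)) (at x)" by (auto intro!: derivative_eq_intros)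
  from has_derivative_compose[OF this, of \<phi> "\<lambda>h. gradient \<phi> (c *\<^sub>R x) \<bullet> h"]
  have d: "((\<lambda>x. \<phi> (c *\<^sub>R x)) has_derivative (\<lambda>h. (c *\<^sub>R gradient \<phi> (c *\<^sub>R x)) \<bullet> h)) (at x)"
    using has_derivative_gradient[OF assms] by simp
  show "(\<lambda>x. \<phi> (c *\<^sub>R x)) differentiable (at x)" using d by (auto simp: differentiable_def)
  show "gradient (\<lambda>x. \<phi> (c *\<^sub>R x)) x = c *\<^sub>R gradient \<phi> (c *\<^sub>R x)" by (rule gradient_unique[OF d])
qed

lemma continuously_differentiable_scale:
  "continuously_differentiable k \<phi> \<Longrightarrow> continuously_differentiable k (\<lambda>x. \<phi> (c *\<^sub>R x))"
proof (induction k arbitrary: \<phi>)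
  case 0
  then show ?case
    using continuous_on_compose2[of UNIV \<phi> UNIV "\<lambda>x. c *\<^sub>R x"] by (simp add: continuous_on_scaleR continuous_on_const continuous_on_id)
next
  case (Suc k)
  have d: "\<phi> differentiable (at x)" for x using Suc.prems by simp
  have "continuously_differentiable k (\<lambda>x. c * gradient \<phi> (c *\<^sub>R x) $ i)" for i
    using Suc.prems by (intro continuously_differentiable_mult continuously_differentiable_const Suc.IH[of "\<lambda>x. gradient \<phi> x $ i"]) simp
  then show ?case using gradient_scale[OF d] by simp
qed

lemma smooth_scale: "smooth \<phi> \<Longrightarrow> smooth (\<lambda>x. \<phi> (c *\<^sub>R x))"
  by (simp add: smooth_def continuously_differentiable_scale)

lemma gradient_reflect: "smooth \<phi> \<Longrightarrow> gradient (\<lambda>x. \<phi> (- x)) x = - gradient \<phi> (- x)"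
  using gradient_scale(2)[of \<phi> "-1" x] smooth_differentiable[of \<phi> "- x"] by simp

lemma test_functions_reflect:
  assumes "\<phi> \<in> test_functions UNIV" shows "(\<lambda>x. \<phi> (- x)) \<in> test_functions UNIV"
proof -
  obtain K where K: "compact K" "\<And>x. x \<notin> K \<Longrightarrow> \<phi> x = 0" using test_functions_support[OF assms] by blast
  show ?thesis
  proof (rule test_functionsI)
    show "smooth (\<lambda>x. \<phi> (- x))" using smooth_scale[OF test_functions_smooth[OF assms], of "-1"] by simp
    show "compact (uminus ` K)" by (rule compact_negations[OF K(1)])
    show "\<phi> (- x) = 0" if "x \<notin> uminus ` K" for x
      using K(2)[of "- x"] that by force
  qed simp
qed

lemma lborel_integral_reflect:
  fixes f :: "'a::euclidean_space \<Rightarrow> 'b::{banach, second_countable_topology}"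
  assumes [measurable]: "f \<in> borel_measurable borel"
  shows "(LINT x|lborel. f (- x)) = (LINT x|lborel. f x)"
proof -
  have "lborel = distr lborel borel (\<lambda>x::'a. - x)"
    using lborel_affine[of "-1" "0::'a"] by (simp add: density_1)
  then have "(LINT x|lborel. f x) = (LINT x|distr lborel borel (\<lambda>x. - x). f x)" by metis
  also have "\<dots> = (LINT x|lborel. f (- x))" by (rule integral_distr) auto
  finally show ?thesis ..
qed

text \<open>Moves the mollification from \<open>h\<close> to the test function, so that limits can
  be taken on the smooth side.\<close>

lemma corr_Fubini:
  fixes h :: "real ^ 'n::finite \<Rightarrow> real"
  assumes phi: "\<phi> \<in> test_functions UNIV" and k: "\<kappa> \<in> test_functions UNIV" "\<And>z. 0 \<le> \<kappa> z"
    and h: "locally_integrable h"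
  shows "(LINT y|lborel. \<phi> y * corr \<kappa> h y) = (LINT z|lborel. h z * (LINT y|lborel. \<kappa> (z - y) * \<phi> y))"
    and "integrable lborel (\<lambda>z. h z * (LINT y|lborel. \<kappa> (z - y) * \<phi> y))"
proof -
  have [measurable]: "h \<in> borel_measurable borel" "\<phi> \<in> borel_measurable borel" "\<kappa> \<in> borel_measurable borel"
    using h smooth_borel[OF test_functions_smooth] phi k(1) by (auto simp: locally_integrable_def)
  have ha: "locally_integrable (\<lambda>z. \<bar>h z\<bar>)"
    unfolding locally_integrable_def
  proof (intro conjI allI)
    fix R :: real
    have "integrable lborel (\<lambda>z. norm (indicat_real (cball 0 R) z *\<^sub>R h z))"
      using h by (intro integrable_norm) (simp add: locally_integrable_def)
    then show "integrable lborel (\<lambda>z. indicat_real (cball 0 R) z *\<^sub>R \<bar>h z\<bar>)" by (simp add: abs_mult)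
  qed measurable
  have I: "integrable (lborel \<Otimes>\<^sub>M lborel) (\<lambda>(y, z). \<phi> y * (\<kappa> (z - y) * h z))"
  proof (rule lborel_pair.Fubini_integrable)
    show "(\<lambda>(y, z). \<phi> y * (\<kappa> (z - y) * h z)) \<in> borel_measurable (lborel \<Otimes>\<^sub>M lborel)" by measurable
    show "AE y in lborel. integrable lborel (\<lambda>z. case (y, z) of (y, z) \<Rightarrow> \<phi> y * (\<kappa> (z - y) * h z))"
      using corr_integrable[OF k(1) h] by simp
    \<comment> \<open>Since \<open>\<kappa>\<close> is nonnegative, the inner integral of the
      absolute value is, up to the factor \<open>\<bar>\<phi> y\<bar>\<close>, itself a correlation,
      of \<open>\<bar>h\<bar>\<close>; it is smooth, and the test function cuts it off.\<close>
    have "(\<lambda>y. LINT z|lborel. norm (case (y, z) of (y, z) \<Rightarrow> \<phi> y * (\<kappa> (z - y) * h z))) = (\<lambda>y. norm (\<phi> y * corr \<kappa> (\<lambda>z. \<bar>h z\<bar>) y))"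
    proof
      fix y
      have "0 \<le> corr \<kappa> (\<lambda>z. \<bar>h z\<bar>) y" unfolding corr_def using k(2) by (intro integral_nonneg_AE AE_I2) simp
      then show "(LINT z|lborel. norm (case (y, z) of (y, z) \<Rightarrow> \<phi> y * (\<kappa> (z - y) * h z))) = norm (\<phi> y * corr \<kappa> (\<lambda>z. \<bar>h z\<bar>) y)"
        using k(2) by (simp add: abs_mult corr_def)
    qed
    then show "integrable lborel (\<lambda>y. LINT z|lborel. norm (case (y, z) of (y, z) \<Rightarrow> \<phi> y * (\<kappa> (z - y) * h z)))"
      using integrable_norm[OF test_functions_integrable[OF test_functions_mult[OF phi corr_smooth[OF k(1) ha]]]] by simp
  qed
  have e: "(LINT y|lborel. \<phi> y * (\<kappa> (z - y) * h z)) = h z * (LINT y|lborel. \<kappa> (z - y) * \<phi> y)" for z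
    by (subst integral_mult_right_zero[symmetric]) (simp add: mult_ac)
  show "(LINT y|lborel. \<phi> y * corr \<kappa> h y) = (LINT z|lborel. h z * (LINT y|lborel. \<kappa> (z - y) * \<phi> y))"
    using lborel_pair.Fubini_integral[OF I] by (simp add: e corr_def)
  show "integrable lborel (\<lambda>z. h z * (LINT y|lborel. \<kappa> (z - y) * \<phi> y))"
    using lborel_pair.integrable_snd[OF I] by (simp add: e)
qed

text \<open>If all mollifications are divergence free, integration by parts makes \<open>h\<close>
  orthogonal to the mollified gradient of \<open>\<phi>\<close>. The mollified gradients approach
  the gradient uniformly, with supports in one ball on which \<open>h\<close> is integrable.\<close>

lemma mollified_divergence_0:
  fixes h :: "'n::finite \<Rightarrow> real ^ 'n \<Rightarrow> real"
  assumes h: "\<And>i. locally_integrable (h i)" and phi: "\<phi> \<in> test_functions UNIV"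
    and k: "\<And>n. \<kappa> n \<in> test_functions UNIV" "\<And>n z. 0 \<le> \<kappa> n z" "\<And>n. (LINT z|lborel. \<kappa> n z) = 1"
      "\<And>n z. \<kappa> n z \<noteq> 0 \<Longrightarrow> norm z < 1 / real (Suc n)"
    and 0: "\<And>n. AE z in lborel. (\<Sum>i\<in>UNIV. corr (\<lambda>x. gradient (\<kappa> n) x $ i) (h i) z) = 0"
  shows "(\<Sum>i\<in>UNIV. LINT z|lborel. h i z * gradient \<phi> z $ i) = 0"
proof -
  have hm[measurable]: "h i \<in> borel_measurable borel" for i using h by (simp add: locally_integrable_def)
  have gt: "(\<lambda>x. gradient \<phi> x $ i) \<in> test_functions UNIV" for i by (rule test_functions_gradient[OF phi])
  have gm[measurable]: "(\<lambda>x. gradient \<phi> x $ i) \<in> borel_measurable borel" for i by (rule smooth_borel[OF test_functions_smooth[OF gt]])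
  have km[measurable]: "\<kappa> n \<in> borel_measurable borel" for n by (rule smooth_borel[OF test_functions_smooth[OF k(1)]])
  obtain L where L: "0 < L" "\<And>x y. norm (gradient \<phi> x - gradient \<phi> y) \<le> L * norm (x - y)"
    using test_functions_gradient_Lipschitz[OF phi] by blast
  obtain R where R: "0 < R" "\<And>i x. R < norm x \<Longrightarrow> gradient \<phi> x $ i = 0"
  proof -
    obtain K where K: "compact K" "\<And>x. x \<notin> K \<Longrightarrow> \<phi> x = 0" using test_functions_support[OF phi] by blast
    obtain R where "\<And>x. x \<in> K \<Longrightarrow> norm x \<le> R" using compact_imp_bounded[OF K(1)] by (auto simp: bounded_iff)
    then have "gradient \<phi> x = 0" if "\<bar>R\<bar> + 1 < norm x" for x
      using that by (intro gradient_outside[OF compact_imp_closed[OF K(1)] K(2)]) fastforce+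
    then show thesis by (intro that[of "\<bar>R\<bar> + 1"]) auto
  qed
  define m where "m n i z = (LINT y|lborel. \<kappa> n (z - y) * gradient \<phi> y $ i)" for n i z
  have I1: "integrable lborel (\<lambda>z. h i z * m n i z)" and F: "(LINT y|lborel. gradient \<phi> y $ i * corr (\<kappa> n) (h i) y) = (LINT z|lborel. h i z * m n i z)" for n i
    using corr_Fubini[OF gt k(1,2) h] by (simp_all add: m_def)
  have I2: "integrable lborel (\<lambda>z. h i z * gradient \<phi> z $ i)" for i
    using corr_integrable[OF gt h, of 0] by (simp add: mult.commute)
  have S0: "(\<Sum>i\<in>UNIV. LINT z|lborel. h i z * m n i z) = 0" for n
  proof -
    have ip: "integrable lborel (\<lambda>y. \<phi> y * corr (\<lambda>x. gradient (\<kappa> n) x $ i) (h i) y)" for i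
      by (rule test_functions_integrable[OF test_functions_mult[OF phi corr_smooth[OF test_functions_gradient[OF k(1)] h]]])
    have "(LINT y|lborel. gradient \<phi> y $ i * corr (\<kappa> n) (h i) y) = (LINT y|lborel. \<phi> y * corr (\<lambda>x. gradient (\<kappa> n) x $ i) (h i) y)" for i
    proof -
      have "gradient (corr (\<kappa> n) (h i)) y $ i = - corr (\<lambda>x. gradient (\<kappa> n) x $ i) (h i) y" for y
        by (rule gradient_corr[OF k(1) h])
      then show ?thesis using integral_gradient_by_parts[OF phi corr_smooth[OF k(1) h, of n i], of i] by simp
    qed
    then have "(\<Sum>i\<in>UNIV. LINT z|lborel. h i z * m n i z) = (LINT y|lborel. \<phi> y * (\<Sum>i\<in>UNIV. corr (\<lambda>x. gradient (\<kappa> n) x $ i) (h i) y))"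
      using Bochner_Integration.integral_sum[of UNIV lborel "\<lambda>i y. \<phi> y * corr (\<lambda>x. gradient (\<kappa> n) x $ i) (h i) y", OF ip] by (simp add: F[symmetric] sum_distrib_left)
    also have "\<dots> = 0"
      by (rule integral_eq_zero_AE) (use 0[of n] in eventually_elim, simp)
    finally show ?thesis .
  qed
  \<comment> \<open>The Lipschitz bound for the gradient of \<open>\<phi>\<close> meets kernels of
    radius \<open>1 / (n + 1)\<close>. For \<open>norm z > R + 1\<close> both terms vanish, since
    the kernels have radius at most 1.\<close>
  have dm: "\<bar>m n i z - gradient \<phi> z $ i\<bar> \<le> L / real (Suc n) * indicator (cball 0 (R + 1)) z" for n i z
  proof -
    have ks: "\<kappa> n (z - y) = 0" if "1 / real (Suc n) \<le> norm (z - y)" for y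
      using k(4)[of n "z - y"] that by (auto simp: not_less)
    have tr: "(LINT y|lborel. g (z - y)) = (LINT y|lborel. g y)" if [measurable]: "g \<in> borel_measurable borel" for g :: "real ^ 'n \<Rightarrow> real"
      using lborel_integral_reflect[of "\<lambda>y. g (z + y)"] lborel_integral_translation[of g z] by simp
    have int: "integrable lborel (\<lambda>y. \<kappa> n (z - y))"
    proof -
      have "integrable lborel (\<lambda>y. \<kappa> n (- (- z + y)))"
        using test_functions_integrable[OF test_functions_reflect[OF k(1)], of n]
        by (subst lborel_integrable_translation[of "\<lambda>y. \<kappa> n (- y)" "- z"]) auto
      then show ?thesis by simp
    qed
    have i1: "(LINT y|lborel. \<kappa> n (z - y)) = 1" using tr[OF km] k(3) by simp
    have i2: "integrable lborel (\<lambda>y. \<kappa> n (z - y) * gradient \<phi> y $ i)"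
    proof -
      obtain B where B: "\<And>y. \<bar>gradient \<phi> y $ i\<bar> \<le> B" using test_functions_bounded[OF gt[of i]] by blast
      show ?thesis
      proof (rule Bochner_Integration.integrable_bound[OF integrable_mult_left[OF int, of B]])
        show "AE y in lborel. norm (\<kappa> n (z - y) * gradient \<phi> y $ i) \<le> norm (\<kappa> n (z - y) * B)"
          using order_trans[OF B abs_ge_self] by (intro AE_I2) (simp add: abs_mult mult_left_mono)
      qed measurable
    qed
    have "m n i z - gradient \<phi> z $ i = (LINT y|lborel. \<kappa> n (z - y) * gradient \<phi> y $ i - \<kappa> n (z - y) * gradient \<phi> z $ i)"
      using int i2 i1 by (simp add: m_def)
    also have "\<bar>\<dots>\<bar> \<le> (LINT y|lborel. \<bar>\<kappa> n (z - y) * gradient \<phi> y $ i - \<kappa> n (z - y) * gradient \<phi> z $ i\<bar>)" by (rule integral_abs_bound)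
    also have "\<dots> \<le> (LINT y|lborel. \<kappa> n (z - y) * (L / real (Suc n) * indicator (cball 0 (R + 1)) z))"
    proof (intro integral_mono integrable_abs Bochner_Integration.integrable_diff i2 integrable_mult_left int)
      fix y
      show "\<bar>\<kappa> n (z - y) * gradient \<phi> y $ i - \<kappa> n (z - y) * gradient \<phi> z $ i\<bar> \<le> \<kappa> n (z - y) * (L / real (Suc n) * indicator (cball 0 (R + 1)) z)"
      proof (cases "\<kappa> n (z - y) = 0")
        case False
        then have d: "norm (z - y) < 1 / real (Suc n)" by (rule k(4))
        then have d1: "norm (z - y) \<le> 1" using order_less_le_trans[OF d, of 1] by simp
        have "\<bar>gradient \<phi> y $ i - gradient \<phi> z $ i\<bar> \<le> L / real (Suc n) * indicator (cball 0 (R + 1)) z"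
        proof (cases "norm z \<le> R + 1")
          case True
          have "\<bar>gradient \<phi> y $ i - gradient \<phi> z $ i\<bar> \<le> norm (gradient \<phi> y - gradient \<phi> z)"
            using component_le_norm_cart[of "gradient \<phi> y - gradient \<phi> z" i] by simp
          also have "\<dots> \<le> L * norm (y - z)" by (rule L)
          also have "\<dots> \<le> L * (1 / real (Suc n))" using d L(1) by (intro mult_left_mono) (auto simp: norm_minus_commute)
          finally show ?thesis using True by simp
        next
          case False
          then have "R < norm z" "R < norm y" using d1 norm_triangle_ineq2[of z y] by auto
          then show ?thesis using R(2) L(1) by simp
        qed
        then have "\<kappa> n (z - y) * \<bar>gradient \<phi> y $ i - gradient \<phi> z $ i\<bar> \<le> \<kappa> n (z - y) * (L / real (Suc n) * indicator (cball 0 (R + 1)) z)"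
          by (rule mult_left_mono) (rule k(2))
        then show ?thesis using k(2)[of n "z - y"] by (simp add: abs_mult flip: right_diff_distrib)
      qed simp
    qed
    also have "\<dots> = L / real (Suc n) * indicator (cball 0 (R + 1)) z" using i1 by simp
    finally show ?thesis .
  qed
  define H where "H = (\<Sum>i\<in>UNIV. LINT z|lborel. \<bar>indicator (cball 0 (R + 1)) z * h i z\<bar>)"
  have hI: "integrable lborel (\<lambda>z. indicator (cball 0 (R + 1)) z * h i z)" for i
    using h[of i] by (simp add: locally_integrable_def)
  have "\<bar>\<Sum>i\<in>UNIV. LINT z|lborel. h i z * gradient \<phi> z $ i\<bar> \<le> L / real (Suc n) * H" for n
  proof -
    have "(\<Sum>i\<in>UNIV. LINT z|lborel. h i z * gradient \<phi> z $ i) = (\<Sum>i\<in>UNIV. (LINT z|lborel. h i z * gradient \<phi> z $ i) - (LINT z|lborel. h i z * m n i z))"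
      by (simp only: sum_subtractf S0 diff_zero)
    also have "\<bar>\<dots>\<bar> \<le> (\<Sum>i\<in>UNIV. \<bar>(LINT z|lborel. h i z * gradient \<phi> z $ i) - (LINT z|lborel. h i z * m n i z)\<bar>)" by (rule sum_abs)
    also have "\<dots> \<le> (\<Sum>i\<in>UNIV. L / real (Suc n) * (LINT z|lborel. \<bar>indicator (cball 0 (R + 1)) z * h i z\<bar>))"
    proof (rule sum_mono)
      fix i
      have "\<bar>(LINT z|lborel. h i z * gradient \<phi> z $ i) - (LINT z|lborel. h i z * m n i z)\<bar> = \<bar>LINT z|lborel. h i z * gradient \<phi> z $ i - h i z * m n i z\<bar>"
        by (simp only: Bochner_Integration.integral_diff[OF I2 I1])
      also have "\<dots> \<le> (LINT z|lborel. \<bar>h i z * gradient \<phi> z $ i - h i z * m n i z\<bar>)" by (rule integral_abs_bound)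
      also have "\<dots> \<le> (LINT z|lborel. L / real (Suc n) * \<bar>indicator (cball 0 (R + 1)) z * h i z\<bar>)"
      proof (intro integral_mono integrable_abs Bochner_Integration.integrable_diff I1 I2 integrable_mult_right hI)
        fix z
        have "\<bar>h i z\<bar> * \<bar>m n i z - gradient \<phi> z $ i\<bar> \<le> \<bar>h i z\<bar> * (L / real (Suc n) * indicator (cball 0 (R + 1)) z)"
          by (rule mult_left_mono[OF dm]) simp
        moreover have "\<bar>h i z * gradient \<phi> z $ i - h i z * m n i z\<bar> = \<bar>h i z\<bar> * \<bar>m n i z - gradient \<phi> z $ i\<bar>"
          by (metis abs_mult abs_minus_commute right_diff_distrib)
        ultimately show "\<bar>h i z * gradient \<phi> z $ i - h i z * m n i z\<bar> \<le> L / real (Suc n) * \<bar>indicator (cball 0 (R + 1)) z * h i z\<bar>"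
          by (simp only: abs_mult mult_ac abs_indicator)
      qed
      finally show "\<bar>(LINT z|lborel. h i z * gradient \<phi> z $ i) - (LINT z|lborel. h i z * m n i z)\<bar> \<le> L / real (Suc n) * (LINT z|lborel. \<bar>indicator (cball 0 (R + 1)) z * h i z\<bar>)"
        by simp
    qed
    finally show ?thesis by (simp add: H_def sum_distrib_left)
  qed
  note bound = this
  have "(\<lambda>n. L / real (Suc n) * H) \<longlonglongrightarrow> 0"
    by (rule tendsto_mult_left_zero[OF LIMSEQ_Suc[OF lim_const_over_n]])
  then have "\<bar>\<Sum>i\<in>UNIV. LINT z|lborel. h i z * gradient \<phi> z $ i\<bar> \<le> 0"
    by (rule LIMSEQ_le_const) (use bound in blast)
  then show ?thesis by simp
qed

context flow
begin

text \<open>Duality on the probability space: the mollified divergence is, up to sign, the adjoint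
  expression \<open>J\<close>, and orthogonality to gradients of mollified bounded functions makes
  it orthogonal to a bounded function of the same sign.\<close>

lemma solenoidal_orbit_corr:
  fixes q :: "'n \<Rightarrow> 'w \<Rightarrow> real"
  assumes q: "\<And>i. integrable M (q i)" and k: "\<kappa> \<in> test_functions UNIV"
    and orth: "\<And>\<kappa> k. \<kappa> \<in> test_functions UNIV \<Longrightarrow> k \<in> borel_measurable M \<Longrightarrow> (\<And>w. \<bar>k w\<bar> \<le> 1) \<Longrightarrow>
      (\<Sum>i\<in>UNIV. LINT w|M. q i w * orbit_corr (\<lambda>z. gradient \<kappa> z $ i) k w) = 0"
  shows "AE w in M. (\<Sum>i\<in>UNIV. orbit_corr (\<lambda>z. gradient \<kappa> z $ i) (q i) w) = 0"
proof -
  have qm[measurable]: "q i \<in> borel_measurable M" for i using q by auto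
  \<comment> \<open>The adjoint runs the flow backwards; the reflected kernel compensates for
    this.\<close>
  define \<kappa>' where "\<kappa>' = (\<lambda>x. \<kappa> (- x))"
  have k': "\<kappa>' \<in> test_functions UNIV" unfolding \<kappa>'_def by (rule test_functions_reflect[OF k])
  have g': "gradient \<kappa>' y = - gradient \<kappa> (- y)" for y
    unfolding \<kappa>'_def by (rule gradient_reflect[OF test_functions_smooth[OF k]])
  have gi: "integrable lborel (\<lambda>y. gradient \<kappa>' y $ i)" for i
    by (rule test_functions_integrable[OF test_functions_gradient[OF k']])
  have gm[measurable]: "(\<lambda>y. gradient \<kappa> y $ i) \<in> borel_measurable borel" for i
    by (rule smooth_borel[OF test_functions_smooth[OF test_functions_gradient[OF k]]])
  define J where "J w = (\<Sum>i\<in>UNIV. LINT y|lborel. gradient \<kappa>' y $ i * q i (T (- y) w))" for w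
  \<comment> \<open>Bounded by 1 as required of an admissible \<open>k\<close>, and with the sign of
    \<open>J\<close>, so that \<open>b * J\<close> is nonnegative and vanishes only where
    \<open>J\<close> does.\<close>
  define b where "b w = J w / (1 + \<bar>J w\<bar>)" for w
  have b1: "\<bar>b w\<bar> \<le> 1" for w by (simp add: b_def abs_divide pos_divide_le_eq)
  have Ji: "integrable M J"
    unfolding J_def by (intro Bochner_Integration.integrable_sum orbit_adjoint(4)[OF q gi, of "\<lambda>_. 0"]) auto
  then have [measurable]: "J \<in> borel_measurable M" by auto
  have bm[measurable]: "b \<in> borel_measurable M" unfolding b_def by measurable
  \<comment> \<open>\<open>T 0\<close> is absorbed because \<open>T (- y)\<close> composed with
    \<open>T 0\<close> is \<open>T (- y)\<close>.\<close>
  have J0: "J (T 0 w) = J w" if "w \<in> space M" for w using that by (simp add: J_def flip: T_add)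
  note adj = orbit_adjoint[OF q gi bm b1]
  have "0 = (\<Sum>i\<in>UNIV. LINT w|M. q i w * orbit_corr (\<lambda>z. gradient \<kappa>' z $ i) b w)" using orth[OF k' bm b1] by simp
  also have "\<dots> = (LINT w|M. b (T 0 w) * J w)"
    using adj(2) by (simp add: adj(3) J_def sum_distrib_left)
  also have "\<dots> = (LINT w|M. b w * J w)"
    by (intro Bochner_Integration.integral_cong refl) (simp add: b_def J0)
  finally have bJ0: "(LINT w|M. b w * J w) = 0" by simp
  have bJ: "integrable M (\<lambda>w. b w * J w)"
    by (rule Bochner_Integration.integrable_bound[OF Ji]) (auto simp: abs_mult b1 mult_left_le_one_le intro!: AE_I2)
  have "AE w in M. b w * J w = 0"
    using bJ0 by (subst (asm) integral_nonneg_eq_0_iff_AE[OF bJ]) (auto simp: b_def zero_le_mult_iff intro!: AE_I2)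
  then show ?thesis
    using AE_space
  proof eventually_elim
    case (elim w)
    then have "J w = 0" by (auto simp: b_def)
    moreover have "(LINT y|lborel. gradient \<kappa>' y $ i * q i (T (- y) w)) = - orbit_corr (\<lambda>z. gradient \<kappa> z $ i) (q i) w" for i
    proof -
      note [measurable] = orbit_borel_measurable[OF elim(2) qm[of i]]
      have "(\<lambda>y. gradient \<kappa> y $ i * q i (T y w)) \<in> borel_measurable borel" by measurable
      from lborel_integral_reflect[OF this] show ?thesis by (simp add: g' orbit_corr_def)
    qed
    ultimately show ?case by (simp add: J_def sum_negf)
  qed
qed

text \<open>Countably many mollifiers give countably many null sets, and for an orbit outside them
  the deterministic \<open>mollified_divergence_0\<close> treats all test functions at once.\<close>

lemma solenoidal_orbit:
  fixes q :: "'n \<Rightarrow> 'w \<Rightarrow> real"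
  assumes q: "\<And>i. integrable M (q i)"
    and orth: "\<And>\<kappa> k. \<kappa> \<in> test_functions UNIV \<Longrightarrow> k \<in> borel_measurable M \<Longrightarrow> (\<And>w. \<bar>k w\<bar> \<le> 1) \<Longrightarrow>
      (\<Sum>i\<in>UNIV. LINT w|M. q i w * orbit_corr (\<lambda>z. gradient \<kappa> z $ i) k w) = 0"
  shows "AE w in M. \<forall>\<phi>\<in>test_functions UNIV. (\<Sum>i\<in>UNIV. LINT z|lborel. q i (T z w) * gradient \<phi> z $ i) = 0"
proof -
  have qm[measurable]: "q i \<in> borel_measurable M" for i using q by auto
  have "\<forall>n. \<exists>\<kappa> :: real ^ 'n \<Rightarrow> real. \<kappa> \<in> test_functions UNIV \<and> (\<forall>z. 0 \<le> \<kappa> z) \<and> (LINT z|lborel. \<kappa> z) = 1 \<and>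
      (\<forall>z. \<kappa> z \<noteq> 0 \<longrightarrow> norm z < 1 / real (Suc n))"
    by (intro allI mollifier_exists) simp
  then obtain \<kappa> :: "nat \<Rightarrow> real ^ 'n \<Rightarrow> real" where k: "\<And>n. \<kappa> n \<in> test_functions UNIV" "\<And>n z. 0 \<le> \<kappa> n z"
    "\<And>n. (LINT z|lborel. \<kappa> n z) = 1" "\<And>n z. \<kappa> n z \<noteq> 0 \<Longrightarrow> norm z < 1 / real (Suc n)"
    by metis
  have gm[measurable]: "(\<lambda>z. gradient (\<kappa> n) z $ i) \<in> borel_measurable borel" for n i
    by (rule smooth_borel[OF test_functions_smooth[OF test_functions_gradient[OF k(1)]]])
  define S where "S n w = (\<Sum>i\<in>UNIV. orbit_corr (\<lambda>z. gradient (\<kappa> n) z $ i) (q i) w)" for n w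
  have Sm[measurable]: "S n \<in> borel_measurable M" for n unfolding S_def orbit_corr_def by measurable
  have "AE w in M. \<forall>n. AE z in lborel. S n (T z w) = 0"
    unfolding AE_all_countable
  proof
    fix n
    have "AE w in M. S n w = 0"
      unfolding S_def by (rule solenoidal_orbit_corr[OF q k(1)]) (rule orth)
    then have "AE z in lborel. AE w in M. S n (T z w) = 0"
      using AE_T[of "\<lambda>w. S n w = 0"] by (metis (lifting) AE_I2)
    moreover have "(\<lambda>p. S n (T (fst p) (snd p))) \<in> borel_measurable (lborel \<Otimes>\<^sub>M M)"
      by (rule measurable_compose[OF _ Sm]) measurable
    then have "{p \<in> space (lborel \<Otimes>\<^sub>M M). S n (T (fst p) (snd p)) = 0} \<in> sets (lborel \<Otimes>\<^sub>M M)"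
      by (rule borel_measurable_eq[OF _ borel_measurable_const])
    ultimately show "AE w in M. AE z in lborel. S n (T z w) = 0"
      by (intro iffD1[OF lebesgue_M.AE_commute])
  qed
  moreover have "AE w in M. \<forall>i. locally_integrable (\<lambda>z. q i (T z w))"
    by (intro eventually_all_finite AE_locally_integrable q)
  ultimately show ?thesis
    using AE_space
  proof eventually_elim
    case (elim w)
    show ?case
    proof
      fix \<phi> :: "real ^ 'n \<Rightarrow> real" assume phi: "\<phi> \<in> test_functions UNIV"
      show "(\<Sum>i\<in>UNIV. LINT z|lborel. q i (T z w) * gradient \<phi> z $ i) = 0"
      proof (rule mollified_divergence_0[OF _ phi k])
        show "locally_integrable (\<lambda>z. q i (T z w))" for i using elim(2) by blast
        show "AE z in lborel. (\<Sum>i\<in>UNIV. corr (\<lambda>x. gradient (\<kappa> n) x $ i) (\<lambda>z. q i (T z w)) z) = 0" for n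
          using elim(1)[rule_format, of n] by eventually_elim (simp add: S_def orbit_corr_T[OF elim(3) qm gm])
      qed
    qed
  qed
qed

end

section \<open>Orbits in product spaces\<close>

lemma AE_pair_sections:
  assumes "finite_measure N" "finite_measure M" and P: "AE p in N \<Otimes>\<^sub>M M. P p"
  shows "AE w in M. AE x in N. P (x, w)"
proof -
  interpret N: finite_measure N by fact
  interpret M: finite_measure M by fact
  interpret NM: pair_sigma_finite N M ..
  interpret NM': pair_sigma_finite M N ..
  have "AE p in distr (M \<Otimes>\<^sub>M N) (N \<Otimes>\<^sub>M M) (\<lambda>(x, y). (y, x)). P p"
    using P by (simp only: NM.distr_pair_swap[symmetric])
  from AE_distrD[OF measurable_pair_swap' this]
  have "AE p in M \<Otimes>\<^sub>M N. P (case p of (x, y) \<Rightarrow> (y, x))" .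
  from NM'.AE_pair[OF this] show ?thesis by simp
qed

lemma AE_lborel_lebesgue_on:
  assumes "AE y in lborel. P y" "S \<in> sets lebesgue" shows "AE y in lebesgue_on S. P y"
proof -
  have "AE y in lebesgue. P y" by (rule AE_completion[OF assms(1)])
  then have "AE y in lebesgue. y \<in> S \<longrightarrow> P y" by eventually_elim simp
  then show ?thesis using assms(2) by (subst AE_restrict_space_iff) auto
qed

lemma L2_section_integral:
  fixes q :: "'a \<times> 'b \<Rightarrow> 'c::euclidean_space"
  assumes fin: "finite_measure N" "finite_measure Q" and q: "q \<in> L2 (N \<Otimes>\<^sub>M Q)"
  shows "(\<lambda>x. LINT y|Q. q (x, y)) \<in> L2 N"
    and "L2_nrm N (\<lambda>x. LINT y|Q. q (x, y)) \<le> sqrt (measure Q (space Q)) * L2_nrm (N \<Otimes>\<^sub>M Q) q"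
    and "AE x in N. (\<lambda>y. q (x, y)) \<in> L2 Q"
proof -
  interpret N: finite_measure N by fact
  interpret Q: finite_measure Q by fact
  interpret NQ: pair_sigma_finite N Q ..
  have qm[measurable]: "q \<in> borel_measurable (N \<Otimes>\<^sub>M Q)" by (rule L2_measurable[OF q])
  note qi = L2_integrable_sq[OF q]
  show sec: "AE x in N. (\<lambda>y. q (x, y)) \<in> L2 Q"
    using NQ.AE_integrable_fst'[OF qi] AE_space
    by eventually_elim (auto intro!: L2_I measurable_compose[OF measurable_Pair1' qm])
  have le: "AE x in N. (norm (LINT y|Q. q (x, y)))\<^sup>2 \<le> measure Q (space Q) * (LINT y|Q. (norm (q (x, y)))\<^sup>2)"
    using sec
  proof eventually_elim
    case (elim x)
    have "norm (LINT y|Q. q (x, y)) \<le> (LINT y|Q. norm (q (x, y)) * norm (1::real))" by simp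
    also have "\<dots> \<le> L2_nrm Q (\<lambda>y. q (x, y)) * L2_nrm Q (\<lambda>y. 1 :: real)"
      by (rule L2_Cauchy_Schwarz_norm[OF elim Q.L2_const])
    finally have "(norm (LINT y|Q. q (x, y)))\<^sup>2 \<le> (L2_nrm Q (\<lambda>y. q (x, y)) * L2_nrm Q (\<lambda>y. 1 :: real))\<^sup>2"
      by (rule power_mono) simp
    then show ?case by (simp add: power_mult_distrib L2_nrm_sq mult.commute)
  qed
  have I: "integrable N (\<lambda>x. measure Q (space Q) * (LINT y|Q. (norm (q (x, y)))\<^sup>2))"
    using NQ.integrable_fst'[OF qi] by simp
  have m: "(\<lambda>x. LINT y|Q. q (x, y)) \<in> borel_measurable N" by measurable
  show L: "(\<lambda>x. LINT y|Q. q (x, y)) \<in> L2 N" by (rule L2_dominated[OF m I le])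
  show "L2_nrm N (\<lambda>x. LINT y|Q. q (x, y)) \<le> sqrt (measure Q (space Q)) * L2_nrm (N \<Otimes>\<^sub>M Q) q"
  proof (rule L2_nrm_leI)
    have "(LINT x|N. (norm (LINT y|Q. q (x, y)))\<^sup>2) \<le> (LINT x|N. measure Q (space Q) * (LINT y|Q. (norm (q (x, y)))\<^sup>2))"
      by (rule integral_mono_AE[OF L2_integrable_sq[OF L] I le])
    also have "\<dots> = measure Q (space Q) * (LINT p|(N \<Otimes>\<^sub>M Q). (norm (q p))\<^sup>2)"
      using NQ.integral_fst'[OF qi] by simp
    finally show "(LINT x|N. (norm (LINT y|Q. q (x, y)))\<^sup>2) \<le> (sqrt (measure Q (space Q)) * L2_nrm (N \<Otimes>\<^sub>M Q) q)\<^sup>2"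
      by (simp add: power_mult_distrib L2_nrm_sq)
  qed simp
qed

context flow
begin

text \<open>Fubini on times and points, after enclosing the exceptional set, which need not be
  measurable, in a measurable null set.\<close>

lemma AE_orbit:
  assumes "AE w in M. P w" shows "AE w in M. AE y in lborel. P (T y w)"
proof -
  obtain Z where Z: "Z \<in> null_sets M" "{w \<in> space M. \<not> P w} \<subseteq> Z" using AE_E2 assms unfolding eventually_ae_filter by blast
  have [measurable]: "Z \<in> sets M" using Z(1) by auto
  have "AE w in M. w \<notin> Z" by (rule AE_not_in[OF Z(1)])
  then have "AE w in M. T y w \<notin> Z" for y by (rule AE_T)
  then have "AE y in lborel. AE w in M. T y w \<notin> Z" by simp
  moreover have "{p \<in> space (lborel \<Otimes>\<^sub>M M). T (fst p) (snd p) \<notin> Z} \<in> sets (lborel \<Otimes>\<^sub>M M)" by measurable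
  ultimately have "AE w in M. AE y in lborel. T y w \<notin> Z" by (intro iffD1[OF lebesgue_M.AE_commute])
  then show ?thesis
    using AE_space
  proof eventually_elim
    case (elim w)
    from elim(1) show ?case by eventually_elim (use Z(2) elim(2) T_space in blast)
  qed
qed

text \<open>The macroscopic variable becomes part of the measure space and is not moved. Statements
  about almost every orbit of the product then hold for almost every pair of \<open>x\<close> and
  \<omega>.\<close>

lemma product_flow:
  assumes "finite_measure N"
  shows "flow (N \<Otimes>\<^sub>M M) (\<lambda>y p. (fst p, T y (snd p)))"
proof -
  interpret N: finite_measure N by fact
  interpret NM: finite_measure "N \<Otimes>\<^sub>M M" by (rule finite_measure_pair[OF assms]) unfold_locales
  show ?thesis
  proof
    show "(\<lambda>(y, p). (fst p, T y (snd p))) \<in> measurable (borel \<Otimes>\<^sub>M (N \<Otimes>\<^sub>M M)) (N \<Otimes>\<^sub>M M)" by measurable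
    fix y
    have d: "distr M M (T y) = M" by (rule T_distr)
    have s: "sigma_finite_measure (distr M M (T y))" unfolding d ..
    have "distr N N (\<lambda>x. x) \<Otimes>\<^sub>M distr M M (T y) = distr (N \<Otimes>\<^sub>M M) (N \<Otimes>\<^sub>M M) (\<lambda>(x, w). (x, T y w))"
      by (rule pair_measure_distr[OF _ _ s]) auto
    then show "distr (N \<Otimes>\<^sub>M M) (N \<Otimes>\<^sub>M M) (\<lambda>p. (fst p, T y (snd p))) = N \<Otimes>\<^sub>M M"
      by (simp add: d distr_id2 case_prod_beta')
  next
    fix p y y' assume "p \<in> space (N \<Otimes>\<^sub>M M)"
    then show "(fst p, T (y + y') (snd p)) = (fst (fst p, T y' (snd p)), T y (snd (fst p, T y' (snd p))))"
      by (auto simp: space_pair_measure T_add)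
  qed
qed

text \<open>The bounded functions against which the product flow tests depend jointly on
  \<open>x\<close> and \<omega>. For each \<open>x\<close> their mollified gradients are potential
  fields by \<open>L2_pot_orbit_corr\<close>, so the hypothesis covers them.\<close>

lemma solenoidal_product:
  fixes q :: "'a \<Rightarrow> 'w \<Rightarrow> real ^ 'n"
  assumes N: "finite_measure N" and q: "(\<lambda>(x, w). q x w) \<in> L2 (N \<Otimes>\<^sub>M M)"
    and orth: "\<And>\<Phi>. (\<lambda>(x, w). \<Phi> x w) \<in> L2 (N \<Otimes>\<^sub>M M) \<Longrightarrow> (\<And>x. x \<in> space N \<Longrightarrow> \<Phi> x \<in> L2_pot M T) \<Longrightarrow>
      (LINT p|(N \<Otimes>\<^sub>M M). q (fst p) (snd p) \<bullet> \<Phi> (fst p) (snd p)) = 0"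
  shows "AE w in M. AE x in N. \<forall>\<phi>\<in>test_functions UNIV. (LINT z|lborel. q x (T z w) \<bullet> gradient \<phi> z) = 0"
proof -
  have M: "finite_measure M" by unfold_locales
  interpret X: flow "N \<Otimes>\<^sub>M M" "\<lambda>y p. (fst p, T y (snd p))" by (rule product_flow[OF N])
  have qL: "(\<lambda>p. q (fst p) (snd p)) \<in> L2 (N \<Otimes>\<^sub>M M)" using q by (simp add: case_prod_beta')
  have qi: "(\<lambda>p. q (fst p) (snd p) $ i) \<in> L2 (N \<Otimes>\<^sub>M M)" for i by (rule L2_component[OF qL])
  have "AE p in N \<Otimes>\<^sub>M M. \<forall>\<phi>\<in>test_functions UNIV.
      (\<Sum>i\<in>UNIV. LINT z|lborel. q (fst (fst p, T z (snd p))) (snd (fst p, T z (snd p))) $ i * gradient \<phi> z $ i) = 0"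
  proof (rule X.solenoidal_orbit)
    show "integrable (N \<Otimes>\<^sub>M M) (\<lambda>p. q (fst p) (snd p) $ i)" for i by (rule X.L2_integrable[OF qi])
    fix \<kappa> :: "real ^ 'n \<Rightarrow> real" and k assume k: "\<kappa> \<in> test_functions UNIV" and km[measurable]: "k \<in> borel_measurable (N \<Otimes>\<^sub>M M)"
      and k1: "\<And>w. \<bar>k w\<bar> \<le> (1::real)"
    define \<Phi> where "\<Phi> x w = (\<chi> i. - orbit_corr (\<lambda>z. gradient \<kappa> z $ i) (\<lambda>w. k (x, w)) w)" for x w
    have eq: "\<Phi> (fst p) (snd p) $ i = - X.orbit_corr (\<lambda>z. gradient \<kappa> z $ i) k p" for p i
      by (simp add: \<Phi>_def orbit_corr_def X.orbit_corr_def)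
    have kL: "k \<in> L2 (N \<Otimes>\<^sub>M M)" by (rule X.L2_bounded[OF km, of 1]) (simp add: k1)
    have oL: "X.orbit_corr (\<lambda>z. gradient \<kappa> z $ i) k \<in> L2 (N \<Otimes>\<^sub>M M)" for i
      by (rule X.orbit_corr_L2[OF test_functions_integrable[OF test_functions_gradient[OF k]] kL])
    have PL: "(\<lambda>p. \<Phi> (fst p) (snd p)) \<in> L2 (N \<Otimes>\<^sub>M M)"
      by (rule L2_vecI) (simp add: eq L2_uminus oL)
    have "(LINT p|(N \<Otimes>\<^sub>M M). q (fst p) (snd p) \<bullet> \<Phi> (fst p) (snd p)) = 0"
    proof (rule orth)
      show "(\<lambda>(x, w). \<Phi> x w) \<in> L2 (N \<Otimes>\<^sub>M M)" using PL by (simp add: case_prod_beta')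
      show "\<Phi> x \<in> L2_pot M T" if "x \<in> space N" for x
        unfolding \<Phi>_def using that by (intro L2_pot_orbit_corr[OF k, of _ 1] k1) measurable
    qed
    moreover have "(LINT p|(N \<Otimes>\<^sub>M M). q (fst p) (snd p) \<bullet> \<Phi> (fst p) (snd p)) =
        (\<Sum>i\<in>UNIV. LINT p|(N \<Otimes>\<^sub>M M). - (q (fst p) (snd p) $ i * X.orbit_corr (\<lambda>z. gradient \<kappa> z $ i) k p))"
      unfolding inner_vec_def by (subst Bochner_Integration.integral_sum[symmetric]) (auto simp: eq intro!: L2_mult_integrable qi oL)
    ultimately show "(\<Sum>i\<in>UNIV. LINT p|(N \<Otimes>\<^sub>M M). q (fst p) (snd p) $ i * X.orbit_corr (\<lambda>z. gradient \<kappa> z $ i) k p) = 0"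
      by (simp add: sum_negf)
  qed
  then have A: "AE w in M. AE x in N. \<forall>\<phi>\<in>test_functions UNIV.
      (\<Sum>i\<in>UNIV. LINT z|lborel. q x (T z w) $ i * gradient \<phi> z $ i) = 0"
    using AE_pair_sections[OF N M] by fastforce
  have "AE p in N \<Otimes>\<^sub>M M. \<forall>i. locally_integrable (\<lambda>z. q (fst (fst p, T z (snd p))) (snd (fst p, T z (snd p))) $ i)"
    by (intro eventually_all_finite X.AE_locally_integrable X.L2_integrable qi)
  then have B: "AE w in M. AE x in N. \<forall>i. locally_integrable (\<lambda>z. q x (T z w) $ i)"
    using AE_pair_sections[OF N M] by fastforce
  show ?thesis
    using A B
  proof eventually_elim
    case (elim w)
    show ?case
      using elim
    proof eventually_elim
      case (elim x)
      show ?case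
      proof
        fix \<phi> :: "real ^ 'n \<Rightarrow> real" assume phi: "\<phi> \<in> test_functions UNIV"
        have "integrable lborel (\<lambda>z. q x (T z w) $ i * gradient \<phi> z $ i)" for i
          using corr_integrable[OF test_functions_gradient[OF phi] elim(2)[rule_format], of 0] by (simp add: mult.commute)
        then have "(LINT z|lborel. q x (T z w) \<bullet> gradient \<phi> z) = (\<Sum>i\<in>UNIV. LINT z|lborel. q x (T z w) $ i * gradient \<phi> z $ i)"
          by (simp add: inner_vec_def)
        then show "(LINT z|lborel. q x (T z w) \<bullet> gradient \<phi> z) = 0" using elim(1) phi by simp
      qed
    qed
  qed
qed

lemma orbit_product_measurable:
  assumes F: "(\<lambda>(x, w). F x w) \<in> measurable (N \<Otimes>\<^sub>M M) L" and wa: "w \<in> space M"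
  shows "(\<lambda>(x, y). F x (T y w)) \<in> measurable (N \<Otimes>\<^sub>M lebesgue_on S) L"
proof -
  have "(\<lambda>y. T y w) \<in> measurable (lebesgue_on S) M"
    by (rule measurable_lebesgue_on_borel[OF orbit_measurable[OF wa]])
  then have "(\<lambda>p. (fst p, T (snd p) w)) \<in> measurable (N \<Otimes>\<^sub>M lebesgue_on S) (N \<Otimes>\<^sub>M M)"
    by (intro measurable_Pair measurable_fst measurable_compose[OF measurable_snd])
  from measurable_compose[OF this F] show ?thesis by (simp add: case_prod_beta')
qed

end

context ergodic_flow
begin

text \<open>The square is integrated over \<open>x\<close> first, which leaves a scalar integrable
  function \<open>h\<close> of \<omega>; its averages along the orbit are the normalised squared
  norms over the cubes. The null set does not depend on \<rho>.\<close>

lemma L2_orbit_ergodic: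
  fixes F :: "'a \<Rightarrow> 'w \<Rightarrow> 'b::euclidean_space"
  assumes N: "finite_measure N" and F: "(\<lambda>(x, w). F x w) \<in> L2 (N \<Otimes>\<^sub>M M)"
  shows "AE w in M. (\<forall>\<rho>>0. (\<lambda>(x, y). F x (T y w)) \<in> L2 (N \<Otimes>\<^sub>M lebesgue_on (cube \<rho>))) \<and>
    ((\<lambda>\<rho>. L2_nrm (N \<Otimes>\<^sub>M lebesgue_on (cube \<rho>)) (\<lambda>(x, y). F x (T y w)) / sqrt (measure lebesgue (cube \<rho> :: (real ^ 'n) set)))
      \<longlongrightarrow> L2_nrm (N \<Otimes>\<^sub>M M) (\<lambda>(x, w). F x w)) at_top"
proof -
  interpret N: finite_measure N by fact
  interpret NM: pair_sigma_finite N M ..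
  let ?f = "\<lambda>p. (norm (F (fst p) (snd p)))\<^sup>2"
  have fI: "integrable (N \<Otimes>\<^sub>M M) ?f" using L2_integrable_sq[OF F] by (simp add: case_prod_beta')
  then have fm[measurable]: "?f \<in> borel_measurable (N \<Otimes>\<^sub>M M)" by auto
  define h where "h w = (LINT x|N. ?f (x, w))" for w
  have hI: "integrable M h" using NM.integrable_snd[of "\<lambda>x w. ?f (x, w)"] fI by (simp add: h_def[abs_def] case_prod_beta')
  have hint: "(LINT w|M. h w) = (L2_nrm (N \<Otimes>\<^sub>M M) (\<lambda>(x, w). F x w))\<^sup>2"
    using NM.integral_snd[of "\<lambda>x w. ?f (x, w)"] fI by (simp add: h_def L2_nrm_sq case_prod_beta')
  have h0: "0 \<le> h w" for w unfolding h_def by (intro integral_nonneg_AE AE_I2) simp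
  have "AE w in M. integrable N (\<lambda>x. ?f (x, w))"
    using NM.AE_integrable_snd[of "\<lambda>x w. ?f (x, w)"] fI by (simp add: case_prod_beta')
  \<comment> \<open>\<open>AE_orbit\<close> will carry this identity from almost every point to
    almost every time on almost every orbit, which is enough inside an integral over the
    cube.\<close>
  then have "AE w in M. (\<integral>\<^sup>+ x. ennreal (?f (x, w)) \<partial>N) = ennreal (h w)"
    by eventually_elim (unfold h_def, rule nn_integral_eq_integral, auto)
  from AE_orbit[OF this] AE_orbit_int[OF hI] pointwise_ergodic[OF hI] AE_space
  show ?thesis
  proof eventually_elim
    case (elim w)
    let ?Q = "\<lambda>\<rho>. lebesgue_on (cube \<rho> :: (real ^ 'n) set)"
    have FT: "(\<lambda>p. F (fst p) (T (snd p) w)) \<in> borel_measurable (N \<Otimes>\<^sub>M ?Q \<rho>)" for \<rho>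
      using orbit_product_measurable[OF L2_measurable[OF F] elim(4)] by (simp add: case_prod_beta')
    have hm: "(\<lambda>y. h (T y w)) \<in> borel_measurable borel" using hI by (intro orbit_borel_measurable[OF elim(4)]) auto
    have nn: "(\<integral>\<^sup>+ p. ennreal (?f (fst p, T (snd p) w)) \<partial>(N \<Otimes>\<^sub>M ?Q \<rho>)) = ennreal ((2 * \<rho>) ^ CARD('n) * avg \<rho> h w)" if r: "0 < \<rho>" for \<rho>
    proof -
      interpret Q: finite_measure "?Q \<rho>" by (rule finite_measure_lebesgue_on_open) auto
      interpret NQ: pair_sigma_finite N "?Q \<rho>" ..
      note [measurable] = FT[of \<rho>]
      have "(\<integral>\<^sup>+ p. ennreal (?f (fst p, T (snd p) w)) \<partial>(N \<Otimes>\<^sub>M ?Q \<rho>)) = (\<integral>\<^sup>+ y. (\<integral>\<^sup>+ x. ennreal (?f (x, T y w)) \<partial>N) \<partial>?Q \<rho>)"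
        by (subst NQ.nn_integral_snd[symmetric]) simp_all
      also have "\<dots> = (\<integral>\<^sup>+ y. ennreal (h (T y w)) \<partial>?Q \<rho>)"
        by (rule nn_integral_cong_AE, rule AE_lborel_lebesgue_on[OF elim(1)]) simp
      also have "\<dots> = ennreal (LINT y|?Q \<rho>. h (T y w))"
        using elim(2) by (intro nn_integral_eq_integral) (auto simp: integrable_lebesgue_on_borel[OF hm] orbit_int_def h0)
      also have "(LINT y|?Q \<rho>. h (T y w)) = (2 * \<rho>) ^ CARD('n) * avg \<rho> h w"
        using r by (simp add: avg_def integral_lebesgue_on_borel[OF hm])
      finally show ?thesis .
    qed
    have L: "(\<lambda>(x, y). F x (T y w)) \<in> L2 (N \<Otimes>\<^sub>M ?Q \<rho>)" if "0 < \<rho>" for \<rho>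
      using FT nn[OF that] by (auto simp: case_prod_beta' intro!: L2_I integrableI_bounded)
    have nrm: "L2_nrm (N \<Otimes>\<^sub>M ?Q \<rho>) (\<lambda>(x, y). F x (T y w)) / sqrt (measure lebesgue (cube \<rho> :: (real ^ 'n) set)) = sqrt (avg \<rho> h w)"
      if r: "0 < \<rho>" for \<rho>
    proof -
      have a0: "0 \<le> avg \<rho> h w" using r h0 by (auto simp: avg_def intro!: divide_nonneg_nonneg integral_nonneg_AE AE_I2)
      have "ennreal (LINT p|(N \<Otimes>\<^sub>M ?Q \<rho>). ?f (fst p, T (snd p) w)) = ennreal ((2 * \<rho>) ^ CARD('n) * avg \<rho> h w)"
        unfolding nn[OF r, symmetric] using L2_integrable_sq[OF L[OF r]]
        by (intro nn_integral_eq_integral[symmetric]) (auto simp: case_prod_beta')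
      then have "(LINT p|(N \<Otimes>\<^sub>M ?Q \<rho>). ?f (fst p, T (snd p) w)) = (2 * \<rho>) ^ CARD('n) * avg \<rho> h w"
        using r a0 by (subst (asm) ennreal_inj) (auto intro!: integral_nonneg_AE)
      then show ?thesis
        using r by (simp add: L2_nrm_def case_prod_beta' measure_cube real_sqrt_mult power_mult_distrib)
    qed
    have "((\<lambda>\<rho>. sqrt (avg \<rho> h w)) \<longlongrightarrow> L2_nrm (N \<Otimes>\<^sub>M M) (\<lambda>(x, w). F x w)) at_top"
      using tendsto_real_sqrt[OF elim(3)] by (simp add: hint)
    then have "((\<lambda>\<rho>. L2_nrm (N \<Otimes>\<^sub>M ?Q \<rho>) (\<lambda>(x, y). F x (T y w)) / sqrt (measure lebesgue (cube \<rho> :: (real ^ 'n) set)))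
      \<longlongrightarrow> L2_nrm (N \<Otimes>\<^sub>M M) (\<lambda>(x, w). F x w)) at_top"
      by (rule Lim_transform_eventually) (rule eventually_mono[OF eventually_gt_at_top[of 0]], rule nrm[symmetric])
    with L show ?case by blast
  qed
qed

end

section \<open>The energy estimate\<close>

lemma borel_measurable_matrix_vector_mult:
  fixes B :: "'a \<Rightarrow> real ^ 'n::finite ^ 'm::finite"
  assumes B: "B \<in> borel_measurable M" and h: "h \<in> borel_measurable M"
  shows "(\<lambda>p. B p *v h p) \<in> borel_measurable M"
proof (rule borel_measurable_vecI)
  fix i
  have "(\<lambda>A :: real ^ 'n ^ 'm. A $ i $ j) \<in> borel_measurable borel" "(\<lambda>v :: real ^ 'n. v $ j) \<in> borel_measurable borel" for j
    by (intro borel_measurable_continuous_onI continuous_intros)+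
  then have [measurable]: "(\<lambda>p. B p $ i $ j) \<in> borel_measurable M" "(\<lambda>p. h p $ j) \<in> borel_measurable M" for j
    using measurable_compose[OF B] measurable_compose[OF h] by blast+
  show "(\<lambda>p. (B p *v h p) $ i) \<in> borel_measurable M" by (simp add: matrix_vector_mult_def)
qed

lemma norm_le_of_inner_le:
  assumes "\<And>\<zeta>. b \<bullet> \<zeta> \<le> c * norm (\<zeta> :: 'a::real_inner)" "0 \<le> c"
  shows "norm b \<le> c"
proof (cases "b = 0")
  case False
  have "norm b * norm b \<le> c * norm b" using assms(1)[of b] by (simp add: power2_norm_eq_inner[symmetric] power2_eq_square)
  then show ?thesis using False by simp
qed (use assms in simp)

definition elliptic :: "real \<Rightarrow> real \<Rightarrow> real ^ 'n::finite ^ 'n \<Rightarrow> bool" where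
  "elliptic c1 c2 B \<longleftrightarrow>
    (\<forall>\<xi> \<zeta>. c1 * (norm \<xi>)\<^sup>2 \<le> (B *v \<xi>) \<bullet> \<xi> \<and> (B *v \<xi>) \<bullet> \<zeta> \<le> c2 * norm \<xi> * norm \<zeta>)"

lemma L2_matrix_vector_mult:
  fixes B :: "'a \<Rightarrow> real ^ 'n::finite ^ 'n"
  assumes B: "B \<in> borel_measurable P" and c2: "0 < c2" and h: "h \<in> L2 P"
    and ell: "AE p in P. elliptic c1 c2 (B p)"
  shows "(\<lambda>p. B p *v h p) \<in> L2 P" "L2_nrm P (\<lambda>p. B p *v h p) \<le> c2 * L2_nrm P h"
proof -
  have le: "AE p in P. (norm (B p *v h p))\<^sup>2 \<le> c2\<^sup>2 * (norm (h p))\<^sup>2"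
    using ell
  proof eventually_elim
    case (elim p)
    have "norm (B p *v h p) \<le> c2 * norm (h p)" using elim c2 by (intro norm_le_of_inner_le) (auto simp: elliptic_def)
    from power_mono[OF this, of 2] show ?case by (simp add: power_mult_distrib)
  qed
  have I: "integrable P (\<lambda>p. c2\<^sup>2 * (norm (h p))\<^sup>2)" using L2_integrable_sq[OF h] by simp
  show L: "(\<lambda>p. B p *v h p) \<in> L2 P"
    by (rule L2_dominated[OF borel_measurable_matrix_vector_mult[OF B L2_measurable[OF h]] I le])
  show "L2_nrm P (\<lambda>p. B p *v h p) \<le> c2 * L2_nrm P h"
  proof (rule L2_nrm_leI)
    have "(LINT p|P. (norm (B p *v h p))\<^sup>2) \<le> (LINT p|P. c2\<^sup>2 * (norm (h p))\<^sup>2)"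
      by (rule integral_mono_AE[OF L2_integrable_sq[OF L] I le])
    then show "(LINT p|P. (norm (B p *v h p))\<^sup>2) \<le> (c2 * L2_nrm P h)\<^sup>2" by (simp add: power_mult_distrib L2_nrm_sq)
  qed (use c2 in simp)
qed

lemma L2_fst:
  fixes f :: "'a \<Rightarrow> 'c::euclidean_space"
  assumes fin: "finite_measure N" "finite_measure Q" and f: "f \<in> L2 N"
  shows "(\<lambda>p. f (fst p)) \<in> L2 (N \<Otimes>\<^sub>M Q)"
    and "(L2_nrm (N \<Otimes>\<^sub>M Q) (\<lambda>p. f (fst p)))\<^sup>2 = measure Q (space Q) * (L2_nrm N f)\<^sup>2"
proof -
  interpret N: finite_measure N by fact
  interpret Q: finite_measure Q by fact
  interpret NQ: pair_sigma_finite N Q ..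
  have [measurable]: "f \<in> borel_measurable N" by (rule L2_measurable[OF f])
  have I: "integrable (N \<Otimes>\<^sub>M Q) (\<lambda>p. (norm (f (fst p)))\<^sup>2)"
    using L2_integrable_sq[OF f] by (intro NQ.Fubini_integrable) (auto simp: mult.commute)
  then show "(\<lambda>p. f (fst p)) \<in> L2 (N \<Otimes>\<^sub>M Q)" by (intro L2_I) measurable
  show "(L2_nrm (N \<Otimes>\<^sub>M Q) (\<lambda>p. f (fst p)))\<^sup>2 = measure Q (space Q) * (L2_nrm N f)\<^sup>2"
    using NQ.integral_fst'[OF I] by (simp add: L2_nrm_sq)
qed

lemma integral_inner_fst:
  fixes q :: "'a \<times> 'b \<Rightarrow> 'c::euclidean_space"
  assumes fin: "finite_measure N" "finite_measure Q" and q: "q \<in> L2 (N \<Otimes>\<^sub>M Q)" and f: "f \<in> L2 N"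
  shows "(LINT p|(N \<Otimes>\<^sub>M Q). q p \<bullet> f (fst p)) = (LINT x|N. (LINT y|Q. q (x, y)) \<bullet> f x)"
proof -
  interpret N: finite_measure N by fact
  interpret Q: finite_measure Q by fact
  interpret NQ: pair_sigma_finite N Q ..
  note I = L2_inner_integrable[OF q L2_fst(1)[OF fin f]]
  have "(LINT p|(N \<Otimes>\<^sub>M Q). q p \<bullet> f (fst p)) = (LINT x|N. LINT y|Q. q (x, y) \<bullet> f x)"
    using NQ.integral_fst'[OF I] by simp
  also have "\<dots> = (LINT x|N. (LINT y|Q. q (x, y)) \<bullet> f x)"
  proof (rule integral_cong_AE)
    show "AE x in N. (LINT y|Q. q (x, y) \<bullet> f x) = (LINT y|Q. q (x, y)) \<bullet> f x"
      using L2_section_integral(3)[OF fin q] by eventually_elim (rule integral_inner_left, rule Q.L2_integrable)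
    show "(\<lambda>x. LINT y|Q. q (x, y) \<bullet> f x) \<in> borel_measurable N" using NQ.integrable_fst'[OF I] by simp
    show "(\<lambda>x. (LINT y|Q. q (x, y)) \<bullet> f x) \<in> borel_measurable N"
      using L2_inner_integrable[OF L2_section_integral(1)[OF fin q] f] by simp
  qed
  finally show ?thesis .
qed

text \<open>Here \<open>g\<close> is the homogenised gradient with flux \<open>m\<close>, \<open>d\<close> is the error of the corrector, and
  \<open>e0\<close>, \<open>e1\<close> are the macroscopic and microscopic parts of the remaining error; they are orthogonal
  because \<open>e1\<close> has mean 0 in the second variable.\<close>

lemma two_scale_energy:
  fixes B :: "'a \<times> 'b \<Rightarrow> real ^ 'n::finite ^ 'n" and g d e1 :: "'a \<times> 'b \<Rightarrow> real ^ 'n" and e0 m :: "'a \<Rightarrow> real ^ 'n"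
  assumes fin: "finite_measure N" "finite_measure Q" and c: "c = measure Q (space Q)" "0 < c"
    and B: "B \<in> borel_measurable (N \<Otimes>\<^sub>M Q)" and c12: "0 < c1" "0 < c2"
    and ell: "AE p in N \<Otimes>\<^sub>M Q. elliptic c1 c2 (B p)"
    and L: "g \<in> L2 (N \<Otimes>\<^sub>M Q)" "d \<in> L2 (N \<Otimes>\<^sub>M Q)" "e1 \<in> L2 (N \<Otimes>\<^sub>M Q)" "e0 \<in> L2 N" "m \<in> L2 N"
    and mean: "AE x in N. \<forall>v. (LINT y|Q. v \<bullet> e1 (x, y)) = 0"
    and eq1: "(LINT p|(N \<Otimes>\<^sub>M Q). (B p *v (g p - d p + e0 (fst p) + e1 p)) \<bullet> (e0 (fst p) + e1 p)) = c * (LINT x|N. m x \<bullet> e0 x)"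
    and eq2: "(LINT p|(N \<Otimes>\<^sub>M Q). (B p *v g p) \<bullet> e1 p) = 0"
  shows "L2_nrm (N \<Otimes>\<^sub>M Q) (\<lambda>p. d p - e1 p) \<le> L2_nrm (N \<Otimes>\<^sub>M Q) d +
    (sqrt c * L2_nrm N (\<lambda>x. m x - (1 / c) *\<^sub>R (LINT y|Q. B (x, y) *v g (x, y))) + c2 * L2_nrm (N \<Otimes>\<^sub>M Q) d) / c1"
proof -
  interpret N: finite_measure N by fact
  interpret Q: finite_measure Q by fact
  interpret NQ: pair_sigma_finite N Q ..
  let ?P = "N \<Otimes>\<^sub>M Q"
  define e where "e p = e0 (fst p) + e1 p" for p
  note e0P = L2_fst[OF fin L(4)]
  have eL: "e \<in> L2 ?P" unfolding e_def by (rule L2_add[OF e0P(1) L(3)])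
  note BL = L2_matrix_vector_mult(1)[OF B c12(2) _ ell]
  define r where "r x = m x - (1 / c) *\<^sub>R (LINT y|Q. B (x, y) *v g (x, y))" for x
  have qL: "(\<lambda>x. LINT y|Q. B (x, y) *v g (x, y)) \<in> L2 N" using L2_section_integral(1)[OF fin BL[OF L(1)]] by simp
  have rL: "r \<in> L2 N" unfolding r_def by (intro L2_diff L L2_scaleR qL)
  have cross: "(LINT p|?P. e0 (fst p) \<bullet> e1 p) = 0"
  proof -
    have "(LINT p|?P. e0 (fst p) \<bullet> e1 p) = (LINT x|N. LINT y|Q. e0 x \<bullet> e1 (x, y))"
      using NQ.integral_fst'[OF L2_inner_integrable[OF e0P(1) L(3)]] by simp
    also have "\<dots> = 0" by (rule integral_eq_zero_AE) (use mean in eventually_elim, simp)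
    finally show ?thesis .
  qed
  \<comment> \<open>Pythagoras: the mixed term vanishes, and the square of a function of the first
    variable alone acquires the factor \<open>c\<close>.\<close>
  have enorm: "(L2_nrm ?P e)\<^sup>2 = c * (L2_nrm N e0)\<^sup>2 + (L2_nrm ?P e1)\<^sup>2"
  proof -
    have "(LINT p|?P. (norm (e p))\<^sup>2) = (LINT p|?P. (norm (e0 (fst p)))\<^sup>2 + (norm (e1 p))\<^sup>2 + 2 * (e0 (fst p) \<bullet> e1 p))"
      by (simp add: e_def power2_norm_eq_inner inner_simps inner_commute algebra_simps)
    also have "\<dots> = (LINT p|?P. (norm (e0 (fst p)))\<^sup>2) + (LINT p|?P. (norm (e1 p))\<^sup>2)"
      using L2_integrable_sq[OF e0P(1)] L2_integrable_sq[OF L(3)] L2_inner_integrable[OF e0P(1) L(3)] cross by simp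
    finally show ?thesis using e0P(2) by (simp add: L2_nrm_sq c(1))
  qed
  have e1le: "L2_nrm ?P e1 \<le> L2_nrm ?P e" by (rule power2_le_imp_le) (use enorm c(2) in simp_all)
  have e0le: "sqrt c * L2_nrm N e0 \<le> L2_nrm ?P e"
    by (rule power2_le_imp_le) (use enorm c(2) in \<open>simp_all add: power_mult_distrib\<close>)
  have s1: "(LINT p|?P. (B p *v g p) \<bullet> e p) = (LINT x|N. (LINT y|Q. B (x, y) *v g (x, y)) \<bullet> e0 x)"
  proof -
    have "(LINT p|?P. (B p *v g p) \<bullet> e p) = (LINT p|?P. (B p *v g p) \<bullet> e0 (fst p)) + (LINT p|?P. (B p *v g p) \<bullet> e1 p)"
      unfolding e_def inner_add_right
      by (rule Bochner_Integration.integral_add[OF L2_inner_integrable[OF BL[OF L(1)] e0P(1)] L2_inner_integrable[OF BL[OF L(1)] L(3)]])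
    also have "\<dots> = (LINT x|N. (LINT y|Q. B (x, y) *v g (x, y)) \<bullet> e0 x)"
      using integral_inner_fst[OF fin BL[OF L(1)] L(4)] eq2 by simp
    finally show ?thesis .
  qed
  \<comment> \<open>With \<open>h = g - d + e\<close> the gradient of the solution on the cube, the
    flux of \<open>e\<close> is \<open>B h - B g + B d\<close>. Paired with \<open>e\<close>, the
    first term is evaluated by \<open>eq1\<close>, and \<open>eq2\<close> has removed the
    microscopic part of the second.\<close>
  have s2: "(LINT p|?P. (B p *v e p) \<bullet> e p) = c * (LINT x|N. m x \<bullet> e0 x) - (LINT x|N. (LINT y|Q. B (x, y) *v g (x, y)) \<bullet> e0 x) + (LINT p|?P. (B p *v d p) \<bullet> e p)"
  proof -
    have pt: "(B p *v e p) \<bullet> e p = (B p *v (g p - d p + e0 (fst p) + e1 p)) \<bullet> e p - (B p *v g p) \<bullet> e p + (B p *v d p) \<bullet> e p" for p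
      by (simp add: e_def matrix_vector_mult_diff_distrib matrix_vector_right_distrib inner_simps)
    have "(\<lambda>p. g p - d p + e0 (fst p) + e1 p) \<in> L2 ?P" by (intro L2_add L2_diff L e0P(1))
    from L2_inner_integrable[OF BL[OF this] eL] L2_inner_integrable[OF BL[OF L(1)] eL] L2_inner_integrable[OF BL[OF L(2)] eL]
    show ?thesis unfolding pt using eq1 by (simp add: s1[unfolded e_def] e_def)
  qed
  have s3: "c * (LINT x|N. m x \<bullet> e0 x) - (LINT x|N. (LINT y|Q. B (x, y) *v g (x, y)) \<bullet> e0 x) = c * (LINT x|N. r x \<bullet> e0 x)"
    using L2_inner_integrable[OF L(5) L(4)] L2_inner_integrable[OF qL L(4)] c(2)
    by (simp add: r_def inner_simps right_diff_distrib)
  have "c1 * (L2_nrm ?P e)\<^sup>2 = (LINT p|?P. c1 * (norm (e p))\<^sup>2)" by (simp add: L2_nrm_sq)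
  also have "\<dots> \<le> (LINT p|?P. (B p *v e p) \<bullet> e p)"
  proof (rule integral_mono_AE)
    show "integrable ?P (\<lambda>p. c1 * (norm (e p))\<^sup>2)" using L2_integrable_sq[OF eL] by simp
    show "integrable ?P (\<lambda>p. (B p *v e p) \<bullet> e p)" by (rule L2_inner_integrable[OF BL[OF eL] eL])
    show "AE p in ?P. c1 * (norm (e p))\<^sup>2 \<le> (B p *v e p) \<bullet> e p" using ell by eventually_elim (simp add: elliptic_def)
  qed
  also have "\<dots> = c * (LINT x|N. r x \<bullet> e0 x) + (LINT p|?P. (B p *v d p) \<bullet> e p)" using s2 s3 by simp
  also have "\<dots> \<le> c * (L2_nrm N r * L2_nrm N e0) + L2_nrm ?P (\<lambda>p. B p *v d p) * L2_nrm ?P e"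
    using L2_Cauchy_Schwarz[OF rL L(4)] L2_Cauchy_Schwarz[OF BL[OF L(2)] eL] c(2)
    by (intro add_mono mult_left_mono) auto
  also have "\<dots> \<le> (sqrt c * L2_nrm N r) * L2_nrm ?P e + (c2 * L2_nrm ?P d) * L2_nrm ?P e"
  proof (intro add_mono mult_right_mono)
    \<comment> \<open>\<open>c\<close> is split into two roots, because
      \<open>sqrt c * L2_nrm N e0\<close> is the norm of \<open>e0\<close> on the product.\<close>
    have "c * (L2_nrm N r * L2_nrm N e0) = (sqrt c * L2_nrm N r) * (sqrt c * L2_nrm N e0)" using c(2) by simp
    also have "\<dots> \<le> (sqrt c * L2_nrm N r) * L2_nrm ?P e" using e0le c(2) by (intro mult_left_mono) auto
    finally show "c * (L2_nrm N r * L2_nrm N e0) \<le> (sqrt c * L2_nrm N r) * L2_nrm ?P e" .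
  qed (use L2_matrix_vector_mult(2)[OF B c12(2) L(2) ell] in auto)
  finally have "(c1 * L2_nrm ?P e) * L2_nrm ?P e \<le> (sqrt c * L2_nrm N r + c2 * L2_nrm ?P d) * L2_nrm ?P e"
    by (simp add: power2_eq_square distrib_right mult.assoc)
  moreover have "0 \<le> sqrt c * L2_nrm N r + c2 * L2_nrm ?P d" using c(2) c12 by simp
  ultimately have "c1 * L2_nrm ?P e \<le> sqrt c * L2_nrm N r + c2 * L2_nrm ?P d"
    using L2_nrm_nonneg[of ?P e] by (cases "L2_nrm ?P e = 0") auto
  then have "L2_nrm ?P e \<le> (sqrt c * L2_nrm N r + c2 * L2_nrm ?P d) / c1" using c12 by (simp add: pos_le_divide_eq mult.commute)
  moreover have "L2_nrm ?P (\<lambda>p. d p - e1 p) \<le> L2_nrm ?P d + L2_nrm ?P e1"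
    using L2_triangle[OF L(2) L2_uminus[OF L(3)]] by (simp add: L2_nrm_uminus)
  ultimately show ?thesis using e1le by (simp add: r_def[abs_def])
qed

text \<open>A steep bump on a slightly smaller cube. Bumps stay below 1, so the cut-off is only
  close to 1 on \<open>cube r\<close>, which is enough for an estimate up to
  \<open>e\<close>.\<close>

lemma cutoff_exists:
  assumes e: "0 < e"
  shows "\<exists>(\<eta> :: real ^ 'n::finite \<Rightarrow> real) r. \<eta> \<in> test_functions (cube 1) \<and> 0 < r \<and> r < 1 \<and> 1 - r ^ CARD('n) \<le> e \<and>
    (\<forall>y. 0 \<le> \<eta> y \<and> \<eta> y \<le> 1) \<and> (\<forall>y\<in>cube r. 1 - e \<le> \<eta> y)"
proof -
  have "((\<lambda>r::real. 1 - r ^ CARD('n)) \<longlongrightarrow> 0) (at_left 1)" by (auto intro!: tendsto_eq_intros)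
  then have "\<forall>\<^sub>F r in at_left (1::real). 1 - r ^ CARD('n) < e" using e by (rule order_tendstoD)
  then have "\<forall>\<^sub>F r in at_left (1::real). 1 - r ^ CARD('n) < e \<and> r \<in> {0<..<1}"
    by (rule eventually_conj) (rule eventually_at_left_real, simp)
  then obtain r :: real where r: "1 - r ^ CARD('n) < e" "0 < r" "r < 1"
    using eventually_happens'[OF trivial_limit_at_left_real] by fastforce
  \<comment> \<open>Points of \<open>cube r\<close> have distance at least \<open>\<delta>\<close>
    from the faces of the cube of half-width \<open>r2\<close>, whose closure lies in
    \<open>cube 1\<close>.\<close>
  define r2 \<delta> where "r2 = (1 + r) / 2" and "\<delta> = (1 - r) / 2"
  have d: "0 < \<delta>" and r2: "r2 < 1" "r + \<delta> = r2" using r by (auto simp: r2_def \<delta>_def field_simps)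
  \<comment> \<open>Lower bound for one profile of steepness \<open>k\<close> at distance at least
    \<open>\<delta>\<close> from its face; each of the \<open>CARD('n)\<close> directions
    contributes two such profiles.\<close>
  define c where "c k = exp (- (inverse \<delta> * inverse (real k)))" for k
  have "(\<lambda>k. inverse \<delta> * inverse (real k)) \<longlonglongrightarrow> 0" by (rule tendsto_mult_right_zero[OF lim_inverse_n])
  from tendsto_exp[OF tendsto_minus[OF this]] have "c \<longlonglongrightarrow> 1" by (simp add: c_def[abs_def])
  from tendsto_power[OF tendsto_mult[OF this this], of "CARD('n)"]
  have "(\<lambda>k. (c k * c k) ^ CARD('n)) \<longlonglongrightarrow> 1" by simp
  then have "\<forall>\<^sub>F k in sequentially. 1 - e < (c k * c k) ^ CARD('n)" by (rule order_tendstoD) (use e in simp)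
  then have "\<forall>\<^sub>F k in sequentially. 1 - e < (c k * c k) ^ CARD('n) \<and> 0 < k"
    by (rule eventually_conj) (rule eventually_gt_at_top)
  then obtain k :: nat where k: "1 - e < (c k * c k) ^ CARD('n)" "0 < k"
    using eventually_happens'[OF sequentially_bot] by fastforce
  define a b :: "real ^ 'n" where "a = (\<chi> i. - r2)" and "b = (\<chi> i. r2)"
  show ?thesis
  proof (intro exI[of _ "bump (real k) a b"] exI[of _ r] conjI allI ballI)
    show "bump (real k) a b \<in> test_functions (cube 1)"
    proof (rule bump_test_function)
      show "cbox a b \<subseteq> cube 1"
      proof
        fix y assume "y \<in> cbox a b"
        then have y: "- r2 \<le> y $ i \<and> y $ i \<le> r2" for i by (simp add: mem_box_cart a_def b_def)
        show "y \<in> cube 1" unfolding cube_def using y r2(1) by (smt (verit) mem_Collect_eq)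
      qed
    qed (use k in simp)
    fix y :: "real ^ 'n" assume y: "y \<in> cube r"
    have fe: "c k \<le> flat_exp 1 (real k * t)" if t: "\<delta> \<le> t" for t
    proof -
      have "0 < real k * t" using k(2) d t by simp
      moreover have "1 / (real k * t) \<le> inverse \<delta> * inverse (real k)"
        using k(2) d t by (simp add: field_simps)
      ultimately show ?thesis by (simp add: flat_exp_def c_def)
    qed
    have "(c k * c k) ^ CARD('n) = (\<Prod>i\<in>(UNIV::'n set). c k * c k)" by simp
    also have "\<dots> \<le> bump (real k) a b y"
      unfolding bump_def
    proof (rule prod_mono, intro conjI mult_mono fe)
      fix i
      have "- r < y $ i" "y $ i < r" using y by (auto simp: cube_def)
      then show "\<delta> \<le> y $ i - a $ i" "\<delta> \<le> b $ i - y $ i" using r2(2) by (auto simp: a_def b_def)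
      show "0 \<le> flat_exp 1 (real k * (y $ i - a $ i))" by (simp add: flat_exp_def)
    qed (auto simp: c_def)
    finally show "1 - e \<le> bump (real k) a b y" using k(1) by simp
  qed (use r in \<open>auto simp: bump_bounds\<close>)
qed

section \<open>Approximation by finitely many smooth potentials\<close>

context flow
begin

lemma nice_potential_zero: "nice_potential (\<lambda>w. 0) (\<lambda>w. 0)"
  by (simp add: nice_potential_def smooth_const L2_zero)

text \<open>An almost best approximation exists for every \<open>v\<close>, potential or not. This
  matters because the values of a step function approximating a potential field need not be
  potential themselves.\<close>

lemma near_optimal_potential:
  assumes e: "0 < e"
  shows "\<exists>p. nice_potential (fst p) (snd p) \<and>
    (\<forall>p'. nice_potential (fst p') (snd p') \<longrightarrow> L2_nrm M (\<lambda>w. v w - snd p w) \<le> L2_nrm M (\<lambda>w. v w - snd p' w) + e)"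
proof -
  let ?S = "(\<lambda>p. L2_nrm M (\<lambda>w. v w - snd p w)) ` {p. nice_potential (fst p) (snd p)}"
  have "(\<lambda>w. 0, \<lambda>w. 0) \<in> {p. nice_potential (fst p) (snd p)}" using nice_potential_zero by simp
  then have ne: "?S \<noteq> {}" by blast
  have bd: "bdd_below ?S" by (rule bdd_belowI2[of _ 0]) (rule L2_nrm_nonneg)
  have "Inf ?S < Inf ?S + e" using e by simp
  from cInf_lessD[OF ne this] obtain p where p: "nice_potential (fst p) (snd p)" "L2_nrm M (\<lambda>w. v w - snd p w) < Inf ?S + e" by blast
  have "Inf ?S \<le> L2_nrm M (\<lambda>w. v w - snd p' w)" if "nice_potential (fst p') (snd p')" for p'
    by (rule cInf_lower[OF _ bd], rule imageI) (use that in simp)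
  then have "L2_nrm M (\<lambda>w. v w - snd p w) \<le> L2_nrm M (\<lambda>w. v w - snd p' w) + e" if "nice_potential (fst p') (snd p')" for p'
    using p(2) that by (meson add_right_mono less_eq_real_def order_trans)
  with p(1) show ?thesis by blast
qed

text \<open>The values \<open>t x\<close> of an approximating step function are replaced by almost
  nearest nice potentials. As \<open>U x\<close> is itself a limit of nice potentials, the distance
  from \<open>U x\<close> at most doubles, up to \<open>2 * e2\<close>. Only finitely many values
  occur, so the chosen potentials depend measurably on \<open>x\<close>.\<close>

lemma potential_step:
  fixes U :: "'a \<Rightarrow> 'w \<Rightarrow> real ^ 'n"
  assumes N: "finite_measure N" and U: "(\<lambda>(x, w). U x w) \<in> L2 (N \<Otimes>\<^sub>M M)"
    and pot: "AE x in N. U x \<in> L2_pot M T" and e: "0 < e"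
  shows "\<exists>s. simple_function N s \<and> (\<forall>x\<in>space N. nice_potential (fst (s x)) (snd (s x))) \<and>
    L2_nrm (N \<Otimes>\<^sub>M M) (\<lambda>(x, w). U x w - snd (s x) w) \<le> e"
proof -
  interpret N: finite_measure N by fact
  interpret NM: pair_sigma_finite N M ..
  have M: "finite_measure M" by unfold_locales
  have "0 < e / 4" using e by simp
  from L2_tensor_approx[OF N M U this]
  obtain t where t: "tensor_step N M t" "L2_nrm (N \<Otimes>\<^sub>M M) (\<lambda>(x, w). U x w - t x w) < e / 4" by auto
  define \<mu> where "\<mu> = measure N (space N)"
  \<comment> \<open>Scaled with the mass of \<open>N\<close>: \<open>8 * e2\<^sup>2 * \<mu>\<close>
    stays below \<open>e\<^sup>2 / 2\<close>, and \<open>8 * (e / 4)\<^sup>2\<close> is the other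
    half.\<close>
  define e2 where "e2 = e / (4 * sqrt (\<mu> + 1))"
  have mu: "0 \<le> \<mu>" by (simp add: \<mu>_def)
  have e2: "0 < e2" using e mu by (simp add: e2_def)
  have "\<forall>v. \<exists>p. nice_potential (fst p) (snd p) \<and>
      (\<forall>p'. nice_potential (fst p') (snd p') \<longrightarrow> L2_nrm M (\<lambda>w. v w - snd p w) \<le> L2_nrm M (\<lambda>w. v w - snd p' w) + e2)"
    by (intro allI near_optimal_potential[OF e2])
  from choice[OF this] obtain G where G': "\<forall>v. nice_potential (fst (G v)) (snd (G v)) \<and>
      (\<forall>p'. nice_potential (fst p') (snd p') \<longrightarrow> L2_nrm M (\<lambda>w. v w - snd (G v) w) \<le> L2_nrm M (\<lambda>w. v w - snd p' w) + e2)"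
    by (rule exE)
  have G: "nice_potential (fst (G v)) (snd (G v))"
    "nice_potential (fst p') (snd p') \<Longrightarrow> L2_nrm M (\<lambda>w. v w - snd (G v) w) \<le> L2_nrm M (\<lambda>w. v w - snd p' w) + e2" for v p'
    using G' by blast+
  have ts: "simple_function N t" and tL: "\<And>x. x \<in> space N \<Longrightarrow> t x \<in> L2 M" using t(1) by (auto simp: tensor_step_def)
  have GL: "snd (G v) \<in> L2 M" for v using G(1)[of v] by (simp add: nice_potential_def)
  have UL: "(\<lambda>p. U (fst p) (snd p)) \<in> L2 (N \<Otimes>\<^sub>M M)" using U by (simp add: case_prod_beta')
  have tP: "(\<lambda>p. t (fst p) (snd p)) \<in> L2 (N \<Otimes>\<^sub>M M)" using tensor_step_L2[OF N M t(1)] by (simp add: case_prod_beta')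
  have GP: "(\<lambda>p. snd (G (t (fst p))) (snd p)) \<in> L2 (N \<Otimes>\<^sub>M M)"
    using simple_function_family_L2[OF N M ts, of "\<lambda>v. snd (G v)"] GL by (simp add: case_prod_beta')
  note I1 = L2_integrable_sq[OF L2_diff[OF UL GP]] and I2 = L2_integrable_sq[OF L2_diff[OF UL tP]]
  define a where "a x = L2_nrm M (\<lambda>w. U x w - t x w)" for x
  have a2: "(\<lambda>x. LINT w|M. (norm (U x w - t x w))\<^sup>2) = (\<lambda>x. (a x)\<^sup>2)" by (simp add: a_def L2_nrm_sq)
  have aI: "integrable N (\<lambda>x. (a x)\<^sup>2)" using NM.integrable_fst'[OF I2] by (simp add: a2)
  have "AE x in N. (LINT w|M. (norm (U x w - snd (G (t x)) w))\<^sup>2) \<le> 8 * (a x)\<^sup>2 + 8 * e2\<^sup>2"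
    using pot AE_space
  proof eventually_elim
    case (elim x)
    have ux: "U x \<in> L2 M" using elim(1) by (simp add: L2_pot_def)
    obtain \<psi> wa where wa: "nice_potential \<psi> wa" "L2_nrm M (\<lambda>w. U x w - wa w) < e2" using nice_potential_dense[OF elim(1) e2] by blast
    then have wL: "wa \<in> L2 M" by (simp add: nice_potential_def)
    have "L2_nrm M (\<lambda>w. t x w - snd (G (t x)) w) \<le> L2_nrm M (\<lambda>w. t x w - wa w) + e2" using G(2)[of "(\<psi>, wa)" "t x"] wa(1) by simp
    also have "L2_nrm M (\<lambda>w. t x w - wa w) \<le> L2_nrm M (\<lambda>w. t x w - U x w) + L2_nrm M (\<lambda>w. U x w - wa w)"
      by (rule L2_triangle_diff[OF tL[OF elim(2)] ux wL])
    finally have "L2_nrm M (\<lambda>w. t x w - snd (G (t x)) w) \<le> a x + 2 * e2"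
      using wa(2) L2_nrm_minus_commute[of M "t x" "U x"] by (simp add: a_def)
    then have "L2_nrm M (\<lambda>w. U x w - snd (G (t x)) w) \<le> 2 * a x + 2 * e2"
      using L2_triangle_diff[OF ux tL[OF elim(2)] GL[of "t x"]] by (simp add: a_def)
    then have "(L2_nrm M (\<lambda>w. U x w - snd (G (t x)) w))\<^sup>2 \<le> (2 * a x + 2 * e2)\<^sup>2" by (rule power_mono) simp
    also have "\<dots> \<le> 2 * (2 * a x)\<^sup>2 + 2 * (2 * e2)\<^sup>2" using norm_add_sq_le[of "2 * a x" "2 * e2"] by simp
    finally show ?case by (simp add: L2_nrm_sq power_mult_distrib)
  qed
  then have "(LINT x|N. LINT w|M. (norm (U x w - snd (G (t x)) w))\<^sup>2) \<le> (LINT x|N. 8 * (a x)\<^sup>2 + 8 * e2\<^sup>2)"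
    using NM.integrable_fst'[OF I1] aI by (intro integral_mono_AE) auto
  also have "\<dots> = 8 * (LINT x|N. (a x)\<^sup>2) + 8 * e2\<^sup>2 * \<mu>" using aI by (simp add: \<mu>_def)
  also have "(LINT x|N. (a x)\<^sup>2) = (L2_nrm (N \<Otimes>\<^sub>M M) (\<lambda>(x, w). U x w - t x w))\<^sup>2"
    using NM.integral_fst'[OF I2] by (simp add: a2 L2_nrm_sq case_prod_beta')
  also have "8 * \<dots> + 8 * e2\<^sup>2 * \<mu> \<le> 8 * (e / 4)\<^sup>2 + e\<^sup>2 / 2"
  proof (intro add_mono mult_left_mono power_mono)
    have "e2\<^sup>2 = e\<^sup>2 / (16 * (\<mu> + 1))" using mu by (simp add: e2_def power_divide power_mult_distrib)
    moreover have "8 * (e\<^sup>2 / (16 * n)) * \<mu> = e\<^sup>2 / 2 * (\<mu> / n)" for n by simp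
    ultimately have "8 * e2\<^sup>2 * \<mu> = e\<^sup>2 / 2 * (\<mu> / (\<mu> + 1))" by metis
    also have "\<dots> \<le> e\<^sup>2 / 2" using mu by (intro mult_left_le) auto
    finally show "8 * e2\<^sup>2 * \<mu> \<le> e\<^sup>2 / 2" .
  qed (use t(2) in auto)
  also have "\<dots> = e\<^sup>2" by (simp add: power2_eq_square)
  finally have "L2_nrm (N \<Otimes>\<^sub>M M) (\<lambda>(x, w). U x w - snd (G (t x)) w) \<le> e"
    using e NM.integral_fst'[OF I1] by (intro L2_nrm_leI) (auto simp: case_prod_beta')
  moreover have "simple_function N (\<lambda>x. G (t x))" by (rule simple_function_compose1[OF ts])
  ultimately show ?thesis using G(1) by (intro exI[of _ "\<lambda>x. G (t x)"]) simp
qed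

end

section \<open>Ergodic averages in the macroscopic variable\<close>

context ergodic_flow
begin

lemma vector_avg_tendsto:
  fixes v :: "'w \<Rightarrow> real ^ 'm::finite"
  assumes v: "v \<in> L2 M"
  shows "AE w in M. ((\<lambda>\<rho>. (1 / measure lebesgue (cube \<rho> :: (real ^ 'n) set)) *\<^sub>R (LINT y|lebesgue_on (cube \<rho>). v (T y w))) \<longlongrightarrow> (LINT w|M. v w)) at_top"
proof -
  have vI: "integrable M v" by (rule L2_integrable[OF v])
  have viI: "integrable M (\<lambda>w. v w $ i)" for i by (rule L2_integrable[OF L2_component[OF v]])
  have "AE w in M. \<forall>i. ((\<lambda>\<rho>. avg \<rho> (\<lambda>w. v w $ i) w) \<longlongrightarrow> (LINT w|M. v w $ i)) at_top"
    by (intro eventually_all_finite pointwise_ergodic viI)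
  moreover have "AE w in M. \<forall>r. orbit_int r (\<lambda>w. norm (v w)) w" by (intro AE_orbit_int integrable_norm vI)
  ultimately show ?thesis
    using AE_space
  proof eventually_elim
    case (elim w)
    have vm: "(\<lambda>y. v (T y w)) \<in> borel_measurable borel" by (rule orbit_borel_measurable[OF elim(3) L2_measurable[OF v]])
    have vim: "(\<lambda>y. v (T y w) $ i) \<in> borel_measurable borel" for i
      by (rule orbit_borel_measurable[OF elim(3) L2_measurable[OF L2_component[OF v]]])
    have I: "integrable (lebesgue_on (cube \<rho>)) (\<lambda>y. v (T y w))" for \<rho>
      unfolding integrable_lebesgue_on_borel[OF vm borel_cube]
      by (rule Bochner_Integration.integrable_bound[of _ "\<lambda>y. indicator (cube \<rho>) y * norm (v (T y w))"])
        (use elim(2) vm in \<open>auto simp: orbit_int_def\<close>)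
    show ?case
    proof (rule vec_tendstoI)
      fix i
      have ei: "(LINT w|M. v w) $ i = (LINT w|M. v w $ i)"
        by (rule integral_bounded_linear[OF bounded_linear_vec_nth vI, symmetric])
      have "((1 / measure lebesgue (cube \<rho> :: (real ^ 'n) set)) *\<^sub>R (LINT y|lebesgue_on (cube \<rho>). v (T y w))) $ i = avg \<rho> (\<lambda>w. v w $ i) w" if "0 < \<rho>" for \<rho>
      proof -
        have "(LINT y|lebesgue_on (cube \<rho>). v (T y w)) $ i = (LINT y|lebesgue_on (cube \<rho>). v (T y w) $ i)"
          by (rule integral_bounded_linear[OF bounded_linear_vec_nth I, symmetric])
        then show ?thesis using that by (simp add: avg_def integral_lebesgue_on_borel[OF vim] measure_cube power_mult_distrib)
      qed
      from this have "\<forall>\<^sub>F \<rho> in at_top. avg \<rho> (\<lambda>w. v w $ i) w = ((1 / measure lebesgue (cube \<rho> :: (real ^ 'n) set)) *\<^sub>R (LINT y|lebesgue_on (cube \<rho>). v (T y w))) $ i"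
        by (intro eventually_mono[OF eventually_gt_at_top[of "0::real"]]) (rule sym)
      then show "((\<lambda>\<rho>. ((1 / measure lebesgue (cube \<rho> :: (real ^ 'n) set)) *\<^sub>R (LINT y|lebesgue_on (cube \<rho>). v (T y w))) $ i) \<longlongrightarrow> (LINT w|M. v w) $ i) at_top"
        unfolding ei by (rule Lim_transform_eventually[OF elim(1)[rule_format, of i]])
    qed
  qed
qed

text \<open>An ergodic theorem with values in L2 of \<open>x\<close>. For step functions it reduces
  to finitely many vector-valued averages; the average of the remainder is bounded by its root mean
  square along the orbit, which \<open>L2_orbit_ergodic\<close> makes small for large
  \<rho>.\<close>

lemma mean_orbit_tendsto:
  fixes q :: "'a \<Rightarrow> 'w \<Rightarrow> real ^ 'm::finite"
  assumes N: "finite_measure N" and q: "(\<lambda>(x, w). q x w) \<in> L2 (N \<Otimes>\<^sub>M M)"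
  shows "AE w in M. ((\<lambda>\<rho>. L2_nrm N (\<lambda>x. (LINT w|M. q x w) -
    (1 / measure lebesgue (cube \<rho> :: (real ^ 'n) set)) *\<^sub>R (LINT y|lebesgue_on (cube \<rho>). q x (T y w)))) \<longlongrightarrow> 0) at_top"
proof -
  interpret N: finite_measure N by fact
  have M: "finite_measure M" by unfold_locales
  have "\<forall>m. \<exists>s. tensor_step N M s \<and> L2_nrm (N \<Otimes>\<^sub>M M) (\<lambda>(x, w). q x w - s x w) < 1 / real (Suc m)"
  proof
    fix m
    have "0 < 1 / real (Suc m)" by simp
    from L2_tensor_approx[OF N M q this]
    show "\<exists>s. tensor_step N M s \<and> L2_nrm (N \<Otimes>\<^sub>M M) (\<lambda>(x, w). q x w - s x w) < 1 / real (Suc m)" by auto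
  qed
  from choice[OF this] obtain s where s': "\<forall>m. tensor_step N M (s m) \<and> L2_nrm (N \<Otimes>\<^sub>M M) (\<lambda>(x, w). q x w - s m x w) < 1 / real (Suc m)"
    by (rule exE)
  then have s: "tensor_step N M (s m)" "L2_nrm (N \<Otimes>\<^sub>M M) (\<lambda>(x, w). q x w - s m x w) < 1 / real (Suc m)" for m by blast+
  have ss: "simple_function N (s m)" and sL: "\<And>x. x \<in> space N \<Longrightarrow> s m x \<in> L2 M" for m using s(1) by (auto simp: tensor_step_def)
  have fin: "finite (s m ` space N)" for m using simple_functionD(1)[OF ss] .
  have dL: "(\<lambda>(x, w). q x w - s m x w) \<in> L2 (N \<Otimes>\<^sub>M M)" for m
    using L2_diff[OF q tensor_step_L2[OF N M s(1)]] by (simp add: case_prod_beta')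
  have A1: "AE w in M. \<forall>m. (\<forall>\<rho>>0. (\<lambda>(x, y). q x (T y w) - s m x (T y w)) \<in> L2 (N \<Otimes>\<^sub>M lebesgue_on (cube \<rho>))) \<and>
    ((\<lambda>\<rho>. L2_nrm (N \<Otimes>\<^sub>M lebesgue_on (cube \<rho>)) (\<lambda>(x, y). q x (T y w) - s m x (T y w)) / sqrt (measure lebesgue (cube \<rho> :: (real ^ 'n) set)))
      \<longlongrightarrow> L2_nrm (N \<Otimes>\<^sub>M M) (\<lambda>(x, w). q x w - s m x w)) at_top"
    unfolding AE_all_countable by (intro allI L2_orbit_ergodic[OF N dL])
  have A2: "AE w in M. \<forall>\<rho>>0. (\<lambda>(x, y). q x (T y w)) \<in> L2 (N \<Otimes>\<^sub>M lebesgue_on (cube \<rho>))"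
    using L2_orbit_ergodic[OF N q] by eventually_elim blast
  have "AE w in M. \<forall>v\<in>s m ` space N. ((\<lambda>\<rho>. (1 / measure lebesgue (cube \<rho> :: (real ^ 'n) set)) *\<^sub>R (LINT y|lebesgue_on (cube \<rho>). v (T y w))) \<longlongrightarrow> (LINT w|M. v w)) at_top" for m
    unfolding AE_ball_countable[OF countable_finite[OF fin]]
    by (intro ballI vector_avg_tendsto) (use sL in blast)
  then have A3: "AE w in M. \<forall>m. \<forall>v\<in>s m ` space N. ((\<lambda>\<rho>. (1 / measure lebesgue (cube \<rho> :: (real ^ 'n) set)) *\<^sub>R (LINT y|lebesgue_on (cube \<rho>). v (T y w))) \<longlongrightarrow> (LINT w|M. v w)) at_top"
    unfolding AE_all_countable by blast
  show ?thesis
    using A1 A2 A3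
  proof eventually_elim
    case (elim w)
    let ?Q = "\<lambda>\<rho>. lebesgue_on (cube \<rho> :: (real ^ 'n) set)"
    let ?c = "\<lambda>\<rho>. measure lebesgue (cube \<rho> :: (real ^ 'n) set)"
    define A where "A \<rho> v = (LINT w|M. v w) - (1 / ?c \<rho>) *\<^sub>R (LINT y|?Q \<rho>. v (T y w))" for \<rho> and v :: "'w \<Rightarrow> real ^ 'm"
    define \<mu> where "\<mu> = measure N (space N)"
    \<comment> \<open>Three parts: the expectation of the remainder, its average over the cube, and
      the deviations of the averages of the finitely many values of the step function.\<close>
    have key: "L2_nrm N (\<lambda>x. A \<rho> (q x)) \<le> 1 / real (Suc m) + L2_nrm (N \<Otimes>\<^sub>M ?Q \<rho>) (\<lambda>(x, y). q x (T y w) - s m x (T y w)) / sqrt (?c \<rho>)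
        + sqrt (\<mu> * (\<Sum>v\<in>s m ` space N. (norm (A \<rho> v))\<^sup>2))" if r: "0 < \<rho>" for \<rho> m
    proof -
      have Q: "finite_measure (?Q \<rho>)" by (rule finite_measure_lebesgue_on_open) auto
      interpret Q: finite_measure "?Q \<rho>" by (rule Q)
      have c: "0 < ?c \<rho>" using r by (simp add: measure_cube)
      have cm: "measure (?Q \<rho>) (space (?Q \<rho>)) = ?c \<rho>" by (simp add: measure_restrict_space)
      let ?d = "\<lambda>(x, w). q x w - s m x w" and ?dT = "\<lambda>(x, y). q x (T y w) - s m x (T y w)"
      have dT: "?dT \<in> L2 (N \<Otimes>\<^sub>M ?Q \<rho>)" using elim(1) r by blast
      have qT: "(\<lambda>(x, y). q x (T y w)) \<in> L2 (N \<Otimes>\<^sub>M ?Q \<rho>)" using elim(2) r by blast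
      have E1: "(\<lambda>x. LINT w|M. ?d (x, w)) \<in> L2 N" "L2_nrm N (\<lambda>x. LINT w|M. ?d (x, w)) \<le> L2_nrm (N \<Otimes>\<^sub>M M) ?d"
        using L2_section_integral(1,2)[OF N M dL[of m]] by (simp_all add: prob_space)
      have E2: "(\<lambda>x. (1 / ?c \<rho>) *\<^sub>R (LINT y|?Q \<rho>. ?dT (x, y))) \<in> L2 N"
        by (rule L2_scaleR[OF L2_section_integral(1)[OF N Q dT]])
      have E2': "L2_nrm N (\<lambda>x. (1 / ?c \<rho>) *\<^sub>R (LINT y|?Q \<rho>. ?dT (x, y))) \<le> L2_nrm (N \<Otimes>\<^sub>M ?Q \<rho>) ?dT / sqrt (?c \<rho>)"
      proof -
        have "L2_nrm N (\<lambda>x. (1 / ?c \<rho>) *\<^sub>R (LINT y|?Q \<rho>. ?dT (x, y))) = (1 / ?c \<rho>) * L2_nrm N (\<lambda>x. LINT y|?Q \<rho>. ?dT (x, y))"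
          using c by (subst L2_nrm_scaleR) simp
        also have "\<dots> \<le> (1 / ?c \<rho>) * (sqrt (?c \<rho>) * L2_nrm (N \<Otimes>\<^sub>M ?Q \<rho>) ?dT)"
          using L2_section_integral(2)[OF N Q dT] c unfolding cm by (intro mult_left_mono) auto
        also have "\<dots> = L2_nrm (N \<Otimes>\<^sub>M ?Q \<rho>) ?dT / sqrt (?c \<rho>)" using c by (simp add: field_simps real_div_sqrt)
        finally show ?thesis .
      qed
      have Am: "simple_function N (\<lambda>x. A \<rho> (s m x))" by (rule simple_function_compose1[OF ss])
      have Ale: "(norm (A \<rho> (s m x)))\<^sup>2 \<le> (\<Sum>v\<in>s m ` space N. (norm (A \<rho> v))\<^sup>2)" if "x \<in> space N" for x
        using member_le_sum[of "s m x" "s m ` space N" "\<lambda>v. (norm (A \<rho> v))\<^sup>2"] that fin by simp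
      have E3: "(\<lambda>x. A \<rho> (s m x)) \<in> L2 N"
        by (rule L2_dominated[OF borel_measurable_simple_function[OF Am] N.integrable_const]) (use Ale in \<open>auto intro: AE_I2\<close>)
      have "(LINT x|N. (norm (A \<rho> (s m x)))\<^sup>2) \<le> (LINT x|N. (\<Sum>v\<in>s m ` space N. (norm (A \<rho> v))\<^sup>2))"
        by (intro integral_mono L2_integrable_sq[OF E3] N.integrable_const Ale)
      then have E3': "L2_nrm N (\<lambda>x. A \<rho> (s m x)) \<le> sqrt (\<mu> * (\<Sum>v\<in>s m ` space N. (norm (A \<rho> v))\<^sup>2))"
        by (simp add: L2_nrm_def \<mu>_def)
      have "AE x in N. A \<rho> (q x) = (LINT w|M. ?d (x, w)) - (1 / ?c \<rho>) *\<^sub>R (LINT y|?Q \<rho>. ?dT (x, y)) + A \<rho> (s m x)"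
        using L2_section_integral(3)[OF N M q] L2_section_integral(3)[OF N M dL[of m]]
          L2_section_integral(3)[OF N Q qT] L2_section_integral(3)[OF N Q dT]
      proof eventually_elim
        case (elim x)
        then have i: "integrable M (\<lambda>w. q x w)" "integrable M (\<lambda>w. q x w - s m x w)"
          "integrable (?Q \<rho>) (\<lambda>y. q x (T y w))" "integrable (?Q \<rho>) (\<lambda>y. q x (T y w) - s m x (T y w))"
          by (auto dest: L2_integrable Q.L2_integrable)
        have "(LINT w|M. s m x w) = (LINT w|M. q x w) - (LINT w|M. q x w - s m x w)"
          using Bochner_Integration.integral_diff[OF i(1,2)] by simp
        moreover have "(LINT y|?Q \<rho>. s m x (T y w)) = (LINT y|?Q \<rho>. q x (T y w)) - (LINT y|?Q \<rho>. q x (T y w) - s m x (T y w))"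
          using Bochner_Integration.integral_diff[OF i(3,4)] by simp
        ultimately show ?case unfolding A_def by (simp add: scaleR_diff_right)
      qed
      then have "L2_nrm N (\<lambda>x. A \<rho> (q x)) = L2_nrm N (\<lambda>x. (LINT w|M. ?d (x, w)) - (1 / ?c \<rho>) *\<^sub>R (LINT y|?Q \<rho>. ?dT (x, y)) + A \<rho> (s m x))"
      proof (intro L2_nrm_cong_AE)
        show "(\<lambda>x. A \<rho> (q x)) \<in> borel_measurable N"
          using L2_measurable[OF L2_diff[OF L2_section_integral(1)[OF N M q] L2_scaleR[OF L2_section_integral(1)[OF N Q qT], of "1 / ?c \<rho>"]]]
          by (simp add: A_def)
      qed (rule L2_measurable[OF L2_add[OF L2_diff[OF E1(1) E2] E3]])
      also have "\<dots> \<le> L2_nrm N (\<lambda>x. (LINT w|M. ?d (x, w)) - (1 / ?c \<rho>) *\<^sub>R (LINT y|?Q \<rho>. ?dT (x, y))) + L2_nrm N (\<lambda>x. A \<rho> (s m x))"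
        by (rule L2_triangle[OF L2_diff[OF E1(1) E2] E3])
      also have "L2_nrm N (\<lambda>x. (LINT w|M. ?d (x, w)) - (1 / ?c \<rho>) *\<^sub>R (LINT y|?Q \<rho>. ?dT (x, y))) \<le> L2_nrm N (\<lambda>x. LINT w|M. ?d (x, w)) + L2_nrm N (\<lambda>x. (1 / ?c \<rho>) *\<^sub>R (LINT y|?Q \<rho>. ?dT (x, y)))"
        using L2_triangle[OF E1(1) L2_uminus[OF E2]] by (simp only: L2_nrm_uminus diff_conv_add_uminus)
      finally show ?thesis using E1(2) E2' E3' s(2)[of m] by linarith
    qed
    show "((\<lambda>\<rho>. L2_nrm N (\<lambda>x. (LINT w|M. q x w) - (1 / ?c \<rho>) *\<^sub>R (LINT y|?Q \<rho>. q x (T y w)))) \<longlongrightarrow> 0) at_top"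
      unfolding A_def[symmetric]
    proof (rule order_tendstoI)
      fix a :: real assume "0 < a"
      then obtain m where m: "1 / real (Suc m) < a / 2" using nat_approx_posE[of "a / 2"] by (auto simp: half_gt_zero)
      have "((\<lambda>\<rho>. A \<rho> v) \<longlongrightarrow> 0) at_top" if "v \<in> s m ` space N" for v
      proof -
        have "((\<lambda>\<rho>. (LINT w|M. v w) - (1 / ?c \<rho>) *\<^sub>R (LINT y|?Q \<rho>. v (T y w))) \<longlongrightarrow> (LINT w|M. v w) - (LINT w|M. v w)) at_top"
          using elim(3) that by (intro tendsto_diff tendsto_const) blast
        then show ?thesis by (simp add: A_def)
      qed
      then have "((\<lambda>\<rho>. \<Sum>v\<in>s m ` space N. (norm (A \<rho> v))\<^sup>2) \<longlongrightarrow> (\<Sum>v\<in>s m ` space N. (norm (0 :: real ^ 'm))\<^sup>2)) at_top"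
        by (intro tendsto_sum tendsto_power tendsto_norm) blast
      from tendsto_real_sqrt[OF tendsto_mult[OF tendsto_const[of \<mu>] this]]
      have l3: "((\<lambda>\<rho>. sqrt (\<mu> * (\<Sum>v\<in>s m ` space N. (norm (A \<rho> v))\<^sup>2))) \<longlongrightarrow> 0) at_top" by simp
      let ?l = "1 / real (Suc m) + L2_nrm (N \<Otimes>\<^sub>M M) (\<lambda>(x, w). q x w - s m x w) + 0"
      have "((\<lambda>\<rho>. 1 / real (Suc m) + L2_nrm (N \<Otimes>\<^sub>M ?Q \<rho>) (\<lambda>(x, y). q x (T y w) - s m x (T y w)) / sqrt (?c \<rho>)
        + sqrt (\<mu> * (\<Sum>v\<in>s m ` space N. (norm (A \<rho> v))\<^sup>2))) \<longlongrightarrow> ?l) at_top"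
        using elim(1) by (intro tendsto_add tendsto_const l3) blast
      moreover have "?l < a" using m s(2)[of m] by argo
      ultimately have "\<forall>\<^sub>F \<rho> in at_top. 1 / real (Suc m) + L2_nrm (N \<Otimes>\<^sub>M ?Q \<rho>) (\<lambda>(x, y). q x (T y w) - s m x (T y w)) / sqrt (?c \<rho>)
        + sqrt (\<mu> * (\<Sum>v\<in>s m ` space N. (norm (A \<rho> v))\<^sup>2)) < a" by (rule order_tendstoD)
      then show "\<forall>\<^sub>F \<rho> in at_top. L2_nrm N (\<lambda>x. A \<rho> (q x)) < a"
        using eventually_gt_at_top[of "0::real"] by eventually_elim (use key in \<open>fastforce intro: order_le_less_trans\<close>)
    next
      fix a :: real assume "a < 0"
      then show "\<forall>\<^sub>F \<rho> in at_top. a < L2_nrm N (\<lambda>x. A \<rho> (q x))" by (intro always_eventually allI) (rule order_less_le_trans[OF _ L2_nrm_nonneg])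
    qed
  qed
qed

end

section \<open>Correctors\<close>

lemma AE_fst:
  assumes fin: "finite_measure N" "finite_measure Q" and P: "AE x in N. P x"
  shows "AE p in N \<Otimes>\<^sub>M Q. P (fst p)"
proof -
  interpret N: finite_measure N by fact
  interpret Q: finite_measure Q by fact
  interpret NQ: pair_sigma_finite N Q ..
  obtain Z where Z: "Z \<in> null_sets N" "{x \<in> space N. \<not> P x} \<subseteq> Z" using P unfolding eventually_ae_filter by blast
  have "Z \<times> space Q \<in> null_sets (N \<Otimes>\<^sub>M Q)" by (rule Q.times_in_null_sets1[OF Z(1)]) simp
  from AE_not_in[OF this] AE_space show ?thesis
    by eventually_elim (use Z(2) in \<open>auto simp: space_pair_measure\<close>)
qed

lemma L2_norm_le_mult:
  fixes f :: "'a \<Rightarrow> 'b::euclidean_space" and g :: "'a \<Rightarrow> 'c::euclidean_space"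
  assumes g: "g \<in> borel_measurable M" and f: "f \<in> L2 M" and B: "0 \<le> B" and le: "\<And>x. x \<in> space M \<Longrightarrow> norm (g x) \<le> B * norm (f x)"
  shows "g \<in> L2 M" "L2_nrm M g \<le> B * L2_nrm M f"
proof -
  have le2: "(norm (g x))\<^sup>2 \<le> B\<^sup>2 * (norm (f x))\<^sup>2" if "x \<in> space M" for x
    using power_mono[OF le[OF that], of 2] by (simp add: power_mult_distrib)
  have I: "integrable M (\<lambda>x. B\<^sup>2 * (norm (f x))\<^sup>2)" using L2_integrable_sq[OF f] by simp
  show L: "g \<in> L2 M" by (rule L2_dominated[OF g I AE_I2[OF le2]])
  show "L2_nrm M g \<le> B * L2_nrm M f"
  proof (rule L2_nrm_leI)
    have "(LINT x|M. (norm (g x))\<^sup>2) \<le> (LINT x|M. B\<^sup>2 * (norm (f x))\<^sup>2)"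
      by (rule integral_mono[OF L2_integrable_sq[OF L] I le2])
    then show "(LINT x|M. (norm (g x))\<^sup>2) \<le> (B * L2_nrm M f)\<^sup>2" by (simp add: power_mult_distrib L2_nrm_sq)
  qed (use B in simp)
qed

lemma integral_pair_restrict:
  fixes g :: "'a \<times> 'b::euclidean_space \<Rightarrow> real"
  assumes fin: "finite_measure N" and C: "open C" "bounded C" and S: "open S" "S \<subseteq> C"
    and g: "integrable (N \<Otimes>\<^sub>M lebesgue_on C) g" "integrable (N \<Otimes>\<^sub>M lebesgue_on S) g"
  shows "integrable (N \<Otimes>\<^sub>M lebesgue_on C) (\<lambda>p. indicator S (snd p) * g p)"
    and "(LINT p|(N \<Otimes>\<^sub>M lebesgue_on C). indicator S (snd p) * g p) = (LINT p|(N \<Otimes>\<^sub>M lebesgue_on S). g p)"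
proof -
  interpret N: finite_measure N by fact
  interpret Q: finite_measure "lebesgue_on C" by (rule finite_measure_lebesgue_on_open[OF C])
  interpret R: finite_measure "lebesgue_on S" by (rule finite_measure_lebesgue_on_open[OF S(1) bounded_subset[OF C(2) S(2)]])
  interpret NQ: pair_sigma_finite N "lebesgue_on C" ..
  interpret NR: pair_sigma_finite N "lebesgue_on S" ..
  have sets: "C \<in> sets lebesgue" "S \<in> sets lebesgue" using C(1) S(1) by auto
  have im: "indicat_real S \<in> borel_measurable (lebesgue_on C)"
    using S(1) by (intro measurable_lebesgue_on_borel borel_measurable_indicator) simp
  have im': "(\<lambda>p. indicat_real S (snd p)) \<in> borel_measurable (N \<Otimes>\<^sub>M lebesgue_on C)"
    by (rule measurable_compose[OF measurable_snd im])
  show I: "integrable (N \<Otimes>\<^sub>M lebesgue_on C) (\<lambda>p. indicator S (snd p) * g p)"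
  proof (rule Bochner_Integration.integrable_bound[OF g(1)])
    show "(\<lambda>p. indicator S (snd p) * g p) \<in> borel_measurable (N \<Otimes>\<^sub>M lebesgue_on C)"
      by (rule borel_measurable_times[OF im' borel_measurable_integrable[OF g(1)]])
  qed (simp add: indicator_def)
  have inner: "(LINT y|lebesgue_on C. indicator S y * h y) = (LINT y|lebesgue_on S. h y)" for h :: "'b \<Rightarrow> real"
  proof -
    have "(LINT y|lebesgue_on C. indicator S y * h y) = (LINT y|lebesgue. indicator C y *\<^sub>R (indicator S y * h y))"
      using sets by (intro integral_restrict_space) auto
    also have "\<dots> = (LINT y|lebesgue. indicator S y *\<^sub>R h y)"
      using S(2) by (intro Bochner_Integration.integral_cong) (auto simp: indicator_def)
    also have "\<dots> = (LINT y|lebesgue_on S. h y)"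
      using sets by (intro integral_restrict_space[symmetric]) auto
    finally show ?thesis .
  qed
  show "(LINT p|(N \<Otimes>\<^sub>M lebesgue_on C). indicator S (snd p) * g p) = (LINT p|(N \<Otimes>\<^sub>M lebesgue_on S). g p)"
    using NQ.integral_fst'[OF I] NR.integral_fst'[OF g(2)] by (simp add: inner)
qed

context flow
begin

text \<open>The competitor is the potential along the orbit times the cut-off rescaled to the cube.
  For each \<open>x\<close> it is a test function; its gradient is the cut-off field plus
  \<open>Z\<close>, the term with the gradient of the cut-off, which rescaling makes of order
  \<open>1 / \<rho>\<close>.\<close>

lemma cutoff_potential:
  fixes s :: "real ^ 'n \<Rightarrow> ('w \<Rightarrow> real) \<times> ('w \<Rightarrow> real ^ 'n)"
  assumes D: "open D" "bounded D" and r: "0 < \<rho>" and eta: "\<eta> \<in> test_functions (cube 1)"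
    and nice: "\<And>x. x \<in> D \<Longrightarrow> smooth (\<lambda>y. fst (s x) (T y w)) \<and> (\<forall>y. gradient (\<lambda>y. fst (s x) (T y w)) y = snd (s x) (T y w))"
    and P: "(\<lambda>(x, y). fst (s x) (T y w)) \<in> L2 (lebesgue_on D \<Otimes>\<^sub>M lebesgue_on (cube \<rho>))"
    and V: "(\<lambda>(x, y). snd (s x) (T y w)) \<in> L2 (lebesgue_on D \<Otimes>\<^sub>M lebesgue_on (cube \<rho>))"
    and B: "\<And>y. norm (gradient \<eta> y) \<le> B"
  shows "\<exists>wa W Z. wa \<in> L2_H10 D (cube \<rho>) \<and> has_weak_gradient_y D (cube \<rho>) wa W \<and>
    (\<lambda>(x, y). Z x y) \<in> L2 (lebesgue_on D \<Otimes>\<^sub>M lebesgue_on (cube \<rho>)) \<and>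
    L2_nrm (lebesgue_on D \<Otimes>\<^sub>M lebesgue_on (cube \<rho>)) (\<lambda>(x, y). Z x y) \<le>
      B / \<rho> * L2_nrm (lebesgue_on D \<Otimes>\<^sub>M lebesgue_on (cube \<rho>)) (\<lambda>(x, y). fst (s x) (T y w)) \<and>
    (\<forall>x y. W x y = \<eta> ((1 / \<rho>) *\<^sub>R y) *\<^sub>R snd (s x) (T y w) + Z x y)"
proof -
  let ?P = "lebesgue_on D \<Otimes>\<^sub>M lebesgue_on (cube \<rho> :: (real ^ 'n) set)"
  define h where "h = (\<lambda>y. \<eta> ((1 / \<rho>) *\<^sub>R y))"
  have es: "smooth \<eta>" by (rule test_functions_smooth[OF eta])
  have hs: "smooth h" unfolding h_def by (rule smooth_scale[OF es])
  have hg: "gradient h y = (1 / \<rho>) *\<^sub>R gradient \<eta> ((1 / \<rho>) *\<^sub>R y)" for y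
    unfolding h_def by (rule gradient_scale(2)[OF smooth_differentiable[OF es]])
  have ht: "h \<in> test_functions (cube \<rho>)"
  proof -
    obtain K where K: "compact K" "K \<subseteq> cube 1" "\<And>x. x \<notin> K \<Longrightarrow> \<eta> x = 0" using test_functions_support[OF eta] by blast
    show ?thesis
    proof (rule test_functionsI[OF hs])
      show "compact ((*\<^sub>R) \<rho> ` K)" by (rule compact_scaling[OF K(1)])
      show "(*\<^sub>R) \<rho> ` K \<subseteq> cube \<rho>"
      proof
        fix y assume "y \<in> (*\<^sub>R) \<rho> ` K"
        then obtain z where z: "z \<in> K" "y = \<rho> *\<^sub>R z" by auto
        have "\<bar>z $ i\<bar> < 1" for i using z(1) K(2) by (auto simp: mem_cube)
        then show "y \<in> cube \<rho>" using r by (simp add: mem_cube z(2) abs_mult)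
      qed
      show "h y = 0" if "y \<notin> (*\<^sub>R) \<rho> ` K" for y
      proof -
        have "(1 / \<rho>) *\<^sub>R y \<notin> K"
        proof
          assume "(1 / \<rho>) *\<^sub>R y \<in> K"
          then have "\<rho> *\<^sub>R ((1 / \<rho>) *\<^sub>R y) \<in> (*\<^sub>R) \<rho> ` K" by (rule imageI)
          with that r show False by simp
        qed
        then show ?thesis unfolding h_def by (rule K(3))
      qed
    qed
  qed
  obtain C where C: "0 < C" "\<And>y. \<bar>h y\<bar> \<le> C" using test_functions_bounded[OF ht] by blast
  have [measurable]: "(\<lambda>p. h (snd p)) \<in> borel_measurable ?P" "(\<lambda>p. gradient h (snd p)) \<in> borel_measurable ?P"
    using hs by (auto intro!: measurable_compose[OF measurable_snd] measurable_lebesgue_on_borel smooth_borel smooth_gradient_borel)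
  define wa where "wa x y = h y * fst (s x) (T y w)" for x y
  define Z where "Z x y = fst (s x) (T y w) *\<^sub>R gradient h y" for x y
  define W where "W x y = h y *\<^sub>R snd (s x) (T y w) + Z x y" for x y
  have P': "(\<lambda>p. fst (s (fst p)) (T (snd p) w)) \<in> L2 ?P" and V': "(\<lambda>p. snd (s (fst p)) (T (snd p) w)) \<in> L2 ?P"
    using P V by (simp_all add: case_prod_beta')
  note [measurable] = L2_measurable[OF P'] L2_measurable[OF V']
  have B0: "0 \<le> B" using order_trans[OF norm_ge_zero B] .
  have Zm: "(\<lambda>p. Z (fst p) (snd p)) \<in> borel_measurable ?P" unfolding Z_def by measurable
  have Zle: "norm (Z (fst p) (snd p)) \<le> B / \<rho> * norm (fst (s (fst p)) (T (snd p) w))" for p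
    using mult_right_mono[OF B[of "(1 / \<rho>) *\<^sub>R snd p"], of "\<bar>fst (s (fst p)) (T (snd p) w)\<bar> / \<rho>"] r
    by (simp add: Z_def hg mult.commute)
  have "0 \<le> B / \<rho>" using B0 r by simp
  note ZL = L2_norm_le_mult[OF Zm P' this Zle]
  have wL: "(\<lambda>p. wa (fst p) (snd p)) \<in> L2 ?P"
    unfolding wa_def by (rule L2_norm_le_mult(1)[OF _ P' less_imp_le[OF C(1)]]) (auto simp: abs_mult C intro: mult_right_mono)
  have hV: "(\<lambda>p. h (snd p) *\<^sub>R snd (s (fst p)) (T (snd p) w)) \<in> L2 ?P"
    by (rule L2_norm_le_mult(1)[OF _ V' less_imp_le[OF C(1)]]) (auto simp: C intro: mult_right_mono)
  have WL: "(\<lambda>p. W (fst p) (snd p)) \<in> L2 ?P" unfolding W_def by (rule L2_add[OF hV ZL(1)])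
  have wt: "wa x \<in> test_functions (cube \<rho>)" if "x \<in> D" for x
    unfolding wa_def[abs_def] using test_functions_mult[OF ht] nice[OF that] by blast
  have wg: "gradient (wa x) = W x" if "x \<in> D" for x
  proof
    fix y
    have n: "smooth (\<lambda>y. fst (s x) (T y w))" "gradient (\<lambda>y. fst (s x) (T y w)) y = snd (s x) (T y w)" using nice[OF that] by auto
    show "gradient (wa x) y = W x y"
      using gradient_mult[OF smooth_differentiable[OF hs] smooth_differentiable[OF n(1)], of y]
      by (simp add: wa_def[abs_def] W_def Z_def n(2))
  qed
  have wk: "has_weak_gradient (cube \<rho>) (wa x) (W x)" if "x \<in> D" for x
    using has_weak_gradient_test_function[OF _ _ wt[OF that]] by (simp add: wg[OF that])
  have g: "has_weak_gradient_y D (cube \<rho>) wa W"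
    unfolding has_weak_gradient_y_def using WL wk by (auto simp: case_prod_beta' intro!: AE_I2)
  moreover have "wa \<in> L2_H10 D (cube \<rho>)"
    unfolding L2_H10_def using wL H10_test_function[OF _ _ wt] g by (auto simp: case_prod_beta' intro!: AE_I2)
  ultimately show ?thesis
    using ZL by (intro exI[of _ wa] exI[of _ W] exI[of _ Z]) (simp add: W_def h_def case_prod_beta')
qed

end

context ergodic_flow
begin

text \<open>Three errors of size \<open>\<epsilon> / 3\<close>: the distance of \<open>U\<close> to
  nice potentials, the part of the field removed by the cut-off, and the term with the gradient of
  the cut-off. The approximation levels \<open>m\<close> run through the integers, so the null set
  depends neither on \<epsilon> nor on \<rho>.\<close>

lemma corrector:
  fixes U :: "real ^ 'n \<Rightarrow> 'w \<Rightarrow> real ^ 'n"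
  assumes D: "open D" "bounded D" and U: "(\<lambda>(x, w). U x w) \<in> L2 (lebesgue_on D \<Otimes>\<^sub>M M)"
    and pot: "AE x in lebesgue_on D. U x \<in> L2_pot M T"
  shows "AE w in M. \<forall>\<epsilon>>0. \<forall>\<^sub>F \<rho> in at_top. \<exists>wa W. wa \<in> L2_H10 D (cube \<rho>) \<and> has_weak_gradient_y D (cube \<rho>) wa W \<and>
    L2_nrm (lebesgue_on D \<Otimes>\<^sub>M lebesgue_on (cube \<rho>)) (\<lambda>(x, y). U x (T y w) - W x y) \<le> \<epsilon> * sqrt (measure lebesgue (cube \<rho> :: (real ^ 'n) set))"
proof -
  let ?N = "lebesgue_on D"
  have N: "finite_measure ?N" by (rule finite_measure_lebesgue_on_open[OF D])
  have M: "finite_measure M" by unfold_locales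
  have sp: "space ?N = D" by simp
  have "\<forall>m. \<exists>s. simple_function ?N s \<and> (\<forall>x\<in>space ?N. nice_potential (fst (s x)) (snd (s x))) \<and>
      L2_nrm (?N \<Otimes>\<^sub>M M) (\<lambda>(x, w). U x w - snd (s x) w) \<le> 1 / real (Suc m)"
    by (intro allI potential_step[OF N U pot]) simp
  from choice[OF this] obtain s where s': "\<forall>m. simple_function ?N (s m) \<and> (\<forall>x\<in>space ?N. nice_potential (fst (s m x)) (snd (s m x))) \<and>
      L2_nrm (?N \<Otimes>\<^sub>M M) (\<lambda>(x, w). U x w - snd (s m x) w) \<le> 1 / real (Suc m)" by (rule exE)
  then have ss: "simple_function ?N (s m)" and sn: "\<And>x. x \<in> space ?N \<Longrightarrow> nice_potential (fst (s m x)) (snd (s m x))"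
    and sl: "L2_nrm (?N \<Otimes>\<^sub>M M) (\<lambda>(x, w). U x w - snd (s m x) w) \<le> 1 / real (Suc m)" for m by blast+
  have PL: "(\<lambda>(x, w). fst (s m x) w) \<in> L2 (?N \<Otimes>\<^sub>M M)" for m
    by (rule simple_function_family_L2[OF N M ss, where F=fst]) (use sn in \<open>auto simp: nice_potential_def\<close>)
  have VL: "(\<lambda>(x, w). snd (s m x) w) \<in> L2 (?N \<Otimes>\<^sub>M M)" for m
    by (rule simple_function_family_L2[OF N M ss, where F=snd]) (use sn in \<open>auto simp: nice_potential_def\<close>)
  have dL: "(\<lambda>(x, w). U x w - snd (s m x) w) \<in> L2 (?N \<Otimes>\<^sub>M M)" for m
    using L2_diff[OF U VL] by (simp add: case_prod_beta')
  have fin: "finite (s m ` space ?N)" for m using simple_functionD(1)[OF ss] .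
  have "AE w in M. \<forall>p\<in>s m ` space ?N. smooth (\<lambda>y. fst p (T y w)) \<and> (\<forall>y. gradient (\<lambda>y. fst p (T y w)) y = snd p (T y w))" for m
    unfolding AE_ball_countable[OF countable_finite[OF fin]] using sn by (auto simp: nice_potential_def simp del: space_restrict_space)
  then have A0: "AE w in M. \<forall>m. \<forall>p\<in>s m ` space ?N. smooth (\<lambda>y. fst p (T y w)) \<and> (\<forall>y. gradient (\<lambda>y. fst p (T y w)) y = snd p (T y w))"
    unfolding AE_all_countable by blast
  note LO = L2_orbit_ergodic[OF N]
  have A1: "AE w in M. \<forall>m. (\<forall>\<rho>>0. (\<lambda>(x, y). U x (T y w) - snd (s m x) (T y w)) \<in> L2 (?N \<Otimes>\<^sub>M lebesgue_on (cube \<rho>))) \<and>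
    ((\<lambda>\<rho>. L2_nrm (?N \<Otimes>\<^sub>M lebesgue_on (cube \<rho>)) (\<lambda>(x, y). U x (T y w) - snd (s m x) (T y w)) / sqrt (measure lebesgue (cube \<rho> :: (real ^ 'n) set)))
      \<longlongrightarrow> L2_nrm (?N \<Otimes>\<^sub>M M) (\<lambda>(x, w). U x w - snd (s m x) w)) at_top"
    unfolding AE_all_countable by (intro allI LO[OF dL])
  have A2: "AE w in M. \<forall>m. (\<forall>\<rho>>0. (\<lambda>(x, y). snd (s m x) (T y w)) \<in> L2 (?N \<Otimes>\<^sub>M lebesgue_on (cube \<rho>))) \<and>
    ((\<lambda>\<rho>. L2_nrm (?N \<Otimes>\<^sub>M lebesgue_on (cube \<rho>)) (\<lambda>(x, y). snd (s m x) (T y w)) / sqrt (measure lebesgue (cube \<rho> :: (real ^ 'n) set)))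
      \<longlongrightarrow> L2_nrm (?N \<Otimes>\<^sub>M M) (\<lambda>(x, w). snd (s m x) w)) at_top"
    unfolding AE_all_countable by (intro allI LO[OF VL])
  have A3: "AE w in M. \<forall>m. (\<forall>\<rho>>0. (\<lambda>(x, y). fst (s m x) (T y w)) \<in> L2 (?N \<Otimes>\<^sub>M lebesgue_on (cube \<rho>))) \<and>
    ((\<lambda>\<rho>. L2_nrm (?N \<Otimes>\<^sub>M lebesgue_on (cube \<rho>)) (\<lambda>(x, y). fst (s m x) (T y w)) / sqrt (measure lebesgue (cube \<rho> :: (real ^ 'n) set)))
      \<longlongrightarrow> L2_nrm (?N \<Otimes>\<^sub>M M) (\<lambda>(x, w). fst (s m x) w)) at_top"
    unfolding AE_all_countable by (intro allI LO[OF PL])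
  show ?thesis
    using A0 A1 A2 A3
  proof eventually_elim
    case (elim w)
    show ?case
    proof (intro allI impI)
      fix \<epsilon> :: real assume eps: "0 < \<epsilon>"
      obtain m where m: "1 / real (Suc m) < \<epsilon> / 3" using nat_approx_posE[of "\<epsilon> / 3"] eps by auto
      let ?Q = "\<lambda>\<rho>. lebesgue_on (cube \<rho> :: (real ^ 'n) set)"
      let ?c = "\<lambda>\<rho>. measure lebesgue (cube \<rho> :: (real ^ 'n) set)"
      let ?dT = "\<lambda>(x, y). U x (T y w) - snd (s m x) (T y w)"
      let ?VT = "\<lambda>(x, y). snd (s m x) (T y w)"
      let ?PT = "\<lambda>(x, y). fst (s m x) (T y w)"
      define K where "K = L2_nrm (?N \<Otimes>\<^sub>M M) (\<lambda>(x, w). snd (s m x) w)"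
      \<comment> \<open>Small against the mean energy \<open>K\<^sup>2\<close> of the field, so that
        \<open>2 * e * K\<^sup>2\<close> stays below the allowed square;
        \<open>K\<^sup>2 + 1\<close> avoids division by 0.\<close>
      define e where "e = min 1 ((\<epsilon> / 3)\<^sup>2 / (4 * (K\<^sup>2 + 1)))"
      have e0: "0 < e" using eps by (simp add: e_def add_nonneg_pos)
      have e1: "e \<le> 1" by (simp add: e_def)
      have eK: "2 * e * K\<^sup>2 < (\<epsilon> / 3)\<^sup>2"
      proof -
        have p: "0 < K\<^sup>2 + 1" by (simp add: add_nonneg_pos)
        have "2 * e * K\<^sup>2 \<le> 2 * e * (K\<^sup>2 + 1)" using e0 by simp
        also have "\<dots> \<le> 2 * ((\<epsilon> / 3)\<^sup>2 / (4 * (K\<^sup>2 + 1))) * (K\<^sup>2 + 1)"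
          using p by (intro mult_right_mono mult_left_mono) (auto simp: e_def)
        also have "\<dots> = (\<epsilon> / 3)\<^sup>2 / 2" using p by (simp add: field_simps)
        also have "\<dots> < (\<epsilon> / 3)\<^sup>2" using eps by simp
        finally show ?thesis .
      qed
      obtain \<eta> :: "real ^ 'n \<Rightarrow> real" and r where eta: "\<eta> \<in> test_functions (cube 1)" and r: "0 < r" "r < 1" "1 - r ^ CARD('n) \<le> e"
        and eb: "\<And>y. 0 \<le> \<eta> y" "\<And>y. \<eta> y \<le> 1" "\<And>y. y \<in> cube r \<Longrightarrow> 1 - e \<le> \<eta> y"
        using cutoff_exists[OF e0] by metis
      obtain B where B: "\<And>y. norm (gradient \<eta> y) \<le> B" using test_functions_gradient_bounded[OF eta] by blast
      define v where "v \<rho> = L2_nrm (?N \<Otimes>\<^sub>M ?Q \<rho>) ?VT / sqrt (?c \<rho>)" for \<rho>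
      define u where "u \<rho> = L2_nrm (?N \<Otimes>\<^sub>M ?Q \<rho>) ?dT / sqrt (?c \<rho>)" for \<rho>
      define b where "b \<rho> = L2_nrm (?N \<Otimes>\<^sub>M ?Q \<rho>) ?PT / sqrt (?c \<rho>)" for \<rho>
      have lv: "(v \<longlongrightarrow> K) at_top" using elim(3) unfolding v_def[abs_def] K_def by blast
      have lu: "(u \<longlongrightarrow> L2_nrm (?N \<Otimes>\<^sub>M M) (\<lambda>(x, w). U x w - snd (s m x) w)) at_top" using elim(2) unfolding u_def[abs_def] by blast
      have lb: "(b \<longlongrightarrow> L2_nrm (?N \<Otimes>\<^sub>M M) (\<lambda>(x, w). fst (s m x) w)) at_top" using elim(4) unfolding b_def[abs_def] by blast
      have lr: "((\<lambda>\<rho>. v (r * \<rho>)) \<longlongrightarrow> K) at_top"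
        by (rule filterlim_compose[OF lv]) (rule filterlim_tendsto_pos_mult_at_top[OF tendsto_const r(1) filterlim_ident])
      have ev1: "\<forall>\<^sub>F \<rho> in at_top. u \<rho> < \<epsilon> / 3" by (rule order_tendstoD(2)[OF lu order_le_less_trans[OF sl m]])
      have "((\<lambda>\<rho>. B / \<rho> * b \<rho>) \<longlongrightarrow> 0 * L2_nrm (?N \<Otimes>\<^sub>M M) (\<lambda>(x, w). fst (s m x) w)) at_top"
        by (intro tendsto_mult lb tendsto_divide_0[OF tendsto_const] filterlim_at_top_imp_at_infinity filterlim_ident)
      then have ev2: "\<forall>\<^sub>F \<rho> in at_top. B / \<rho> * b \<rho> < \<epsilon> / 3" by (rule order_tendstoD) (use eps in simp)
      \<comment> \<open>The energy removed by the cut-off: the cubes of sizes \<rho> and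
        \<open>r * \<rho>\<close> have the same limiting mean energy \<open>K\<^sup>2\<close>, so
        the layer between them keeps the fraction \<open>1 - r ^ CARD('n)\<close>, and
        \<open>e\<close> accounts for the incomplete cut-off inside.\<close>
      have "((\<lambda>\<rho>. (1 + e) * (v \<rho>)\<^sup>2 - r ^ CARD('n) * (v (r * \<rho>))\<^sup>2) \<longlongrightarrow> (1 + e) * K\<^sup>2 - r ^ CARD('n) * K\<^sup>2) at_top"
        by (intro tendsto_diff tendsto_mult tendsto_const tendsto_power lv lr)
      moreover have "(1 + e) * K\<^sup>2 - r ^ CARD('n) * K\<^sup>2 < (\<epsilon> / 3)\<^sup>2"
      proof -
        have "(1 + e) * K\<^sup>2 - r ^ CARD('n) * K\<^sup>2 = (e + (1 - r ^ CARD('n))) * K\<^sup>2" by (simp add: algebra_simps)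
        also have "\<dots> \<le> (e + e) * K\<^sup>2" using r(3) by (intro mult_right_mono) auto
        also have "\<dots> < (\<epsilon> / 3)\<^sup>2" using eK by simp
        finally show ?thesis .
      qed
      ultimately have ev3: "\<forall>\<^sub>F \<rho> in at_top. (1 + e) * (v \<rho>)\<^sup>2 - r ^ CARD('n) * (v (r * \<rho>))\<^sup>2 < (\<epsilon> / 3)\<^sup>2"
        by (rule order_tendstoD)
      show "\<forall>\<^sub>F \<rho> in at_top. \<exists>wa W. wa \<in> L2_H10 D (cube \<rho>) \<and> has_weak_gradient_y D (cube \<rho>) wa W \<and>
        L2_nrm (?N \<Otimes>\<^sub>M ?Q \<rho>) (\<lambda>(x, y). U x (T y w) - W x y) \<le> \<epsilon> * sqrt (?c \<rho>)"
        using ev1 ev2 ev3 eventually_gt_at_top[of 0]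
      proof eventually_elim
        case h: (elim \<rho>)
        let ?P = "?N \<Otimes>\<^sub>M ?Q \<rho>"
        have c: "0 < ?c \<rho>" using h(4) by (simp add: measure_cube)
        have L: "?dT \<in> L2 ?P" "?VT \<in> L2 ?P" "?PT \<in> L2 ?P" using elim(2-4) h(4) by blast+
        have nice: "smooth (\<lambda>y. fst (s m x) (T y w)) \<and> (\<forall>y. gradient (\<lambda>y. fst (s m x) (T y w)) y = snd (s m x) (T y w))" if "x \<in> D" for x
          using elim(1) that sp by blast
        obtain wa W Z where wa: "wa \<in> L2_H10 D (cube \<rho>)" "has_weak_gradient_y D (cube \<rho>) wa W"
          and Z: "(\<lambda>(x, y). Z x y) \<in> L2 ?P" "L2_nrm ?P (\<lambda>(x, y). Z x y) \<le> B / \<rho> * L2_nrm ?P ?PT"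
          and W: "\<And>x y. W x y = \<eta> ((1 / \<rho>) *\<^sub>R y) *\<^sub>R snd (s m x) (T y w) + Z x y"
          using cutoff_potential[OF D h(4) eta nice L(3) L(2) B] by blast
        define t where "t y = 1 - \<eta> ((1 / \<rho>) *\<^sub>R y)" for y
        have tm: "(\<lambda>p. t (snd p)) \<in> borel_measurable ?P"
          unfolding t_def by (intro borel_measurable_diff borel_measurable_const measurable_compose[OF measurable_snd]
            measurable_lebesgue_on_borel smooth_borel smooth_scale test_functions_smooth[OF eta])
        have t01: "0 \<le> t y" "t y \<le> 1" for y using eb(1,2)[of "(1 / \<rho>) *\<^sub>R y"] by (auto simp: t_def)
        have te: "t y \<le> e" if "y \<in> cube (r * \<rho>)" for y
        proof -
          have "(1 / \<rho>) *\<^sub>R y \<in> cube r" using that h(4) by (simp add: mem_cube abs_mult divide_simps)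
          from eb(3)[OF this] show ?thesis by (simp add: t_def)
        qed
        have tV: "(\<lambda>p. t (snd p) *\<^sub>R ?VT p) \<in> L2 ?P"
          by (rule L2_norm_le_mult(1)[OF borel_measurable_scaleR[OF tm L2_measurable[OF L(2)]] L(2), of 1]) (simp_all add: t01 mult_left_le_one_le)
        have tVle: "L2_nrm ?P (\<lambda>p. t (snd p) *\<^sub>R ?VT p) \<le> \<epsilon> / 3 * sqrt (?c \<rho>)"
        proof (rule L2_nrm_leI)
          let ?g = "\<lambda>p. (norm (?VT p))\<^sup>2"
          have rr: "0 < r * \<rho>" "r * \<rho> \<le> \<rho>" using r h(4) by (auto simp: mult_left_le_one_le)
          have VR: "?VT \<in> L2 (?N \<Otimes>\<^sub>M ?Q (r * \<rho>))" using elim(3) rr(1) by blast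
          note res = integral_pair_restrict[OF N open_cube bounded_cube open_cube cube_mono[OF rr(2)] L2_integrable_sq[OF L(2)] L2_integrable_sq[OF VR]]
          have "(LINT p|?P. (norm (t (snd p) *\<^sub>R ?VT p))\<^sup>2) \<le> (LINT p|?P. (1 + e) * ?g p - indicator (cube (r * \<rho>)) (snd p) * ?g p)"
          proof (rule integral_mono)
            show "integrable ?P (\<lambda>p. (norm (t (snd p) *\<^sub>R ?VT p))\<^sup>2)" by (rule L2_integrable_sq[OF tV])
            show "integrable ?P (\<lambda>p. (1 + e) * ?g p - indicator (cube (r * \<rho>)) (snd p) * ?g p)"
              by (intro Bochner_Integration.integrable_diff integrable_mult_right L2_integrable_sq[OF L(2)] res(1))
            fix p :: "(real ^ 'n) \<times> (real ^ 'n)"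
            \<comment> \<open>Inside the smaller cube \<open>t\<^sup>2 \<le> t \<le> e\<close>;
              outside, \<open>t\<^sup>2 \<le> 1\<close>.\<close>
            have "(t (snd p))\<^sup>2 \<le> (1 + e) - indicator (cube (r * \<rho>)) (snd p)"
            proof (cases "snd p \<in> cube (r * \<rho>)")
              case True
              have "(t (snd p))\<^sup>2 \<le> t (snd p)" using t01[of "snd p"] by (simp add: power2_eq_square mult_left_le_one_le)
              then show ?thesis using te[OF True] True by simp
            next
              case False
              have "(t (snd p))\<^sup>2 \<le> 1" using t01[of "snd p"] by (simp add: power_le_one)
              then show ?thesis using False e0 by simp
            qed
            from mult_right_mono[OF this, of "?g p"]
            show "(norm (t (snd p) *\<^sub>R ?VT p))\<^sup>2 \<le> (1 + e) * ?g p - indicator (cube (r * \<rho>)) (snd p) * ?g p"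
              by (simp add: power_mult_distrib left_diff_distrib)
          qed
          also have "\<dots> = (1 + e) * (L2_nrm ?P ?VT)\<^sup>2 - (L2_nrm (?N \<Otimes>\<^sub>M ?Q (r * \<rho>)) ?VT)\<^sup>2"
            using res L2_integrable_sq[OF L(2)] by (subst Bochner_Integration.integral_diff) (auto simp: L2_nrm_sq)
          also have "(L2_nrm ?P ?VT)\<^sup>2 = ?c \<rho> * (v \<rho>)\<^sup>2" using c by (simp add: v_def power_divide)
          also have "(L2_nrm (?N \<Otimes>\<^sub>M ?Q (r * \<rho>)) ?VT)\<^sup>2 = ?c (r * \<rho>) * (v (r * \<rho>))\<^sup>2"
            using rr(1) r(1) h(4) by (simp add: v_def power_divide measure_cube)
          also have "?c (r * \<rho>) = r ^ CARD('n) * ?c \<rho>" using rr(1) h(4) by (simp add: measure_cube power_mult_distrib)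
          also have "(1 + e) * (?c \<rho> * (v \<rho>)\<^sup>2) - r ^ CARD('n) * ?c \<rho> * (v (r * \<rho>))\<^sup>2 = ?c \<rho> * ((1 + e) * (v \<rho>)\<^sup>2 - r ^ CARD('n) * (v (r * \<rho>))\<^sup>2)"
            by (simp only: right_diff_distrib mult_ac)
          also have "\<dots> \<le> ?c \<rho> * (\<epsilon> / 3)\<^sup>2" using h(3) c by (intro mult_left_mono) auto
          also have "\<dots> = (\<epsilon> / 3 * sqrt (?c \<rho>))\<^sup>2" using c by (simp add: power_mult_distrib power_divide)
          finally show "(LINT p|?P. (norm (t (snd p) *\<^sub>R ?VT p))\<^sup>2) \<le> (\<epsilon> / 3 * sqrt (?c \<rho>))\<^sup>2" .
        qed (use eps in simp)
        have eq: "(\<lambda>(x, y). U x (T y w) - W x y) = (\<lambda>p. ?dT p + t (snd p) *\<^sub>R ?VT p - (\<lambda>(x, y). Z x y) p)"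
          by (simp add: fun_eq_iff W t_def scaleR_diff_left)
        have n1: "L2_nrm ?P (\<lambda>p. ?dT p + t (snd p) *\<^sub>R ?VT p - (\<lambda>(x, y). Z x y) p) \<le> L2_nrm ?P (\<lambda>p. ?dT p + t (snd p) *\<^sub>R ?VT p) + L2_nrm ?P (\<lambda>(x, y). Z x y)"
          using L2_triangle[OF L2_add[OF L(1) tV] L2_uminus[OF Z(1)]] unfolding L2_nrm_uminus by (simp only: add_uminus_conv_diff)
        have n2: "L2_nrm ?P (\<lambda>p. ?dT p + t (snd p) *\<^sub>R ?VT p) \<le> L2_nrm ?P ?dT + L2_nrm ?P (\<lambda>p. t (snd p) *\<^sub>R ?VT p)"
          by (rule L2_triangle[OF L(1) tV])
        have sc: "0 < sqrt (?c \<rho>)" using c by simp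
        have n3: "L2_nrm ?P ?dT \<le> \<epsilon> / 3 * sqrt (?c \<rho>)"
          using h(1) unfolding u_def pos_divide_less_eq[OF sc] by (rule less_imp_le)
        have n4: "L2_nrm ?P (\<lambda>(x, y). Z x y) \<le> \<epsilon> / 3 * sqrt (?c \<rho>)"
        proof (rule order_trans[OF Z(2)])
          have "k * X = k * (X / z) * z" if "0 < z" for k X z :: real using that by simp
          from this[OF sc] have "B / \<rho> * L2_nrm ?P ?PT = (B / \<rho> * b \<rho>) * sqrt (?c \<rho>)" unfolding b_def .
          also have "\<dots> \<le> \<epsilon> / 3 * sqrt (?c \<rho>)" using h(2) sc by (intro mult_right_mono) auto
          finally show "B / \<rho> * L2_nrm ?P ?PT \<le> \<epsilon> / 3 * sqrt (?c \<rho>)" .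
        qed
        have "\<epsilon> / 3 * sqrt (?c \<rho>) + \<epsilon> / 3 * sqrt (?c \<rho>) + \<epsilon> / 3 * sqrt (?c \<rho>) = \<epsilon> * sqrt (?c \<rho>)" by (simp add: field_simps)
        then have "L2_nrm ?P (\<lambda>(x, y). U x (T y w) - W x y) \<le> \<epsilon> * sqrt (?c \<rho>)"
          unfolding eq using n1 n2 n3 n4 tVle by linarith
        with wa show ?case by blast
      qed
    qed
  qed
qed

end

text \<open>Ellipticity quantifies over uncountably many vectors, but it is a closed condition on
  the matrix. The set of good points is therefore measurable, and the iterated almost everywhere
  hypothesis becomes one on the product.\<close>

lemma closed_elliptic_matrices:
  "closed {B :: real ^ 'n::finite ^ 'n. elliptic c1 c2 B}"
proof -
  have "continuous_on UNIV (\<lambda>B :: real ^ 'n ^ 'n. (B *v \<xi>) \<bullet> \<zeta>)" for \<xi> \<zeta>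
    by (simp add: matrix_vector_mult_def inner_vec_def) (intro continuous_intros)
  then show ?thesis
    unfolding elliptic_def by (intro closed_Collect_all closed_Collect_conj closed_Collect_le continuous_on_const)
qed

lemma elliptic_measurable:
  fixes B :: "'a \<Rightarrow> real ^ 'n::finite ^ 'n"
  assumes "B \<in> borel_measurable P"
  shows "{p \<in> space P. elliptic c1 c2 (B p)} \<in> sets P"
  using measurable_sets[OF assms borel_closed[OF closed_elliptic_matrices[of c1 c2]]]
  by (simp add: vimage_def Int_def conj_commute)

lemma (in flow) L2_pot_zero: "(\<lambda>w. 0) \<in> L2_pot M T"
proof -
  have "has_stochastic_gradient M T (\<lambda>w. 0) (\<lambda>w. 0)" by (simp add: has_stochastic_gradient_def L2_zero L2_nrm_def)
  then show ?thesis by (auto simp: L2_pot_def L2_zero L2_nrm_def intro!: exI)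
qed

theorem lemma5p2:
  fixes D :: "(real ^ 'n::finite) set"
    and M :: "'w measure"
    and T :: "real ^ 'n \<Rightarrow> 'w \<Rightarrow> 'w"
    and A :: "real ^ 'n \<Rightarrow> 'w \<Rightarrow> real ^ 'n ^ 'n"
    and c1 c2 :: real
    and f :: "(real ^ 'n \<Rightarrow> real) \<Rightarrow> real"
    and u0 :: "real ^ 'n \<Rightarrow> real"
    and U1 :: "real ^ 'n \<Rightarrow> 'w \<Rightarrow> real ^ 'n"
    and u0\<rho> :: "real \<Rightarrow> 'w \<Rightarrow> real ^ 'n \<Rightarrow> real"
    and u1\<rho> :: "real \<Rightarrow> 'w \<Rightarrow> real ^ 'n \<Rightarrow> real ^ 'n \<Rightarrow> real"
  assumes "bounded_Lipschitz_domain D"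
    and "f \<in> dual_H10 D"
    and "prob_space M"
    and "ergodic_dynamical_system M T"
    and "0 < c1" and "0 < c2"
    and "admissible_coefficient D M A c1 c2"
    and "u0 \<in> H10 D" and "U1 \<in> L2_L2_pot D M T"
    and "\<And>\<phi>0 \<Phi>1. \<phi>0 \<in> H10 D \<Longrightarrow> \<Phi>1 \<in> L2_L2_pot D M T \<Longrightarrow>
       (LINT \<omega>|M. LINT x|lebesgue_on D.
          (A x \<omega> *v (weak_gradient D u0 x + U1 x \<omega>)) \<bullet> (weak_gradient D \<phi>0 x + \<Phi>1 x \<omega>)) = f \<phi>0"
    and "AE \<omega> in M. \<forall>\<rho>>0.
       u0\<rho> \<rho> \<omega> \<in> H10 D \<and> u1\<rho> \<rho> \<omega> \<in> L2_H10 D (cube \<rho>) \<and>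
       (\<forall>\<phi>0 \<in> H10 D. \<forall>\<phi>1 \<in> L2_H10 D (cube \<rho>).
          1 / measure lebesgue (cube \<rho> :: (real ^ 'n) set) *
          (LINT x|lebesgue_on D. LINT y|lebesgue_on (cube \<rho>).
             (A x (T y \<omega>) *v (weak_gradient D (u0\<rho> \<rho> \<omega>) x + weak_gradient_y D (cube \<rho>) (u1\<rho> \<rho> \<omega>) x y))
               \<bullet> (weak_gradient D \<phi>0 x + weak_gradient_y D (cube \<rho>) \<phi>1 x y)) = f \<phi>0)"
  shows "AE \<omega> in M.
       (\<forall>\<rho>>0. (\<lambda>(x, y). U1 x (T y \<omega>)) \<in> L2 (lebesgue_on D \<Otimes>\<^sub>M lebesgue_on (cube \<rho>))) \<and>
       ((\<lambda>\<rho>. 1 / sqrt (measure lebesgue (cube \<rho> :: (real ^ 'n) set)) *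
          L2_nrm (lebesgue_on D \<Otimes>\<^sub>M lebesgue_on (cube \<rho>))
            (\<lambda>(x, y). U1 x (T y \<omega>) - weak_gradient_y D (cube \<rho>) (u1\<rho> \<rho> \<omega>) x y)) \<longlongrightarrow> 0) at_top"
proof -
  note macro = assms(10) and micro = assms(11)
  have D: "open D" "bounded D" using assms(1) by (auto simp: bounded_Lipschitz_domain_def)
  let ?N = "lebesgue_on D"
  have N: "finite_measure ?N" by (rule finite_measure_lebesgue_on_open[OF D])
  interpret N: finite_measure ?N by (rule N)
  interpret prob_space M by fact
  interpret ergodic_flow M T
    using assms(4) unfolding ergodic_dynamical_system_def by unfold_locales blast+
  have M: "finite_measure M" by unfold_locales
  interpret NM: pair_sigma_finite ?N M ..
  let ?P = "?N \<Otimes>\<^sub>M M"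
  have Am: "(\<lambda>(x, \<omega>). A x \<omega>) \<in> borel_measurable ?P" and Aell: "AE x in ?N. AE \<omega> in M. elliptic c1 c2 (A x \<omega>)"
    using assms(7) by (simp_all add: admissible_coefficient_def elliptic_def)
  have Am': "(\<lambda>p. A (fst p) (snd p)) \<in> borel_measurable ?P" using Am by (simp add: case_prod_beta')
  have ell: "AE p in ?P. elliptic c1 c2 (A (fst p) (snd p))"
    by (rule NM.AE_pair_measure[OF elliptic_measurable[OF Am']]) (use Aell in simp)
  define g0 where "g0 = weak_gradient D u0"
  have g0: "g0 \<in> L2 ?N" and g0w: "has_weak_gradient D u0 g0"
    using H10_has_weak_gradient[OF assms(8)] by (auto simp: g0_def has_weak_gradient_def)
  have U: "(\<lambda>(x, \<omega>). U1 x \<omega>) \<in> L2 ?P" and Upot: "AE x in ?N. U1 x \<in> L2_pot M T"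
    using assms(9) by (auto simp: L2_L2_pot_def)
  have U': "(\<lambda>p. U1 (fst p) (snd p)) \<in> L2 ?P" using U by (simp add: case_prod_beta')
  define q where "q x \<omega> = A x \<omega> *v (g0 x + U1 x \<omega>)" for x \<omega>
  have q': "(\<lambda>p. q (fst p) (snd p)) \<in> L2 ?P"
    unfolding q_def by (rule L2_matrix_vector_mult(1)[OF Am' assms(6) L2_add[OF L2_fst(1)[OF N M g0] U'] ell])
  then have q: "(\<lambda>(x, \<omega>). q x \<omega>) \<in> L2 ?P" by (simp add: case_prod_beta')
  have macroP: "(LINT p|?P. q (fst p) (snd p) \<bullet> (weak_gradient D \<phi> (fst p) + \<Phi> (fst p) (snd p))) = f \<phi>"
    if phi: "\<phi> \<in> H10 D" and Phi: "\<Phi> \<in> L2_L2_pot D M T" for \<phi> \<Phi>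
  proof -
    have "weak_gradient D \<phi> \<in> L2 ?N" using H10_has_weak_gradient[OF phi] by (simp add: has_weak_gradient_def)
    moreover have "(\<lambda>p. \<Phi> (fst p) (snd p)) \<in> L2 ?P" using Phi by (simp add: L2_L2_pot_def case_prod_beta')
    ultimately have "integrable ?P (\<lambda>p. q (fst p) (snd p) \<bullet> (weak_gradient D \<phi> (fst p) + \<Phi> (fst p) (snd p)))"
      by (intro L2_inner_integrable q' L2_add L2_fst(1)[OF N M])
    then have "(LINT \<omega>|M. LINT x|?N. q x \<omega> \<bullet> (weak_gradient D \<phi> x + \<Phi> x \<omega>)) = (LINT p|?P. q (fst p) (snd p) \<bullet> (weak_gradient D \<phi> (fst p) + \<Phi> (fst p) (snd p)))"
      using NM.integral_snd[of "\<lambda>x \<omega>. q x \<omega> \<bullet> (weak_gradient D \<phi> x + \<Phi> x \<omega>)"] by (simp add: case_prod_beta')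
    then show ?thesis using macro[OF phi Phi] by (simp add: q_def g0_def)
  qed
  have zpot: "(\<lambda>x \<omega>. 0) \<in> L2_L2_pot D M T"
    using L2_pot_zero by (auto simp: L2_L2_pot_def L2_zero case_prod_beta')
  define m where "m x = (LINT \<omega>|M. q x \<omega>)" for x
  have mL: "m \<in> L2 ?N" using L2_section_integral(1)[OF N M q] by (simp add: m_def[abs_def])
  \<comment> \<open>Testing with the zero field: the mean flux \<open>m\<close> represents
    \<open>f\<close> on \<open>H10 D\<close>. On the cube, \<open>f\<close> can then be compared
    with averages of the flux along the orbit.\<close>
  have fm: "f \<phi> = (LINT x|?N. m x \<bullet> weak_gradient D \<phi> x)" if phi: "\<phi> \<in> H10 D" for \<phi>
  proof -
    have "weak_gradient D \<phi> \<in> L2 ?N" using H10_has_weak_gradient[OF phi] by (simp add: has_weak_gradient_def)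
    from integral_inner_fst[OF N M q' this] macroP[OF phi zpot] show ?thesis by (simp add: m_def)
  qed
  have sol: "AE \<omega> in M. AE x in ?N. \<forall>\<phi>\<in>test_functions UNIV. (LINT z|lborel. q x (T z \<omega>) \<bullet> gradient \<phi> z) = 0"
  proof (rule solenoidal_product[OF N q])
    fix \<Phi> :: "real ^ 'n \<Rightarrow> 'w \<Rightarrow> real ^ 'n" assume Phi: "(\<lambda>(x, \<omega>). \<Phi> x \<omega>) \<in> L2 ?P" "\<And>x. x \<in> space ?N \<Longrightarrow> \<Phi> x \<in> L2_pot M T"
    have z: "(\<lambda>x. 0) \<in> H10 D" by (rule H10_test_function[OF D test_functions_zero])
    have Phi': "(\<lambda>p. \<Phi> (fst p) (snd p)) \<in> L2 ?P" using Phi(1) by (simp add: case_prod_beta')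
    have PP: "\<Phi> \<in> L2_L2_pot D M T" using Phi by (auto simp: L2_L2_pot_def intro!: AE_I2)
    have wz: "weak_gradient D (\<lambda>x. 0) \<in> L2 ?N" using H10_has_weak_gradient[OF z] by (simp add: has_weak_gradient_def)
    \<comment> \<open>The chosen gradient of the zero function is not evaluated: subtracting the
      same identity with the zero field cancels it together with the value of
      \<open>f\<close>.\<close>
    have "(LINT p|?P. q (fst p) (snd p) \<bullet> (weak_gradient D (\<lambda>x. 0) (fst p) + \<Phi> (fst p) (snd p))) =
      (LINT p|?P. q (fst p) (snd p) \<bullet> weak_gradient D (\<lambda>x. 0) (fst p)) + (LINT p|?P. q (fst p) (snd p) \<bullet> \<Phi> (fst p) (snd p))"
      unfolding inner_add_right by (intro Bochner_Integration.integral_add L2_inner_integrable q' Phi' L2_fst(1)[OF N M wz])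
    then show "(LINT p|?P. q (fst p) (snd p) \<bullet> \<Phi> (fst p) (snd p)) = 0"
      using macroP[OF z PP] macroP[OF z zpot] by simp
  qed
  interpret X: flow ?P "\<lambda>y p. (fst p, T y (snd p))" by (rule product_flow[OF N])
  \<comment> \<open>Ellipticity holds almost everywhere on the product; the product flow carries it
    to almost every time on the orbit of almost every pair.\<close>
  have ellT: "AE \<omega> in M. AE x in ?N. AE y in lborel. elliptic c1 c2 (A x (T y \<omega>))"
    using AE_pair_sections[OF N M X.AE_orbit[OF ell]] by simp
  have qT: "AE \<omega> in M. \<forall>\<rho>>0. (\<lambda>(x, y). q x (T y \<omega>)) \<in> L2 (?N \<Otimes>\<^sub>M lebesgue_on (cube \<rho>))"
    using L2_orbit_ergodic[OF N q] by eventually_elim blast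
  have UT: "AE \<omega> in M. \<forall>\<rho>>0. (\<lambda>(x, y). U1 x (T y \<omega>)) \<in> L2 (?N \<Otimes>\<^sub>M lebesgue_on (cube \<rho>))"
    using L2_orbit_ergodic[OF N U] by eventually_elim blast
  show ?thesis
    using micro sol ellT qT UT corrector[OF D U Upot] mean_orbit_tendsto[OF N q] AE_space
  proof eventually_elim
    case (elim \<omega>)
    let ?Q = "\<lambda>\<rho>. lebesgue_on (cube \<rho> :: (real ^ 'n) set)"
    let ?c = "\<lambda>\<rho>. measure lebesgue (cube \<rho> :: (real ^ 'n) set)"
    let ?d = "\<lambda>\<rho>. L2_nrm (?N \<Otimes>\<^sub>M ?Q \<rho>) (\<lambda>(x, y). U1 x (T y \<omega>) - weak_gradient_y D (cube \<rho>) (u1\<rho> \<rho> \<omega>) x y)"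
    define a where "a \<rho> = L2_nrm ?N (\<lambda>x. m x - (1 / ?c \<rho>) *\<^sub>R (LINT y|?Q \<rho>. q x (T y \<omega>)))" for \<rho>
    have alim: "(a \<longlongrightarrow> 0) at_top" using elim(7) by (simp only: a_def[abs_def] m_def)
    \<comment> \<open>Any competitor \<open>w\<close> with gradient within \<epsilon> of the field,
      in root mean square, serves; \<open>a \<rho>\<close> is the deviation of the averaged flux
      from its mean.\<close>
    have key: "1 / sqrt (?c \<rho>) * ?d \<rho> \<le> \<epsilon> + (a \<rho> + c2 * \<epsilon>) / c1"
      if r: "0 < \<rho>" and w: "w \<in> L2_H10 D (cube \<rho>)" "has_weak_gradient_y D (cube \<rho>) w W"
        and le: "L2_nrm (?N \<Otimes>\<^sub>M ?Q \<rho>) (\<lambda>(x, y). U1 x (T y \<omega>) - W x y) \<le> \<epsilon> * sqrt (?c \<rho>)" for \<rho> \<epsilon> w W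
    proof -
      have Y: "open (cube \<rho> :: (real ^ 'n) set)" "bounded (cube \<rho> :: (real ^ 'n) set)" by simp_all
      have Q: "finite_measure (?Q \<rho>)" by (rule finite_measure_lebesgue_on_open[OF Y])
      interpret Q: finite_measure "?Q \<rho>" by (rule Q)
      interpret NQ: pair_sigma_finite ?N "?Q \<rho>" ..
      let ?R = "?N \<Otimes>\<^sub>M ?Q \<rho>"
      have c: "0 < ?c \<rho>" using r by (simp add: measure_cube)
      have cm: "?c \<rho> = measure (?Q \<rho>) (space (?Q \<rho>))" by (simp add: measure_restrict_space)
      define v0 v1 where "v0 = u0\<rho> \<rho> \<omega>" and "v1 = u1\<rho> \<rho> \<omega>"
      have v: "v0 \<in> H10 D" "v1 \<in> L2_H10 D (cube \<rho>)" and tst: "\<And>\<phi>0 \<phi>1. \<phi>0 \<in> H10 D \<Longrightarrow> \<phi>1 \<in> L2_H10 D (cube \<rho>) \<Longrightarrow>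
          1 / ?c \<rho> * (LINT x|?N. LINT y|?Q \<rho>. (A x (T y \<omega>) *v (weak_gradient D v0 x + weak_gradient_y D (cube \<rho>) v1 x y))
               \<bullet> (weak_gradient D \<phi>0 x + weak_gradient_y D (cube \<rho>) \<phi>1 x y)) = f \<phi>0"
        using elim(1) r unfolding v0_def v1_def by blast+
      define h0 h1 where "h0 = weak_gradient D v0" and "h1 = weak_gradient_y D (cube \<rho>) v1"
      have h0w: "has_weak_gradient D v0 h0" unfolding h0_def by (rule H10_has_weak_gradient[OF v(1)])
      have h1w: "has_weak_gradient_y D (cube \<rho>) v1 h1" unfolding h1_def by (rule L2_H10_has_weak_gradient_y[OF v(2)])
      \<comment> \<open>The test pair: the solution on the cube minus the pair of \<open>u0\<close>
        and the competitor. Its gradients are \<open>e0\<close> and \<open>e1\<close> of the energy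
        estimate.\<close>
      define p0 p1 where "p0 = (\<lambda>x. v0 x - u0 x)" and "p1 = (\<lambda>x y. v1 x y - w x y)"
      have p0: "p0 \<in> H10 D" unfolding p0_def by (rule H10_diff[OF D v(1) assms(8)])
      have p1: "p1 \<in> L2_H10 D (cube \<rho>)" unfolding p1_def by (rule L2_H10_diff[OF Y v(2) w(1)])
      define e0 e1 where "e0 = weak_gradient D p0" and "e1 = weak_gradient_y D (cube \<rho>) p1"
      have e0w: "has_weak_gradient D p0 e0" unfolding e0_def by (rule H10_has_weak_gradient[OF p0])
      have e1w: "has_weak_gradient_y D (cube \<rho>) p1 e1" unfolding e1_def by (rule L2_H10_has_weak_gradient_y[OF p1])
      \<comment> \<open>Gradients are chosen for each function separately; that of a difference
        agrees with the difference of the chosen ones only almost everywhere.\<close>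
      have e0eq: "AE x in ?N. e0 x = h0 x - g0 x"
        unfolding e0_def p0_def by (rule weak_gradient_AE_eq[OF D has_weak_gradient_diff[OF D h0w g0w]])
      have e1eq: "AE p in ?R. e1 (fst p) (snd p) = h1 (fst p) (snd p) - W (fst p) (snd p)"
        unfolding e1_def p1_def by (rule weak_gradient_y_AE_eq[OF D Y has_weak_gradient_y_diff[OF Y h1w w(2)]])
      have e0L: "e0 \<in> L2 ?N" and h0L: "h0 \<in> L2 ?N" using e0w h0w by (auto simp: has_weak_gradient_def)
      have e1L: "(\<lambda>p. e1 (fst p) (snd p)) \<in> L2 ?R" and h1L: "(\<lambda>p. h1 (fst p) (snd p)) \<in> L2 ?R" and WL: "(\<lambda>p. W (fst p) (snd p)) \<in> L2 ?R"
        using e1w h1w w(2) by (simp_all add: has_weak_gradient_y_def case_prod_beta')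
      have UL: "(\<lambda>p. U1 (fst p) (T (snd p) \<omega>)) \<in> L2 ?R" using elim(5) r by (simp add: case_prod_beta')
      have qL: "(\<lambda>p. q (fst p) (T (snd p) \<omega>)) \<in> L2 ?R" using elim(4) r by (simp add: case_prod_beta')
      define B where "B p = A (fst p) (T (snd p) \<omega>)" for p
      define g where "g p = g0 (fst p) + U1 (fst p) (T (snd p) \<omega>)" for p
      \<comment> \<open>With this sign \<open>g - d\<close> is \<open>g0 + W\<close>, so that
        \<open>g - d + e0 + e1\<close> is almost everywhere the total gradient
        \<open>h0 + h1\<close> of the solution on the cube.\<close>
      define d where "d p = U1 (fst p) (T (snd p) \<omega>) - W (fst p) (snd p)" for p
      have Bg: "B p *v g p = q (fst p) (T (snd p) \<omega>)" for p by (simp add: B_def g_def q_def)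
      have Bm: "B \<in> borel_measurable ?R"
        using orbit_product_measurable[OF Am elim(8)] by (simp add: B_def[abs_def] case_prod_beta')
      have Bell: "AE p in ?R. elliptic c1 c2 (B p)"
      proof (rule NQ.AE_pair_measure[OF elliptic_measurable[OF Bm]])
        show "AE x in ?N. AE y in ?Q \<rho>. elliptic c1 c2 (B (x, y))"
          using elim(3) by eventually_elim (rule AE_lborel_lebesgue_on, simp_all add: B_def)
      qed
      have gL: "g \<in> L2 ?R" unfolding g_def by (rule L2_add[OF L2_fst(1)[OF N Q g0] UL])
      have dL: "d \<in> L2 ?R" unfolding d_def by (rule L2_diff[OF UL WL])
      have p1s: "AE x in ?N. p1 x \<in> H10 (cube \<rho>) \<and> has_weak_gradient (cube \<rho>) (p1 x) (e1 x)"
        using p1 e1w by (auto simp: L2_H10_def has_weak_gradient_y_def)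
      have mean: "AE x in ?N. \<forall>v. (LINT y|?Q \<rho>. v \<bullet> e1 (fst (x, y)) (snd (x, y))) = 0"
        using p1s
      proof eventually_elim
        case (elim x)
        then show ?case using H10_mean_gradient_0[OF Y, of "p1 x" "e1 x"] by simp
      qed
      have eq1: "(LINT p|?R. (B p *v (g p - d p + e0 (fst p) + e1 (fst p) (snd p))) \<bullet> (e0 (fst p) + e1 (fst p) (snd p))) = ?c \<rho> * (LINT x|?N. m x \<bullet> e0 x)"
      proof -
        let ?h = "\<lambda>p. h0 (fst p) + h1 (fst p) (snd p)" and ?e = "\<lambda>p. e0 (fst p) + e1 (fst p) (snd p)"
        have hL: "?h \<in> L2 ?R" by (rule L2_add[OF L2_fst(1)[OF N Q h0L] h1L])
        have eL: "?e \<in> L2 ?R" by (rule L2_add[OF L2_fst(1)[OF N Q e0L] e1L])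
        have gdL: "(\<lambda>p. g p - d p + e0 (fst p) + e1 (fst p) (snd p)) \<in> L2 ?R"
          by (rule L2_add[OF L2_add[OF L2_diff[OF gL dL] L2_fst(1)[OF N Q e0L]] e1L])
        note BL = L2_matrix_vector_mult(1)[OF Bm assms(6) _ Bell]
        have "(LINT p|?R. (B p *v (g p - d p + e0 (fst p) + e1 (fst p) (snd p))) \<bullet> ?e p) = (LINT p|?R. (B p *v ?h p) \<bullet> ?e p)"
        proof (rule integral_cong_AE)
          show "(\<lambda>p. (B p *v (g p - d p + e0 (fst p) + e1 (fst p) (snd p))) \<bullet> ?e p) \<in> borel_measurable ?R"
            by (rule borel_measurable_integrable[OF L2_inner_integrable[OF BL[OF gdL] eL]])
          show "(\<lambda>p. (B p *v ?h p) \<bullet> ?e p) \<in> borel_measurable ?R"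
            by (rule borel_measurable_integrable[OF L2_inner_integrable[OF BL[OF hL] eL]])
          show "AE p in ?R. (B p *v (g p - d p + e0 (fst p) + e1 (fst p) (snd p))) \<bullet> ?e p = (B p *v ?h p) \<bullet> ?e p"
            using AE_fst[OF N Q e0eq] e1eq
          proof eventually_elim
            case (elim p)
            have "g p - d p + e0 (fst p) + e1 (fst p) (snd p) = ?h p" by (simp add: g_def d_def elim)
            then show ?case by (simp only:)
          qed
        qed
        also have "\<dots> = (LINT x|?N. LINT y|?Q \<rho>. (A x (T y \<omega>) *v (h0 x + h1 x y)) \<bullet> (e0 x + e1 x y))"
          using NQ.integral_fst'[OF L2_inner_integrable[OF BL[OF hL] eL]] by (simp add: B_def)
        also have "\<dots> = ?c \<rho> * f p0"
          using tst[OF p0 p1] c by (simp add: h0_def h1_def e0_def e1_def field_simps)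
        finally show ?thesis using fm[OF p0] by (simp add: e0_def)
      qed
      \<comment> \<open>For almost every \<open>x\<close> the realisation of the flux is solenoidal
        on the whole space. Test functions of the cube are test functions there, and
        \<open>H10_orthogonal\<close> passes to the microscopic gradient.\<close>
      have eq2: "(LINT p|?R. (B p *v g p) \<bullet> e1 (fst p) (snd p)) = 0"
      proof -
        have "(LINT p|?R. q (fst p) (T (snd p) \<omega>) \<bullet> e1 (fst p) (snd p)) = (LINT x|?N. LINT y|?Q \<rho>. q x (T y \<omega>) \<bullet> e1 x y)"
          using NQ.integral_fst'[OF L2_inner_integrable[OF qL e1L]] by simp
        also have "\<dots> = 0"
        proof (rule integral_eq_zero_AE)
          show "AE x in ?N. (LINT y|?Q \<rho>. q x (T y \<omega>) \<bullet> e1 x y) = 0"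
            using elim(2) p1s L2_section_integral(3)[OF N Q qL] AE_space
          proof eventually_elim
            case x: (elim x)
            show ?case
            proof (rule H10_orthogonal[OF Y])
              show "p1 x \<in> H10 (cube \<rho>)" "has_weak_gradient (cube \<rho>) (p1 x) (e1 x)" using x(2) by auto
              show "(\<lambda>y. q x (T y \<omega>)) \<in> L2 (?Q \<rho>)" using x(3) by simp
              fix \<phi> :: "real ^ 'n \<Rightarrow> real" assume phi: "\<phi> \<in> test_functions (cube \<rho>)"
              have "q x \<in> borel_measurable M"
                using measurable_compose[OF measurable_Pair1'[OF x(4)] L2_measurable[OF q]] by simp
              from orbit_borel_measurable[OF elim(8) this]
              have "(\<lambda>z. q x (T z \<omega>) \<bullet> gradient \<phi> z) \<in> borel_measurable borel"
                by (intro borel_measurable_inner smooth_gradient_borel test_functions_smooth[OF phi])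
              moreover have "gradient \<phi> z = 0" if "z \<notin> cube \<rho>" for z
                using test_functions_outside[OF test_functions_gradient[OF phi] that] by (simp add: vec_eq_iff)
              ultimately have "(LINT z|?Q \<rho>. q x (T z \<omega>) \<bullet> gradient \<phi> z) = (LINT z|lborel. q x (T z \<omega>) \<bullet> gradient \<phi> z)"
                by (intro integral_lebesgue_on_support) auto
              then show "(LINT z|?Q \<rho>. q x (T z \<omega>) \<bullet> gradient \<phi> z) = 0"
                using x(1) test_functions_mono[OF phi subset_UNIV] by simp
            qed
          qed
        qed
        finally show ?thesis by (simp add: Bg)
      qed
      have "L2_nrm ?R (\<lambda>p. d p - e1 (fst p) (snd p)) \<le> L2_nrm ?R d + (sqrt (?c \<rho>) * L2_nrm ?N (\<lambda>x. m x - (1 / ?c \<rho>) *\<^sub>R (LINT y|?Q \<rho>. B (x, y) *v g (x, y))) + c2 * L2_nrm ?R d) / c1"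
        by (rule two_scale_energy[OF N Q cm c Bm assms(5,6) Bell gL dL e1L e0L mL mean eq1 eq2])
      also have "L2_nrm ?N (\<lambda>x. m x - (1 / ?c \<rho>) *\<^sub>R (LINT y|?Q \<rho>. B (x, y) *v g (x, y))) = a \<rho>"
        by (simp add: Bg a_def)
      also have "L2_nrm ?R d + (sqrt (?c \<rho>) * a \<rho> + c2 * L2_nrm ?R d) / c1 \<le> \<epsilon> * sqrt (?c \<rho>) + (sqrt (?c \<rho>) * a \<rho> + c2 * (\<epsilon> * sqrt (?c \<rho>))) / c1"
        using le assms(5,6) by (intro add_mono divide_right_mono mult_left_mono) (auto simp: d_def[abs_def] case_prod_beta')
      also have "\<dots> = sqrt (?c \<rho>) * (\<epsilon> + (a \<rho> + c2 * \<epsilon>) / c1)"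
        by (simp add: distrib_left add_divide_distrib mult_ac)
      also have "L2_nrm ?R (\<lambda>p. d p - e1 (fst p) (snd p)) = ?d \<rho>"
      proof (rule L2_nrm_cong_AE)
        show "(\<lambda>p. d p - e1 (fst p) (snd p)) \<in> borel_measurable ?R" by (rule L2_measurable[OF L2_diff[OF dL e1L]])
        show "(\<lambda>(x, y). U1 x (T y \<omega>) - weak_gradient_y D (cube \<rho>) (u1\<rho> \<rho> \<omega>) x y) \<in> borel_measurable ?R"
          using L2_measurable[OF L2_diff[OF UL h1L]] by (simp add: h1_def v1_def case_prod_beta')
        show "AE p in ?R. d p - e1 (fst p) (snd p) = (case p of (x, y) \<Rightarrow> U1 x (T y \<omega>) - weak_gradient_y D (cube \<rho>) (u1\<rho> \<rho> \<omega>) x y)"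
          using e1eq by eventually_elim (simp add: d_def h1_def v1_def case_prod_beta')
      qed
      finally show ?thesis using c by (simp add: pos_divide_le_eq mult.commute)
    qed
    have "((\<lambda>\<rho>. 1 / sqrt (?c \<rho>) * ?d \<rho>) \<longlongrightarrow> 0) at_top"
    proof (rule order_tendstoI)
      fix b :: real assume b: "0 < b"
      \<comment> \<open>Half of \<open>b\<close> is reserved for the terms with
        \<open>\<epsilon>\<close>, which add up to \<open>\<epsilon> * (1 + c2 / c1)\<close>; the
        other half absorbs \<open>a \<rho> / c1\<close>.\<close>
      define \<epsilon> where "\<epsilon> = b / (2 * (1 + c2 / c1))"
      have pos: "0 < 1 + c2 / c1" using assms(5,6) by (simp add: add_pos_pos)
      have eps: "0 < \<epsilon>" using b pos by (simp add: \<epsilon>_def)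
      have "b / (2 * k) * k = b / 2" if "0 < k" for k :: real using that by simp
      from this[OF pos] have "\<epsilon> * (1 + c2 / c1) = b / 2" unfolding \<epsilon>_def .
      moreover have "\<epsilon> * (1 + c2 / c1) = \<epsilon> + c2 * \<epsilon> / c1" by (simp only: distrib_left mult_1_right times_divide_eq_right mult.commute)
      ultimately have eb: "\<epsilon> + c2 * \<epsilon> / c1 = b / 2" by simp
      have "\<forall>\<^sub>F \<rho> in at_top. a \<rho> < c1 * b / 2" by (rule order_tendstoD(2)[OF alim]) (use b assms(5) in simp)
      moreover have "\<forall>\<^sub>F \<rho> in at_top. \<exists>w W. w \<in> L2_H10 D (cube \<rho>) \<and> has_weak_gradient_y D (cube \<rho>) w W \<and>
        L2_nrm (?N \<Otimes>\<^sub>M ?Q \<rho>) (\<lambda>(x, y). U1 x (T y \<omega>) - W x y) \<le> \<epsilon> * sqrt (?c \<rho>)"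
        using elim(6) eps by blast
      ultimately show "\<forall>\<^sub>F \<rho> in at_top. 1 / sqrt (?c \<rho>) * ?d \<rho> < b"
        using eventually_gt_at_top[of 0]
      proof eventually_elim
        case h: (elim \<rho>)
        from h(2) obtain w W where "w \<in> L2_H10 D (cube \<rho>)" "has_weak_gradient_y D (cube \<rho>) w W"
          "L2_nrm (?N \<Otimes>\<^sub>M ?Q \<rho>) (\<lambda>(x, y). U1 x (T y \<omega>) - W x y) \<le> \<epsilon> * sqrt (?c \<rho>)" by blast
        from key[OF h(3) this] have "1 / sqrt (?c \<rho>) * ?d \<rho> \<le> \<epsilon> + (a \<rho> + c2 * \<epsilon>) / c1" .
        also have "\<dots> = a \<rho> / c1 + b / 2" using eb by (simp add: add_divide_distrib)
        also have "\<dots> < b / 2 + b / 2" using h(1) assms(5) by (intro add_strict_right_mono) (simp add: pos_divide_less_eq mult.commute)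
        finally show ?case by simp
      qed
    next
      fix b :: real assume "b < 0"
      then show "\<forall>\<^sub>F \<rho> in at_top. b < 1 / sqrt (?c \<rho>) * ?d \<rho>"
        by (intro always_eventually allI) (rule order_less_le_trans[OF _ mult_nonneg_nonneg], simp_all)
    qed
    with elim(5) show ?case by blast
  qed
qed

end
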